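(* Let $n\geq3$, $k\in\{1,\ldots,n\}$ and $\alpha\geq n-3$ be integers. Suppose that either (i) $\alpha$ is even and $n-k$ is odd, or (ii) both $\alpha$ and $n$ are odd. Then $$ \mathbf J_{n,k}\Big(\frac{\alpha-n+1}{2}\Big)=\binom nk c_{\frac{\alpha n}{2}}\big(c_{\frac{\alpha-1}{2}}\big)^{n-k}\,\pi\,\operatorname{Res}_{x=0}\left[\frac{\big(\int_0^x(\sin y)^\alpha dy\big)^{n-k}}{(\sin x)^{\alpha n+2}}\right]. $$
   Context: $\operatorname{Res}_{x=0} g(x)$ denotes the coefficient of $x^{-1}$ in the Laurent expansion of $g$ at $0$. For $d\in\mathbb N$ and $\beta>-1$ the $d$-dimensional beta distribution has density $f_{d,\beta}(x)=c_{d,\beta}(1-\|x\|^2)^\beta\mathbf 1_{\{\|x\|<1\}}$ with $c_{d,\beta}=\Gamma(\frac d2+\beta+1)/(\pi^{d/2}\Gamma(\beta+1))$; for $\beta=-1$ it means the uniform distribution on $\mathbb S^{d-1}$. Write $c_\beta=\Gamma(\beta+\frac32)/(\sqrt\pi\,\Gamma(\beta+1))$. The internal angle $\beta(F,T)$ of a simplex $T\subset\mathbb R^d$ at a face $F$ is $\lim_{r\downarrow0}\mathrm{Vol}_d(B_r(z)\cap T)/\mathrm{Vol}_d(B_r(z))$ with $z$ in the relative interior of $F$. For $X_1,\ldots,X_n$ i.i.d. in $\mathbb R^{n-1}$ with distribution $f_{n-1,\beta}$, $\mathbf J_{n,k}(\beta)=\binom nk\,\mathbb E\,\beta([X_1,\ldots,X_k],[X_1,\ldots,X_n])$.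 *)

theory Defs
  imports "HOL-Probability.Probability" "HOL-Complex_Analysis.Complex_Analysis"
begin

definition beta_const :: "nat \<Rightarrow> real \<Rightarrow> real" where
  "beta_const d \<beta> = Gamma (real d / 2 + \<beta> + 1) / (pi powr (real d / 2) * Gamma (\<beta> + 1))"

definition c_const :: "real \<Rightarrow> real" where
  "c_const \<beta> = Gamma (\<beta> + 3/2) / (sqrt pi * Gamma (\<beta> + 1))"

text \<open>The beta distribution on the Euclidean space 'a (dimension DIM('a)).
  For beta > -1 it has density c (1-|x|^2)^beta on the open unit ball; for beta = -1
  it is the uniform distribution on the unit sphere, realised as the normalised
  cone (surface) measure: the image of the uniform distribution on the unit ball
  under radial projection x \<mapsto> x/|x|.\<close>
definition beta_dist :: "real \<Rightarrow> ('a::euclidean_space) measure" where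
  "beta_dist \<beta> =
     (if \<beta> = -1 then distr (uniform_measure lborel (ball 0 1)) borel (\<lambda>x. sgn x)
      else density lborel (\<lambda>x. ennreal (beta_const DIM('a) \<beta> * (1 - norm x ^ 2) powr \<beta>
                                         * indicator (ball 0 1) x)))"

text \<open>Internal angle of a (full-dimensional) simplex T at a face F: the limit of the
  relative volume of small balls around a point z of the relative interior of F.\<close>
definition internal_angle :: "('a::euclidean_space) set \<Rightarrow> 'a set \<Rightarrow> real" where
  "internal_angle F T =
     (let z = (SOME z. z \<in> rel_interior F) in
       Lim (at_right 0) (\<lambda>r. measure lebesgue (ball z r \<inter> T) / measure lebesgue (ball z r)))"

text \<open>J_{n,k}(beta): points X 0, ..., X (n-1) i.i.d. beta distributed in 'a
  (where DIM('a) = n - 1 is intended).\<close>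
definition J :: "('a::euclidean_space) itself \<Rightarrow> nat \<Rightarrow> nat \<Rightarrow> real \<Rightarrow> real" where
  "J _ n k \<beta> = real (n choose k) *
     (\<integral>X. internal_angle (convex hull (X ` {..<k})) (convex hull (X ` {..<n}))
        \<partial>(PiM {..<n} (\<lambda>_. (beta_dist \<beta> :: 'a measure))))"

definition sin_pow_int :: "nat \<Rightarrow> complex \<Rightarrow> complex" where
  "sin_pow_int \<alpha> x = contour_integral (linepath 0 x) (\<lambda>y. sin y ^ \<alpha>)"

end

theory Submission
 imports Defs
begin

text \<open>The expected internal angle is the probability that a fixed direction e lies in the
 random cone of the simplex at the face, hence (adding the probability for -e) one half of the
 probability that the face is not preserved by the projection along e. Dropping two further
 coordinates of a generic point configuration changes the event that the face is not preserved
 exactly at pairs of facets, so that these probabilities satisfy a linear recursion over the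
 number of points. Its coefficients are explicit, since the hyperplane through the vertices of a
 facet is independent of their shape inside the hyperplane.

 The numbers given by the integrals of (1/2 + c int_0^(iy) cos^alpha)^(s-k) / cosh(y)^(alpha s+2)
 over the line satisfy the same recursion: the corresponding sum is the integral of the derivative
 of a function of y that vanishes at infinity. Translation by pi/2 moves the integral to a vertical
 line, and the integral over a rectangle with vertical sides at distance pi/2 from 0 is twice the
 line integral, because the parity hypothesis makes the integrand odd.\<close>

section \<open>Facets of projected configurations\<close>

text \<open>Let \<open>\<alpha>\<close> be twice the exponent beta plus the dimension. A marginal in
  m coordinates then has the exponent (\<open>\<alpha>\<close> - m)/2, so \<open>\<alpha>\<close>
  stays fixed while coordinates are dropped and all dimensions of the recursion live in one space.
  Coordinates go in pairs because a pointed cone that meets a plane in inner points has exactly two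
  boundary rays there, so the number of facets is twice an indicator. Only every second dimension is
  visited, which is the source of the factors 1 + (-1)^(m + j). The recursion is inhomogeneous, so
  the analytic side must produce its constant too. It comes from a pole: the function of y is an
  integral over phi of a quotient with denominator sin(iy - phi), singular at phi = y = 0, and a
  single power in the numerator would leave a jump at y = 0. Two m-th powers minus the zeroth power
  have a numerator vanishing there, so nothing jumps, and the zeroth power alone contributes 2 pi.
  For beta = -1 there is no density in the full space; hence the laws enter only through densities
  of marginals in fewer coordinates.\<close>

definition aff_indep :: "'b set => nat set => (nat => 'b => real) => bool" where
 "aff_indep U S y \<longleftrightarrow>
   (ALL l. sum l S = 0 & (ALL b:U. (\<Sum>i\<in>S. l i * y i b) = 0) --> (ALL i:S. l i = 0))"

text \<open>By linear duality the failure of this condition says that some affine function of the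
  coordinates in \<open>U\<close> vanishes at the vertices with index below \<open>k\<close> and is
  positive at all others in \<open>I\<close>: the first \<open>k\<close> vertices span a face of the
  projected hull. Accordingly the coefficients at indices below \<open>k\<close> have free
  sign.\<close>

definition not_face :: "'b set => nat => nat set => (nat => 'b => real) => bool" where
 "not_face U k I y \<longleftrightarrow>
   (EX l. sum l I = 0 & (ALL b:U. (\<Sum>i\<in>I. l i * y i b) = 0) &
    (ALL i:I. k <= i --> 0 <= l i) & (EX i:I. k <= i & 0 < l i))"

definition facet :: "'b set => nat set => nat set => (nat => 'b => real) => bool" where
 "facet U S I y \<longleftrightarrow>
   (EX v t. (EX b:U. v b ~= 0) & (ALL i:S. (\<Sum>b\<in>U. v b * y i b) = t) &
    (ALL i:I. t <= (\<Sum>b\<in>U. v b * y i b)))"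

text \<open>Gaussian elimination: an equation with a nonzero coefficient removes one unknown and
  itself, and the difference of the two cardinalities is kept.\<close>

lemma underdetermined_nontrivial:
 fixes M :: "'a => 'b => real"
 assumes "finite A" "finite B" "card A < card B"
 shows "EX u. (EX b:B. u b ~= 0) & (ALL a:A. (\<Sum>b\<in>B. u b * M a b) = 0)"
 using assms
proof (induction A arbitrary: B M rule: finite_induct)
 case empty
 then obtain b where "b : B" by fastforce
 then show ?case by (intro exI[of _ "%_. 1"]) auto
next
 case (insert a A)
 show ?case
 proof (cases "ALL b:B. M a b = 0")
  case True
  from insert have "card A < card B" by simp
  from insert.IH[OF insert.prems(1) this, of M] obtain u where
   "EX b:B. u b ~= 0" "ALL a:A. (\<Sum>b\<in>B. u b * M a b) = 0" by auto
  then show ?thesis using True by (intro exI[of _ u]) auto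
 next
  case False
  then obtain b0 where b0: "b0 : B" "M a b0 ~= 0" by auto
  define B' where "B' = B - {b0}"
  have B': "finite B'" "card A < card B'" "b0 ~: B'" "B = insert b0 B'"
   using insert b0 by (auto simp: B'_def)
  define M' where "M' = (%a' b. M a' b - M a' b0 * (M a b / M a b0))"
  from insert.IH[OF B'(1,2), of M'] obtain u where
   u: "EX b:B'. u b ~= 0" "!!a'. a'\<in>A ==> (\<Sum>b\<in>B'. u b * M' a' b) = 0" by auto
  define s where "s = (\<Sum>b\<in>B'. u b * M a b)"
  define u' where "u' = u(b0 := - s / M a b0)"
  have u's: "(\<Sum>b\<in>B. u' b * M a' b) = (\<Sum>b\<in>B'. u b * M a' b) - s / M a b0 * M a' b0" for a'
  proof -
   have "(\<Sum>b\<in>B'. u' b * M a' b) = (\<Sum>b\<in>B'. u b * M a' b)"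
    using B'(3) by (intro sum.cong) (auto simp: u'_def)
   then show ?thesis using B' by (simp add: u'_def)
  qed
  have "(\<Sum>b\<in>B. u' b * M a' b) = 0" if "a' : A" for a'
  proof -
   have "(\<Sum>b\<in>B'. u b * M' a' b) = (\<Sum>b\<in>B'. u b * M a' b) - s / M a b0 * M a' b0"
    unfolding M'_def s_def
    by (simp add: algebra_simps sum_subtractf sum_distrib_left sum_divide_distrib)
   then show ?thesis using u(2)[OF that] u's[of a'] by simp
  qed
  moreover have "(\<Sum>b\<in>B. u' b * M a b) = 0"
   using u's[of a] b0 by (simp add: s_def)
  moreover have "EX b:B. u' b ~= 0"
   using u(1) B' by (auto simp: u'_def)
  ultimately show ?thesis by (intro exI[of _ u']) auto
 qed
qed

text \<open>The coefficient of \<open>w\<close> is treated as a further unknown, at index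
  \<open>None\<close>. This gives card U + 2 unknowns for card U + 1 equations, and affine
  independence forbids that coefficient to vanish in a nontrivial solution, so one can divide by
  it.\<close>

lemma aff_indep_spans:
 fixes y :: "nat => 'b => real"
 assumes "finite S" "finite U" "card S = card U + 1" "aff_indep U S y"
 shows "EX l. sum l S = 0 & (ALL b:U. (\<Sum>i\<in>S. l i * y i b) = w b)"
proof -
 define M :: "'b option => nat option => real" where
  "M = (%a i. case a of None => (case i of None => 0 | Some i => 1)
    | Some b => (case i of None => - w b | Some i => y i b))"
 have "card (insert None (Some ` U)) = card U + 1" "card (insert None (Some ` S)) = card S + 1"
  using assms by (auto simp: card_image card_insert_if)
 then have "EX u. (EX b:insert None (Some ` S). u b ~= 0) &
   (ALL a:insert None (Some ` U). (\<Sum>b\<in>insert None (Some ` S). u b * M a b) = 0)"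
  using assms by (intro underdetermined_nontrivial) auto
 then obtain u where u: "EX b:insert None (Some ` S). u b ~= 0"
  "!!a. a\<in>insert None (Some ` U) ==> (\<Sum>b\<in>insert None (Some ` S). u b * M a b) = 0" by blast
 have expand: "(\<Sum>b\<in>insert None (Some ` S). u b * M a b) = u None * M a None + (\<Sum>i\<in>S. u (Some i) * M a (Some i))" for a
  using assms(1) by (simp add: sum.reindex)
 define l where "l i = u (Some i)" for i
 have 1: "sum l S = 0" using u(2)[of None] unfolding expand by (simp add: M_def l_def)
 have 2: "(\<Sum>i\<in>S. l i * y i b) = u None * w b" if "b : U" for b
  using u(2)[of "Some b"] that unfolding expand by (simp add: M_def l_def)
 have "u None ~= 0"
 proof
  assume "u None = 0"
  then have "ALL i:S. l i = 0" using 1 2 assms(4) by (auto simp: aff_indep_def)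
  then show False using u(1) \<open>u None = 0\<close> by (auto simp: l_def)
 qed
 then show ?thesis using 1 2
  by (intro exI[of _ "%i. l i / u None"]) (auto simp flip: sum_divide_distrib)
qed

lemma ex_normal:
 fixes y :: "nat => 'b => real"
 assumes "finite S" "finite U" "card S <= card U" "S ~= {}"
 shows "EX v t. (EX b:U. v b ~= 0) & (ALL i:S. (\<Sum>b\<in>U. v b * y i b) = (t::real))"
proof -
 define M :: "nat => 'b option => real" where
  "M = (%i a. case a of None => -1 | Some b => y i b)"
 have "card (insert None (Some ` U)) = card U + 1"
  using assms by (auto simp: card_image card_insert_if)
 then have "EX u. (EX b:insert None (Some ` U). u b ~= 0) &
   (ALL i:S. (\<Sum>b\<in>insert None (Some ` U). u b * M i b) = 0)"
  using assms by (intro underdetermined_nontrivial) auto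
 then obtain u where u: "EX b:insert None (Some ` U). u b ~= 0"
  "!!i. i\<in>S ==> (\<Sum>b\<in>insert None (Some ` U). u b * M i b) = 0" by blast
 have eq: "(\<Sum>b\<in>U. u (Some b) * y i b) = u None" if "i : S" for i
  using u(2)[OF that] assms(2) by (simp add: sum.reindex M_def)
 have "EX b:U. u (Some b) ~= 0"
 proof (rule ccontr)
  assume neg: "~ ?thesis"
  obtain i where "i : S" using assms by auto
  from eq[OF this] neg have "u None = 0" by simp
  then show False using neg u(1) by auto
 qed
 then show ?thesis using eq by (intro exI[of _ "%b. u (Some b)"] exI[of _ "u None"]) auto
qed

text \<open>Applying the affine function given by \<open>v\<close> and \<open>t\<close> to a
  dependency isolates the coefficient of the new point.\<close>

lemma aff_indep_insert:
 assumes "finite S" "i ~: S" "aff_indep U S y" "finite U"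
  and "ALL j:S. (\<Sum>b\<in>U. v b * y j b) = t" "(\<Sum>b\<in>U. v b * y i b) ~= (t::real)"
 shows "aff_indep U (insert i S) y"
 unfolding aff_indep_def
proof (intro allI impI, elim conjE)
 fix l assume l: "sum l (insert i S) = 0" "ALL b:U. (\<Sum>i\<in>insert i S. l i * y i b) = 0"
 let ?g = "%j. \<Sum>b\<in>U. v b * y j b"
 have "(\<Sum>j\<in>insert i S. l j * ?g j) = (\<Sum>b\<in>U. v b * (\<Sum>j\<in>insert i S. l j * y j b))"
  unfolding sum_distrib_left by (subst sum.swap) (simp add: algebra_simps)
 also have "... = 0" using l(2) by (intro sum.neutral) auto
 finally have "l i * ?g i + (\<Sum>j\<in>S. l j * t) = 0" using assms by simp
 moreover have "sum l S = - l i" using l(1) assms by simp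
 ultimately have "l i * ?g i + (- l i) * t = 0" by (metis sum_distrib_right)
 then have "l i * (?g i - t) = 0" by (simp add: algebra_simps)
 then have li: "l i = 0" using assms by simp
 then have "ALL j:S. l j = 0" using l assms by (auto simp: aff_indep_def)
 then show "ALL j:insert i S. l j = 0" using li by simp
qed

text \<open>Otherwise card U + 1 affinely independent points on the hyperplane would represent its
  normal \<open>v\<close> with coefficients of sum 0. Such combinations are orthogonal to
  \<open>v\<close>, so \<open>v\<close> would be orthogonal to itself.\<close>

lemma card_hyperplane_le:
 assumes fin: "finite I" "finite U"
  and gp: "!!S. S <= I ==> card S <= card U + 1 ==> aff_indep U S y"
  and v: "EX b:U. v b ~= 0"
 shows "card {i:I. (\<Sum>b\<in>U. v b * y i b) = (t::real)} <= card U"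
proof (rule ccontr)
 assume "~ ?thesis"
 then have le: "card U + 1 <= card {i:I. (\<Sum>b\<in>U. v b * y i b) = t}" by simp
 obtain S where S: "S <= {i:I. (\<Sum>b\<in>U. v b * y i b) = t}" "card S = card U + 1"
  by (rule obtain_subset_with_card_n[OF le]) auto
 then have SI: "S <= I" by auto
 then have "finite S" "aff_indep U S y" using fin gp[OF SI] S(2) by (auto intro: finite_subset)
 from aff_indep_spans[OF this(1) fin(2) S(2) this(2), of v] obtain l where
  l: "sum l S = 0" "!!b. b : U ==> (\<Sum>i\<in>S. l i * y i b) = v b" by auto
 have "(\<Sum>b\<in>U. v b * v b) = (\<Sum>b\<in>U. v b * (\<Sum>i\<in>S. l i * y i b))"
  using l by simp
 also have "... = (\<Sum>i\<in>S. l i * (\<Sum>b\<in>U. v b * y i b))"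
  unfolding sum_distrib_left by (subst sum.swap) (simp add: algebra_simps)
 also have "... = (\<Sum>i\<in>S. l i * t)" using S by (intro sum.cong) auto
 also have "... = 0" using l by (simp flip: sum_distrib_right)
 finally show False using v fin
  by (auto simp: sum_nonneg_eq_0_iff)
qed

lemma ex_multiple_pos:
 fixes p d :: "'a => real"
 assumes "finite A" "!!i. i : A ==> p i > 0"
 shows "\<exists>N\<ge>0. ALL i:A. N * p i + d i > 0"
proof -
 define N where "N = (\<Sum>i\<in>A. (\<bar>d i\<bar> + 1) / p i)"
 have "N * p i + d i > 0" if "i : A" for i
 proof -
  have "(\<bar>d i\<bar> + 1) / p i <= N" unfolding N_def
   using assms that by (intro member_le_sum) (auto intro!: divide_nonneg_pos)
  then have "\<bar>d i\<bar> + 1 <= N * p i" using assms(2)[OF that] by (simp add: field_simps)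
  then show ?thesis by linarith
 qed
 moreover have "N >= 0" unfolding N_def using assms by (intro sum_nonneg) (auto intro!: divide_nonneg_pos)
 ultimately show ?thesis by blast
qed

text \<open>Move along the line through \<open>w\<close> in direction \<open>- c\<close> as long as
  it stays in \<open>C\<close>. The last point lies on the boundary, and a hyperplane separating
  \<open>C\<close> from the rest of the line supports \<open>C\<close> there.\<close>

lemma closed_cone_boundary:
 fixes C :: "'e::euclidean_space set"
 assumes C: "closed C" "convex_cone C" and c: "- c ~: C" and w: "\<theta>1 *\<^sub>R c + w : C"
 obtains \<theta> a where "\<theta> *\<^sub>R c + w : C" "a ~= 0" "a \<bullet> (\<theta> *\<^sub>R c + w) = 0" "!!x. x : C ==> 0 <= a \<bullet> x"
proof -
 have cmul: "!!r x. r >= 0 ==> x : C ==> r *\<^sub>R x : C" and c0: "0 : C" and conv: "convex C"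
  using C(2) by (auto simp: convex_cone_def conic_def convex_cone_contains_0)
 define T where "T = {\<theta>. \<theta> *\<^sub>R c + w : C}"
 have "closed T" unfolding T_def
  using continuous_closed_vimage[OF C(1), of "%\<theta>. \<theta> *\<^sub>R c + w"] by (simp add: vimage_def)
 \<comment> \<open>Points of \<open>C\<close> arbitrarily far in direction \<open>- c\<close>,
   divided by their parameter, converge to \<open>- c\<close>, which the closed cone does not
   contain.\<close>
 have bdd: "bdd_below T"
 proof (rule ccontr)
  assume "~ bdd_below T"
  then have "ALL n. EX \<theta>:T. \<theta> < - real (Suc n)" unfolding bdd_below_def by (meson not_le)
  then obtain f where f: "!!n. f n : T" "!!n. f n < - real (Suc n)" by metis
  define g where "g n = (1 / \<bar>f n\<bar>) *\<^sub>R (f n *\<^sub>R c + w)" for n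
  have "g n : C" for n unfolding g_def using f[of n] by (intro cmul) (auto simp: T_def)
  have fneg: "f n < 0" for n using f(2)[of n] by simp
  have g: "g n = - c + (1 / \<bar>f n\<bar>) *\<^sub>R w" for n
   using fneg[of n] by (simp add: g_def algebra_simps abs_of_neg)
  have "(%n. 1 / \<bar>f n\<bar>) \<longlonglongrightarrow> 0"
  proof (rule tendsto_sandwich[OF _ _ tendsto_const LIMSEQ_inverse_real_of_nat])
   show "\<forall>\<^sub>F n in sequentially. 1 / \<bar>f n\<bar> <= inverse (real (Suc n))"
   proof (rule always_eventually, rule allI)
    fix n
    have "1 / \<bar>f n\<bar> <= 1 / real (Suc n)" using f(2)[of n] fneg[of n] by (intro frac_le) auto
    then show "1 / \<bar>f n\<bar> <= inverse (real (Suc n))" by (simp add: inverse_eq_divide)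
   qed
  qed auto
  then have "g \<longlonglongrightarrow> - c + 0 *\<^sub>R w" unfolding g by (intro tendsto_intros)
  then have "- c : C" using closed_sequentially[OF C(1), of g "- c"] \<open>!!n. g n : C\<close> by simp
  then show False using c by simp
 qed
 define \<theta> where "\<theta> = Inf T"
 have "\<theta> : T" unfolding \<theta>_def using w bdd \<open>closed T\<close> by (intro closed_contains_Inf) (auto simp: T_def)
 then have pC: "\<theta> *\<^sub>R c + w : C" by (simp add: T_def)
 define p where "p = \<theta> *\<^sub>R c + w"
 \<comment> \<open>The open ray behind the last point: convex and disjoint from \<open>C\<close>.
   Its end point is \<open>p\<close>, so the separating functional is at most 0 at \<open>p\<close>
   in the limit, and at least 0 since \<open>p\<close> is in \<open>C\<close>.\<close>
 define L where "L = (%\<epsilon>. p - \<epsilon> *\<^sub>R c) ` {0<..}"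
 have "convex L"
 proof -
  have "L = (%x. p + x) ` ((%\<epsilon>. \<epsilon> *\<^sub>R (- c)) ` {0<..})" by (auto simp: L_def image_image)
  moreover have "convex ((%\<epsilon>::real. \<epsilon> *\<^sub>R (- c)) ` {0<..})"
   by (intro convex_linear_image) (auto intro!: linearI simp: algebra_simps)
  ultimately show ?thesis using convex_translation by metis
 qed
 moreover have "L Int C = {}"
 proof -
  { fix \<epsilon> :: real assume e: "\<epsilon> > 0" "p - \<epsilon> *\<^sub>R c : C"
   then have "\<theta> - \<epsilon> : T" by (simp add: T_def p_def algebra_simps)
   then have "\<theta> <= \<theta> - \<epsilon>" unfolding \<theta>_def using bdd by (intro cInf_lower)
   then have False using e by simp }
  then show ?thesis by (auto simp: L_def)
 qed
 moreover have "L ~= {}" by (auto simp: L_def)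
 ultimately obtain a b where ab: "a ~= 0" "ALL x:L. a \<bullet> x <= b" "ALL x:C. b <= a \<bullet> x"
  using separating_hyperplane_sets[of L C] conv c0 by blast
 have b0: "b <= 0" using ab(3) c0 by force
 have pos: "0 <= a \<bullet> x" if "x : C" for x
 proof (rule ccontr)
  assume "~ 0 <= a \<bullet> x"
  then have neg: "a \<bullet> x < 0" by simp
  define r where "r = (b - 1) / (a \<bullet> x)"
  have "r >= 0" using neg b0 by (auto simp: r_def intro!: divide_nonpos_neg)
  then have "b <= a \<bullet> (r *\<^sub>R x)" using ab(3) cmul[OF _ that] by blast
  then show False using neg by (simp add: r_def)
 qed
 have "a \<bullet> p <= \<epsilon> * (a \<bullet> c)" if "\<epsilon> > 0" for \<epsilon>
  using ab(2) that b0 by (force simp: L_def inner_diff_right)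
 then have "a \<bullet> p - \<epsilon> * (a \<bullet> c) <= 0" if "\<epsilon> > 0" for \<epsilon> using that by force
 moreover have "((%\<epsilon>. a \<bullet> p - \<epsilon> * (a \<bullet> c)) \<longlongrightarrow> a \<bullet> p - 0 * (a \<bullet> c)) (at_right 0)"
  by (intro tendsto_intros)
 ultimately have "a \<bullet> p - 0 * (a \<bullet> c) <= 0"
  by (intro tendsto_upperbound[where F="at_right (0::real)"]) (auto simp: eventually_at_filter)
 then have "a \<bullet> p = 0" using pos[of p] pC by (simp add: p_def)
 then show ?thesis using that pC ab(1) pos p_def by blast
qed

text \<open>The tangent cone of the projected simplex at the face of the first \<open>k\<close>
  vertices. Coordinates outside \<open>U\<close> are left free, so that cones of all dimensions are
  subsets of the one Euclidean space in which separation and closedness results apply.\<close>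

definition cone_over :: "'e::euclidean_space set => nat => nat set => (nat => 'e => real) => 'e set" where
 "cone_over U k I y = {x. EX l. sum l I = 0 & (ALL i:I. k <= i --> 0 <= l i) &
   (ALL b:U. x \<bullet> b = (\<Sum>i\<in>I. l i * y i b))}"

lemma convex_cone_cone_over: "convex_cone (cone_over U k I y)"
 unfolding convex_cone_iff
proof (intro conjI ballI impI allI)
 show "0 : cone_over U k I y"
  unfolding cone_over_def by (simp, rule exI[of _ "%_. 0"], simp)
next
 fix x z assume "x : cone_over U k I y" "z : cone_over U k I y"
 then obtain l m where "sum l I = 0" "ALL i:I. k <= i --> 0 <= l i" "ALL b:U. x \<bullet> b = (\<Sum>i\<in>I. l i * y i b)"
  "sum m I = 0" "ALL i:I. k <= i --> 0 <= m i" "ALL b:U. z \<bullet> b = (\<Sum>i\<in>I. m i * y i b)"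
  unfolding cone_over_def by blast
 then have "sum (%i. l i + m i) I = 0 & (ALL i:I. k <= i --> 0 <= l i + m i) &
   (ALL b:U. (x + z) \<bullet> b = (\<Sum>i\<in>I. (l i + m i) * y i b))"
  by (simp add: sum.distrib algebra_simps inner_add_left)
 then show "x + z : cone_over U k I y" unfolding cone_over_def by blast
next
 fix x and c :: real assume "x : cone_over U k I y" and c: "0 <= c"
 then obtain l where "sum l I = 0" "ALL i:I. k <= i --> 0 <= l i" "ALL b:U. x \<bullet> b = (\<Sum>i\<in>I. l i * y i b)"
  unfolding cone_over_def by blast
 then have "sum (%i. c * l i) I = 0 & (ALL i:I. k <= i --> 0 <= c * l i) &
   (ALL b:U. (c *\<^sub>R x) \<bullet> b = (\<Sum>i\<in>I. (c * l i) * y i b))"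
  using c by (simp add: mult.assoc flip: sum_distrib_left)
 then show "c *\<^sub>R x : cone_over U k I y" unfolding cone_over_def by blast
qed

lemma inner_basis_sum:
 assumes "U <= Basis" "b : Basis"
 shows "(\<Sum>c\<in>U. f c *\<^sub>R c) \<bullet> b = (if b : U then f b else (0::real))"
proof -
 have "finite U" by (rule finite_subset[OF assms(1) finite_Basis])
 have "(\<Sum>c\<in>U. f c *\<^sub>R c) \<bullet> b = (\<Sum>c\<in>U. if c = b then f c else 0)"
  unfolding inner_sum_left
 proof (intro sum.cong refl)
  fix c assume "c : U"
  then have "c : Basis" using assms(1) by auto
  then show "f c *\<^sub>R c \<bullet> b = (if c = b then f c else 0)"
   using assms(2) by (simp add: inner_Basis)
 qed
 then show ?thesis using \<open>finite U\<close> by simp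
qed

lemma cone_over_diff_mem:
 assumes "finite I" "i : I" "j : I" "j < k" "U <= Basis"
 shows "(\<Sum>b\<in>U. (y i b - y j b) *\<^sub>R b) : cone_over U k I y"
proof -
 define l :: "nat => real" where "l = (%m. of_bool (m = i) - of_bool (m = j))"
 have "finite U" by (rule finite_subset[OF assms(5) finite_Basis])
 have "sum l I = 0" using assms by (simp add: l_def sum_subtractf of_bool_def)
 moreover have "ALL m:I. k <= m --> 0 <= l m" using assms by (auto simp: l_def)
 moreover have "(\<Sum>m\<in>I. l m * y m b) = y i b - y j b" for b
 proof -
  have "(\<Sum>m\<in>I. l m * y m b) = (\<Sum>m\<in>I. if m = i then y m b else 0) - (\<Sum>m\<in>I. if m = j then y m b else 0)"
   unfolding sum_subtractf[symmetric] by (intro sum.cong) (auto simp: l_def)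
  then show ?thesis using assms by simp
 qed
 moreover have "(\<Sum>b\<in>U. (y i b - y j b) *\<^sub>R b) \<bullet> b = y i b - y j b" if "b : U" for b
  using inner_basis_sum[OF assms(5), of b "%b. y i b - y j b"] assms(5) that by auto
 ultimately show ?thesis unfolding cone_over_def by auto
qed

text \<open>The cone is finitely generated: by the differences of the vertices with a base vertex
  \<open>j0\<close> of the face, the negatives of those that belong to the face, and both signs of
  the free basis directions.\<close>

lemma closed_cone_over:
 assumes I: "finite I" "j0 : I" "j0 < k" and U: "U <= Basis"
 shows "closed (cone_over U k I (y :: nat => 'e => real) :: 'e::euclidean_space set)"
proof -
 define d where "d i = (\<Sum>b\<in>U. (y i b - y j0 b) *\<^sub>R b)" for i
 define G where "G = d ` I Un (%i. - d i) ` {i:I. i < k} Un (Basis - U) Un uminus ` (Basis - U)"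
 have finG: "finite G" using I by (auto simp: G_def)
 have fJ: "finite U" by (rule finite_subset[OF U finite_Basis])
 let ?C = "cone_over U k I y" and ?H = "convex_cone hull G"
 have nc: "- d i : ?C" if "i : I" "i < k" for i
 proof -
  have "(\<Sum>b\<in>U. (y j0 b - y i b) *\<^sub>R b) : ?C" using that I U by (intro cone_over_diff_mem) auto
  moreover have "(\<Sum>b\<in>U. (y j0 b - y i b) *\<^sub>R b) = - d i"
   by (simp add: d_def sum_negf[symmetric] algebra_simps)
  ultimately show ?thesis by simp
 qed
 have "b : ?C" "- b : ?C" if "b : Basis - U" for b
  using that U by (auto simp: cone_over_def inner_Basis subset_iff intro!: exI[of _ "%_. 0"])
 moreover have "d i : ?C" if "i : I" for i unfolding d_def using that I U by (intro cone_over_diff_mem) auto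
 ultimately have "G <= ?C" using nc by (auto simp: G_def)
 then have "?H <= ?C" using convex_cone_cone_over by (intro hull_minimal)
 moreover have "?C <= ?H"
 proof
  fix x assume "x : ?C"
  then obtain l where l: "sum l I = 0" "ALL i:I. k <= i --> 0 <= l i" "ALL b:U. x \<bullet> b = (\<Sum>i\<in>I. l i * y i b)"
   unfolding cone_over_def by blast
  have sumH: "sum f A : ?H" if "finite A" "!!a. a : A ==> f a : ?H" for A :: "'z set" and f
   using that by (induction A rule: finite_induct) (auto simp: convex_cone_hull_contains_0 convex_cone_hull_add)
  have inH: "g : ?H" if "g : G" for g using that by (rule hull_inc)
  have "l i *\<^sub>R d i : ?H" if i: "i : I" for i
  proof (cases "0 <= l i")
   case True then show ?thesis using i by (intro convex_cone_hull_mul inH) (auto simp: G_def)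
  next
   case False
   then have "i < k" using l(2) i by force
   then have "(- l i) *\<^sub>R (- d i) : ?H" using False i by (intro convex_cone_hull_mul inH) (auto simp: G_def)
   then show ?thesis by simp
  qed
  then have 1: "(\<Sum>i\<in>I. l i *\<^sub>R d i) : ?H" using I by (intro sumH)
  have "(x \<bullet> b) *\<^sub>R b : ?H" if b: "b : Basis - U" for b
  proof (cases "0 <= x \<bullet> b")
   case True then show ?thesis using b by (intro convex_cone_hull_mul inH) (auto simp: G_def)
  next
   case False
   then have "(- (x \<bullet> b)) *\<^sub>R (- b) : ?H" using b by (intro convex_cone_hull_mul inH) (auto simp: G_def)
   then show ?thesis by simp
  qed
  then have 2: "(\<Sum>b\<in>Basis-U. (x \<bullet> b) *\<^sub>R b) : ?H" by (intro sumH) auto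
  have "x = (\<Sum>i\<in>I. l i *\<^sub>R d i) + (\<Sum>b\<in>Basis-U. (x \<bullet> b) *\<^sub>R b)"
  proof (rule euclidean_eqI)
   fix b :: 'e assume b: "b : Basis"
   have "d i \<bullet> b = (if b : U then y i b - y j0 b else 0)" for i
    unfolding d_def using U b by (rule inner_basis_sum)
   then have "(\<Sum>i\<in>I. l i *\<^sub>R d i) \<bullet> b = (if b : U then (\<Sum>i\<in>I. l i * y i b) - sum l I * y j0 b else 0)"
    by (simp add: inner_sum_left algebra_simps sum_subtractf sum_distrib_right)
   moreover have "(\<Sum>b\<in>Basis-U. (x \<bullet> b) *\<^sub>R b) \<bullet> b = (if b : U then 0 else x \<bullet> b)"
    using inner_basis_sum[of "Basis - U" b "%b. x \<bullet> b"] b by auto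
   ultimately show "x \<bullet> b = ((\<Sum>i\<in>I. l i *\<^sub>R d i) + (\<Sum>b\<in>Basis-U. (x \<bullet> b) *\<^sub>R b)) \<bullet> b"
    using l b by (auto simp: inner_add_left)
  qed
  then show "x : ?H" using convex_cone_hull_add[OF 1 2] by simp
 qed
 ultimately have "?C = ?H" by auto
 then show ?thesis using closed_convex_cone_hull[OF finG] by simp
qed

section \<open>Dropping two coordinates changes faces at pairs of facets\<close>

locale planar_cone =
 fixes y :: "nat => 'e::euclidean_space => real" and U :: "'e set" and e1 e2 :: 'e
  and I :: "nat set" and k :: nat
 assumes U: "U <= Basis" and e12: "e1 : U" "e2 : U" "e1 ~= e2"
  and I: "finite I" "{..<k} <= I" and k1: "1 <= k" and kJ: "k + 1 <= card U" and cardI: "card U + 1 <= card I"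
  and gp1: "!!S. S <= I ==> card S <= card U + 1 ==> aff_indep U S y"
  and gp2: "!!S. S <= I ==> card S <= card U - 1 ==> aff_indep (U - {e1, e2}) S y"
begin

abbreviation "J2 \<equiv> U - {e1, e2}"

definition wsum :: "(nat => real) => nat set => 'e => real" where
 "wsum l S b = (\<Sum>i\<in>S. l i * y i b)"

definition hgt :: "('e => real) => nat => real" where
 "hgt v i = (\<Sum>b\<in>U. v b * y i b)"

lemma finJ: "finite U" using finite_subset[OF U finite_Basis] .

lemma cardJ2: "card U = card J2 + 2"
proof -
 have "card J2 = card U - 2" using e12 finJ by (subst card_Diff_subset) auto
 moreover have "card U >= card {e1, e2}" using e12 finJ by (intro card_mono) auto
 ultimately show ?thesis using e12 by simp
qed

lemma zero_I: "0 : I" using I k1 by auto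

text \<open>Exchange of summation; the level \<open>t\<close> may be subtracted because the
  coefficients sum to 0. When the heights are measured from a supporting hyperplane through the
  face, every term on the right is nonnegative, which is how facets are tested against
  dependencies.\<close>

lemma wsum_hgt:
 assumes "sum l S = 0"
 shows "(\<Sum>b\<in>U. v b * wsum l S b) = (\<Sum>i\<in>S. l i * (hgt v i - t))"
proof -
 have "(\<Sum>b\<in>U. v b * wsum l S b) = (\<Sum>i\<in>S. l i * hgt v i)"
  unfolding wsum_def hgt_def sum_distrib_left by (subst sum.swap) (simp add: algebra_simps)
 also have "... = (\<Sum>i\<in>S. l i * (hgt v i - t))"
  using assms by (simp add: algebra_simps sum_subtractf flip: sum_distrib_left)
 finally show ?thesis .
qed

lemma sum_J_split: "(\<Sum>b\<in>U. f b) = f e1 + f e2 + (\<Sum>b\<in>J2. f b)" for f :: "'e => real"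
proof -
 have "U = insert e1 (insert e2 J2)" using e12 by auto
 then have "sum f U = sum f (insert e1 (insert e2 J2))" by simp
 also have "... = f e1 + f e2 + sum f J2" using e12 finJ by simp
 finally show ?thesis .
qed

text \<open>A dependency modulo the plane has too few points unless its support is large.\<close>
lemma support_full:
 assumes S: "S <= I" "card S = card U" "{..<k} <= S"
  and l: "sum l S = 0" "ALL b:J2. wsum l S b = 0" "i : S" "l i ~= 0"
  and j: "j : S" "k <= j"
 shows "l j ~= 0"
proof
 assume lj: "l j = 0"
 have fS: "finite S" using S I finite_subset by blast
 have "aff_indep J2 (S - {j}) y" using S j fS by (intro gp2) auto
 moreover have "sum l (S - {j}) = 0" using l lj j fS by (simp add: sum_diff1)
 moreover have "ALL b:J2. (\<Sum>i\<in>S - {j}. l i * y i b) = 0"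
  using l(2) lj j fS by (simp add: sum_diff1 wsum_def)
 ultimately have "ALL i:S-{j}. l i = 0" unfolding aff_indep_def by blast
 then show False using l lj by auto
qed

lemma not_faceI:
 assumes "S <= I" "sum l S = 0" "ALL b:B. wsum l S b = 0" "ALL i:S. k <= i --> 0 <= l i" "i : S" "k <= i" "0 < l i"
 shows "not_face B k S y"
 unfolding not_face_def using assms by (intro exI[of _ l]) (auto simp: wsum_def)

lemma not_faceE:
 assumes "not_face B k S y"
 obtains l i where "sum l S = 0" "ALL b:B. wsum l S b = 0" "ALL i:S. k <= i --> 0 <= l i" "i : S" "k <= i" "0 < l i"
 using assms unfolding not_face_def wsum_def by blast

lemma facetE:
 assumes "facet U S I y"
 obtains v t where "EX b:U. v b ~= 0" "ALL i:S. hgt v i = t" "ALL i:I. t <= hgt v i"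
 using assms unfolding facet_def hgt_def by blast

lemma not_face_mono:
 assumes "not_face B k S y" "S <= I"
 shows "not_face B k I y"
proof -
 obtain l i where l: "sum l S = 0" "ALL b:B. wsum l S b = 0" "ALL i:S. k <= i --> 0 <= l i" "i : S" "k <= i" "0 < l i"
  using assms(1) by (rule not_faceE)
 define l' where "l' i = (if i : S then l i else 0)" for i
 have "sum l' I = sum l S" using assms I by (simp add: l'_def sum.If_cases Int_absorb1)
 moreover have "wsum l' I b = wsum l S b" for b
  unfolding wsum_def using assms I by (intro sum.mono_neutral_cong_right) (auto simp: l'_def)
 ultimately show ?thesis using l assms(2) by (intro not_faceI[of _ l' _ i]) (auto simp: l'_def)
qed

lemma not_face_anti: "not_face U k S y ==> not_face J2 k S y"
 unfolding not_face_def by blast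

lemma zero_set_eq:
 assumes "S <= I" "card S = card U" "EX b:U. v b ~= 0" "ALL i:S. hgt v i = t"
 shows "{i:I. hgt v i = t} = S"
proof -
 have "card {i:I. hgt v i = t} <= card S"
  using card_hyperplane_le[OF I(1) finJ gp1 assms(3)] assms(2) unfolding hgt_def by simp
 moreover have "S <= {i:I. hgt v i = t}" using assms by auto
 ultimately show ?thesis using I(1) by (metis (no_types, lifting) card_seteq finite_subset mem_Collect_eq subsetI)
qed

text \<open>Complementary slackness: pairing the dependency with the heights above the facet gives a
  sum of nonnegative terms equal to 0. So the dependency is carried by the vertices of
  \<open>S\<close>, which are affinely independent.\<close>

lemma not_face_no_facet:
 assumes nf: "not_face U k I y" and S: "S <= I" "card S = card U" "{..<k} <= S"
 shows "~ facet U S I y"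
proof
 assume "facet U S I y"
 then obtain v t where v: "EX b:U. v b ~= 0" "ALL i:S. hgt v i = t" "ALL i:I. t <= hgt v i" by (rule facetE)
 obtain l i where l: "sum l I = 0" "ALL b:U. wsum l I b = 0" "ALL i:I. k <= i --> 0 <= l i" "i : I" "k <= i" "0 < l i"
  using nf by (rule not_faceE)
 have fS: "finite S" using S I finite_subset by blast
 have "(\<Sum>i\<in>I. l i * (hgt v i - t)) = 0" using wsum_hgt[OF l(1), of v t] l(2) by simp
 moreover have "0 <= l i * (hgt v i - t)" if "i : I" for i
 proof (cases "k <= i")
  case True then show ?thesis using l(3) v(3) that by auto
 next
  case False then have "i : S" using S(3) by auto
  then show ?thesis using v(2) by simp
 qed
 ultimately have z: "ALL i:I. l i * (hgt v i - t) = 0" using I(1) by (simp add: sum_nonneg_eq_0_iff)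
 have "{i:I. hgt v i = t} = S" using S v by (intro zero_set_eq) auto
 then have off: "l i = 0" if "i : I - S" for i using z that by auto
 have "sum l S = sum l I" "wsum l S b = wsum l I b" for b
  unfolding wsum_def using S I off by (auto intro!: sum.mono_neutral_left)
 then have "ALL i:S. l i = 0" using gp1[of S] S l unfolding aff_indep_def wsum_def by simp
 then show False using off l by (cases "i : S") auto
qed

end

text \<open>Here the face survives in \<open>U\<close> but not in \<open>J2\<close>. The tangent
  cone then meets the plane of \<open>e1\<close> and \<open>e2\<close> in a pointed two-dimensional
  cone, and the facets to be counted are those through its two boundary rays.\<close>

locale planar_cone_two = planar_cone y U e1 e2 I k
 for y :: "nat => 'e::euclidean_space => real" and U e1 e2 I k +
 assumes nf2: "not_face J2 k I y" and f1: "~ not_face U k I y"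
begin

text \<open>The support of a nonnegative dependency, joined with the face, has at least card J2 + 1
  points, since fewer are independent in \<open>J2\<close>. Enough points are thus available to
  compensate weight 1 put on each vertex outside it: this is \<open>d\<close>. A large multiple of
  \<open>l0\<close> then restores positivity on the support, where alone \<open>d\<close> may be
  negative off the face.\<close>

lemma ex_strict: "EX l. sum l I = 0 & (ALL b:J2. wsum l I b = 0) & (ALL i:I. k <= i --> 0 < l i)"
proof -
 obtain l0 i0 where l0: "sum l0 I = 0" "ALL b:J2. wsum l0 I b = 0" "ALL i:I. k <= i --> 0 <= l0 i" "i0 : I" "k <= i0" "0 < l0 i0"
  using nf2 by (rule not_faceE)
 define T where "T = {i:I. i < k | 0 < l0 i}"
 have T: "T <= I" "finite T" using I by (auto simp: T_def)
 have offT: "l0 i = 0" if "i : I - T" for i using that l0(3) by (force simp: T_def)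
 have "card U - 1 <= card T"
 proof (rule ccontr)
  assume "~ ?thesis"
  then have "aff_indep J2 T y" using T by (intro gp2) auto
  moreover have "sum l0 T = sum l0 I" "wsum l0 T b = wsum l0 I b" for b
   unfolding wsum_def using T I offT by (auto intro!: sum.mono_neutral_left)
  ultimately have "ALL i:T. l0 i = 0" using l0 unfolding aff_indep_def wsum_def by simp
  then show False using l0 by (auto simp: T_def)
 qed
 then obtain T0 where T0: "T0 <= T" "card T0 = card U - 1" "finite T0" by (rule obtain_subset_with_card_n)
 have "aff_indep J2 T0 y" using T0 T by (intro gp2) auto
 then obtain m where m: "sum m T0 = 0" "ALL b:J2. (\<Sum>i\<in>T0. m i * y i b) = (\<Sum>j\<in>I-T. y j b - y 0 b)"
  using aff_indep_spans[OF T0(3), of J2 y "%b. \<Sum>j\<in>I-T. y j b - y 0 b"] cardJ2 finJ T0(2) by auto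
 define m' where "m' i = (if i : T0 then m i else 0)" for i
 define d where "d i = of_bool (i : I - T) - real (card (I - T)) * of_bool (i = 0) - m' i" for i
 have "sum m' I = sum m T0" using T0 T I by (simp add: m'_def sum.If_cases Int_absorb1)
 moreover have "(\<Sum>i\<in>I. of_bool (i : I - T) :: real) = card (I - T)"
 proof -
  have "I Int {i. i ~: T} = I - T" by auto
  then show ?thesis using I by (simp add: of_bool_def sum.If_cases)
 qed
 moreover have "(\<Sum>i\<in>I. of_bool (i = 0) :: real) = 1" using I zero_I by (simp add: of_bool_def)
 ultimately have sd: "sum d I = 0" using m(1) unfolding d_def
  by (simp add: sum_subtractf flip: sum_distrib_left)
 have wd: "wsum d I b = 0" if "b : J2" for b
 proof -
  have "wsum d I b = (\<Sum>i\<in>I. of_bool (i : I - T) * y i b) - real (card (I - T)) * (\<Sum>i\<in>I. of_bool (i = 0) * y i b)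
    - (\<Sum>i\<in>I. m' i * y i b)"
   unfolding wsum_def d_def by (simp add: algebra_simps sum_subtractf sum_distrib_left sum.distrib)
  moreover have "(\<Sum>i\<in>I. of_bool (i : I - T) * y i b) = (\<Sum>i\<in>I-T. y i b)"
   using I by (intro sum.mono_neutral_cong_right) auto
  moreover have "(\<Sum>i\<in>I. of_bool (i = 0) * y i b) = (\<Sum>i\<in>{0}. y i b)"
   using I zero_I by (intro sum.mono_neutral_cong_right) auto
  moreover have "(\<Sum>i\<in>I. m' i * y i b) = (\<Sum>i\<in>T0. m i * y i b)"
   using I T0 T by (intro sum.mono_neutral_cong_right) (auto simp: m'_def)
  ultimately show ?thesis using m(2) that by (simp add: sum_subtractf)
 qed
 have "\<exists>N\<ge>0. ALL i:{i:I. l0 i > 0}. N * l0 i + d i > 0"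
  by (rule ex_multiple_pos) (use I in auto)
 then obtain N where N: "N >= 0" "ALL i:{i:I. l0 i > 0}. N * l0 i + d i > 0" by blast
 define l where "l i = N * l0 i + d i" for i
 have "sum l I = 0" using l0 sd by (simp add: l_def sum.distrib flip: sum_distrib_left)
 moreover have "wsum l I b = N * wsum l0 I b + wsum d I b" for b
  unfolding wsum_def l_def by (simp add: algebra_simps sum.distrib sum_distrib_left)
 moreover have "0 < l i" if i: "i : I" "k <= i" for i
 proof (cases "l0 i > 0")
  case True then show ?thesis using N(2) i by (auto simp: l_def)
 next
  case False
  then have "i : I - T" "i ~: T0" "i ~= 0" using i T0 k1 by (auto simp: T_def)
  moreover then have "l0 i = 0" using offT by simp
  ultimately show ?thesis by (simp add: l_def d_def m'_def)
 qed
 ultimately show ?thesis using l0 wd by (intro exI[of _ l]) auto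
qed

definition "l1 = (SOME l. sum l I = 0 & (ALL b:J2. wsum l I b = 0) & (ALL i:I. k <= i --> 0 < l i))"

lemma l1: "sum l1 I = 0" "ALL b:J2. wsum l1 I b = 0" "ALL i:I. k <= i --> 0 < l1 i"
 using someI_ex[OF ex_strict] unfolding l1_def by blast+

text \<open>The point (\<open>c1\<close>, \<open>c2\<close>) of the plane comes from coefficients
  that are strictly positive off the face, so it is an inner direction of the plane cone and a
  natural axis for separating the two boundary rays.\<close>

definition "c1 = wsum l1 I e1"
definition "c2 = wsum l1 I e2"

lemma ex_off: "EX i:I. k <= i"
proof (rule ccontr)
 assume "~ ?thesis"
 then have "I <= {..<k}" by auto
 then have "card I <= k" by (metis card_lessThan card_mono finite_lessThan)
 then show False using cardI kJ by simp
qed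

lemma no_dep:
 assumes "sum l I = 0" "ALL b:U. wsum l I b = 0" "ALL i:I. k <= i --> 0 <= l i" "i : I" "k <= i"
 shows "l i = 0"
 using f1 not_faceI[of I l U i] assms by force

lemma c_nz: "c1\<^sup>2 + c2\<^sup>2 > 0"
proof (rule ccontr)
 assume "~ ?thesis"
 then have "c1 = 0" "c2 = 0" by (auto simp: sum_power2_gt_zero_iff)
 then have "ALL b:U. wsum l1 I b = 0" using l1(2) by (auto simp: c1_def c2_def)
 moreover obtain i where "i : I" "k <= i" using ex_off by auto
 ultimately have "l1 i = 0" "0 < l1 i" using no_dep[of l1 i] l1 less_imp_le by (blast, blast)
 then show False by simp
qed

text \<open>The point of the plane with coordinates theta, eta in the orthogonal frame c, c^perp
 is a nonnegative combination of the vertices of S.\<close>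
definition rep :: "nat set => real => real => (nat => real) => bool" where
 "rep S \<theta> \<eta> l \<longleftrightarrow> sum l S = 0 & (ALL i:S. k <= i --> 0 <= l i) & (ALL b:J2. wsum l S b = 0) &
   wsum l S e1 = \<theta> * c1 - \<eta> * c2 & wsum l S e2 = \<theta> * c2 + \<eta> * c1"

lemma rep_scale:
 assumes "rep S \<theta> \<eta> l" "r >= 0" shows "rep S (r * \<theta>) (r * \<eta>) (%i. r * l i)"
proof -
 have "wsum (%i. r * l i) S b = r * wsum l S b" for b
  by (simp add: wsum_def mult.assoc flip: sum_distrib_left)
 note w = this
 have h: "wsum l S e1 = \<theta> * c1 - \<eta> * c2" "wsum l S e2 = \<theta> * c2 + \<eta> * c1" using assms by (auto simp: rep_def)
 have "sum l S = 0" "ALL i:S. k <= i --> 0 <= l i" "ALL b:J2. wsum l S b = 0" using assms by (auto simp: rep_def)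
 then show ?thesis using assms(2) unfolding rep_def w h
  by (simp add: right_diff_distrib distrib_left mult.assoc flip: sum_distrib_left)
qed

lemma rep_add:
 assumes "rep S \<theta> \<eta> l" "rep S \<theta>' \<eta>' l'" shows "rep S (\<theta> + \<theta>') (\<eta> + \<eta>') (%i. l i + l' i)"
proof -
 have "wsum (%i. l i + l' i) S b = wsum l S b + wsum l' S b" for b
  by (simp add: wsum_def sum.distrib algebra_simps)
 then show ?thesis using assms unfolding rep_def by (auto simp: algebra_simps sum.distrib)
qed

definition good :: "nat set => bool" where
 "good S \<longleftrightarrow> {..<k} <= S & S <= I & card S = card U & facet U S I y & not_face J2 k S y"

definition vc :: "('e => real) => real" where "vc v = v e1 * c1 + v e2 * c2"

text \<open>\<open>vc v\<close> is the sum of the heights weighted with \<open>l1\<close>. By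
  general position only \<open>S\<close> lies on the hyperplane, so a vertex outside
  \<open>S\<close> contributes a strictly positive term.\<close>

lemma vc_pos:
 assumes S: "S <= I" "card S = card U" "{..<k} <= S"
  and v: "EX b:U. v b ~= 0" "ALL i:S. hgt v i = t" "ALL i:I. t <= hgt v i"
 shows "vc v > 0"
proof -
 have "vc v = (\<Sum>b\<in>U. v b * wsum l1 I b)"
  unfolding sum_J_split using l1(2) by (simp add: vc_def c1_def c2_def)
 also have "... = (\<Sum>i\<in>I. l1 i * (hgt v i - t))" using l1(1) by (rule wsum_hgt)
 finally have eq: "vc v = (\<Sum>i\<in>I. l1 i * (hgt v i - t))" .
 have Z: "{i:I. hgt v i = t} = S" using S v by (intro zero_set_eq) auto
 have "S ~= I" using S cardI by auto
 then obtain i where i: "i : I" "i ~: S" using S by auto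
 then have ki: "k <= i" using S(3) by (meson lessThan_iff not_le subsetD)
 have "0 < l1 i * (hgt v i - t)"
 proof -
  have "hgt v i ~= t" using i Z by auto
  then have "hgt v i > t" using v(3) i by force
  then show ?thesis using l1(3) i ki by auto
 qed
 moreover have "0 <= l1 j * (hgt v j - t)" if "j : I" for j
 proof (cases "k <= j")
  case True
  then have "0 < l1 j" "t <= hgt v j" using l1(3) v(3) that by auto
  then show ?thesis by simp
 next
  case False then have "j : S" using S(3) by auto
  then show ?thesis using v(2) by simp
 qed
 ultimately show ?thesis unfolding eq using I(1) i by (intro sum_pos2[of _ i]) auto
qed

lemma rep_hgt:
 assumes "rep S \<theta> \<eta> l"
 shows "\<theta> * vc v + \<eta> * (v e2 * c1 - v e1 * c2) = (\<Sum>i\<in>S. l i * (hgt v i - t))"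
proof -
 have "(\<Sum>b\<in>U. v b * wsum l S b) = \<theta> * vc v + \<eta> * (v e2 * c1 - v e1 * c2)"
 proof -
  have h: "wsum l S e1 = \<theta> * c1 - \<eta> * c2" "wsum l S e2 = \<theta> * c2 + \<eta> * c1" "ALL b:J2. wsum l S b = 0"
   using assms by (auto simp: rep_def)
  show ?thesis unfolding sum_J_split h(1,2) using h(3) by (simp add: vc_def algebra_simps)
 qed
 then show ?thesis using wsum_hgt[of l S v t] assms by (simp add: rep_def)
qed

lemma good_facetE:
 assumes "good S"
 obtains v t where "EX b:U. v b ~= 0" "ALL i:S. hgt v i = t" "ALL i:I. t <= hgt v i" "vc v > 0"
  "{i:I. hgt v i = t} = S"
proof -
 have g: "{..<k} <= S" "S <= I" "card S = card U" "facet U S I y" using assms by (auto simp: good_def)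
 obtain v t where v: "EX b:U. v b ~= 0" "ALL i:S. hgt v i = t" "ALL i:I. t <= hgt v i"
  using g(4) by (rule facetE)
 show ?thesis by (rule that[OF v vc_pos[OF g(2,3,1) v] zero_set_eq[OF g(2,3) v(1,2)]])
qed

text \<open>The normal of the facet through \<open>S\<close> vanishes at its own point of the plane
  and is nonnegative at every other point of the cone. Since it is positive on \<open>c\<close>, the
  facet attains the least \<theta> for the given \<eta>.\<close>

lemma unique_aux:
 assumes g: "good S" "good S'" and r: "rep S \<theta> \<eta> l" "rep S' \<theta>' \<eta> l'"
 shows "\<theta> <= \<theta>'"
proof -
 obtain v t where "EX b:U. v b ~= 0" and v: "ALL i:S. hgt v i = t" "ALL i:I. t <= hgt v i" "vc v > 0" "{i:I. hgt v i = t} = S"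
  by (rule good_facetE[OF g(1)])
 have "\<theta> * vc v + \<eta> * (v e2 * c1 - v e1 * c2) = 0"
  using rep_hgt[OF r(1), of v t] v(1) by simp
 moreover have "(\<Sum>i\<in>S'. l' i * (hgt v i - t)) >= 0"
 proof (intro sum_nonneg)
  fix i assume i: "i : S'"
  show "0 <= l' i * (hgt v i - t)"
  proof (cases "k <= i")
   case True then show ?thesis using i r(2) v(2) g(2) by (auto simp: rep_def good_def)
  next
   case False
   then have "i : S" using g(1) by (auto simp: good_def)
   then show ?thesis using v by auto
  qed
 qed
 then have "0 <= \<theta>' * vc v + \<eta> * (v e2 * c1 - v e1 * c2)"
  using rep_hgt[OF r(2), of v t] by simp
 ultimately have "0 <= (\<theta>' - \<theta>) * vc v" by (simp add: algebra_simps)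
 then show ?thesis using v(3) by (simp add: zero_le_mult_iff)
qed

text \<open>With equal \<theta> the point represented over \<open>S'\<close> lies on the hyperplane
  of \<open>S\<close>, so every vertex with nonzero coefficient does. By \<open>support_full\<close>
  these include all vertices of \<open>S'\<close> off the face.\<close>

lemma unique:
 assumes g: "good S" "good S'" and r: "rep S \<theta> \<eta> l" "rep S' \<theta>' \<eta> l'" and e: "\<eta> ~= 0"
 shows "S = S'"
proof -
 have th: "\<theta> = \<theta>'" using unique_aux[OF g r] unique_aux[OF g(2,1) r(2,1)] by simp
 obtain v t where "EX b:U. v b ~= 0" and v: "ALL i:S. hgt v i = t" "ALL i:I. t <= hgt v i" "vc v > 0" "{i:I. hgt v i = t} = S"
  by (rule good_facetE[OF g(1)])
 have S': "S' <= I" "card S' = card U" "{..<k} <= S'" "finite S'" and Sc: "card S = card U" "finite S" "{..<k} <= S"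
  using g I finite_subset unfolding good_def by blast+
 have "(\<Sum>i\<in>S'. l' i * (hgt v i - t)) = 0"
  using rep_hgt[OF r(1), of v t] rep_hgt[OF r(2), of v t] th v(1) by simp
 moreover have nn: "0 <= l' i * (hgt v i - t)" if i: "i : S'" for i
 proof (cases "k <= i")
  case True then show ?thesis using i r(2) v(2) g(2) by (auto simp: rep_def good_def)
 next
  case False
  then have "i : S" using g(1) by (auto simp: good_def)
  then show ?thesis using v by auto
 qed
 ultimately have z: "ALL i:S'. l' i * (hgt v i - t) = 0"
  using S'(4) by (simp add: sum_nonneg_eq_0_iff)
 have "EX i:S'. l' i ~= 0"
 proof (rule ccontr)
  assume "~ ?thesis"
  then have "wsum l' S' e1 = 0" "wsum l' S' e2 = 0" by (auto simp: wsum_def)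
  then have "\<theta>' * c1 - \<eta> * c2 = 0" "\<theta>' * c2 + \<eta> * c1 = 0" using r(2) by (auto simp: rep_def)
  then have "\<eta> * (c1\<^sup>2 + c2\<^sup>2) = 0" by algebra
  then show False using e c_nz by simp
 qed
 then obtain i where i: "i : S'" "l' i ~= 0" by auto
 have "S' <= S"
 proof
  fix j assume j: "j : S'"
  show "j : S"
  proof (cases "k <= j")
   case True
   then have "l' j ~= 0" using support_full[of S' l' i j] S' i j r(2) by (simp add: rep_def)
   then have "hgt v j = t" using z j by auto
   then show ?thesis using v(4) j S'(1) by auto
  next
   case False then show ?thesis using Sc by auto
  qed
 qed
 then show ?thesis using Sc S' by (metis card_subset_eq)
qed

text \<open>The dependency modulo \<open>J2\<close> gives a point of the plane on the facet
  hyperplane. It is off the axis of \<open>c\<close>: a point of that axis on the hyperplane is 0,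
  and then the dependency would hold in \<open>U\<close>. Scaling makes \<eta> equal to 1 or
  -1.\<close>

lemma good_rep:
 assumes g: "good S"
 shows "EX \<theta> l. rep S \<theta> 1 l | rep S \<theta> (-1) l"
proof -
 have S: "S <= I" "card S = card U" "{..<k} <= S" "not_face J2 k S y" using g by (auto simp: good_def)
 obtain l i where l: "sum l S = 0" "ALL b:J2. wsum l S b = 0" "ALL i:S. k <= i --> 0 <= l i" "i : S" "k <= i" "0 < l i"
  using S(4) by (rule not_faceE)
 define n where "n = c1\<^sup>2 + c2\<^sup>2"
 have n: "n > 0" using c_nz by (simp add: n_def)
 define \<theta> where "\<theta> = (wsum l S e1 * c1 + wsum l S e2 * c2) / n"
 define \<eta> where "\<eta> = (wsum l S e2 * c1 - wsum l S e1 * c2) / n"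
 have "\<theta> * c1 - \<eta> * c2 = (wsum l S e1 * n) / n" "\<theta> * c2 + \<eta> * c1 = (wsum l S e2 * n) / n"
  unfolding \<theta>_def \<eta>_def by (simp_all add: n_def power2_eq_square algebra_simps add_divide_distrib diff_divide_distrib)
 then have r: "rep S \<theta> \<eta> l" using l n unfolding rep_def by simp
 obtain v t where "EX b:U. v b ~= 0" and v: "ALL i:S. hgt v i = t" "ALL i:I. t <= hgt v i" "vc v > 0" "{i:I. hgt v i = t} = S"
  by (rule good_facetE[OF g(1)])
 have "\<eta> ~= 0"
 proof
  assume e: "\<eta> = 0"
  have "\<theta> * vc v = 0" using rep_hgt[OF r, of v t] v(1) e by simp
  then have "\<theta> = 0" using v by simp
  then have "ALL b:U. wsum l S b = 0" using r e by (auto simp: rep_def)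
  then have "ALL i:S. l i = 0" using gp1[of S] S l(1) unfolding aff_indep_def wsum_def by simp
  then show False using l by auto
 qed
 then consider "\<eta> > 0" | "\<eta> < 0" by linarith
 then show ?thesis
 proof cases
  case 1
  then have "rep S (1 / \<eta> * \<theta>) 1 (%i. 1 / \<eta> * l i)" using rep_scale[OF r, of "1 / \<eta>"] by simp
  then show ?thesis by blast
 next
  case 2
  then have "rep S (- 1 / \<eta> * \<theta>) (- 1) (%i. - 1 / \<eta> * l i)"
   using rep_scale[OF r, of "- 1 / \<eta>"] by (simp add: divide_nonpos_neg)
  then show ?thesis by blast
 qed
qed

text \<open>The sum of two representations on opposite sides lies on the axis of \<open>c\<close>
  and on the facet hyperplane, so it is 0 and the coefficients cancel. Off the face they are
  nonnegative, hence zero, against \<open>support_full\<close>.\<close>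

lemma rep_not_both:
 assumes g: "good S" and r: "rep S \<theta> 1 l" "rep S \<theta>' (-1) l'"
 shows False
proof -
 have S: "S <= I" "card S = card U" "{..<k} <= S" "finite S" using g I finite_subset by (auto simp: good_def)
 have r': "rep S (\<theta> + \<theta>') 0 (%i. l i + l' i)" using rep_add[OF r] by simp
 obtain v t where "EX b:U. v b ~= 0" and v: "ALL i:S. hgt v i = t" "ALL i:I. t <= hgt v i" "vc v > 0" "{i:I. hgt v i = t} = S"
  by (rule good_facetE[OF g(1)])
 have "(\<theta> + \<theta>') * vc v = 0" using rep_hgt[OF r', of v t] v(1) by simp
 then have "\<theta> + \<theta>' = 0" using v by simp
 then have "ALL b:U. wsum (%i. l i + l' i) S b = 0" using r' by (auto simp: rep_def)
 moreover have "sum (%i. l i + l' i) S = 0" using r' by (simp add: rep_def)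
 moreover have "aff_indep U S y" using gp1[of S] S by simp
 ultimately have z: "ALL i:S. l i + l' i = 0" unfolding aff_indep_def wsum_def by (elim allE[of _ "%i. l i + l' i"]) blast
 have lz: "l i = 0" if "i : S" "k <= i" for i
  using z that r by (force simp: rep_def)
 obtain j where j: "j : S" "k <= j"
 proof (rule ccontr)
  assume "~ thesis"
  then have "S <= {..<k}" using that by force
  then have "card S <= k" by (metis card_lessThan card_mono finite_lessThan)
  then show False using S kJ by simp
 qed
 have "ALL i:S. l i = 0"
 proof (rule ccontr)
  assume "~ ?thesis"
  then obtain i where "i : S" "l i ~= 0" by auto
  then have "l j ~= 0" using support_full[OF S(1-3), of l i j] r(1) j by (auto simp: rep_def)
  then show False using lz j by auto
 qed
 then have "wsum l S e1 = 0" "wsum l S e2 = 0" by (auto simp: wsum_def)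
 then have "\<theta> * c1 - 1 * c2 = 0" "\<theta> * c2 + 1 * c1 = 0" using r(1) by (auto simp: rep_def)
 then have "c1\<^sup>2 + c2\<^sup>2 = 0" by algebra
 then show False using c_nz by simp
qed

text \<open>The line parallel to \<open>c\<close> at offset \<eta> enters the plane cone, because a
  large multiple of \<open>l1\<close> absorbs any negative coefficients, and leaves it in direction
  \<open>- c\<close>. The supporting functional at the last point is the normal of the
  facet.\<close>

lemma ex_good:
 assumes e: "\<eta> ~= 0"
 shows "EX S \<theta> l. good S & rep S \<theta> \<eta> l"
proof -
 let ?C = "cone_over U k I y :: 'e set"
 have e1B: "e1 : Basis" "e2 : Basis" using U e12 by auto
 define c where "c = c1 *\<^sub>R e1 + c2 *\<^sub>R e2"
 define w where "w = (- \<eta> * c2) *\<^sub>R e1 + (\<eta> * c1) *\<^sub>R e2"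
 have inn: "(p *\<^sub>R e1 + q *\<^sub>R e2) \<bullet> b = (if b = e1 then p else if b = e2 then q else 0)" if "b : U" for p q b
  using that U e12 e1B by (auto simp: inner_add_left inner_Basis)
 have cw: "\<theta> *\<^sub>R c + w = (\<theta> * c1 - \<eta> * c2) *\<^sub>R e1 + (\<theta> * c2 + \<eta> * c1) *\<^sub>R e2" for \<theta>
  by (simp add: c_def w_def algebra_simps)
 have "- c ~: ?C"
 proof
  assume "- c : ?C"
  then obtain l where l: "sum l I = 0" "ALL i:I. k <= i --> 0 <= l i" "ALL b:U. (- c) \<bullet> b = wsum l I b"
   by (auto simp: cone_over_def wsum_def)
  obtain i where i: "i : I" "k <= i" using ex_off by auto
  have ws: "wsum (%i. l i + l1 i) I b = wsum l I b + wsum l1 I b" for b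
   by (simp add: wsum_def sum.distrib algebra_simps)
  have "l i + l1 i = 0"
  proof (rule no_dep[of "%i. l i + l1 i"])
   show "ALL b:U. wsum (%i. l i + l1 i) I b = 0"
   proof
    fix b assume b: "b : U"
    have "wsum l I b = - (c \<bullet> b)" using l(3) b by simp
    moreover have "wsum l1 I b = c \<bullet> b"
    using l1(2) b unfolding c_def inn[OF b] by (auto simp: c1_def c2_def)
    ultimately show "wsum (%i. l i + l1 i) I b = 0" by (simp add: ws)
   qed
   show "ALL i:I. k <= i --> 0 <= l i + l1 i" using l(2) l1(3) by (meson add_nonneg_nonneg less_imp_le)
  qed (use l l1 i in \<open>auto simp: sum.distrib\<close>)
  moreover have "0 <= l i" "0 < l1 i" using l(2) l1(3) i by auto
  ultimately show False by simp
 qed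
 moreover have "EX \<theta>. \<theta> *\<^sub>R c + w : ?C"
 proof -
  obtain T where T: "T <= I" "card T = card U + 1" "finite T"
   by (rule obtain_subset_with_card_n[OF cardI])
  have "aff_indep U T y" using T by (intro gp1) auto
  then obtain m where m: "sum m T = 0" "ALL b:U. (\<Sum>i\<in>T. m i * y i b) = w \<bullet> b"
   using aff_indep_spans[OF T(3) finJ T(2), of y "%b. w \<bullet> b"] by auto
  define m' where "m' i = (if i : T then m i else 0)" for i
  have m1: "sum m' I = 0" using T I m(1) by (simp add: m'_def sum.If_cases Int_absorb1)
  have m2: "wsum m' I b = (\<Sum>i\<in>T. m i * y i b)" for b
   unfolding wsum_def using I T by (intro sum.mono_neutral_cong_right) (auto simp: m'_def)
  have "\<exists>N\<ge>0. ALL i:{i:I. k <= i}. N * l1 i + m' i > 0"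
   by (rule ex_multiple_pos) (use I l1 in auto)
  then obtain N where N: "N >= 0" "ALL i:{i:I. k <= i}. N * l1 i + m' i > 0" by blast
  have "(N *\<^sub>R c + w) \<bullet> b = (\<Sum>i\<in>I. (N * l1 i + m' i) * y i b)" if b: "b : U" for b
  proof -
   have "(\<Sum>i\<in>I. (N * l1 i + m' i) * y i b) = N * wsum l1 I b + wsum m' I b"
    by (simp add: wsum_def sum.distrib algebra_simps sum_distrib_left)
   also have "wsum m' I b = w \<bullet> b" using m2 m(2) b by simp
   also have "wsum l1 I b = c \<bullet> b"
    using l1(2) b unfolding c_def inn[OF b] by (auto simp: c1_def c2_def)
   finally show ?thesis by (simp add: inner_add_left)
  qed
  moreover have "sum (%i. N * l1 i + m' i) I = 0"
   using l1(1) m1 by (simp add: sum.distrib flip: sum_distrib_left)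
  ultimately have "N *\<^sub>R c + w : ?C" unfolding cone_over_def using N(2)
   by (intro CollectI exI[of _ "%i. N * l1 i + m' i"]) (auto intro: less_imp_le)
  then show ?thesis by blast
 qed
 moreover have "closed ?C" using closed_cone_over[OF I(1) zero_I _ U] k1 by simp
 ultimately obtain \<theta> a where a: "\<theta> *\<^sub>R c + w : ?C" "a ~= 0" "a \<bullet> (\<theta> *\<^sub>R c + w) = 0" "!!x. x : ?C ==> 0 <= a \<bullet> x"
  using closed_cone_boundary[OF _ convex_cone_cone_over] by metis
 define p where "p = \<theta> *\<^sub>R c + w"
 define v where "v b = a \<bullet> b" for b
 have aoff: "a \<bullet> b = 0" if "b : Basis - U" for b
 proof -
  have "b : ?C" "- b : ?C"
   using that U by (auto simp: cone_over_def inner_Basis subset_iff intro!: exI[of _ "%_. 0"])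
  from a(4)[OF this(1)] a(4)[OF this(2)] show ?thesis by simp
 qed
 have av: "a \<bullet> x = (\<Sum>b\<in>U. v b * (x \<bullet> b))" for x
 proof -
  have "a \<bullet> x = (\<Sum>b\<in>Basis. v b * (x \<bullet> b))" unfolding v_def by (rule euclidean_inner)
  also have "... = (\<Sum>b\<in>U. v b * (x \<bullet> b))"
   using U aoff by (intro sum.mono_neutral_right) (auto simp: v_def)
  finally show ?thesis .
 qed
 have vnz: "EX b:U. v b ~= 0"
 proof (rule ccontr)
  assume "~ ?thesis"
  then have "a \<bullet> a = 0" unfolding av by simp
  then show False using a(2) by simp
 qed
 define t where "t = hgt v 0"
 have ad: "a \<bullet> (\<Sum>b\<in>U. (y i b - y j b) *\<^sub>R b) = hgt v i - hgt v j" for i j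
 proof -
  have "a \<bullet> (\<Sum>b\<in>U. (y i b - y j b) *\<^sub>R b) = (\<Sum>b\<in>U. v b * (y i b - y j b))"
   unfolding av using inner_basis_sum[OF U] U by (intro sum.cong) auto
  then show ?thesis by (simp add: hgt_def algebra_simps sum_subtractf)
 qed
 have h1: "t <= hgt v i" if "i : I" for i
  using a(4)[OF cone_over_diff_mem[OF I(1) that zero_I _ U, of k y]] k1 ad[of i 0] by (simp add: t_def)
 have h2: "hgt v i = t" if "i < k" for i
  using a(4)[OF cone_over_diff_mem[OF I(1) zero_I _ that U, of y]] I(2) that ad[of 0 i] h1[of i] by (force simp: t_def)
 obtain l where l: "sum l I = 0" "ALL i:I. k <= i --> 0 <= l i" "ALL b:U. p \<bullet> b = wsum l I b"
  using a(1) by (auto simp: cone_over_def wsum_def p_def)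
 have "(\<Sum>i\<in>I. l i * (hgt v i - t)) = (\<Sum>b\<in>U. v b * wsum l I b)" using wsum_hgt[OF l(1)] by simp
 also have "... = a \<bullet> p" unfolding av using l(3) by (intro sum.cong) auto
 also have "... = 0" using a(3) by (simp add: p_def)
 finally have "(\<Sum>i\<in>I. l i * (hgt v i - t)) = 0" .
 moreover have "0 <= l i * (hgt v i - t)" if "i : I" for i
 proof (cases "k <= i")
  case True then show ?thesis using l(2) h1 that by auto
 next
  case False then show ?thesis using h2 by auto
 qed
 ultimately have z: "ALL i:I. l i * (hgt v i - t) = 0" using I(1) by (simp add: sum_nonneg_eq_0_iff)
 define S where "S = {i:I. hgt v i = t}"
 have SI: "S <= I" "{..<k} <= S" "finite S" using I h2 by (auto simp: S_def)
 have off: "l i = 0" if "i : I - S" for i using z that by (auto simp: S_def)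
 have sS: "sum l S = 0" "wsum l S b = wsum l I b" for b
 proof -
  have "sum l S = sum l I" using SI I off by (intro sum.mono_neutral_left) auto
  then show "sum l S = 0" using l by simp
  show "wsum l S b = wsum l I b" unfolding wsum_def using SI I off by (intro sum.mono_neutral_left) auto
 qed
 have pb: "p \<bullet> b = (if b = e1 then \<theta> * c1 - \<eta> * c2 else if b = e2 then \<theta> * c2 + \<eta> * c1 else 0)" if "b : U" for b
  unfolding p_def cw using inn[OF that] .
 have wJ: "wsum l S b = (if b = e1 then \<theta> * c1 - \<eta> * c2 else if b = e2 then \<theta> * c2 + \<eta> * c1 else 0)" if "b : U" for b
  using pb[OF that] l(3) sS(2) that by simp
 then have rp: "rep S \<theta> \<eta> l" using sS l(2) SI e12 by (auto simp: rep_def)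
 have nz: "EX i:S. l i ~= 0"
 proof (rule ccontr)
  assume "~ ?thesis"
  then have "wsum l S e1 = 0" "wsum l S e2 = 0" by (auto simp: wsum_def)
  then have "\<theta> * c1 - \<eta> * c2 = 0" "\<theta> * c2 + \<eta> * c1 = 0" using rp by (auto simp: rep_def)
  then have "\<eta> * (c1\<^sup>2 + c2\<^sup>2) = 0" by algebra
  then show False using e c_nz by simp
 qed
 \<comment> \<open>With fewer vertices on the supporting hyperplane the represented point would be a
   dependency of points independent in \<open>J2\<close>; more than card U vertices are excluded by
   general position in \<open>U\<close>.\<close>
 have "card U <= card S"
 proof (rule ccontr)
  assume "~ ?thesis"
  then have "aff_indep J2 S y" using SI by (intro gp2) auto
  then show False using nz rp unfolding aff_indep_def rep_def wsum_def by blast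
 qed
 moreover have "card S <= card U"
  unfolding S_def hgt_def using card_hyperplane_le[OF I(1) finJ gp1 vnz] by simp
 ultimately have cS: "card S = card U" by simp
 have "facet U S I y" unfolding facet_def using vnz h1
  by (intro exI[of _ v] exI[of _ t]) (auto simp: S_def hgt_def)
 moreover have "not_face J2 k S y"
 proof -
  obtain j where j: "j : S" "k <= j"
  proof (rule ccontr)
   assume "~ thesis"
   then have "S <= {..<k}" using that by force
   then have "card S <= k" by (metis card_lessThan card_mono finite_lessThan)
   then show False using cS kJ by simp
  qed
  obtain i where "i : S" "l i ~= 0" using nz by auto
  then have "l j ~= 0" using support_full[OF SI(1) cS SI(2), of l i j] rp j by (auto simp: rep_def)
  then have "0 < l j" using l(2) j SI by force
  then show ?thesis using rp SI j by (intro not_faceI[of S l J2 j]) (auto simp: rep_def)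
 qed
 ultimately have "good S" using SI cS by (simp add: good_def)
 then show ?thesis using rp by blast
qed

lemma card_good: "card {S. good S} = 2"
proof -
 obtain S1 t1 m1 S2 t2 m2 where 1: "good S1" "rep S1 t1 1 m1" and 2: "good S2" "rep S2 t2 (-1) m2"
  using ex_good[of 1] ex_good[of "-1"] by auto
 have "S1 ~= S2" using rep_not_both 1 2 by blast
 moreover have "{S. good S} = {S1, S2}"
 proof (intro equalityI subsetI)
  fix S assume "S : {S. good S}"
  then have g: "good S" by simp
  then obtain \<theta> l where "rep S \<theta> 1 l | rep S \<theta> (-1) l" using good_rep by blast
  then show "S : {S1, S2}"
   using unique[OF g 1(1) _ 1(2)] unique[OF g 2(1) _ 2(2)] by auto
 qed (use 1 2 in auto)
 ultimately show ?thesis by simp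
qed

end

context planar_cone
begin

text \<open>A face lost already in \<open>U\<close> lies in no facet, and a face kept in
  \<open>J2\<close> is not lost by any subset of the vertices, so both sides vanish in these cases.
  Between them the count is two, one facet for each side of the axis of \<open>c\<close>.\<close>

theorem not_face_difference:
 "2 * (of_bool (not_face J2 k I y) - of_bool (not_face U k I y)) =
   (\<Sum>S | {..<k} <= S & S <= I & card S = card U. of_bool (facet U S I y & not_face J2 k S y) :: real)"
proof -
 let ?A = "{S. {..<k} <= S & S <= I & card S = card U}"
 have finA: "finite ?A" by (rule finite_subset[of _ "Pow I"]) (use I in auto)
 consider "not_face U k I y" | "~ not_face J2 k I y" | "not_face J2 k I y" "~ not_face U k I y" by blast
 then show ?thesis
 proof cases
  case 1
  then have "(\<Sum>S\<in>?A. of_bool (facet U S I y & not_face J2 k S y) :: real) = 0"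
   using not_face_no_facet by (intro sum.neutral) auto
  then show ?thesis using 1 not_face_anti by simp
 next
  case 2
  then have "(\<Sum>S\<in>?A. of_bool (facet U S I y & not_face J2 k S y) :: real) = 0"
   using not_face_mono by (intro sum.neutral) auto
  then show ?thesis using 2 not_face_anti by auto
 next
  case 3
  then interpret planar_cone_two y U e1 e2 I k by unfold_locales
  have "(\<Sum>S\<in>?A. of_bool (facet U S I y & not_face J2 k S y) :: real) = card {S. good S}"
   using finA by (simp add: of_bool_def sum.If_cases good_def conj_assoc Collect_conj_eq[symmetric])
  then show ?thesis using 3 card_good by simp
 qed
qed

end

text \<open>An artificial point off the hyperplane, at an index \<open>p\<close> outside
  \<open>S\<close>, completes \<open>S\<close> to card U + 1 independent points. Every unit vector
  is then a combination of these, and a functional constant on \<open>S\<close> sees only the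
  coefficient of the new point.\<close>

lemma normal_unique:
 assumes fin: "finite S" "finite U" and card: "card S = card U" "S ~= {}" and ai: "aff_indep U S y"
  and v: "EX b:U. v b ~= 0" "ALL i:S. (\<Sum>b\<in>U. v b * y i b) = t"
  and v': "ALL i:S. (\<Sum>b\<in>U. v' b * y i b) = (t'::real)"
 obtains r where "ALL b:U. v' b = r * v b" "t' = r * t"
proof -
 obtain p where p: "p ~: S" using fin(1) infinite_UNIV_nat by (metis ex_new_if_finite)
 obtain s where s: "s : S" using card(2) by auto
 define y' where "y' = y(p := %b. y s b + v b)"
 have y'S: "y' i = y i" if "i : S" for i using that p by (auto simp: y'_def)
 have "(\<Sum>b\<in>U. v b * y' p b) = t + (\<Sum>b\<in>U. v b * v b)"
  using v(2) s by (simp add: y'_def algebra_simps sum.distrib)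
 moreover have "(\<Sum>b\<in>U. v b * v b) > 0" using v(1) fin(2)
  by (metis (mono_tags, lifting) not_real_square_gt_zero sum_pos2 zero_le_square)
 ultimately have off: "(\<Sum>b\<in>U. v b * y' p b) ~= t" by simp
 have A: "aff_indep U S y'" using ai unfolding aff_indep_def by (simp add: y'S cong: sum.cong)
 have B: "ALL j:S. (\<Sum>b\<in>U. v b * y' j b) = t" using v(2) by (simp add: y'S)
 have ai': "aff_indep U (insert p S) y'" by (rule aff_indep_insert[OF fin(1) p A fin(2) B off])
 define g where "g u = (\<Sum>b\<in>U. u b * y' p b)" for u
 define r where "r = (g v' - t') / (g v - t)"
 have "v' b0 = r * v b0" if b0: "b0 : U" for b0
 proof -
  have "EX l. sum l (insert p S) = 0 & (ALL b:U. (\<Sum>i\<in>insert p S. l i * y' i b) = of_bool (b = b0))"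
   using aff_indep_spans[OF _ fin(2) _ ai'] fin(1) p card(1) by simp
  then obtain l where l: "sum l (insert p S) = 0" "!!b. b\<in>U ==> (\<Sum>i\<in>insert p S. l i * y' i b) = of_bool (b = b0)"
   by blast
  have key: "u b0 = l p * (g u - t0)" if u: "ALL i:S. (\<Sum>b\<in>U. u b * y i b) = t0" for u :: "'a => real" and t0
  proof -
   have "(\<Sum>b\<in>U. u b * of_bool (b = b0)) = (\<Sum>b\<in>{b0}. u b)"
    using b0 fin(2) by (intro sum.mono_neutral_cong_right) auto
   then have "u b0 = (\<Sum>b\<in>U. u b * of_bool (b = b0))" by simp
   also have "... = (\<Sum>b\<in>U. u b * (\<Sum>i\<in>insert p S. l i * y' i b))"
    using l(2) by (intro sum.cong) auto
   also have "... = (\<Sum>i\<in>insert p S. l i * (\<Sum>b\<in>U. u b * y' i b))"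
    unfolding sum_distrib_left by (subst sum.swap) (simp add: algebra_simps)
   also have "... = l p * g u + (\<Sum>i\<in>S. l i * t0)"
    using p fin(1) u y'S by (simp add: g_def)
   also have "... = l p * (g u - t0)"
   proof -
    have "sum l S = - l p" using l(1) p fin(1) by simp
    moreover have "(\<Sum>i\<in>S. l i * t0) = sum l S * t0" by (simp add: sum_distrib_right)
    ultimately show ?thesis by (simp add: algebra_simps)
   qed
   finally show ?thesis .
  qed
  show ?thesis using key[OF v(2)] key[OF v'] off by (simp add: r_def g_def)
 qed
 then have 1: "ALL b:U. v' b = r * v b" by blast
 have "t' = (\<Sum>b\<in>U. v' b * y s b)" using v' s by simp
 also have "... = r * (\<Sum>b\<in>U. v b * y s b)"
  unfolding sum_distrib_left using 1 by (intro sum.cong) auto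
 also have "... = r * t" using v(2) s by simp
 finally show ?thesis using that 1 by blast
qed

text \<open>The normal is unique up to a factor, and a negative factor exchanges the two
  sides.\<close>

lemma facet_iff:
 assumes fin: "finite S" "finite U" and card: "card S = card U" "S ~= {}" and ai: "aff_indep U S y"
  and v: "EX b:U. v b ~= 0" "ALL i:S. (\<Sum>b\<in>U. v b * y i b) = t"
 shows "facet U S I y \<longleftrightarrow> (ALL i:I. t <= (\<Sum>b\<in>U. v b * y i b)) | (ALL i:I. (\<Sum>b\<in>U. v b * y i b) <= t)"
proof
 assume "facet U S I y"
 then obtain v' t' where v': "EX b:U. v' b ~= 0" "ALL i:S. (\<Sum>b\<in>U. v' b * y i b) = t'"
  "ALL i:I. t' <= (\<Sum>b\<in>U. v' b * y i b)" unfolding facet_def by blast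
 obtain r where r: "ALL b:U. v' b = r * v b" "t' = r * t"
  using normal_unique[OF fin card ai v v'(2)] by blast
 have "r ~= 0" using r v'(1) by auto
 have eq: "(\<Sum>b\<in>U. v' b * y i b) = r * (\<Sum>b\<in>U. v b * y i b)" for i
  unfolding sum_distrib_left using r by (intro sum.cong) auto
 have *: "ALL i:I. r * t <= r * (\<Sum>b\<in>U. v b * y i b)" using v'(3) unfolding eq r(2) .
 show "(ALL i:I. t <= (\<Sum>b\<in>U. v b * y i b)) | (ALL i:I. (\<Sum>b\<in>U. v b * y i b) <= t)"
  using * \<open>r ~= 0\<close> by (cases "r > 0") (auto simp: mult_le_cancel_left)
next
 assume "(ALL i:I. t <= (\<Sum>b\<in>U. v b * y i b)) | (ALL i:I. (\<Sum>b\<in>U. v b * y i b) <= t)"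
 then show "facet U S I y"
 proof
  assume "ALL i:I. t <= (\<Sum>b\<in>U. v b * y i b)"
  then show ?thesis unfolding facet_def using v by blast
 next
  assume "ALL i:I. (\<Sum>b\<in>U. v b * y i b) <= t"
  then show ?thesis unfolding facet_def using v
   by (intro exI[of _ "%b. - v b"] exI[of _ "- t"]) (auto simp: sum_negf)
 qed
qed

text \<open>The first \<open>k\<close> vertices affinely span the whole space of the coordinates in
  \<open>U\<close>, so any further vertex can be written in terms of them; its own coefficient 1 is
  the required positive one.\<close>

lemma not_face_full_dim:
 assumes I: "finite I" "{..<k} <= I" "j : I" "k <= j" and k: "k = card U + 1" and fJ: "finite U"
  and ai: "aff_indep U {..<k} y"
 shows "not_face U k I y"
proof -
 obtain m where m: "sum m {..<k} = 0" "ALL b:U. (\<Sum>i<k. m i * y i b) = y j b - y 0 b"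
  using aff_indep_spans[OF _ fJ _ ai, of "%b. y j b - y 0 b"] k by auto
 define l where "l i = of_bool (i = j) - of_bool (i = 0) - (if i < k then m i else 0)" for i
 have k0: "0 : I" "0 < k" using I k by auto
 have split: "(\<Sum>i\<in>I. l i * f i) = f j - f 0 - (\<Sum>i<k. m i * f i)" for f
 proof -
  have "(\<Sum>i\<in>I. l i * f i) = (\<Sum>i\<in>I. of_bool (i = j) * f i) - (\<Sum>i\<in>I. of_bool (i = 0) * f i)
    - (\<Sum>i\<in>I. (if i < k then m i else 0) * f i)"
   by (simp add: l_def algebra_simps sum_subtractf sum.distrib)
  moreover have "(\<Sum>i\<in>I. of_bool (i = j) * f i) = (\<Sum>i\<in>{j}. f i)"
   using I by (intro sum.mono_neutral_cong_right) auto
  moreover have "(\<Sum>i\<in>I. of_bool (i = 0) * f i) = (\<Sum>i\<in>{0}. f i)"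
   using I k0 by (intro sum.mono_neutral_cong_right) auto
  moreover have "(\<Sum>i\<in>I. (if i < k then m i else 0) * f i) = (\<Sum>i<k. m i * f i)"
   using I by (intro sum.mono_neutral_cong_right) auto
  ultimately show ?thesis by simp
 qed
 have "sum l I = 0" using split[of "%_. 1"] m(1) by simp
 moreover have "ALL b:U. (\<Sum>i\<in>I. l i * y i b) = 0" using split m(2) by simp
 moreover have "ALL i:I. k <= i --> 0 <= l i" "l j > 0" using k0 I(4) by (auto simp: l_def)
 ultimately show ?thesis unfolding not_face_def using I by blast
qed

text \<open>If the hyperplane through the first \<open>k\<close> vertices has vertices
  \<open>i1\<close> and \<open>i2\<close> on opposite sides, weights taken from the distances of the
  other one balance their heights. What remains is parallel to the hyperplane and can be cancelled
  by the first \<open>k\<close> vertices alone: its height 0 forces \<open>m i1\<close> to vanish.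
  Conversely, slackness puts one vertex too many on a supporting hyperplane.\<close>

lemma not_face_iff_not_facet:
 assumes I: "finite I" "{..<k} <= I" and k: "k = card U" "1 <= k" and fJ: "finite U"
  and gp: "!!S. S <= I ==> card S <= card U + 1 ==> aff_indep U S y"
 shows "not_face U k I y \<longleftrightarrow> ~ facet U {..<k} I y"
proof
 assume "not_face U k I y"
 then obtain l i0 where l: "sum l I = 0" "ALL b:U. (\<Sum>i\<in>I. l i * y i b) = 0"
   "ALL i:I. k <= i --> 0 <= l i" "i0 : I" "k <= i0" "0 < l i0" unfolding not_face_def by blast
 show "~ facet U {..<k} I y"
 proof
  assume "facet U {..<k} I y"
  then obtain v t where v: "EX b:U. v b ~= 0" "ALL i:{..<k}. (\<Sum>b\<in>U. v b * y i b) = t"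
   "ALL i:I. t <= (\<Sum>b\<in>U. v b * y i b)" unfolding facet_def by blast
  let ?h = "%i. \<Sum>b\<in>U. v b * y i b"
  have "(\<Sum>i\<in>I. l i * ?h i) = (\<Sum>b\<in>U. v b * (\<Sum>i\<in>I. l i * y i b))"
   unfolding sum_distrib_left by (subst sum.swap) (simp add: algebra_simps)
  also have "... = 0" using l(2) by simp
  finally have "(\<Sum>i\<in>I. l i * (?h i - t)) = 0"
   using l(1) by (simp add: algebra_simps sum_subtractf flip: sum_distrib_left)
  moreover have "0 <= l i * (?h i - t)" if "i : I" for i
   using that v l(3) by (cases "k <= i") auto
  ultimately have "l i0 * (?h i0 - t) = 0" using I(1) l(4) by (simp add: sum_nonneg_eq_0_iff)
  then have "?h i0 = t" using l(6) by simp
  then have "insert i0 {..<k} <= {i:I. ?h i = t}" using v l I by auto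
  then have "card (insert i0 {..<k}) <= card {i:I. ?h i = t}" using I by (intro card_mono) auto
  also have "... <= card U" using card_hyperplane_le[OF I(1) fJ gp v(1)] by simp
  finally show False using l(5) k by simp
 qed
next
 assume nf: "~ facet U {..<k} I y"
 have "U ~= {}" using k by auto
 then obtain v t where v: "EX b:U. v b ~= 0" "ALL i:{..<k}. (\<Sum>b\<in>U. v b * y i b) = t"
  using ex_normal[of "{..<k}" U y] k fJ by (auto simp: lessThan_empty_iff bot_nat_def)
 let ?h = "%i. \<Sum>b\<in>U. v b * y i b"
 have "aff_indep U {..<k} y" using gp[OF I(2)] k by simp
 moreover have "{..<k} ~= {}" using k by (auto simp: lessThan_empty_iff bot_nat_def)
 ultimately have "EX i:I. ?h i < t" "EX i:I. t < ?h i"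
  using nf facet_iff[OF finite_lessThan fJ _ _ _ v, of I] k by (auto simp: not_le)
 then obtain i1 i2 where i: "i1 : I" "?h i1 < t" "i2 : I" "t < ?h i2" by blast
 have ik: "k <= i1" "k <= i2" using i v(2) by (metis lessThan_iff not_le less_irrefl)+
 have i12: "i1 ~= i2" using i by auto
 define s1 where "s1 = t - ?h i1"
 define s2 where "s2 = ?h i2 - t"
 have s: "s1 > 0" "s2 > 0" using i by (auto simp: s1_def s2_def)
 have "aff_indep U (insert i1 {..<k}) y" using gp[of "insert i1 {..<k}"] I i ik k by simp
 then obtain m where m: "sum m (insert i1 {..<k}) = 0"
  "!!b. b\<in>U ==> (\<Sum>i\<in>insert i1 {..<k}. m i * y i b) = s2 * y i1 b + s1 * y i2 b - (s1 + s2) * y 0 b"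
  using aff_indep_spans[of "insert i1 {..<k}" U y "%b. s2 * y i1 b + s1 * y i2 b - (s1 + s2) * y 0 b"] fJ ik k by auto
 have "(\<Sum>b\<in>U. v b * (s2 * y i1 b + s1 * y i2 b - (s1 + s2) * y 0 b)) = s2 * ?h i1 + s1 * ?h i2 - (s1 + s2) * ?h 0"
  by (simp add: algebra_simps sum.distrib sum_subtractf sum_distrib_left)
 also have "?h 0 = t" using v(2) k by auto
 also have "s2 * ?h i1 + s1 * ?h i2 - (s1 + s2) * t = 0" by (simp add: s1_def s2_def algebra_simps)
 finally have "0 = (\<Sum>b\<in>U. v b * (\<Sum>i\<in>insert i1 {..<k}. m i * y i b))" using m(2) by simp
 also have "... = (\<Sum>i\<in>insert i1 {..<k}. m i * ?h i)"
  unfolding sum_distrib_left by (subst sum.swap) (simp add: algebra_simps)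
 also have "... = m i1 * ?h i1 + (\<Sum>i<k. m i * t)" using ik v(2) by simp
 also have "... = m i1 * (?h i1 - t)"
 proof -
  have "sum m {..<k} = - m i1" using m(1) ik by simp
  moreover have "(\<Sum>i<k. m i * t) = sum m {..<k} * t" by (simp add: sum_distrib_right)
  ultimately show ?thesis by (simp add: algebra_simps)
 qed
 finally have mi1: "m i1 = 0" using i by simp
 define l where "l i = s2 * of_bool (i = i1) + s1 * of_bool (i = i2) - (s1 + s2) * of_bool (i = 0) - (if i < k then m i else 0)" for i
 have k0: "0 : I" "0 < k" using I k by auto
 have split: "(\<Sum>i\<in>I. l i * f i) = s2 * f i1 + s1 * f i2 - (s1 + s2) * f 0 - (\<Sum>i<k. m i * f i)" for f
 proof -
  have "(\<Sum>i\<in>I. l i * f i) = s2 * (\<Sum>i\<in>I. of_bool (i = i1) * f i) + s1 * (\<Sum>i\<in>I. of_bool (i = i2) * f i)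
    - (s1 + s2) * (\<Sum>i\<in>I. of_bool (i = 0) * f i) - (\<Sum>i\<in>I. (if i < k then m i else 0) * f i)"
   unfolding l_def sum_distrib_left sum.distrib[symmetric] sum_subtractf[symmetric]
   by (intro sum.cong) (auto simp: algebra_simps)
  moreover have "(\<Sum>i\<in>I. of_bool (i = i1) * f i) = (\<Sum>i\<in>{i1}. f i)"
   using I i by (intro sum.mono_neutral_cong_right) auto
  moreover have "(\<Sum>i\<in>I. of_bool (i = i2) * f i) = (\<Sum>i\<in>{i2}. f i)"
   using I i by (intro sum.mono_neutral_cong_right) auto
  moreover have "(\<Sum>i\<in>I. of_bool (i = 0) * f i) = (\<Sum>i\<in>{0}. f i)"
   using I k0 by (intro sum.mono_neutral_cong_right) auto
  moreover have "(\<Sum>i\<in>I. (if i < k then m i else 0) * f i) = (\<Sum>i<k. m i * f i)"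
   using I by (intro sum.mono_neutral_cong_right) auto
  ultimately show ?thesis by simp
 qed
 have "sum l I = 0" using split[of "%_. 1"] m(1) mi1 ik by simp
 moreover have "ALL b:U. (\<Sum>i\<in>I. l i * y i b) = 0" using split m(2) mi1 ik by simp
 moreover have "ALL i:I. k <= i --> 0 <= l i" "l i1 > 0" using k0 ik i12 s by (auto simp: l_def)
 ultimately show "not_face U k I y" unfolding not_face_def using i ik by blast
qed

text \<open>A dependency of the projection along \<open>e\<close> is, before projecting, a nonzero
  multiple of \<open>e\<close>, and the sign of the multiple decides which of \<open>e\<close> and
  \<open>- e\<close> lies in the cone. If both did, the sum of their coefficients would be a
  dependency in the full space.\<close>

lemma basis_vector_in_cone:
 fixes y :: "nat => 'e::euclidean_space => real"
 assumes I: "finite I" "{..<k} <= I" and e: "e : Basis"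
  and ai: "aff_indep Basis I y" and aiF: "aff_indep (Basis - {e}) {..<k} y"
 shows "of_bool (e : cone_over Basis k I y) + of_bool (- e : cone_over Basis k I y)
  = (of_bool (not_face (Basis - {e}) k I y) :: real)"
proof -
 let ?C = "cone_over Basis k I y"
 let ?w = "%l b. \<Sum>i\<in>I. l i * y i b"
 have off: "EX i:I. k <= i & l i ~= 0" if l: "sum l I = 0" "ALL b:Basis-{e}. ?w l b = 0" "?w l e ~= 0" for l
 proof (rule ccontr)
  assume neg: "~ ?thesis"
  then have z: "ALL i:I - {..<k}. l i = 0" by auto
  have "sum l {..<k} = sum l I" "(\<Sum>i<k. l i * y i b) = ?w l b" for b
   using I z by (auto intro!: sum.mono_neutral_left)
  then have "ALL i<k. l i = 0" using aiF l unfolding aff_indep_def by auto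
  then have "ALL i:I. l i = 0" using neg by (meson not_le)
  then show False using l(3) by simp
 qed
 have inC: "s *\<^sub>R e : ?C" if l: "sum l I = 0" "ALL b:Basis-{e}. ?w l b = 0" "?w l e = s" "ALL i:I. k <= i --> 0 <= l i" for l s
  using l e unfolding cone_over_def by (intro CollectI exI[of _ l]) (auto simp: inner_Basis)
 have Cin: "EX l. sum l I = 0 & (ALL b:Basis-{e}. ?w l b = 0) & ?w l e = s & (ALL i:I. k <= i --> 0 <= l i)"
  if sC: "s *\<^sub>R e : ?C" for s
 proof -
  obtain l where l: "sum l I = 0" "ALL i:I. k <= i --> 0 <= l i" "ALL b:Basis. (s *\<^sub>R e) \<bullet> b = ?w l b"
   using sC unfolding cone_over_def by blast
  have "?w l b = 0" if "b : Basis - {e}" for b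
   using l(3)[rule_format, of b] that e by (auto simp: inner_Basis)
  moreover have "?w l e = s" using l(3)[rule_format, of e] e by simp
  ultimately show ?thesis using l by blast
 qed
 have NF: "not_face (Basis - {e}) k I y" if hC: "s *\<^sub>R e : ?C" "s ~= 0" for s
 proof -
  obtain l where l: "sum l I = 0" "ALL b:Basis-{e}. ?w l b = 0" "?w l e = s" "ALL i:I. k <= i --> 0 <= l i"
   using Cin[OF hC(1)] by blast
  obtain i where i: "i : I" "k <= i" "l i ~= 0" using off[of l] l hC(2) by auto
  then have "0 < l i" using l(4) by force
  then show ?thesis unfolding not_face_def using l i by blast
 qed
 have nboth: False if hC: "e : ?C" "- e : ?C"
 proof -
  obtain l where l: "sum l I = 0" "ALL b:Basis-{e}. ?w l b = 0" "?w l e = 1" "ALL i:I. k <= i --> 0 <= l i"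
   using Cin[of 1] hC(1) by auto
  obtain m where m: "sum m I = 0" "ALL b:Basis-{e}. ?w m b = 0" "?w m e = - 1" "ALL i:I. k <= i --> 0 <= m i"
   using Cin[of "-1"] hC(2) by auto
  have ws: "?w (%i. l i + m i) b = ?w l b + ?w m b" for b by (simp add: sum.distrib algebra_simps)
  have "ALL b:Basis. ?w (%i. l i + m i) b = 0"
  proof
   fix b :: 'e assume "b : Basis"
   then show "?w (%i. l i + m i) b = 0" unfolding ws using l m by (cases "b = e") auto
  qed
  moreover have "sum (%i. l i + m i) I = 0" using l m by (simp add: sum.distrib)
  ultimately have "ALL i:I. l i + m i = 0"
   using ai unfolding aff_indep_def by (elim allE[of _ "%i. l i + m i"]) blast
  moreover obtain i where i: "i : I" "k <= i" "l i ~= 0" using off[of l] l by auto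
  ultimately have "l i = - m i" "0 <= l i" "0 <= m i" using l m by (auto simp: eq_neg_iff_add_eq_0)
  then show False using i by auto
 qed
 have ex: "e : ?C | - e : ?C" if nf: "not_face (Basis - {e}) k I y"
 proof -
  obtain l i where l: "sum l I = 0" "ALL b:Basis-{e}. ?w l b = 0" "ALL i:I. k <= i --> 0 <= l i" "i : I" "0 < l i"
   using nf unfolding not_face_def by blast
  have nz: "?w l e ~= 0"
  proof
   assume "?w l e = 0"
   then have "ALL b:Basis. ?w l b = 0" using l(2) by auto
   then have "ALL i:I. l i = 0" using ai l(1) unfolding aff_indep_def by blast
   then show False using l by auto
  qed
  have eC: "?w l e *\<^sub>R e : ?C" using inC[OF l(1,2) refl l(3)] .
  have "(1 / \<bar>?w l e\<bar>) *\<^sub>R (?w l e *\<^sub>R e) : ?C"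
   by (rule convex_cone_scaleR[OF convex_cone_cone_over _ eC]) simp
  then show ?thesis using nz by (cases "?w l e > 0") auto
 qed
 show ?thesis using NF[of 1] NF[of "-1"] nboth ex by auto
qed

section \<open>Linear changes of variables\<close>

abbreviation lb :: "'i set => ('i => real) measure" where
 "lb A \<equiv> PiM A (%_. lborel)"

interpretation lb: product_sigma_finite "%_. lborel :: real measure"
 by standard

lemma sigma_finite_lb: "finite A ==> sigma_finite_measure (lb A)"
 by (rule lb.sigma_finite)

lemma measurable_fun_upd_lb [measurable]:
 "(%(x, s). x(i := s)) : measurable (lb A \<Otimes>\<^sub>M lborel) (lb (insert i A))"
 using measurable_add_dim[of i A "%_. lborel"] by simp

lemma nn_integral_lb_affine:
 fixes c t :: "'i => real"
 assumes "finite A" "!!a. a : A ==> c a ~= 0" and f: "f : borel_measurable (lb A)"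
 shows "(\<integral>\<^sup>+x. f x \<partial>lb A) = (\<Prod>a\<in>A. ennreal \<bar>c a\<bar>) * (\<integral>\<^sup>+x. f (\<lambda>a\<in>A. t a + c a * x a) \<partial>lb A)"
 using assms
proof (induction A arbitrary: f rule: finite_induct)
 case empty
 then show ?case by (simp add: PiM_empty nn_integral_count_space_finite)
next
 case (insert i A)
 note f [measurable] = insert.prems(2)
 have [measurable]: "(%x. \<lambda>a\<in>insert i A. t a + c a * x a) : measurable (lb (insert i A)) (lb (insert i A))"
  by (intro measurable_restrict) auto
 have m1 [measurable]: "(%x. f (x(i := s))) : borel_measurable (lb A)" for s
 proof -
  have "(%x. x(i := s)) : measurable (lb A) (lb (insert i A))"
   by (intro measurable_fun_upd[where J = A]) auto
  from measurable_compose[OF this f] show ?thesis .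
 qed
 let ?g = "%x. \<lambda>a\<in>A. t a + c a * x a"
 have m2: "(%s. \<integral>\<^sup>+x. f ((?g x)(i := h s)) \<partial>lb A) : borel_measurable lborel" if [measurable]: "h : borel_measurable borel" for h
 proof -
  interpret A: sigma_finite_measure "lb A" using insert by (intro sigma_finite_lb)
  have "(%(s, x). (?g x)(i := h s)) : measurable (lborel \<Otimes>\<^sub>M lb A) (lb (insert i A))"
   unfolding case_prod_beta by (intro measurable_fun_upd[where J = A] measurable_restrict) auto
  from measurable_compose[OF this f] show ?thesis
   by (intro A.borel_measurable_nn_integral) (simp add: case_prod_beta)
 qed
 have "(\<integral>\<^sup>+x. f x \<partial>lb (insert i A)) = (\<integral>\<^sup>+s. \<integral>\<^sup>+x. f (x(i := s)) \<partial>lb A \<partial>lborel)"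
  using insert by (intro lb.product_nn_integral_insert_rev) auto
 also have "... = (\<integral>\<^sup>+s. (\<Prod>a\<in>A. ennreal \<bar>c a\<bar>) * (\<integral>\<^sup>+x. f ((?g x)(i := s)) \<partial>lb A) \<partial>lborel)"
  using insert.prems(1) by (intro nn_integral_cong insert.IH m1) auto
 also have "... = (\<integral>\<^sup>+s. (\<Prod>a\<in>A. ennreal \<bar>c a\<bar>) * (\<integral>\<^sup>+x. f ((?g x)(i := t i + c i * s)) \<partial>lb A) \<partial>lborel) * ennreal \<bar>c i\<bar>"
  using insert.prems(1) m2[of "%s. s"]
  by (subst nn_integral_real_affine[where c = "c i" and t = "t i"]) (auto simp: mult.commute)
 also have "... = ennreal \<bar>c i\<bar> * (\<Prod>a\<in>A. ennreal \<bar>c a\<bar>) * (\<integral>\<^sup>+s. (\<integral>\<^sup>+x. f ((?g x)(i := t i + c i * s)) \<partial>lb A) \<partial>lborel)"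
  using m2[of "%s. t i + c i * s"] by (subst nn_integral_cmult) (auto simp: mult_ac)
 also have "(\<integral>\<^sup>+s. (\<integral>\<^sup>+x. f ((?g x)(i := t i + c i * s)) \<partial>lb A) \<partial>lborel)
   = (\<integral>\<^sup>+s. \<integral>\<^sup>+x. f (\<lambda>a\<in>insert i A. t a + c a * (x(i := s)) a) \<partial>lb A \<partial>lborel)"
  using insert.hyps
  by (intro nn_integral_cong arg_cong[of _ _ f]) (auto simp: fun_eq_iff restrict_def)
 also have "... = (\<integral>\<^sup>+x. f (\<lambda>a\<in>insert i A. t a + c a * x a) \<partial>lb (insert i A))"
  using insert by (intro lb.product_nn_integral_insert_rev[symmetric]) auto
 finally show ?case unfolding prod.insert[OF insert.hyps] .
qed

text \<open>Elimination with pivot \<open>p\<close>: the variable at \<open>c0\<close> is exchanged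
  for the output at \<open>i0\<close>, after which the other outputs are translates of the image
  under the Schur complement \<open>L'\<close>. No formula for the determinant is needed, only that
  \<Delta> does not depend on \<open>f\<close>.\<close>

lemma nn_integral_lb_linear_ex:
 fixes L :: "'a => 'b => real"
 assumes "finite A" "finite B" "card A = card B"
  and inj: "!!u. (ALL i:B. (\<Sum>c\<in>A. u c * L c i) = 0) ==> (ALL c:A. u c = 0)"
 shows "EX \<Delta>>0. ALL f:borel_measurable (lb B).
   (\<integral>\<^sup>+u. f (\<lambda>i\<in>B. \<Sum>c\<in>A. u c * L c i) \<partial>lb A) = ennreal \<Delta> * (\<integral>\<^sup>+x. f x \<partial>lb B)"
 using assms
proof (induction A arbitrary: B L rule: finite_induct)
 case empty
 then have "B = {}" by simp
 then show ?case by (intro exI[of _ 1]) (auto simp: PiM_empty nn_integral_count_space_finite restrict_def)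
next
 case (insert c0 A)
 have "EX i:B. L c0 i ~= 0"
 proof (rule ccontr)
  assume neg: "~ ?thesis"
  have "(\<Sum>c\<in>insert c0 A. of_bool (c = c0) * L c i) = (\<Sum>c\<in>{c0}. L c i)" for i
   using insert.hyps by (intro sum.mono_neutral_cong_right) auto
  then have "ALL c:insert c0 A. (of_bool (c = c0) :: real) = 0"
   using neg by (intro insert.prems(3)) auto
  then show False by auto
 qed
 then obtain i0 where i0: "i0 : B" "L c0 i0 ~= 0" by auto
 define p where "p = L c0 i0"
 have p: "p ~= 0" using i0 by (simp add: p_def)
 define B' where "B' = B - {i0}"
 have B': "finite B'" "card A = card B'" "i0 ~: B'" "B = insert i0 B'"
  using insert i0 by (auto simp: B'_def)
 define L' where "L' c i = L c i - L c i0 * L c0 i / p" for c i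
 have inj': "ALL c:A. u c = 0" if u: "ALL i:B'. (\<Sum>c\<in>A. u c * L' c i) = 0" for u
 proof -
  define u' where "u' = u(c0 := - (\<Sum>c\<in>A. u c * L c i0) / p)"
  have u'A: "(\<Sum>c\<in>A. u' c * f c) = (\<Sum>c\<in>A. u c * f c)" for f
   using insert.hyps by (intro sum.cong) (auto simp: u'_def)
  have "(\<Sum>c\<in>insert c0 A. u' c * L c i) = 0" if i: "i : B" for i
  proof -
   have eq: "(\<Sum>c\<in>insert c0 A. u' c * L c i) = (\<Sum>c\<in>A. u c * L c i) - (\<Sum>c\<in>A. u c * L c i0) / p * L c0 i"
    using insert.hyps u'A by (simp add: u'_def)
   have eq2: "(\<Sum>c\<in>A. u c * L' c i) = (\<Sum>c\<in>A. u c * L c i) - (\<Sum>c\<in>A. u c * L c i0) / p * L c0 i"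
    by (simp add: L'_def algebra_simps sum_subtractf sum_distrib_left sum_divide_distrib)
   show ?thesis
   proof (cases "i = i0")
    case True then show ?thesis unfolding eq using p by (simp add: p_def)
   next
    case False
    then have "i : B'" using i by (simp add: B'_def)
    then show ?thesis using u eq eq2 by simp
   qed
  qed
  then have "ALL c:insert c0 A. u' c = 0" using insert.prems(3) by blast
  then show ?thesis using insert.hyps by (metis fun_upd_other insertCI u'_def)
 qed
 obtain \<Delta> where \<Delta>: "\<Delta> > 0" "!!f. f\<in>borel_measurable (lb B') ==>
   (\<integral>\<^sup>+u. f (\<lambda>i\<in>B'. \<Sum>c\<in>A. u c * L' c i) \<partial>lb A) = ennreal \<Delta> * (\<integral>\<^sup>+x. f x \<partial>lb B')"
  using insert.IH[of B' L', OF B'(1,2) inj'] by blast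
 interpret A: sigma_finite_measure "lb A" using insert by (intro sigma_finite_lb)
 interpret P: pair_sigma_finite "lb A" "lborel :: real measure" ..
 have "(\<integral>\<^sup>+u. f (\<lambda>i\<in>B. \<Sum>c\<in>insert c0 A. u c * L c i) \<partial>lb (insert c0 A)) = ennreal (\<Delta> / (abs p)) * (\<integral>\<^sup>+x. f x \<partial>lb B)"
  if f [measurable]: "f : borel_measurable (lb B)" for f
 proof -
  have [measurable]: "(%u. \<lambda>i\<in>B. \<Sum>c\<in>insert c0 A. u c * L c i) : measurable (lb (insert c0 A)) (lb B)"
   by (intro measurable_restrict) auto
  let ?E = "%u s. \<lambda>i\<in>B. s * L c0 i + (\<Sum>c\<in>A. u c * L c i)"
  have upd: "(\<lambda>i\<in>B. \<Sum>c\<in>insert c0 A. (u(c0 := s)) c * L c i) = (?E u s)" for u s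
   using insert.hyps by (auto simp: fun_eq_iff restrict_def intro!: sum.cong)
  have mm: "(%(u, s). f (?E u s)) : borel_measurable (lb A \<Otimes>\<^sub>M lborel)"
  proof -
   have "(%(u, s). (?E u s)) : measurable (lb A \<Otimes>\<^sub>M lborel) (lb B)"
    unfolding case_prod_beta by (intro measurable_restrict) auto
   from measurable_compose[OF this f] show ?thesis by (simp add: case_prod_beta)
  qed
  \<comment> \<open>The part of row \<open>i0\<close> without \<open>c0\<close>. The integration
    variable at \<open>c0\<close> is replaced by the value \<open>s\<close> of the whole row, which
    costs the factor 1/|p|.\<close>
  define w where "w u = (\<Sum>c\<in>A. u c * L c i0)" for u
  let ?F = "%u s. \<lambda>i\<in>B. (- w u / p + 1 / p * s) * L c0 i + (\<Sum>c\<in>A. u c * L c i)"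
  have [measurable]: "w : borel_measurable (lb A)" unfolding w_def by auto
  have mm2: "(%(u, s). f (?F u s)) : borel_measurable (lb A \<Otimes>\<^sub>M lborel)"
  proof -
   have "(%(u, s). (?F u s)) : measurable (lb A \<Otimes>\<^sub>M lborel) (lb B)"
    unfolding case_prod_beta by (intro measurable_restrict) auto
   from measurable_compose[OF this f] show ?thesis by (simp add: case_prod_beta)
  qed
  have "(\<integral>\<^sup>+u. f (\<lambda>i\<in>B. \<Sum>c\<in>insert c0 A. u c * L c i) \<partial>lb (insert c0 A))
    = (\<integral>\<^sup>+u. \<integral>\<^sup>+s. f (?E u s) \<partial>lborel \<partial>lb A)"
   unfolding upd[symmetric] using insert.hyps by (intro lb.product_nn_integral_insert) auto
  also have "... = (\<integral>\<^sup>+u. ennreal \<bar>1/p\<bar> * (\<integral>\<^sup>+s. f (?F u s) \<partial>lborel) \<partial>lb A)"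
  proof (intro nn_integral_cong)
   fix u assume "u : space (lb A)"
   then have "(%s. f (?E u s)) : borel_measurable lborel"
    using measurable_compose_Pair1[OF _ mm] by simp
   then show "(\<integral>\<^sup>+s. f (?E u s) \<partial>lborel) =
    ennreal \<bar>1/p\<bar> * (\<integral>\<^sup>+s. f (?F u s) \<partial>lborel)"
    using p by (subst nn_integral_real_affine[where c = "1/p" and t = "- w u / p"]) auto
  qed
  also have "... = ennreal \<bar>1/p\<bar> * (\<integral>\<^sup>+u. (\<integral>\<^sup>+s. f (?F u s) \<partial>lborel) \<partial>lb A)"
  proof -
   have "(%u. \<integral>\<^sup>+s. f (?F u s) \<partial>lborel) : borel_measurable (lb A)"
    using lborel.borel_measurable_nn_integral[OF mm2] by simp
   then show ?thesis by (rule nn_integral_cmult)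
  qed
  also have "(\<integral>\<^sup>+u. (\<integral>\<^sup>+s. f (?F u s) \<partial>lborel) \<partial>lb A)
    = (\<integral>\<^sup>+s. (\<integral>\<^sup>+u. f (?F u s) \<partial>lb A) \<partial>lborel)"
   using P.Fubini'[OF mm2] by simp
  also have "... = (\<integral>\<^sup>+s. ennreal \<Delta> * (\<integral>\<^sup>+x. f (x(i0 := s)) \<partial>lb B') \<partial>lborel)"
  proof (intro nn_integral_cong)
   fix s :: real
   define q where "q i = s * L c0 i / p" for i
   have updm: "(%x. x(i0 := s)) : measurable (lb B') (lb B)"
    unfolding B'(4) by (intro measurable_fun_upd[where J = B']) auto
   have updm': "(%x. (\<lambda>i\<in>B'. q i + 1 * x i)(i0 := s)) : measurable (lb B') (lb B)"
    unfolding B'(4) by (intro measurable_fun_upd[where J = B'] measurable_restrict) auto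
   have eq: "(?F u s)
    = (\<lambda>i\<in>B'. q i + 1 * (\<lambda>i\<in>B'. \<Sum>c\<in>A. u c * L' c i) i)(i0 := s)" for u
   proof (rule ext)
    fix i
    have "(\<Sum>c\<in>A. u c * L' c i) = (\<Sum>c\<in>A. u c * L c i) - w u * L c0 i / p"
    by (simp add: L'_def w_def algebra_simps sum_subtractf sum_distrib_left sum_divide_distrib)
    then have a: "(- w u / p + 1 / p * s) * L c0 i + (\<Sum>c\<in>A. u c * L c i) = q i + 1 * (\<Sum>c\<in>A. u c * L' c i)"
    by (simp add: q_def algebra_simps)
    have b: "(- w u / p + 1 / p * s) * L c0 i0 + (\<Sum>c\<in>A. u c * L c i0) = s"
    using p by (simp add: p_def[symmetric] w_def[symmetric] field_simps)
    consider "i = i0" | "i : B'" | "i ~: B" using B'(4) by auto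
    then show "(?F u s) i
    = ((\<lambda>i\<in>B'. q i + 1 * (\<lambda>i\<in>B'. \<Sum>c\<in>A. u c * L' c i) i)(i0 := s)) i"
    proof cases
    case 1 then show ?thesis using b i0 by simp
    next
    case 2 then have "i : B" "i ~= i0" using B' by auto
    then show ?thesis using a 2 by simp
    next
    case 3 then have "i ~= i0" "i ~: B'" using B' by auto
    then show ?thesis using 3 by simp
    qed
   qed
   have "(\<integral>\<^sup>+u. f (?F u s) \<partial>lb A)
    = ennreal \<Delta> * (\<integral>\<^sup>+x. f ((\<lambda>i\<in>B'. q i + 1 * x i)(i0 := s)) \<partial>lb B')"
    unfolding eq by (rule \<Delta>(2)[OF measurable_compose[OF updm' f]])
   also have "(\<integral>\<^sup>+x. f ((\<lambda>i\<in>B'. q i + 1 * x i)(i0 := s)) \<partial>lb B') = (\<integral>\<^sup>+x. f (x(i0 := s)) \<partial>lb B')"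
    using nn_integral_lb_affine[OF B'(1), of "%_. 1" "%x. f (x(i0 := s))" q] measurable_compose[OF updm f] by simp
   finally show "(\<integral>\<^sup>+u. f (?F u s) \<partial>lb A)
    = ennreal \<Delta> * (\<integral>\<^sup>+x. f (x(i0 := s)) \<partial>lb B')" .
  qed
  also have "... = ennreal \<Delta> * (\<integral>\<^sup>+s. (\<integral>\<^sup>+x. f (x(i0 := s)) \<partial>lb B') \<partial>lborel)"
  proof -
   interpret B': sigma_finite_measure "lb B'" using B' by (intro sigma_finite_lb)
   have "(%(s, x). x(i0 := s)) : measurable (lborel \<Otimes>\<^sub>M lb B') (lb B)"
    unfolding B'(4) case_prod_beta by (intro measurable_fun_upd[where J = B']) auto
   from measurable_compose[OF this f] have "(%(s, x). f (x(i0 := s))) : borel_measurable (lborel \<Otimes>\<^sub>M lb B')"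
    by (simp add: case_prod_beta)
   then show ?thesis by (intro nn_integral_cmult B'.borel_measurable_nn_integral)
  qed
  also have "(\<integral>\<^sup>+s. (\<integral>\<^sup>+x. f (x(i0 := s)) \<partial>lb B') \<partial>lborel) = (\<integral>\<^sup>+x. f x \<partial>lb B)"
   unfolding B'(4) using B' f by (intro lb.product_nn_integral_insert_rev[symmetric]) auto
  also have "ennreal \<bar>1/p\<bar> * (ennreal \<Delta> * (\<integral>\<^sup>+x. f x \<partial>lb B)) = ennreal (\<Delta> / (abs p)) * (\<integral>\<^sup>+x. f x \<partial>lb B)"
  proof -
   have "ennreal \<bar>1/p\<bar> * ennreal \<Delta> = ennreal (\<Delta> / (abs p))"
    using \<Delta>(1) by (subst ennreal_mult[symmetric]) (auto simp: abs_divide)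
   then show ?thesis by (simp add: mult.assoc[symmetric])
  qed
  finally show ?thesis .
 qed
 then have "ALL f:borel_measurable (lb B). (\<integral>\<^sup>+u. f (\<lambda>i\<in>B. \<Sum>c\<in>insert c0 A. u c * L c i) \<partial>lb (insert c0 A))
   = ennreal (\<Delta> / (abs p)) * (\<integral>\<^sup>+x. f x \<partial>lb B)" by blast
 moreover have "\<Delta> / (abs p) > 0" using \<Delta>(1) p by simp
 ultimately show ?case by blast
qed

lemma measurable_lb_component:
 "c : A ==> (%u. u c) : borel_measurable (lb A)"
 using measurable_component_singleton[of c A "%_. lborel :: real measure"] by simp

text \<open>The volume of the preimage of the unit cube, that is, the reciprocal of the absolute
  determinant. Written as an integral, it is visibly measurable in the entries of \<open>L\<close>,
  as \<open>measurable_Dm\<close> requires.\<close>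

definition cube_mass :: "'a set => 'b set => ('a => 'b => real) => ennreal" where
 "cube_mass A B L = (\<integral>\<^sup>+u. (\<Prod>i\<in>B. indicator {0..1} (\<Sum>c\<in>A. u c * L c i)) \<partial>lb A)"

lemma nn_integral_lb_linear:
 fixes L :: "'a => 'b => real"
 assumes "finite A" "finite B" "card A = card B"
  and inj: "!!u. (ALL i:B. (\<Sum>c\<in>A. u c * L c i) = 0) ==> (ALL c:A. u c = 0)"
 shows "cube_mass A B L ~= 0" "cube_mass A B L ~= \<infinity>"
  and "f : borel_measurable (lb B) ==>
   (\<integral>\<^sup>+x. f x \<partial>lb B) = inverse (cube_mass A B L) * (\<integral>\<^sup>+u. f (\<lambda>i\<in>B. \<Sum>c\<in>A. u c * L c i) \<partial>lb A)"
proof -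
 obtain \<Delta> where \<Delta>: "\<Delta> > 0" "!!f. f\<in>borel_measurable (lb B) ==>
   (\<integral>\<^sup>+u. f (\<lambda>i\<in>B. \<Sum>c\<in>A. u c * L c i) \<partial>lb A) = ennreal \<Delta> * (\<integral>\<^sup>+x. f x \<partial>lb B)"
  using nn_integral_lb_linear_ex[OF assms] by blast
 have "(\<integral>\<^sup>+x. (\<Prod>i\<in>B. indicator {0..1} (x i)) \<partial>lb B) = (\<Prod>i\<in>B. \<integral>\<^sup>+x. indicator {0..1::real} x \<partial>lborel)"
  by (rule lb.product_nn_integral_prod[OF assms(2)]) auto
 then have one: "(\<integral>\<^sup>+x. (\<Prod>i\<in>B. indicator {0..1::real} (x i)) \<partial>lb B) = 1" by simp
 have "(\<integral>\<^sup>+u. (\<Prod>i\<in>B. indicator {0..1} ((\<lambda>i\<in>B. \<Sum>c\<in>A. u c * L c i) i)) \<partial>lb A)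
   = ennreal \<Delta> * (\<integral>\<^sup>+x. (\<Prod>i\<in>B. indicator {0..1::real} (x i)) \<partial>lb B)"
  by (rule \<Delta>(2)) auto
 then have D: "cube_mass A B L = ennreal \<Delta>" unfolding cube_mass_def one by simp
 show "cube_mass A B L ~= 0" "cube_mass A B L ~= \<infinity>" using \<Delta>(1) D by auto
 assume "f : borel_measurable (lb B)"
 from \<Delta>(2)[OF this] show "(\<integral>\<^sup>+x. f x \<partial>lb B) = inverse (cube_mass A B L) * (\<integral>\<^sup>+u. f (\<lambda>i\<in>B. \<Sum>c\<in>A. u c * L c i) \<partial>lb A)"
  using \<Delta>(1) unfolding D by (simp add: mult.assoc[symmetric] inverse_ennreal ennreal_mult[symmetric])
qed

section \<open>Coordinates adapted to the hyperplane through a set of points\<close>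

definition wt :: "real => real => ennreal" where
 "wt \<beta> r = (if r < 1 then ennreal ((1 - r) powr \<beta>) else 0)"

lemma measurable_wt [measurable]: "wt \<beta> : borel_measurable borel"
 unfolding wt_def by measurable

lemma wt_scale:
 assumes "h\<^sup>2 < 1"
 shows "wt \<beta> (h\<^sup>2 + (1 - h\<^sup>2) * r) = ennreal ((1 - h\<^sup>2) powr \<beta>) * wt \<beta> r"
proof -
 have eq: "1 - (h\<^sup>2 + (1 - h\<^sup>2) * r) = (1 - h\<^sup>2) * (1 - r)" by algebra
 have "h\<^sup>2 + (1 - h\<^sup>2) * r < 1 \<longleftrightarrow> 0 < (1 - h\<^sup>2) * (1 - r)" unfolding eq[symmetric] by simp
 then have iff: "h\<^sup>2 + (1 - h\<^sup>2) * r < 1 \<longleftrightarrow> r < 1" using assms by (simp add: zero_less_mult_iff)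
 show ?thesis using assms unfolding wt_def iff eq
  by (simp add: powr_mult ennreal_mult)
qed

text \<open>The setting of the affine Blaschke-Petkantschin formula in graph coordinates:
  hyperplanes are graphs x_b = t + a.x over the coordinates in \<open>U'\<close>. The event
  \<open>N\<close> speaks of the shape of the points over \<open>U'\<close>, is invariant under
  translations and positive scalings, and guarantees that the points determine their
  hyperplane.\<close>

locale hyperplane_factor =
 fixes S :: "nat set" and U' :: "'b set" and b :: 'b and \<beta> :: real and N :: "(nat \<times> 'b => real) => bool"
 assumes fin: "finite S" "S ~= {}" "finite U'" "b ~: U'" and card: "card S = card U' + 1"
  and N_meas [measurable]: "Measurable.pred (lb (S \<times> U')) N"
  and N_indep: "!!x. N x ==> aff_indep U' S (%i c. x (i, c))"
  and N_inv: "!!x x0 \<rho>. \<rho> > 0 ==> N (\<lambda>p\<in>S \<times> U'. x0 (snd p) + \<rho> * x p) = N x"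
begin

abbreviation "U \<equiv> insert b U'"

definition qf :: "nat => (nat \<times> 'b => real) => ('b => real) => real => real" where
 "qf i x a t = (\<Sum>c\<in>U'. (x (i, c))\<^sup>2) + (t + (\<Sum>c\<in>U'. a c * x (i, c)))\<^sup>2"

text \<open>Length of the normal with entry 1 at \<open>b\<close> and entries -a over
  \<open>U'\<close>; hence t / \<open>rf a\<close> is the signed distance of the hyperplane from the
  origin.\<close>

definition rf :: "('b => real) => real" where "rf a = sqrt (1 + (\<Sum>c\<in>U'. (a c)\<^sup>2))"

definition hp :: "(nat \<times> 'b => real) => ('b => real) => real => nat \<times> 'b => real" where
 "hp x a t = (\<lambda>p\<in>S \<times> U. if snd p = b then t + (\<Sum>c\<in>U'. a c * x (fst p, c)) else x p)"

text \<open>Matrix of the map from the parameters, t at index \<open>b\<close> and a on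
  \<open>U'\<close>, to the heights of the points over \<open>x\<close>. Its absolute determinant is
  (card U')! times the volume of the simplex over \<open>U'\<close>, the classical Jacobian;
  \<open>Dm\<close> is the reciprocal.\<close>

definition Lm :: "(nat \<times> 'b => real) => 'b => nat \<times> 'b => real" where
 "Lm x c p = (if c = b then 1 else x (fst p, c))"

definition Dm :: "(nat \<times> 'b => real) => ennreal" where
 "Dm x = cube_mass U (S \<times> {b}) (Lm x)"

lemma finJ: "finite U" "finite (S \<times> U')" "finite (S \<times> {b})" using fin by auto

lemma sum_Lm: "(\<Sum>c\<in>U. u c * Lm x c p) = u b + (\<Sum>c\<in>U'. u c * x (fst p, c))"
proof -
 have "(\<Sum>c\<in>U'. u c * Lm x c p) = (\<Sum>c\<in>U'. u c * x (fst p, c))"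
  using fin by (intro sum.cong) (auto simp: Lm_def)
 then show ?thesis using fin by (simp add: Lm_def)
qed

lemma rf_pos: "rf a >= 1" "(rf a)\<^sup>2 = 1 + (\<Sum>c\<in>U'. (a c)\<^sup>2)"
proof -
 have "(\<Sum>c\<in>U'. (a c)\<^sup>2) >= 0" by (intro sum_nonneg) auto
 then show "rf a >= 1" "(rf a)\<^sup>2 = 1 + (\<Sum>c\<in>U'. (a c)\<^sup>2)" by (auto simp: rf_def)
qed

text \<open>An affine function vanishing at all the points vanishes on their combinations with
  coefficient sum 0; its linear part is such a combination, so it is orthogonal to itself.\<close>

lemma inj_Lm:
 assumes "N x" "ALL p:S \<times> {b}. (\<Sum>c\<in>U. u c * Lm x c p) = 0"
 shows "ALL c:U. u c = 0"
proof -
 have eq: "u b + (\<Sum>c\<in>U'. u c * x (i, c)) = 0" if "i : S" for i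
  using assms(2) that unfolding sum_Lm by auto
 obtain l where l: "sum l S = 0" "!!c. c\<in>U' ==> (\<Sum>i\<in>S. l i * x (i, c)) = u c"
  using aff_indep_spans[OF fin(1,3) card N_indep[OF assms(1)], of u] by auto
 have "(\<Sum>c\<in>U'. u c * u c) = (\<Sum>c\<in>U'. u c * (\<Sum>i\<in>S. l i * x (i, c)))" using l by simp
 also have "... = (\<Sum>i\<in>S. l i * (\<Sum>c\<in>U'. u c * x (i, c)))"
  unfolding sum_distrib_left by (subst sum.swap) (simp add: algebra_simps)
 also have "... = (\<Sum>i\<in>S. l i * (- u b))"
 proof (intro sum.cong refl)
  fix i assume "i : S"
  then have "(\<Sum>c\<in>U'. u c * x (i, c)) = - u b" using eq by (simp add: eq_neg_iff_add_eq_0 add.commute)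
  then show "l i * (\<Sum>c\<in>U'. u c * x (i, c)) = l i * (- u b)" by simp
 qed
 also have "... = sum l S * (- u b)" by (simp only: sum_distrib_right)
 also have "... = 0" using l by simp
 finally have z: "ALL c:U'. u c = 0" using fin by (auto simp: sum_nonneg_eq_0_iff)
 moreover have "u b = 0" using eq fin(2) z by force
 ultimately show ?thesis by simp
qed

lemma Dm_N:
 assumes "N x"
 shows "Dm x ~= 0" "Dm x ~= \<infinity>"
  and "f : borel_measurable (lb (S \<times> {b})) ==> (\<integral>\<^sup>+y. f y \<partial>lb (S \<times> {b})) =
   inverse (Dm x) * (\<integral>\<^sup>+u. f (\<lambda>p\<in>S \<times> {b}. u b + (\<Sum>c\<in>U'. u c * x (fst p, c))) \<partial>lb U)"
proof -
 have c: "card U = card (S \<times> {b})" using fin card by (simp add: card_cartesian_product)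
 note L = nn_integral_lb_linear[where L = "Lm x", OF finJ(1,3) c inj_Lm[OF assms], folded Dm_def]
 show "Dm x ~= 0" "Dm x ~= \<infinity>" using L(1,2) by auto
 show "f : borel_measurable (lb (S \<times> {b})) ==> (\<integral>\<^sup>+y. f y \<partial>lb (S \<times> {b})) =
   inverse (Dm x) * (\<integral>\<^sup>+u. f (\<lambda>p\<in>S \<times> {b}. u b + (\<Sum>c\<in>U'. u c * x (fst p, c))) \<partial>lb U)"
  using L(3)[of f] unfolding sum_Lm by simp
qed

lemma measurable_pt [measurable (raw)]:
 "f : measurable M (lb (S \<times> U')) ==> i : S ==> c : U' ==> (%\<omega>. f \<omega> (i, c)) : borel_measurable M"
 by (rule measurable_compose[of f M "lb (S \<times> U')"]) auto

lemma Dm_split: "Dm x = (\<integral>\<^sup>+a. \<integral>\<^sup>+t. (\<Prod>i\<in>S. indicator {0..1} (t + (\<Sum>c\<in>U'. a c * x (i, c)))) \<partial>lborel \<partial>lb U')"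
proof -
 have pr: "(\<Prod>p\<in>S \<times> {b}. g (fst p)) = (\<Prod>i\<in>S. g i)" for g :: "nat => ennreal"
  by (rule prod.reindex_bij_witness[of _ "%i. (i, b)" fst]) auto
 have "Dm x = (\<integral>\<^sup>+u. (\<Prod>i\<in>S. indicator {0..1} (u b + (\<Sum>c\<in>U'. u c * x (i, c)))) \<partial>lb U)"
  unfolding Dm_def cube_mass_def sum_Lm
  by (intro nn_integral_cong) (rule pr[of "%i. indicator {0..1} (u b + (\<Sum>c\<in>U'. u c * x (i, c)))" for u])
 also have "... = (\<integral>\<^sup>+a. \<integral>\<^sup>+t. (\<Prod>i\<in>S. indicator {0..1} ((a(b := t)) b + (\<Sum>c\<in>U'. (a(b := t)) c * x (i, c)))) \<partial>lborel \<partial>lb U')"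
 proof (rule lb.product_nn_integral_insert[OF fin(3,4)])
  have "(%u. u b + (\<Sum>c\<in>U'. u c * x (i, c))) : borel_measurable (lb U)" for i
   by (intro borel_measurable_add borel_measurable_sum borel_measurable_times measurable_lb_component) auto
  from measurable_compose[OF this borel_measurable_indicator[of "{0..1}"]]
  show "(%u. \<Prod>i\<in>S. indicator {0..1} (u b + (\<Sum>c\<in>U'. u c * x (i, c))) :: ennreal) : borel_measurable (lb U)"
   by (intro borel_measurable_prod_ennreal) auto
 qed
 also have "... = (\<integral>\<^sup>+a. \<integral>\<^sup>+t. (\<Prod>i\<in>S. indicator {0..1} (t + (\<Sum>c\<in>U'. a c * x (i, c)))) \<partial>lborel \<partial>lb U')"
 proof -
  have "(\<Sum>c\<in>U'. (a(b := t)) c * x (i, c)) = (\<Sum>c\<in>U'. a c * x (i, c))" for a t i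
   using fin by (intro sum.cong) auto
  then show ?thesis by (simp only: fun_upd_same)
 qed
 finally show ?thesis .
qed

text \<open>A translation by \<open>x0\<close> is absorbed by shifting t, and the scaling by \<rho>
  is moved from the points to the card U' slope variables.\<close>

lemma Dm_scale:
 assumes \<rho>: "\<rho> > 0"
 shows "Dm z = ennreal (\<rho> ^ card U') * Dm (\<lambda>p\<in>S \<times> U'. x0 (snd p) + \<rho> * z p)"
proof -
 let ?x = "\<lambda>p\<in>S \<times> U'. x0 (snd p) + \<rho> * z p"
 have [measurable]: "(%t. \<Prod>i\<in>S. indicator {0..1} (t + g i) :: ennreal) : borel_measurable borel" for g :: "nat => real"
  by measurable
 have inner: "(\<integral>\<^sup>+t. (\<Prod>i\<in>S. indicator {0..1} (t + (\<Sum>c\<in>U'. a c * ?x (i, c)))) \<partial>lborel)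
   = (\<integral>\<^sup>+t. (\<Prod>i\<in>S. indicator {0..1} (t + (\<Sum>c\<in>U'. (\<rho> * a c) * z (i, c)))) \<partial>lborel)" (is "?l = ?r") for a
 proof -
  have s: "(\<Sum>c\<in>U'. a c * ?x (i, c)) = (\<Sum>c\<in>U'. a c * x0 c) + (\<Sum>c\<in>U'. (\<rho> * a c) * z (i, c))" if "i : S" for i
   using that unfolding sum.distrib[symmetric] by (intro sum.cong) (auto simp: algebra_simps)
  have "?l = (\<integral>\<^sup>+t. (\<Prod>i\<in>S. indicator {0..1} (t + ((\<Sum>c\<in>U'. a c * x0 c) + (\<Sum>c\<in>U'. (\<rho> * a c) * z (i, c))))) \<partial>lborel)"
   using s by (intro nn_integral_cong prod.cong) auto
  also have "... = ennreal (abs 1) * (\<integral>\<^sup>+t. (\<Prod>i\<in>S. indicator {0..1} ((- (\<Sum>c\<in>U'. a c * x0 c) + 1 * t) + ((\<Sum>c\<in>U'. a c * x0 c) + (\<Sum>c\<in>U'. (\<rho> * a c) * z (i, c))))) \<partial>lborel)"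
   by (rule nn_integral_real_affine) auto
  also have "... = ?r" by (simp add: algebra_simps)
  finally show ?thesis .
 qed
 let ?\<phi> = "%a. \<integral>\<^sup>+t. (\<Prod>i\<in>S. indicator {0..1} (t + (\<Sum>c\<in>U'. a c * z (i, c)))) \<partial>lborel :: ennreal"
 have m: "?\<phi> : borel_measurable (lb U')" by measurable
 have "Dm z = (\<integral>\<^sup>+a. ?\<phi> a \<partial>lb U')" by (rule Dm_split)
 also have "... = (\<Prod>a\<in>U'. ennreal (abs \<rho>)) * (\<integral>\<^sup>+a. ?\<phi> (\<lambda>c\<in>U'. 0 + \<rho> * a c) \<partial>lb U')"
  by (rule nn_integral_lb_affine[OF fin(3) _ m, of "%_. \<rho>" "%_. 0"]) (use \<rho> in auto)
 also have "(\<Prod>a\<in>U'. ennreal (abs \<rho>)) = ennreal (\<rho> ^ card U')" using \<rho> by (simp add: ennreal_power)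
 also have "(\<integral>\<^sup>+a. ?\<phi> (\<lambda>c\<in>U'. 0 + \<rho> * a c) \<partial>lb U') = Dm ?x"
  unfolding Dm_split inner by (intro nn_integral_cong) simp
 finally show ?thesis .
qed

lemma measurable_Dm [measurable]: "Dm : borel_measurable (lb (S \<times> U'))"
proof -
 interpret sJ: sigma_finite_measure "lb U'" using fin by (intro sigma_finite_lb)
 have "(%(x, a). \<integral>\<^sup>+t. (\<Prod>i\<in>S. indicator {0..1} (t + (\<Sum>c\<in>U'. a c * x (i, c)))) \<partial>lborel :: ennreal)
   : borel_measurable (lb (S \<times> U') \<Otimes>\<^sub>M lb U')"
  by measurable
 from sJ.borel_measurable_nn_integral[OF this] show ?thesis unfolding Dm_split .
qed

text \<open>The foot of the perpendicular from the origin to the hyperplane has \<open>U'\<close>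
  coordinates -h a / \<open>rf a\<close>. Measuring the points from this foot, the squared norm
  splits by Pythagoras.\<close>

lemma qf_param:
 assumes "i : S"
 shows "qf i (\<lambda>p\<in>S \<times> U'. - h * a (snd p) / rf a + \<rho> * z p) a (rf a * h) = h\<^sup>2 + \<rho>\<^sup>2 * qf i z a 0"
proof -
 define r where "r = rf a"
 define A where "A = (\<Sum>c\<in>U'. (a c)\<^sup>2)"
 define B where "B = (\<Sum>c\<in>U'. a c * z (i, c))"
 define C where "C = (\<Sum>c\<in>U'. (z (i, c))\<^sup>2)"
 have r: "r > 0" "r\<^sup>2 = 1 + A" using rf_pos[of a] by (auto simp: r_def A_def)
 have "(\<Sum>c\<in>U'. ((\<lambda>p\<in>S \<times> U'. - h * a (snd p) / rf a + \<rho> * z p) (i, c))\<^sup>2)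
   = (\<Sum>c\<in>U'. (h / r)\<^sup>2 * (a c)\<^sup>2 - 2 * (h / r) * \<rho> * (a c * z (i, c)) + \<rho>\<^sup>2 * (z (i, c))\<^sup>2)"
  using assms by (intro sum.cong) (auto simp: r_def power2_eq_square algebra_simps)
 also have "... = (h / r)\<^sup>2 * A - 2 * (h / r) * \<rho> * B + \<rho>\<^sup>2 * C"
  unfolding A_def B_def C_def sum_distrib_left by (simp add: sum.distrib sum_subtractf)
 finally have 1: "(\<Sum>c\<in>U'. ((\<lambda>p\<in>S \<times> U'. - h * a (snd p) / rf a + \<rho> * z p) (i, c))\<^sup>2)
   = (h / r)\<^sup>2 * A - 2 * (h / r) * \<rho> * B + \<rho>\<^sup>2 * C" .
 have "(\<Sum>c\<in>U'. a c * (\<lambda>p\<in>S \<times> U'. - h * a (snd p) / rf a + \<rho> * z p) (i, c))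
   = (\<Sum>c\<in>U'. - (h / r) * (a c)\<^sup>2 + \<rho> * (a c * z (i, c)))"
  using assms by (intro sum.cong) (auto simp: r_def power2_eq_square algebra_simps)
 also have "... = - (h / r) * A + \<rho> * B"
  unfolding A_def B_def by (simp only: sum.distrib sum_distrib_left)
 finally have 2: "(\<Sum>c\<in>U'. a c * (\<lambda>p\<in>S \<times> U'. - h * a (snd p) / rf a + \<rho> * z p) (i, c)) = - (h / r) * A + \<rho> * B" .
 have "r * h - (h / r) * A = h * (r\<^sup>2 - A) / r" using r(1) by (simp add: field_simps power2_eq_square)
 then have 3: "r * h - (h / r) * A = h / r" using r by simp
 have "qf i (\<lambda>p\<in>S \<times> U'. - h * a (snd p) / rf a + \<rho> * z p) a (rf a * h)
   = (h / r)\<^sup>2 * A - 2 * (h / r) * \<rho> * B + \<rho>\<^sup>2 * C + (h / r + \<rho> * B)\<^sup>2"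
  unfolding qf_def 1 2 unfolding r_def[symmetric] using 3 by (simp add: algebra_simps)
 also have "... = (h / r)\<^sup>2 * (A + 1) + \<rho>\<^sup>2 * (C + B\<^sup>2)" by algebra
 also have "(h / r)\<^sup>2 * (A + 1) = (h / r)\<^sup>2 * r\<^sup>2" unfolding r(2) by (simp add: add.commute)
 also have "(h / r)\<^sup>2 * r\<^sup>2 = h\<^sup>2" using r(1) by (simp add: power_divide)
 finally show ?thesis by (simp add: qf_def B_def C_def)
qed

lemma wt_zero:
 assumes "h\<^sup>2 >= 1" "i : S"
 shows "wt \<beta> (qf i x a (rf a * h)) = 0"
proof -
 define z where "z = (%p. x p - (- h * a (snd p) / rf a))"
 have "qf i (\<lambda>p\<in>S \<times> U'. - h * a (snd p) / rf a + 1 * z p) a (rf a * h) = h\<^sup>2 + 1\<^sup>2 * qf i z a 0"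
  by (rule qf_param[OF assms(2)])
 moreover have "qf i (\<lambda>p\<in>S \<times> U'. - h * a (snd p) / rf a + 1 * z p) a (rf a * h) = qf i x a (rf a * h)"
  unfolding qf_def using assms(2) by (simp add: z_def)
 moreover have "qf i z a 0 >= 0" unfolding qf_def by (intro add_nonneg_nonneg sum_nonneg) auto
 ultimately show ?thesis using assms by (simp add: wt_def)
qed

text \<open>The power of 1 - h^2 in \<open>slice\<close>: each of the card S weights gives \<beta>,
  each of the card S * card U' coordinates gives 1/2, and the determinant, of degree card U', gives
  card U' / 2. With card U' = card S - 1 the last two add up to ((card S)^2 - 1)/2.\<close>

definition \<gamma> :: real where "\<gamma> = \<beta> * real (card S) + (real (card S) ^ 2 - 1) / 2"

definition Zf :: "('b => real) => ennreal" where
 "Zf a = (\<integral>\<^sup>+z. (if N z then inverse (Dm z) * (\<Prod>i\<in>S. wt \<beta> (qf i z a 0)) else 0) \<partial>lb (S \<times> U'))"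

lemma measurable_qf [measurable]:
 assumes "i : S"
 shows "(%(x, a, t). qf i x a t) : borel_measurable (lb (S \<times> U') \<Otimes>\<^sub>M lb U' \<Otimes>\<^sub>M lborel)"
 unfolding qf_def using assms by measurable

text \<open>The unit ball meets a hyperplane at distance h in a ball of radius \<rho> = sqrt(1 -
  h^2). Rescaling to the parallel hyperplane through the origin turns weights, volume and
  determinant into powers of \<rho>, and \<open>N\<close> does not notice it.\<close>

lemma slice:
 assumes h: "h\<^sup>2 < 1"
 shows "(\<integral>\<^sup>+x. (if N x then inverse (Dm x) * (\<Prod>i\<in>S. wt \<beta> (qf i x a (rf a * h))) else 0) \<partial>lb (S \<times> U'))
  = ennreal ((1 - h\<^sup>2) powr \<gamma>) * Zf a"
proof -
 define \<rho> where "\<rho> = sqrt (1 - h\<^sup>2)"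
 have \<rho>: "\<rho> > 0" "\<rho>\<^sup>2 = 1 - h\<^sup>2" using h by (auto simp: \<rho>_def)
 define x0 where "x0 c = - h * a c / rf a" for c
 let ?X = "%z. \<lambda>p\<in>S \<times> U'. x0 (snd p) + \<rho> * z p"
 let ?f = "%x. if N x then inverse (Dm x) * (\<Prod>i\<in>S. wt \<beta> (qf i x a (rf a * h))) else 0"
 have m1: "(%x. qf i x a t) : borel_measurable (lb (S \<times> U'))" if "i : S" for i t
  unfolding qf_def using that by measurable
 have m2: "(%x. wt \<beta> (qf i x a t)) : borel_measurable (lb (S \<times> U'))" if "i : S" for i t
  by (rule measurable_compose[OF m1[OF that] measurable_wt])
 have m3: "(%x. \<Prod>i\<in>S. wt \<beta> (qf i x a t)) : borel_measurable (lb (S \<times> U'))" for t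
  by (intro borel_measurable_prod_ennreal m2)
 note m3 [measurable]
 have m: "?f : borel_measurable (lb (S \<times> U'))" by measurable
 have "(\<integral>\<^sup>+x. ?f x \<partial>lb (S \<times> U')) = (\<Prod>p\<in>S \<times> U'. ennreal (abs \<rho>)) * (\<integral>\<^sup>+z. ?f (?X z) \<partial>lb (S \<times> U'))"
  by (rule nn_integral_lb_affine[OF finJ(2) _ m, of "%_. \<rho>" "%p. x0 (snd p)"]) (use \<rho> in auto)
 also have "(\<Prod>p\<in>S \<times> U'. ennreal (abs \<rho>)) = ennreal (\<rho> ^ (card S * card U'))"
  using \<rho> by (simp add: ennreal_power card_cartesian_product)
 also have "(\<integral>\<^sup>+z. ?f (?X z) \<partial>lb (S \<times> U')) = (\<integral>\<^sup>+z. ennreal (\<rho> ^ card U') * ennreal (((1 - h\<^sup>2) powr \<beta>) ^ card S) *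
    (if N z then inverse (Dm z) * (\<Prod>i\<in>S. wt \<beta> (qf i z a 0)) else 0) \<partial>lb (S \<times> U'))"
 proof (intro nn_integral_cong)
  fix z
  show "?f (?X z) = ennreal (\<rho> ^ card U') * ennreal (((1 - h\<^sup>2) powr \<beta>) ^ card S) *
    (if N z then inverse (Dm z) * (\<Prod>i\<in>S. wt \<beta> (qf i z a 0)) else 0)"
  proof (cases "N z")
   case True
   then have NX: "N (?X z)" using N_inv[OF \<rho>(1)] by simp
   have "wt \<beta> (qf i (?X z) a (rf a * h)) = ennreal ((1 - h\<^sup>2) powr \<beta>) * wt \<beta> (qf i z a 0)" if "i : S" for i
    unfolding x0_def qf_param[OF that] \<rho>(2) by (rule wt_scale[OF h])
   then have "(\<Prod>i\<in>S. wt \<beta> (qf i (?X z) a (rf a * h))) = (\<Prod>i\<in>S. ennreal ((1 - h\<^sup>2) powr \<beta>) * wt \<beta> (qf i z a 0))"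
    by (intro prod.cong) auto
   also have "... = ennreal (((1 - h\<^sup>2) powr \<beta>) ^ card S) * (\<Prod>i\<in>S. wt \<beta> (qf i z a 0))"
    by (simp add: prod.distrib ennreal_power)
   finally have W: "(\<Prod>i\<in>S. wt \<beta> (qf i (?X z) a (rf a * h))) = ennreal (((1 - h\<^sup>2) powr \<beta>) ^ card S) * (\<Prod>i\<in>S. wt \<beta> (qf i z a 0))" .
   have "inverse (Dm z) = inverse (ennreal (\<rho> ^ card U')) * inverse (Dm (?X z))"
    unfolding Dm_scale[OF \<rho>(1), of z x0] using Dm_N[OF NX] \<rho>
    by (intro ennreal_inverse_mult) (auto simp: less_top top.not_eq_extremum)
   then have "ennreal (\<rho> ^ card U') * inverse (Dm z) = inverse (Dm (?X z))"
    using \<rho> by (simp add: mult.assoc[symmetric] inverse_ennreal ennreal_mult[symmetric])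
   then have Di: "inverse (Dm (?X z)) = ennreal (\<rho> ^ card U') * inverse (Dm z)" by simp
   have "?f (?X z) = inverse (Dm (?X z)) * (\<Prod>i\<in>S. wt \<beta> (qf i (?X z) a (rf a * h)))" using NX by simp
   also have "... = ennreal (\<rho> ^ card U') * inverse (Dm z) * (ennreal (((1 - h\<^sup>2) powr \<beta>) ^ card S) * (\<Prod>i\<in>S. wt \<beta> (qf i z a 0)))"
    unfolding W Di ..
   finally show ?thesis using True by (simp add: mult_ac)
  next
   case False
   then have "~ N (?X z)" using N_inv[OF \<rho>(1)] by simp
   then show ?thesis using False by simp
  qed
 qed
 also have "... = ennreal (\<rho> ^ card U') * ennreal (((1 - h\<^sup>2) powr \<beta>) ^ card S) * Zf a"
  unfolding Zf_def by (rule nn_integral_cmult) measurable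
 also have "ennreal (\<rho> ^ (card S * card U')) * (ennreal (\<rho> ^ card U') * ennreal (((1 - h\<^sup>2) powr \<beta>) ^ card S) * Zf a)
   = ennreal (\<rho> ^ (card S * card U') * (\<rho> ^ card U' * ((1 - h\<^sup>2) powr \<beta>) ^ card S)) * Zf a"
  using \<rho> by (simp add: ennreal_mult mult.assoc)
 also have "\<rho> ^ (card S * card U') * (\<rho> ^ card U' * ((1 - h\<^sup>2) powr \<beta>) ^ card S) = (1 - h\<^sup>2) powr \<gamma>"
 proof -
  have r2: "\<rho> = (1 - h\<^sup>2) powr (1/2)" using h by (simp add: \<rho>_def powr_half_sqrt)
  have pw: "\<rho> ^ n = (1 - h\<^sup>2) powr (real n / 2)" for n
   unfolding r2 using h by (simp add: powr_realpow[symmetric] powr_powr)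
  have "((1 - h\<^sup>2) powr \<beta>) ^ card S = (1 - h\<^sup>2) powr (\<beta> * card S)"
   using h by (simp add: powr_realpow[symmetric] powr_powr)
  then have "\<rho> ^ (card S * card U') * (\<rho> ^ card U' * ((1 - h\<^sup>2) powr \<beta>) ^ card S)
   = (1 - h\<^sup>2) powr (real (card S * card U') / 2 + (real (card U') / 2 + \<beta> * card S))"
   unfolding pw by (simp add: powr_add)
  also have "real (card S * card U') / 2 + (real (card U') / 2 + \<beta> * card S) = \<gamma>"
   using card by (simp add: \<gamma>_def power2_eq_square field_simps)
  finally show ?thesis .
 qed
 finally show ?thesis .
qed

declare measurable_pt [measurable del]

lemma hp_merge:
 assumes "x : space (lb (S \<times> U'))"
 shows "merge (S \<times> U') (S \<times> {b}) (x, \<lambda>p\<in>S \<times> {b}. t + (\<Sum>c\<in>U'. a c * x (fst p, c))) = hp x a t"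
proof
 fix p :: "nat \<times> 'b"
 consider "p : S \<times> U'" | "p : S \<times> {b}" | "p ~: S \<times> U" by auto
 then show "merge (S \<times> U') (S \<times> {b}) (x, \<lambda>p\<in>S \<times> {b}. t + (\<Sum>c\<in>U'. a c * x (fst p, c))) p = hp x a t p"
 proof cases
  case 1
  then have "snd p ~= b" "p : S \<times> U" using fin by auto
  then show ?thesis using 1 by (simp add: merge_def hp_def)
 next
  case 2
  then have "snd p = b" "p : S \<times> U" "p ~: S \<times> U'" using fin by auto
  then show ?thesis using 2 by (simp add: merge_def hp_def)
 next
  case 3
  then have "p ~: S \<times> U'" "p ~: S \<times> {b}" by auto
  then show ?thesis using 3 by (simp add: merge_def hp_def)
 qed
qed

lemma hp_restrict:
 assumes "x : space (lb (S \<times> U'))"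
 shows "restrict (hp x a t) (S \<times> U') = x"
proof
 fix p :: "nat \<times> 'b"
 show "restrict (hp x a t) (S \<times> U') p = x p"
 proof (cases "p : S \<times> U'")
  case True
  then have "snd p ~= b" "p : S \<times> U" using fin by auto
  then show ?thesis using True by (simp add: hp_def)
 next
  case False
  then show ?thesis using assms by (cases p) (auto simp: space_PiM PiE_iff extensional_def)
 qed
qed

lemma hp_sq:
 assumes "i : S"
 shows "(\<Sum>c\<in>U. (hp x a t (i, c))\<^sup>2) = qf i x a t"
proof -
 have "(\<Sum>c\<in>U'. (hp x a t (i, c))\<^sup>2) = (\<Sum>c\<in>U'. (x (i, c))\<^sup>2)"
  using assms fin by (intro sum.cong) (auto simp: hp_def)
 moreover have "hp x a t (i, b) = t + (\<Sum>c\<in>U'. a c * x (i, c))" using assms by (simp add: hp_def)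
 ultimately show ?thesis using fin by (simp add: qf_def)
qed

text \<open>The heights at \<open>b\<close> are exchanged for the hyperplane parameters (a, t), with
  the points over \<open>U'\<close> fixed, and t for the distance h. By \<open>slice\<close> the
  dependence on h then separates from everything else, which means that shape and distance are
  independent.\<close>

theorem factorization:
 assumes \<Phi> [measurable]: "\<Phi> : borel_measurable (lb (S \<times> U))" and g [measurable]: "g : borel_measurable borel"
  and \<Phi>g: "!!x a t. x : space (lb (S \<times> U')) ==> N x ==> \<Phi> (hp x a t) = g (t / rf a)"
 shows "(\<integral>\<^sup>+x. (if N (restrict x (S \<times> U')) then (\<Prod>i\<in>S. wt \<beta> (\<Sum>c\<in>U. (x (i, c))\<^sup>2)) * \<Phi> x else 0) \<partial>lb (S \<times> U))
  = (\<integral>\<^sup>+a. ennreal (rf a) * Zf a \<partial>lb U') * (\<integral>\<^sup>+h. (if h\<^sup>2 < 1 then ennreal ((1 - h\<^sup>2) powr \<gamma>) * g h else 0) \<partial>lborel)"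
proof -
 let ?F = "%x. if N (restrict x (S \<times> U')) then (\<Prod>i\<in>S. wt \<beta> (\<Sum>c\<in>U. (x (i, c))\<^sup>2)) * \<Phi> x else 0"
 define G where "G x a t = (if N x then inverse (Dm x) * (\<Prod>i\<in>S. wt \<beta> (qf i x a t)) else 0)" for x a t
 have SJ: "S \<times> U = (S \<times> U') Un (S \<times> {b})" "(S \<times> U') Int (S \<times> {b}) = {}" using fin by auto
 interpret sX: sigma_finite_measure "lb (S \<times> U')" using finJ by (intro sigma_finite_lb)
 interpret sJ: sigma_finite_measure "lb U'" using fin by (intro sigma_finite_lb)
 interpret XA: pair_sigma_finite "lb (S \<times> U')" "lb U'" ..
 interpret XL: pair_sigma_finite "lb (S \<times> U')" "lborel :: real measure" ..
 have rsub: "(%x. restrict x (S \<times> U')) : measurable (lb (S \<times> U)) (lb (S \<times> U'))"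
  by (rule measurable_restrict_subset) auto
 have mN: "Measurable.pred (lb (S \<times> U)) (%x. N (restrict x (S \<times> U')))"
  by (rule measurable_compose[OF rsub N_meas])
 have msq: "(%x. wt \<beta> (\<Sum>c\<in>U. (x (i, c))\<^sup>2)) : borel_measurable (lb (S \<times> U))" if "i : S" for i
 proof -
  have "(%x. x (i, c)) : borel_measurable (lb (S \<times> U))" if "c : U" for c
   using that \<open>i : S\<close> by (intro measurable_lb_component) auto
  then show ?thesis by (intro measurable_compose[OF _ measurable_wt] borel_measurable_sum borel_measurable_power)
 qed
 have mF: "?F : borel_measurable (lb (S \<times> U))"
  using mN msq \<Phi> by (intro measurable_If borel_measurable_times borel_measurable_prod_ennreal) auto
 have mG: "(%(x, a, t). G x a t) : borel_measurable (lb (S \<times> U') \<Otimes>\<^sub>M lb U' \<Otimes>\<^sub>M lborel)"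
 proof -
  have "(%\<omega>. wt \<beta> (qf i (fst \<omega>) (fst (snd \<omega>)) (snd (snd \<omega>)))) : borel_measurable (lb (S \<times> U') \<Otimes>\<^sub>M lb U' \<Otimes>\<^sub>M lborel)"
   if "i : S" for i
   using measurable_compose[OF measurable_qf[OF that] measurable_wt] by (simp add: case_prod_beta)
  then have [measurable]: "(%\<omega>. \<Prod>i\<in>S. wt \<beta> (qf i (fst \<omega>) (fst (snd \<omega>)) (snd (snd \<omega>)))) : borel_measurable (lb (S \<times> U') \<Otimes>\<^sub>M lb U' \<Otimes>\<^sub>M lborel)"
   by (intro borel_measurable_prod_ennreal)
  show ?thesis unfolding G_def case_prod_beta by measurable
 qed
 have mrf [measurable]: "rf : borel_measurable (lb U')"
 proof -
  have "(%a. \<Sum>c\<in>U'. (a c)\<^sup>2) : borel_measurable (lb U')"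
   by (intro borel_measurable_sum borel_measurable_power measurable_lb_component)
  from measurable_compose[OF this, of "%s. sqrt (1 + s)" borel] show ?thesis unfolding rf_def by simp
 qed
 have mG': "(%\<omega>. G (p \<omega>) (q \<omega>) (s \<omega>)) : borel_measurable M"
  if "p : measurable M (lb (S \<times> U'))" "q : measurable M (lb U')" "s : borel_measurable M" for M :: "'z measure" and p q s
  using measurable_compose[OF measurable_Pair[OF that(1) measurable_Pair[OF that(2), of s lborel]] mG] that(3) by simp
 have "(\<integral>\<^sup>+x. ?F x \<partial>lb (S \<times> U)) = (\<integral>\<^sup>+x. \<integral>\<^sup>+y. ?F (merge (S \<times> U') (S \<times> {b}) (x, y)) \<partial>lb (S \<times> {b}) \<partial>lb (S \<times> U'))"
  unfolding SJ(1) by (rule lb.product_nn_integral_fold[OF SJ(2) finJ(2,3)]) (use mF SJ(1) in simp)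
 also have "... = (\<integral>\<^sup>+x. \<integral>\<^sup>+u. G x u (u b) * g (u b / rf u) \<partial>lb U \<partial>lb (S \<times> U'))"
 proof (intro nn_integral_cong)
  fix x assume x: "x : space (lb (S \<times> U'))"
  show "(\<integral>\<^sup>+y. ?F (merge (S \<times> U') (S \<times> {b}) (x, y)) \<partial>lb (S \<times> {b})) = (\<integral>\<^sup>+u. G x u (u b) * g (u b / rf u) \<partial>lb U)"
  proof (cases "N x")
   case True
   have mm: "(%y. ?F (merge (S \<times> U') (S \<times> {b}) (x, y))) : borel_measurable (lb (S \<times> {b}))"
   proof -
    have "merge (S \<times> U') (S \<times> {b}) : measurable (lb (S \<times> U') \<Otimes>\<^sub>M lb (S \<times> {b})) (lb (S \<times> U))"
    unfolding SJ(1) by (rule measurable_merge)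
    from measurable_compose[OF measurable_compose[OF measurable_Pair1'[OF x] this] mF] show ?thesis .
   qed
   have "(\<integral>\<^sup>+y. ?F (merge (S \<times> U') (S \<times> {b}) (x, y)) \<partial>lb (S \<times> {b}))
    = inverse (Dm x) * (\<integral>\<^sup>+u. ?F (hp x u (u b)) \<partial>lb U)"
    using Dm_N(3)[OF True mm] unfolding hp_merge[OF x] .
   also have "... = (\<integral>\<^sup>+u. inverse (Dm x) * ?F (hp x u (u b)) \<partial>lb U)"
   proof -
    have "(%u. \<lambda>p\<in>S \<times> {b}. u b + (\<Sum>c\<in>U'. u c * x (fst p, c))) : measurable (lb U) (lb (S \<times> {b}))"
    by (intro measurable_restrict, subst measurable_lborel1)
    (intro borel_measurable_add borel_measurable_sum borel_measurable_times measurable_lb_component, auto)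
    from measurable_compose[OF this mm] have "(%u. ?F (hp x u (u b))) : borel_measurable (lb U)"
    unfolding hp_merge[OF x] .
    then show ?thesis by (rule nn_integral_cmult[symmetric])
   qed
   also have "... = (\<integral>\<^sup>+u. G x u (u b) * g (u b / rf u) \<partial>lb U)"
   proof (intro nn_integral_cong)
    fix u
    have "(\<Prod>i\<in>S. wt \<beta> (\<Sum>c\<in>U. (hp x u (u b) (i, c))\<^sup>2)) = (\<Prod>i\<in>S. wt \<beta> (qf i x u (u b)))"
    using hp_sq by (intro prod.cong) auto
    then show "inverse (Dm x) * ?F (hp x u (u b)) = G x u (u b) * g (u b / rf u)"
    unfolding hp_restrict[OF x] G_def \<Phi>g[OF x True] using True by (simp add: mult.assoc)
   qed
   finally show ?thesis .
  next
   case False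
   have "restrict (merge (S \<times> U') (S \<times> {b}) (x, y)) (S \<times> U') = x" for y
    using x by (auto simp: fun_eq_iff merge_def space_PiM PiE_iff extensional_def)
   then show ?thesis using False by (simp add: G_def)
  qed
 qed
 also have "... = (\<integral>\<^sup>+x. \<integral>\<^sup>+a. \<integral>\<^sup>+t. G x a t * g (t / rf a) \<partial>lborel \<partial>lb U' \<partial>lb (S \<times> U'))"
 proof (intro nn_integral_cong)
  fix x assume x: "x : space (lb (S \<times> U'))"
  have "(%u. restrict u U') : measurable (lb U) (lb U')" by (rule measurable_restrict_subset) auto
  have Gc: "G x (a(b := t)) s = G x a s" "rf (a(b := t)) = rf a" for a t s
  proof -
   have "(\<Sum>c\<in>U'. (a(b := t)) c * x (i, c)) = (\<Sum>c\<in>U'. a c * x (i, c))" for i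
    using fin by (intro sum.cong) auto
   then show "G x (a(b := t)) s = G x a s" unfolding G_def qf_def by (simp only:)
   have "(\<Sum>c\<in>U'. ((a(b := t)) c)\<^sup>2) = (\<Sum>c\<in>U'. (a c)\<^sup>2)"
    using fin by (intro sum.cong) auto
   then show "rf (a(b := t)) = rf a" unfolding rf_def by (simp only:)
  qed
  have Gr: "G x (restrict u U') s = G x u s" "rf (restrict u U') = rf u" for u s
   unfolding G_def qf_def rf_def by simp_all
  have m1: "(%u. G x (restrict u U') (u b)) : borel_measurable (lb U)"
   using x \<open>(%u. restrict u U') : measurable (lb U) (lb U')\<close> by (intro mG' measurable_lb_component) auto
  have m2: "(%u. rf (restrict u U')) : borel_measurable (lb U)"
   by (rule measurable_compose[OF \<open>(%u. restrict u U') : measurable (lb U) (lb U')\<close> mrf])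
  have "(\<integral>\<^sup>+u. G x u (u b) * g (u b / rf u) \<partial>lb U) =
   (\<integral>\<^sup>+a. \<integral>\<^sup>+t. G x (a(b := t)) ((a(b := t)) b) * g ((a(b := t)) b / rf (a(b := t))) \<partial>lborel \<partial>lb U')"
  proof (rule lb.product_nn_integral_insert[OF fin(3,4)])
   note [measurable] = m1[unfolded Gr] m2[unfolded Gr] measurable_lb_component[of b U, OF insertI1]
   show "(%u. G x u (u b) * g (u b / rf u)) : borel_measurable (lb U)" by measurable
  qed
  then show "(\<integral>\<^sup>+u. G x u (u b) * g (u b / rf u) \<partial>lb U) = (\<integral>\<^sup>+a. \<integral>\<^sup>+t. G x a t * g (t / rf a) \<partial>lborel \<partial>lb U')"
   unfolding Gc by simp
 qed
 also have "... = (\<integral>\<^sup>+x. \<integral>\<^sup>+a. \<integral>\<^sup>+h. ennreal (rf a) * (G x a (rf a * h) * g h) \<partial>lborel \<partial>lb U' \<partial>lb (S \<times> U'))"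
 proof (rule nn_integral_cong, rule nn_integral_cong)
  fix x a assume x: "x : space (lb (S \<times> U'))" and a: "a : space (lb U')"
  have r: "rf a > 0" using rf_pos[of a] by simp
  have mt: "(%t. G x a t) : borel_measurable borel" using x a by (intro mG') auto
  have mt': "(%h. G x a (rf a * h)) : borel_measurable borel" using x a by (intro mG') auto
  have "(\<integral>\<^sup>+t. G x a t * g (t / rf a) \<partial>lborel) = ennreal \<bar>rf a\<bar> * (\<integral>\<^sup>+h. G x a (0 + rf a * h) * g ((0 + rf a * h) / rf a) \<partial>lborel)"
   using r mt by (intro nn_integral_real_affine) auto
  also have "... = ennreal (rf a) * (\<integral>\<^sup>+h. G x a (rf a * h) * g h \<partial>lborel)" using r by simp
  also have "... = (\<integral>\<^sup>+h. ennreal (rf a) * (G x a (rf a * h) * g h) \<partial>lborel)"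
   using mt' by (intro nn_integral_cmult[symmetric]) auto
  finally show "(\<integral>\<^sup>+t. G x a t * g (t / rf a) \<partial>lborel) = (\<integral>\<^sup>+h. ennreal (rf a) * (G x a (rf a * h) * g h) \<partial>lborel)" .
 qed
 also have "... = (\<integral>\<^sup>+a. \<integral>\<^sup>+x. \<integral>\<^sup>+h. ennreal (rf a) * (G x a (rf a * h) * g h) \<partial>lborel \<partial>lb (S \<times> U') \<partial>lb U')"
 proof -
  have "(%(\<omega>, h). ennreal (rf (snd \<omega>)) * (G (fst \<omega>) (snd \<omega>) (rf (snd \<omega>) * h) * g h)) : borel_measurable ((lb (S \<times> U') \<Otimes>\<^sub>M lb U') \<Otimes>\<^sub>M lborel)"
  proof -
   have [measurable]: "(%z. G (fst (fst z)) (snd (fst z)) (rf (snd (fst z)) * snd z)) : borel_measurable ((lb (S \<times> U') \<Otimes>\<^sub>M lb U') \<Otimes>\<^sub>M lborel)"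
    by (intro mG') auto
   show ?thesis unfolding case_prod_beta by measurable
  qed
  from lborel.borel_measurable_nn_integral[OF this]
  have "(%(x, a). \<integral>\<^sup>+h. ennreal (rf a) * (G x a (rf a * h) * g h) \<partial>lborel) : borel_measurable (lb (S \<times> U') \<Otimes>\<^sub>M lb U')"
   by (simp add: case_prod_beta)
  from XA.Fubini'[OF this] show ?thesis by simp
 qed
 also have "... = (\<integral>\<^sup>+a. \<integral>\<^sup>+h. (ennreal (rf a) * Zf a) * (if h\<^sup>2 < 1 then ennreal ((1 - h\<^sup>2) powr \<gamma>) * g h else 0) \<partial>lborel \<partial>lb U')"
 proof (intro nn_integral_cong)
  fix a assume a: "a : space (lb U')"
  have "(%(x, h). ennreal (rf a) * (G x a (rf a * h) * g h)) : borel_measurable (lb (S \<times> U') \<Otimes>\<^sub>M lborel)"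
  proof -
   have [measurable]: "(%z. G (fst z) a (rf a * snd z)) : borel_measurable (lb (S \<times> U') \<Otimes>\<^sub>M lborel)"
    using a by (intro mG') auto
   show ?thesis unfolding case_prod_beta by measurable
  qed
  from XL.Fubini'[OF this]
  have "(\<integral>\<^sup>+x. \<integral>\<^sup>+h. ennreal (rf a) * (G x a (rf a * h) * g h) \<partial>lborel \<partial>lb (S \<times> U'))
   = (\<integral>\<^sup>+h. \<integral>\<^sup>+x. ennreal (rf a) * (G x a (rf a * h) * g h) \<partial>lb (S \<times> U') \<partial>lborel)" by simp
  also have "... = (\<integral>\<^sup>+h. (ennreal (rf a) * Zf a) * (if h\<^sup>2 < 1 then ennreal ((1 - h\<^sup>2) powr \<gamma>) * g h else 0) \<partial>lborel)"
  proof (intro nn_integral_cong)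
   fix h :: real
   have mh: "(%x. G x a (rf a * h)) : borel_measurable (lb (S \<times> U'))" using a by (intro mG') auto
   have "(\<integral>\<^sup>+x. ennreal (rf a) * (G x a (rf a * h) * g h) \<partial>lb (S \<times> U')) = ennreal (rf a) * ((\<integral>\<^sup>+x. G x a (rf a * h) \<partial>lb (S \<times> U')) * g h)"
    using mh by (simp add: nn_integral_cmult nn_integral_multc)
   also have "(\<integral>\<^sup>+x. G x a (rf a * h) \<partial>lb (S \<times> U')) = (if h\<^sup>2 < 1 then ennreal ((1 - h\<^sup>2) powr \<gamma>) * Zf a else 0)"
   proof (cases "h\<^sup>2 < 1")
    case True
    then show ?thesis using slice[OF True, of a] by (simp add: G_def)
   next
    case False
    obtain i where i: "i : S" using fin by auto
    have "(\<Prod>i\<in>S. wt \<beta> (qf i x a (rf a * h))) = 0" for x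
    using wt_zero[OF _ i, of h x a] False i fin by (intro prod_zero) auto
    then have "G x a (rf a * h) = 0" for x unfolding G_def by (simp only: mult_zero_right if_cancel)
    then show ?thesis using False by simp
   qed
   finally show "(\<integral>\<^sup>+x. ennreal (rf a) * (G x a (rf a * h) * g h) \<partial>lb (S \<times> U'))
    = (ennreal (rf a) * Zf a) * (if h\<^sup>2 < 1 then ennreal ((1 - h\<^sup>2) powr \<gamma>) * g h else 0)"
    by (simp add: mult_ac)
  qed
  finally show "(\<integral>\<^sup>+x. \<integral>\<^sup>+h. ennreal (rf a) * (G x a (rf a * h) * g h) \<partial>lborel \<partial>lb (S \<times> U'))
   = (\<integral>\<^sup>+h. (ennreal (rf a) * Zf a) * (if h\<^sup>2 < 1 then ennreal ((1 - h\<^sup>2) powr \<gamma>) * g h else 0) \<partial>lborel)" .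
 qed
 also have "... = (\<integral>\<^sup>+a. ennreal (rf a) * Zf a * (\<integral>\<^sup>+h. (if h\<^sup>2 < 1 then ennreal ((1 - h\<^sup>2) powr \<gamma>) * g h else 0) \<partial>lborel) \<partial>lb U')"
  by (intro nn_integral_cong nn_integral_cmult) measurable
 also have "... = (\<integral>\<^sup>+a. ennreal (rf a) * Zf a \<partial>lb U') * (\<integral>\<^sup>+h. (if h\<^sup>2 < 1 then ennreal ((1 - h\<^sup>2) powr \<gamma>) * g h else 0) \<partial>lborel)"
 proof -
  have "(%(a, z). G z a 0) : borel_measurable (lb U' \<Otimes>\<^sub>M lb (S \<times> U'))"
   unfolding case_prod_beta by (intro mG') auto
  from sX.borel_measurable_nn_integral[OF this] have "Zf : borel_measurable (lb U')"
   unfolding Zf_def G_def .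
  then show ?thesis by (intro nn_integral_multc) auto
 qed
 finally show ?thesis .
qed

end

section \<open>Measurability of the geometric events\<close>

lemma closed_Collect_ball:
 "(!!i. i : A ==> closed {x. P i x}) ==> closed {x. ALL i:A. P i x}"
 unfolding Collect_ball_eq by (rule closed_INT) auto

text \<open>The geometric conditions assert the existence of coefficient vectors or normals. After
  normalisation these range over a compact set or a countable union of such, so each event becomes
  closed, F-sigma or the complement of a closed set.\<close>

lemma closed_ex_compact:
 fixes P :: "'a::metric_space => 'b::metric_space => bool"
 assumes K: "compact K" and P: "closed {z. P (fst z) (snd z)}"
 shows "closed {x. EX l:K. P x l}"
 unfolding closed_sequential_limits
proof (intro allI impI, elim conjE)
 fix X x assume X: "ALL n. X n : {x. EX l:K. P x l}" "X \<longlonglongrightarrow> x"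
 then obtain l where l: "!!n. l n : K" "!!n. P (X n) (l n)" by simp metis
 obtain l0 r where r: "l0 : K" "strict_mono r" "(l \<circ> r) \<longlonglongrightarrow> l0"
  using K l(1) unfolding compact_def by metis
 have "(%n. ((X \<circ> r) n, (l \<circ> r) n)) \<longlonglongrightarrow> (x, l0)"
  by (intro tendsto_Pair LIMSEQ_subseq_LIMSEQ X(2) r)
 moreover have "((X \<circ> r) n, (l \<circ> r) n) : {z. P (fst z) (snd z)}" for n using l(2) by simp
 ultimately have "(x, l0) : {z. P (fst z) (snd z)}"
  using closed_sequentially[OF P, of "%n. ((X \<circ> r) n, (l \<circ> r) n)" "(x, l0)"] by blast
 then show "x : {x. EX l:K. P x l}" using r(1) by auto
qed

lemma compact_box_fun: "compact {l :: nat => real. ALL i. \<bar>l i\<bar> <= c}"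
proof -
 have "compactin (product_topology (%_::nat. euclidean) UNIV) (PiE UNIV (%_. {-c..c}))"
  unfolding compactin_PiE by (auto simp: compactin_euclidean_iff)
 moreover have "PiE UNIV (%_. {-c..c}) = {l :: nat => real. ALL i. \<bar>l i\<bar> <= c}"
  by (auto simp: abs_le_iff PiE_iff minus_le_iff)
 ultimately show ?thesis by (simp add: euclidean_product_topology)
qed

lemma bounded_by_nat:
 fixes l :: "nat => real"
 assumes "finite I"
 shows "EX m. ALL i:I. \<bar>l i\<bar> <= real m"
proof -
 obtain m where m: "(\<Sum>i\<in>I. \<bar>l i\<bar>) <= real m" using real_arch_simple by blast
 have "\<bar>l i\<bar> <= real m" if "i : I" for i
  using member_le_sum[OF that, of "%i. \<bar>l i\<bar>"] assms m by fastforce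
 then show ?thesis by blast
qed

lemma truncate_sums:
 fixes l :: "nat => real"
 shows "sum (%i. if i : I then l i else 0) I = sum l I"
  "(\<Sum>i\<in>I. (if i : I then l i else 0) * f i) = (\<Sum>i\<in>I. l i * f i)"
 by (auto intro: sum.cong)

abbreviation crd :: "(nat => 'e::euclidean_space) => nat => 'e => real" where
 "crd X i b \<equiv> X i \<bullet> b"

lemma continuous_fst_comp: "continuous_on UNIV (%z::(nat => 'e::euclidean_space) \<times> 'b::topological_space. fst z i)"
 by (rule continuous_on_product_then_coordinatewise) (intro continuous_intros)

lemma continuous_snd_comp: "continuous_on UNIV (%z::'b::topological_space \<times> (nat => real). snd z i)"
 by (rule continuous_on_product_then_coordinatewise) (intro continuous_intros)

lemmas cont_comp = continuous_fst_comp continuous_snd_comp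

lemma borel_not_face:
 fixes U :: "'e::euclidean_space set"
 assumes I: "finite I"
 shows "{X. not_face U k I (crd X)} : sets borel"
proof -
 \<comment> \<open>Requiring the coefficients off the face to sum to 1 replaces the strict
   inequality in \<open>not_face\<close> by a closed condition.\<close>
 define P :: "(nat => 'e) => (nat => real) => bool" where
  "P X l \<longleftrightarrow> sum l I = 0 & (ALL b:U. (\<Sum>i\<in>I. l i * (X i \<bullet> b)) = 0) & (ALL i:I. k <= i --> 0 <= l i)
    & (\<Sum>i\<in>{i:I. k <= i}. l i) = 1" for X l
 have "closed {z. P (fst z) (snd z)}"
  unfolding P_def
  by (intro closed_Collect_conj closed_Collect_ball closed_Collect_imp closed_Collect_eq closed_Collect_le
    continuous_intros cont_comp open_Collect_const)
 then have cl: "closed {X. EX l:{l. ALL i. \<bar>l i\<bar> <= real m}. P X l}" for m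
  by (rule closed_ex_compact[OF compact_box_fun])
 have "{X. not_face U k I (crd X)} = (\<Union>m. {X. EX l:{l. ALL i. \<bar>l i\<bar> <= real m}. P X l})"
 proof (intro equalityI subsetI)
  fix X assume "X : {X. not_face U k I (crd X)}"
  then obtain l i where l: "sum l I = 0" "ALL b:U. (\<Sum>i\<in>I. l i * (X i \<bullet> b)) = 0" "ALL i:I. k <= i --> 0 <= l i"
   "i : I" "k <= i" "0 < l i" by (auto simp: not_face_def)
  define s where "s = (\<Sum>i\<in>{i:I. k <= i}. l i)"
  have s: "s > 0" unfolding s_def using I l by (intro sum_pos2[of _ i]) auto
  define l' where "l' i = (if i : I then l i / s else 0)" for i
  have "sum l' I = sum l I / s" unfolding l'_def truncate_sums(1) by (simp add: sum_divide_distrib)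
  moreover have "(\<Sum>i\<in>I. l' i * (X i \<bullet> b)) = (\<Sum>i\<in>I. l i * (X i \<bullet> b)) / s" for b
   unfolding l'_def truncate_sums(2) by (simp add: sum_divide_distrib)
  moreover have "(\<Sum>i\<in>{i:I. k <= i}. l' i) = 1"
  proof -
   have "(\<Sum>i\<in>{i:I. k <= i}. l' i) = (\<Sum>i\<in>{i:I. k <= i}. l i / s)"
    by (intro sum.cong) (auto simp: l'_def)
   also have "... = s / s" unfolding s_def by (rule sum_divide_distrib[symmetric])
   finally show ?thesis using s by simp
  qed
  ultimately have "P X l'" using l s by (auto simp: P_def l'_def)
  moreover obtain m where "ALL i:I. \<bar>l' i\<bar> <= real m" using bounded_by_nat[OF I] by blast
  then have "ALL i. \<bar>l' i\<bar> <= real m" by (auto simp: l'_def)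
  ultimately show "X : (\<Union>m. {X. EX l:{l. ALL i. \<bar>l i\<bar> <= real m}. P X l})" by auto
 next
  fix X assume "X : (\<Union>m. {X. EX l:{l. ALL i. \<bar>l i\<bar> <= real m}. P X l})"
  then obtain l where l: "P X l" by auto
  have "EX i:I. k <= i & 0 < l i"
  proof (rule ccontr)
   assume "~ ?thesis"
   then have "(\<Sum>i\<in>{i:I. k <= i}. l i) <= 0" by (intro sum_nonpos) (auto simp: not_less)
   then show False using l by (simp add: P_def)
  qed
  then show "X : {X. not_face U k I (crd X)}" using l by (auto simp: P_def not_face_def)
 qed
 then show ?thesis using cl by (auto intro!: borel_closed)
qed

lemma borel_aff_indep:
 fixes U :: "'e::euclidean_space set"
 assumes S: "finite S"
 shows "{X. aff_indep U S (crd X)} : sets borel"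
proof -
 \<comment> \<open>Nontriviality of the dependency is expressed as absolute sum 1, a closed
   condition that also bounds all coefficients by 1.\<close>
 define P :: "(nat => 'e) => (nat => real) => bool" where
  "P X l \<longleftrightarrow> sum l S = 0 & (ALL b:U. (\<Sum>i\<in>S. l i * (X i \<bullet> b)) = 0) & (\<Sum>i\<in>S. \<bar>l i\<bar>) = 1" for X l
 have "closed {z. P (fst z) (snd z)}"
  unfolding P_def
  by (intro closed_Collect_conj closed_Collect_ball closed_Collect_eq continuous_intros cont_comp)
 then have cl: "closed {X. EX l:{l. ALL i. \<bar>l i\<bar> <= 1}. P X l}"
  by (rule closed_ex_compact[OF compact_box_fun])
 have "{X. EX l:{l. ALL i. \<bar>l i\<bar> <= 1}. P X l} = - {X. aff_indep U S (crd X)}"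
 proof (intro equalityI subsetI)
  fix X assume "X : - {X. aff_indep U S (crd X)}"
  then obtain l i where l: "sum l S = 0" "ALL b:U. (\<Sum>i\<in>S. l i * (X i \<bullet> b)) = 0" "i : S" "l i ~= 0"
   by (auto simp: aff_indep_def)
  define s where "s = (\<Sum>i\<in>S. \<bar>l i\<bar>)"
  have s: "s > 0" unfolding s_def using S l by (intro sum_pos2[of _ i]) auto
  define l' where "l' i = (if i : S then l i / s else 0)" for i
  have "sum l' S = sum l S / s" unfolding l'_def truncate_sums(1) by (simp add: sum_divide_distrib)
  moreover have "(\<Sum>i\<in>S. l' i * (X i \<bullet> b)) = (\<Sum>i\<in>S. l i * (X i \<bullet> b)) / s" for b
   unfolding l'_def truncate_sums(2) by (simp add: sum_divide_distrib)
  moreover have "(\<Sum>i\<in>S. \<bar>l' i\<bar>) = 1"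
  proof -
   have "(\<Sum>i\<in>S. \<bar>l' i\<bar>) = (\<Sum>i\<in>S. \<bar>l i\<bar> / s)"
    using s by (intro sum.cong) (auto simp: l'_def)
   also have "... = s / s" unfolding s_def by (rule sum_divide_distrib[symmetric])
   finally show ?thesis using s by simp
  qed
  ultimately have "P X l'" using l s by (auto simp: P_def)
  moreover have "\<bar>l' i\<bar> <= 1" for i
  proof (cases "i : S")
   case True
   then have "\<bar>l i\<bar> <= s" unfolding s_def using S by (intro member_le_sum) auto
   then show ?thesis using True s by (simp add: l'_def)
  qed (simp add: l'_def)
  ultimately show "X : {X. EX l:{l. ALL i. \<bar>l i\<bar> <= 1}. P X l}" by auto
 next
  fix X assume "X : {X. EX l:{l. ALL i. \<bar>l i\<bar> <= 1}. P X l}"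
  then obtain l where l: "P X l" by auto
  have "~ (ALL i:S. l i = 0)"
  proof
   assume "ALL i:S. l i = 0"
   then have "(\<Sum>i\<in>S. \<bar>l i\<bar>) = 0" by simp
   then show False using l by (simp add: P_def)
  qed
  then show "X : - {X. aff_indep U S (crd X)}" using l by (auto simp: P_def aff_indep_def)
 qed
 then have "closed (- {X. aff_indep U S (crd X)})" using cl by simp
 then have "- (- {X. aff_indep U S (crd X)}) : sets borel" by (intro borel_open) (simp add: open_closed)
 then show ?thesis by simp
qed

lemma sum_basis_subset:
 fixes U :: "'e::euclidean_space set"
 assumes U: "U <= Basis" and v: "ALL b:Basis - U. v \<bullet> b = 0"
 shows "(\<Sum>b\<in>U. (v \<bullet> b) * (x \<bullet> b)) = v \<bullet> x"
proof -
 have "v \<bullet> x = (\<Sum>b\<in>Basis. (v \<bullet> b) * (x \<bullet> b))" by (rule euclidean_inner)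
 also have "... = (\<Sum>b\<in>U. (v \<bullet> b) * (x \<bullet> b))"
  using U v by (intro sum.mono_neutral_right) auto
 finally show ?thesis ..
qed

lemma facet_iff_vector:
 fixes U :: "'e::euclidean_space set"
 assumes U: "U <= Basis" and i0: "i0 : S"
 shows "facet U S I (crd X) \<longleftrightarrow> (EX v:sphere 0 1. (ALL b:Basis - U. v \<bullet> b = 0) & (ALL i:S. v \<bullet> X i = v \<bullet> X i0) & (ALL i:I. v \<bullet> X i0 <= v \<bullet> X i))"
proof
 assume "facet U S I (crd X)"
 then obtain v t where v: "EX b:U. v b ~= 0" "ALL i:S. (\<Sum>b\<in>U. v b * (X i \<bullet> b)) = t"
  "ALL i:I. t <= (\<Sum>b\<in>U. v b * (X i \<bullet> b))" unfolding facet_def by blast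
 define w where "w = (\<Sum>b\<in>U. v b *\<^sub>R b)"
 have wb: "w \<bullet> b = (if b : U then v b else 0)" if "b : Basis" for b
  unfolding w_def by (rule inner_basis_sum[OF U that])
 have "w ~= 0" using v(1) wb U by fastforce
 have wX: "w \<bullet> x = (\<Sum>b\<in>U. v b * (x \<bullet> b))" for x
  unfolding w_def inner_sum_left by (simp add: inner_commute)
 let ?u = "(1 / norm w) *\<^sub>R w"
 have ux: "?u \<bullet> x = (\<Sum>b\<in>U. v b * (x \<bullet> b)) / norm w" for x using wX by simp
 have "?u : sphere 0 1" using \<open>w ~= 0\<close> by simp
 moreover have "ALL b:Basis - U. ?u \<bullet> b = 0" using wb by simp
 moreover have "ALL i:S. ?u \<bullet> X i = ?u \<bullet> X i0" unfolding ux using v(2) i0 by simp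
 moreover have "ALL i:I. ?u \<bullet> X i0 <= ?u \<bullet> X i"
  unfolding ux using v(2,3) i0 by (auto intro!: divide_right_mono)
 ultimately show "EX v:sphere 0 1. (ALL b:Basis - U. v \<bullet> b = 0) & (ALL i:S. v \<bullet> X i = v \<bullet> X i0) & (ALL i:I. v \<bullet> X i0 <= v \<bullet> X i)"
  by blast
next
 assume "EX v:sphere 0 1. (ALL b:Basis - U. v \<bullet> b = 0) & (ALL i:S. v \<bullet> X i = v \<bullet> X i0) & (ALL i:I. v \<bullet> X i0 <= v \<bullet> X i)"
 then obtain v where v: "norm v = 1" "ALL b:Basis - U. v \<bullet> b = 0" "ALL i:S. v \<bullet> X i = v \<bullet> X i0" "ALL i:I. v \<bullet> X i0 <= v \<bullet> X i"
  by auto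
 have "EX b:U. v \<bullet> b ~= 0"
 proof (rule ccontr)
  assume "~ ?thesis"
  then have "v \<bullet> b = 0" if "b : Basis" for b using v(2) that by blast
  then have "v = 0" using euclidean_all_zero_iff by blast
  then show False using v(1) by simp
 qed
 then show "facet U S I (crd X)" unfolding facet_def
  using v by (intro exI[of _ "%b. v \<bullet> b"] exI[of _ "v \<bullet> X i0"]) (auto simp: sum_basis_subset[OF U v(2)])
qed

lemma borel_facet:
 fixes U :: "'e::euclidean_space set"
 assumes U: "U <= Basis" and S: "S ~= {}" and I: "finite I"
 shows "{X. facet U S I (crd X)} : sets borel"
proof -
 obtain i0 where i0: "i0 : S" using S by auto
 have cf: "continuous_on UNIV (%z::(nat => 'e) \<times> 'e. fst z i)" for i
  by (rule continuous_on_product_then_coordinatewise) (intro continuous_intros)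
 have "closed {z::(nat => 'e) \<times> 'e. (ALL b:Basis - U. snd z \<bullet> b = 0) & (ALL i:S. snd z \<bullet> fst z i = snd z \<bullet> fst z i0) & (ALL i:I. snd z \<bullet> fst z i0 <= snd z \<bullet> fst z i)}"
  by (intro closed_Collect_conj closed_Collect_ball closed_Collect_eq closed_Collect_le continuous_intros cf)
 then have "closed {X. EX v:sphere 0 1. (ALL b:Basis - U. v \<bullet> b = 0) & (ALL i:S. v \<bullet> X i = v \<bullet> X i0) & (ALL i:I. v \<bullet> X i0 <= v \<bullet> X i)}"
  using closed_ex_compact[OF compact_sphere[of 0 1],
   of "%X v. (ALL b:Basis - U. v \<bullet> b = 0) & (ALL i:S. v \<bullet> X i = v \<bullet> X i0) & (ALL i:I. v \<bullet> X i0 <= v \<bullet> X i)"] by simp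
 then show ?thesis unfolding facet_iff_vector[OF U i0] by (rule borel_closed)
qed

text \<open>The vertex with index m plays the role of the vector tested for membership in the cone.\<close>
lemma borel_cone_over:
 fixes U :: "'e::euclidean_space set"
 assumes I: "finite I"
 shows "{X. X m : cone_over U k I (crd X)} : sets borel"
proof -
 define P :: "(nat => 'e) => (nat => real) => bool" where
  "P X l \<longleftrightarrow> sum l I = 0 & (ALL i:I. k <= i --> 0 <= l i) & (ALL b:U. X m \<bullet> b = (\<Sum>i\<in>I. l i * (X i \<bullet> b)))" for X l
 have "closed {z. P (fst z) (snd z)}"
  unfolding P_def
  by (intro closed_Collect_conj closed_Collect_ball closed_Collect_imp closed_Collect_eq closed_Collect_le
    continuous_intros cont_comp open_Collect_const)
 then have cl: "closed {X. EX l:{l. ALL i. \<bar>l i\<bar> <= real m}. P X l}" for m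
  by (rule closed_ex_compact[OF compact_box_fun])
 have "{X. X m : cone_over U k I (crd X)} = (\<Union>m. {X. EX l:{l. ALL i. \<bar>l i\<bar> <= real m}. P X l})"
 proof (intro equalityI subsetI)
  fix X assume "X : {X. X m : cone_over U k I (crd X)}"
  then obtain l where l: "P X l" unfolding cone_over_def P_def by blast
  define l' where "l' i = (if i : I then l i else 0)" for i
  have "P X l'" using l unfolding P_def l'_def truncate_sums by auto
  moreover obtain m where "ALL i:I. \<bar>l' i\<bar> <= real m" using bounded_by_nat[OF I] by blast
  then have "ALL i. \<bar>l' i\<bar> <= real m" by (auto simp: l'_def)
  ultimately show "X : (\<Union>m. {X. EX l:{l. ALL i. \<bar>l i\<bar> <= real m}. P X l})" by auto
 qed (auto simp: P_def cone_over_def)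
 then show ?thesis using cl by (auto intro!: borel_closed)
qed

text \<open>Carries configurations over \<open>I\<close> to configurations over all indices, where
  Borel sets of the product topology are at hand; the value 0 is irrelevant for events that only
  look at \<open>I\<close>.\<close>

definition extend0 :: "nat set => (nat => 'e) => nat => 'e::zero" where
 "extend0 I X i = (if i : I then X i else 0)"

lemma measurable_extend0:
 fixes \<mu> :: "'e::euclidean_space measure"
 assumes "sets \<mu> = sets borel"
 shows "extend0 I : measurable (PiM I (%_. \<mu>)) borel"
proof -
 have "extend0 I : measurable (PiM I (%_. \<mu>)) (PiM UNIV (%_. borel))"
 proof (rule measurable_PiM_single')
  fix i :: nat
  have "(%X. X i) : measurable (PiM I (%_. \<mu>)) borel" if "i : I"
   using measurable_component_singleton[OF that, of "%_. \<mu>"] assms by (simp cong: measurable_cong_sets)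
  then show "(%X. extend0 I X i) : borel_measurable (PiM I (%_. \<mu>))"
   by (cases "i : I") (simp_all add: extend0_def)
 qed auto
 then show ?thesis by (simp cong: measurable_cong_sets add: sets_PiM_equal_borel)
qed

lemma pred_extend0:
 fixes \<mu> :: "'e::euclidean_space measure" and I :: "nat set"
 assumes "sets \<mu> = sets borel" "{X. P X} : sets borel" "!!X Y. (ALL i:I. X i = Y i) ==> P X = P Y"
 shows "Measurable.pred (PiM I (%_. \<mu>)) P"
proof -
 have "Measurable.pred borel P" using assms(2) by (simp add: pred_def)
 from measurable_compose[OF measurable_extend0[OF assms(1)] this]
 have "Measurable.pred (PiM I (%_. \<mu>)) (%X. P (extend0 I X))" .
 moreover have "P (extend0 I X) = P X" for X by (rule assms(3)) (simp add: extend0_def)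
 ultimately show ?thesis by simp
qed

lemma aff_indep_cong:
 "(!!i b. i : S ==> b : U ==> y i b = y' i b) ==> aff_indep U S y = aff_indep U S y'"
 unfolding aff_indep_def by simp

lemma not_face_cong:
 "(!!i b. i : I ==> b : U ==> y i b = y' i b) ==> not_face U k I y = not_face U k I y'"
 unfolding not_face_def by simp

lemma facet_cong:
 "S <= I ==> (!!i b. i : I ==> b : U ==> y i b = y' i b) ==> facet U S I y = facet U S I y'"
 unfolding facet_def by (simp add: subset_iff cong: conj_cong)

lemma affine_sum:
 fixes l :: "nat => real"
 assumes "sum l S = 0" shows "(\<Sum>i\<in>S. l i * (c + \<rho> * f i)) = \<rho> * (\<Sum>i\<in>S. l i * f i)"
proof -
 have "(\<Sum>i\<in>S. l i * (c + \<rho> * f i)) = sum l S * c + \<rho> * (\<Sum>i\<in>S. l i * f i)"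
  unfolding sum_distrib_left sum_distrib_right sum.distrib[symmetric]
  by (intro sum.cong) (auto simp: algebra_simps)
 then show ?thesis using assms by simp
qed

lemma aff_indep_affine:
 assumes "\<rho> ~= 0" "!!i b. i : S ==> b : U ==> y' i b = c b + \<rho> * y i b"
 shows "aff_indep U S y' = aff_indep U S y"
proof -
 have "(\<Sum>i\<in>S. l i * y' i b) = \<rho> * (\<Sum>i\<in>S. l i * y i b)" if "sum l S = 0" "b : U" for l b
  using assms(2)[OF _ that(2)] affine_sum[OF that(1), of "c b" \<rho> "%i. y i b"] by simp
 then have "(ALL b:U. (\<Sum>i\<in>S. l i * y' i b) = 0) = (ALL b:U. (\<Sum>i\<in>S. l i * y i b) = 0)" if "sum l S = 0" for l
  using assms(1) that by simp
 then show ?thesis unfolding aff_indep_def by (simp cong: conj_cong)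
qed

lemma not_face_affine:
 assumes "\<rho> ~= 0" "!!i b. i : S ==> b : U ==> y' i b = c b + \<rho> * y i b"
 shows "not_face U k S y' = not_face U k S y"
proof -
 have "(\<Sum>i\<in>S. l i * y' i b) = \<rho> * (\<Sum>i\<in>S. l i * y i b)" if "sum l S = 0" "b : U" for l b
  using assms(2)[OF _ that(2)] affine_sum[OF that(1), of "c b" \<rho> "%i. y i b"] by simp
 then have "(ALL b:U. (\<Sum>i\<in>S. l i * y' i b) = 0) = (ALL b:U. (\<Sum>i\<in>S. l i * y i b) = 0)" if "sum l S = 0" for l
  using assms(1) that by simp
 then show ?thesis unfolding not_face_def by (simp cong: conj_cong)
qed

lemma nn_integral_lb_reindex:
 fixes U :: "'b set" and i :: 'a
 assumes "finite U" and Q: "Q : borel_measurable (lb ({i} \<times> U))"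
 shows "(\<integral>\<^sup>+y. Q y \<partial>lb ({i} \<times> U)) = (\<integral>\<^sup>+u. Q (\<lambda>p\<in>{i} \<times> U. u (snd p)) \<partial>lb U)"
proof -
 define L :: "'b => 'a \<times> 'b => real" where "L c p = of_bool (c = snd p)" for c p
 have s: "(\<Sum>c\<in>U. u c * L c p) = u (snd p)" if "p : {i} \<times> U" for u p
 proof -
  have "(\<Sum>c\<in>U. u c * L c p) = (\<Sum>c\<in>{snd p}. u c)"
   using that assms(1) by (intro sum.mono_neutral_cong_right) (auto simp: L_def)
  then show ?thesis by simp
 qed
 have inj: "ALL c:U. u c = 0" if "ALL p:{i} \<times> U. (\<Sum>c\<in>U. u c * L c p) = 0" for u
  using that s by force
 have c: "card U = card ({i} \<times> U)" by (simp add: card_cartesian_product)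
 have "cube_mass U ({i} \<times> U) L = (\<integral>\<^sup>+u. (\<Prod>c\<in>U. indicator {0..1} (u c)) \<partial>lb U)"
  unfolding cube_mass_def
 proof (intro nn_integral_cong)
  fix u :: "'b => real"
  have "(\<Prod>p\<in>{i} \<times> U. indicator {0..1} (\<Sum>c\<in>U. u c * L c p)) = (\<Prod>p\<in>{i} \<times> U. indicator {0..1} (u (snd p)) :: ennreal)"
   using s by (intro prod.cong) auto
  also have "... = (\<Prod>c\<in>U. indicator {0..1} (u c))"
   by (rule prod.reindex_bij_witness[of _ "%c. (i, c)" snd]) auto
  finally show "(\<Prod>p\<in>{i} \<times> U. indicator {0..1} (\<Sum>c\<in>U. u c * L c p)) = (\<Prod>c\<in>U. indicator {0..1} (u c) :: ennreal)" .
 qed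
 also have "... = (\<Prod>c\<in>U. \<integral>\<^sup>+x. indicator {0..1::real} x \<partial>lborel)"
  by (rule lb.product_nn_integral_prod[OF assms(1)]) auto
 finally have one: "cube_mass U ({i} \<times> U) L = 1" by simp
 have "(\<integral>\<^sup>+y. Q y \<partial>lb ({i} \<times> U)) = (\<integral>\<^sup>+u. Q (\<lambda>p\<in>{i} \<times> U. \<Sum>c\<in>U. u c * L c p) \<partial>lb U)"
  using nn_integral_lb_linear(3)[OF assms(1) _ c inj Q] assms(1) one by simp
 also have "... = (\<integral>\<^sup>+u. Q (\<lambda>p\<in>{i} \<times> U. u (snd p)) \<partial>lb U)"
  using s by (intro nn_integral_cong arg_cong[of _ _ Q]) (auto simp: fun_eq_iff restrict_def)
 finally show ?thesis .
qed

text \<open>Each point is seen only through \<open>\<pi>\<close>, because the law itself need not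
  have a density; this covers the uniform law on the sphere. The induction adds one point at a time
  and merges its coordinates into the flat index set.\<close>

lemma nn_integral_PiM_flatten:
 fixes S :: "nat set" and \<mu> :: "'e measure" and \<pi> :: "'e => 'b => real"
 assumes \<mu>: "prob_space \<mu>" and fin: "finite S" "finite U"
  and \<pi>: "\<pi> : measurable \<mu> (lb U)" and f: "f : borel_measurable (lb U)" and dens: "distr \<mu> (lb U) \<pi> = density (lb U) f"
  and F: "F : borel_measurable (lb (S \<times> U))"
 shows "(\<integral>\<^sup>+X. F (\<lambda>p\<in>S \<times> U. \<pi> (X (fst p)) (snd p)) \<partial>PiM S (%_. \<mu>)) =
  (\<integral>\<^sup>+x. (\<Prod>i\<in>S. f (\<lambda>c\<in>U. x (i, c))) * F x \<partial>lb (S \<times> U))"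
 using fin(1) F
proof (induction S arbitrary: F rule: finite_induct)
 case empty
 then show ?case by (simp add: PiM_empty nn_integral_count_space_finite restrict_def)
next
 case (insert i S)
 interpret \<mu>: prob_space \<mu> by fact
 interpret P: product_sigma_finite "%_. \<mu>" by standard
 interpret sJ: sigma_finite_measure "lb U" using fin by (intro sigma_finite_lb)
 note F [measurable] = insert.prems
 have un: "insert i S \<times> U = (S \<times> U) Un ({i} \<times> U)" "(S \<times> U) Int ({i} \<times> U) = {}" using insert.hyps by auto
 let ?m = "%x y. merge (S \<times> U) ({i} \<times> U) (x, y)" and ?P = "%K x. \<Prod>j\<in>K. f (\<lambda>c\<in>U. x (j, c))"
 define mg :: "(nat \<times> 'b => real) => ('b => real) => nat \<times> 'b => real" where
  "mg x u = merge (S \<times> U) ({i} \<times> U) (x, \<lambda>p\<in>{i} \<times> U. u (snd p))" for x u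
 have mm: "(%z. mg (fst z) (snd z)) : measurable (lb (S \<times> U) \<Otimes>\<^sub>M lb U) (lb (insert i S \<times> U))"
 proof -
  have r: "(%u. \<lambda>p\<in>{i} \<times> U. u (snd p)) : measurable (lb U) (lb ({i} \<times> U))"
   by (intro measurable_restrict measurable_component_singleton) auto
  have "(%z. (fst z, \<lambda>p\<in>{i} \<times> U. snd z (snd p))) : measurable (lb (S \<times> U) \<Otimes>\<^sub>M lb U) (lb (S \<times> U) \<Otimes>\<^sub>M lb ({i} \<times> U))"
   by (intro measurable_Pair measurable_compose[OF measurable_snd r]) auto
  from measurable_compose[OF this measurable_merge] show ?thesis unfolding mg_def un(1) by simp
 qed
 define F' where "F' x = (\<integral>\<^sup>+u. f u * F (mg x u) \<partial>lb U)" for x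
 have mfF: "(%(x, u). f u * F (mg x u)) : borel_measurable (lb (S \<times> U) \<Otimes>\<^sub>M lb U)"
  unfolding case_prod_beta using measurable_compose[OF mm F] f by measurable
 have mF': "F' : borel_measurable (lb (S \<times> U))"
  unfolding F'_def using sJ.borel_measurable_nn_integral[OF mfF] .
 have mX: "(%X. \<lambda>p\<in>insert i S \<times> U. \<pi> (X (fst p)) (snd p)) : measurable (PiM (insert i S) (%_. \<mu>)) (lb (insert i S \<times> U))"
 proof (intro measurable_restrict)
  fix p assume p: "p : insert i S \<times> U"
  have "(%X. \<pi> (X (fst p))) : measurable (PiM (insert i S) (%_. \<mu>)) (lb U)"
   using p by (intro measurable_compose[OF measurable_component_singleton[of "fst p" "insert i S" "%_. \<mu>"] \<pi>]) auto
  then show "(%X. \<pi> (X (fst p)) (snd p)) : measurable (PiM (insert i S) (%_. \<mu>)) lborel"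
   using p by (intro measurable_compose[OF _ measurable_component_singleton[of "snd p" U "%_. lborel"]]) auto
 qed
 have "(\<integral>\<^sup>+X. F (\<lambda>p\<in>insert i S \<times> U. \<pi> (X (fst p)) (snd p)) \<partial>PiM (insert i S) (%_. \<mu>))
   = (\<integral>\<^sup>+X. \<integral>\<^sup>+z. F (\<lambda>p\<in>insert i S \<times> U. \<pi> ((X(i := z)) (fst p)) (snd p)) \<partial>\<mu> \<partial>PiM S (%_. \<mu>))"
  by (rule P.product_nn_integral_insert[OF insert.hyps]) (rule measurable_compose[OF mX F])
 also have "... = (\<integral>\<^sup>+X. F' (\<lambda>p\<in>S \<times> U. \<pi> (X (fst p)) (snd p)) \<partial>PiM S (%_. \<mu>))"
 proof (intro nn_integral_cong)
  fix X assume "X : space (PiM S (%_. \<mu>))"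
  let ?x = "\<lambda>p\<in>S \<times> U. \<pi> (X (fst p)) (snd p)"
  have xs: "?x : space (lb (S \<times> U))" by (simp add: space_PiM)
  have eq: "(\<lambda>p\<in>insert i S \<times> U. \<pi> ((X(i := z)) (fst p)) (snd p)) = mg ?x (\<pi> z)" for z
  proof
   fix p :: "nat \<times> 'b"
   consider "p : S \<times> U" | "p : {i} \<times> U" | "p ~: insert i S \<times> U" by auto
   then show "(\<lambda>p\<in>insert i S \<times> U. \<pi> ((X(i := z)) (fst p)) (snd p)) p = mg ?x (\<pi> z) p"
    using insert.hyps by cases (auto simp: mg_def merge_def)
  qed
  have m1: "(%u. F (mg ?x u)) : borel_measurable (lb U)"
   using measurable_compose[OF measurable_Pair1'[OF xs] measurable_compose[OF mm F]] by simp
  have "(\<integral>\<^sup>+z. F (mg ?x (\<pi> z)) \<partial>\<mu>) = (\<integral>\<^sup>+u. F (mg ?x u) \<partial>distr \<mu> (lb U) \<pi>)"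
   by (rule nn_integral_distr[symmetric, OF \<pi>]) (use m1 in simp)
  also have "... = F' ?x" unfolding dens F'_def by (rule nn_integral_density[OF f]) (use m1 in simp)
  finally show "(\<integral>\<^sup>+z. F (\<lambda>p\<in>insert i S \<times> U. \<pi> ((X(i := z)) (fst p)) (snd p)) \<partial>\<mu>) = F' ?x" unfolding eq .
 qed
 also have "... = (\<integral>\<^sup>+x. (?P S x) * F' x \<partial>lb (S \<times> U))"
  by (rule insert.IH[OF mF'])
 also have "... = (\<integral>\<^sup>+x. \<integral>\<^sup>+y. ?P (insert i S) (?m x y) * F (?m x y) \<partial>lb ({i} \<times> U) \<partial>lb (S \<times> U))"
 proof (intro nn_integral_cong)
  fix x assume x: "x : space (lb (S \<times> U))"
  let ?Q = "%y. ?P (insert i S) (?m x y) * F (?m x y)"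
  have mer: "(%y. ?m x y) : measurable (lb ({i} \<times> U)) (lb (insert i S \<times> U))"
   unfolding un(1) by (rule measurable_compose[OF measurable_Pair1'[OF x] measurable_merge])
  have slice: "(%w. \<lambda>c\<in>U. w (j, c)) : measurable (lb (insert i S \<times> U)) (lb U)" if "j : insert i S" for j
   using that by (intro measurable_restrict measurable_component_singleton) auto
  have "(%w. (?P (insert i S) w) * F w) : borel_measurable (lb (insert i S \<times> U))"
   using measurable_compose[OF slice f] F by (intro borel_measurable_times_ennreal borel_measurable_prod_ennreal) auto
  from measurable_compose[OF mer this] have mQ: "?Q : borel_measurable (lb ({i} \<times> U))" .
  have "(\<integral>\<^sup>+y. ?Q y \<partial>lb ({i} \<times> U)) = (\<integral>\<^sup>+u. ?Q (\<lambda>p\<in>{i} \<times> U. u (snd p)) \<partial>lb U)"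
   by (rule nn_integral_lb_reindex[OF fin(2) mQ])
  also have "... = (\<integral>\<^sup>+u. (?P S x) * (f u * F (mg x u)) \<partial>lb U)"
  proof (intro nn_integral_cong)
   fix u assume u: "u : space (lb U)"
   have 1: "(\<lambda>c\<in>U. mg x u (i, c)) = u"
   proof
    fix c show "(\<lambda>c\<in>U. mg x u (i, c)) c = u c"
    using u insert.hyps by (auto simp: mg_def merge_def space_PiM PiE_iff extensional_def)
   qed
   have 2: "(\<lambda>c\<in>U. mg x u (j, c)) = (\<lambda>c\<in>U. x (j, c))" if "j : S" for j
    using that insert.hyps by (auto simp: mg_def merge_def fun_eq_iff)
   have "?P (insert i S) (mg x u) = f u * (?P S x)"
    using insert.hyps 1 2 by (simp add: prod.insert)
   then show "?Q (\<lambda>p\<in>{i} \<times> U. u (snd p)) = (?P S x) * (f u * F (mg x u))"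
    unfolding mg_def[symmetric] by (simp add: mult_ac)
  qed
  also have "... = (?P S x) * F' x"
  proof -
   have "(%u. f u * F (mg x u)) : borel_measurable (lb U)"
    using measurable_compose[OF measurable_Pair1'[OF x] mfF] by simp
   then show ?thesis unfolding F'_def by (rule nn_integral_cmult)
  qed
  finally show "(?P S x) * F' x = (\<integral>\<^sup>+y. ?Q y \<partial>lb ({i} \<times> U))" ..
 qed
 also have "... = (\<integral>\<^sup>+x. ?P (insert i S) x * F x \<partial>lb (insert i S \<times> U))"
  unfolding un(1)
 proof (rule lb.product_nn_integral_fold[symmetric, OF un(2)])
  show "finite (S \<times> U)" "finite ({i} \<times> U)" using insert.hyps fin by auto
  have slice: "(%w. \<lambda>c\<in>U. w (j, c)) : measurable (lb (insert i S \<times> U)) (lb U)" if "j : insert i S" for j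
   using that by (intro measurable_restrict measurable_component_singleton) auto
  show "(%w. (?P (insert i S) w) * F w) : borel_measurable (lb (S \<times> U Un {i} \<times> U))"
   unfolding un(1)[symmetric]
   using measurable_compose[OF slice f] F by (intro borel_measurable_times_ennreal borel_measurable_prod_ennreal) auto
 qed
 finally show ?case .
qed

section \<open>Rotation invariant laws with beta marginals\<close>

text \<open>The reflection in the hyperplane orthogonal to a - b.\<close>

lemma ex_orthogonal_transformation:
 fixes a b :: "'e::euclidean_space"
 assumes "norm a = norm b"
 obtains f where "orthogonal_transformation f" "f a = b"
proof (cases "a = b")
 case True
 then show ?thesis using that[of "%x. x"] by simp
next
 case False
 define u where "u = a - b"
 have u: "u \<bullet> u > 0" using False by (simp add: u_def)
 define f where "f x = x - (2 * (u \<bullet> x) / (u \<bullet> u)) *\<^sub>R u" for x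
 have lin: "linear f"
  unfolding f_def by (intro linearI) (auto simp: algebra_simps inner_add_right add_divide_distrib scaleR_add_left)
 have "f x \<bullet> f y = x \<bullet> y" for x y
 proof -
  have "f x \<bullet> f y = x \<bullet> y - (2 * (u \<bullet> y) / (u \<bullet> u)) * (u \<bullet> x) - (2 * (u \<bullet> x) / (u \<bullet> u)) * (u \<bullet> y)
    + (2 * (u \<bullet> x) / (u \<bullet> u)) * (2 * (u \<bullet> y) / (u \<bullet> u)) * (u \<bullet> u)"
   by (simp add: f_def inner_diff_left inner_diff_right inner_commute algebra_simps)
  also have "... = x \<bullet> y" using u by (simp add: field_simps)
  finally show ?thesis .
 qed
 then have "orthogonal_transformation f" using lin by (simp add: orthogonal_transformation_def)
 moreover have "f a = b"
 proof -
  have "a \<bullet> a = b \<bullet> b" using assms by (simp add: norm_eq_sqrt_inner)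
  then have "2 * (u \<bullet> a) = u \<bullet> u" by (simp add: u_def inner_diff_left inner_diff_right inner_commute)
  then have "f a = a - u" using u by (simp add: f_def)
  then show ?thesis by (simp add: u_def)
 qed
 ultimately show ?thesis using that by blast
qed

definition hw :: "real => real => ennreal" where
 "hw \<gamma> h = (if h\<^sup>2 < 1 then ennreal ((1 - h\<^sup>2) powr \<gamma>) else 0)"

lemma measurable_hw [measurable]: "hw \<gamma> : borel_measurable borel"
 unfolding hw_def by measurable

text \<open>One interface for the densities and for the sphere. Densities are required for proper
  coordinate subsets only, since the uniform law on the sphere has none in the full space. The
  parameter \<alpha> is shared by the marginals of all dimensions.\<close>

locale beta_law =
 fixes \<mu> :: "'e::euclidean_space measure" and \<alpha> :: nat
 assumes prob: "prob_space \<mu>" and sets_mu: "sets \<mu> = sets borel"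
  and rot: "!!f. orthogonal_transformation f ==> distr \<mu> borel f = \<mu>"
  and dens: "!!U. U \<subset> Basis ==> EX C>0. distr \<mu> (lb U) (%x. \<lambda>b\<in>U. x \<bullet> b) =
    density (lb U) (%x. ennreal C * wt ((real \<alpha> - real (card U)) / 2) (\<Sum>b\<in>U. (x b)\<^sup>2))"
  and dim2: "DIM('e) >= 2"
begin

sublocale mu: prob_space \<mu> by (rule prob)

lemma space_mu [simp]: "space \<mu> = UNIV"
 using sets_eq_imp_space_eq[OF sets_mu] by simp

lemma meas_mu [measurable_cong]: "sets \<mu> = sets borel" by (rule sets_mu)

lemma measurable_coords: "(%x. \<lambda>b\<in>U. x \<bullet> b) : measurable \<mu> (lb U)"
 by (intro measurable_restrict) (simp add: measurable_cong_sets[OF sets_mu refl])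

lemma one_dim_null:
 assumes b: "b : Basis"
 shows "emeasure \<mu> {x. x \<bullet> b = t} = 0"
proof -
 have "{b} \<subset> Basis"
 proof -
  have "{b} ~= Basis" using dim2 by (metis One_nat_def Suc_1 card.empty card_insert_disjoint empty_iff finite.emptyI not_less_eq_eq order_refl)
  then show ?thesis using b by auto
 qed
 then obtain C where C: "distr \<mu> (lb {b}) (%x. \<lambda>c\<in>{b}. x \<bullet> c) =
    density (lb {b}) (%x. ennreal C * wt ((real \<alpha> - real (card {b})) / 2) (\<Sum>c\<in>{b}. (x c)\<^sup>2))"
  using dens by blast
 let ?f = "%x. ennreal C * wt ((real \<alpha> - real (card {b})) / 2) (\<Sum>c\<in>{b}. (x c)\<^sup>2)"
 let ?A = "{x : space (lb {b}). x b = t}"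
 have comp: "(%x. x b) : borel_measurable (lb {b})" by (intro measurable_lb_component) simp
 have "(%x. ennreal C * wt ((real \<alpha> - real (card {b})) / 2) ((x b)\<^sup>2)) : borel_measurable (lb {b})"
  using comp by measurable
 then have mf: "?f : borel_measurable (lb {b})" by simp
 have A: "?A : sets (lb {b})" using comp by measurable
 have "emeasure \<mu> {x. x \<bullet> b = t} = emeasure (distr \<mu> (lb {b}) (%x. \<lambda>c\<in>{b}. x \<bullet> c)) ?A"
  by (subst emeasure_distr[OF measurable_coords A]) (auto intro!: arg_cong[of _ _ "emeasure \<mu>"] simp: space_PiM)
 also have "... = (\<integral>\<^sup>+x. ?f x * indicator ?A x \<partial>lb {b})"
  unfolding C by (rule emeasure_density[OF mf A])
 also have "... = 0"
 proof -
  have "emeasure (lb {b}) ?A = (\<integral>\<^sup>+x. indicator {t} (x b) \<partial>lb {b})"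
  proof -
   have "(\<integral>\<^sup>+x. indicator {t} (x b) \<partial>lb {b}) = (\<integral>\<^sup>+x. indicator ?A x \<partial>lb {b})"
    by (intro nn_integral_cong) (auto simp: indicator_def)
   then show ?thesis using nn_integral_indicator[OF A] by simp
  qed
  also have "... = (\<integral>\<^sup>+s. indicator {t} s \<partial>lborel)"
   by (rule lb.product_nn_integral_singleton) simp
  also have "... = 0" by simp
  finally have "?A : null_sets (lb {b})" using A by auto
  then show ?thesis by (rule nn_integral_null_set)
 qed
 finally show ?thesis .
qed

lemma rotate_functional:
 assumes v: "v ~= 0" and b: "b : Basis" and Q: "Measurable.pred borel Q"
 shows "emeasure \<mu> {x. Q (v \<bullet> x)} = emeasure \<mu> {x. Q (norm v * (x \<bullet> b))}"
proof -
 have "norm v = norm (norm v *\<^sub>R b)" using b by simp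
 then obtain f where f: "orthogonal_transformation f" "f v = norm v *\<^sub>R b"
  by (rule ex_orthogonal_transformation)
 have mf: "f : borel_measurable borel"
  using f(1) by (intro borel_measurable_continuous_onI linear_continuous_on)
   (simp add: linear_conv_bounded_linear orthogonal_transformation_def)
 then have mf': "f : measurable \<mu> borel" by (simp cong: measurable_cong_sets add: sets_mu)
 have S: "{x. Q (norm v * (x \<bullet> b))} : sets borel"
  using Q by measurable
 have "emeasure \<mu> {x. Q (norm v * (x \<bullet> b))} = emeasure (distr \<mu> borel f) {x. Q (norm v * (x \<bullet> b))}"
  using rot[OF f(1)] by simp
 also have "... = emeasure \<mu> (f -` {x. Q (norm v * (x \<bullet> b))} Int space \<mu>)"
  using mf' S by (rule emeasure_distr)
 also have "f -` {x. Q (norm v * (x \<bullet> b))} Int space \<mu> = {x. Q (v \<bullet> x)}"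
 proof -
  have "norm v * (f x \<bullet> b) = v \<bullet> x" for x
  proof -
   have "f x \<bullet> f v = x \<bullet> v" using f(1) by (simp add: orthogonal_transformation_def)
   then show ?thesis unfolding f(2) by (simp add: inner_commute)
  qed
  then show ?thesis by auto
 qed
 finally show ?thesis ..
qed

lemma hyperplane_null:
 assumes v: "v ~= 0"
 shows "emeasure \<mu> {x. v \<bullet> x = t} = 0"
proof -
 obtain b :: 'e where b: "b : Basis" using nonempty_Basis by blast
 have "emeasure \<mu> {x. v \<bullet> x = t} = emeasure \<mu> {x. norm v * (x \<bullet> b) = t}"
  by (rule rotate_functional[OF v b]) measurable
 also have "{x. norm v * (x \<bullet> b) = t} = {x. x \<bullet> b = t / norm v}" using v by (auto simp: field_simps)
 finally show ?thesis using one_dim_null[OF b] by simp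
qed

definition b0 :: 'e where "b0 = (SOME b. b : Basis)"

lemma b0: "b0 : Basis"
 unfolding b0_def by (rule someI_ex) (use nonempty_Basis in blast)

definition G :: "real => real" where "G h = measure \<mu> {x. x \<bullet> b0 <= h}"

lemma halfspace_le:
 assumes v: "v ~= 0"
 shows "measure \<mu> {x. v \<bullet> x <= t} = G (t / norm v)"
proof -
 have "emeasure \<mu> {x. v \<bullet> x <= t} = emeasure \<mu> {x. norm v * (x \<bullet> b0) <= t}"
  by (rule rotate_functional[OF v b0]) measurable
 also have "{x. norm v * (x \<bullet> b0) <= t} = {x. x \<bullet> b0 <= t / norm v}" using v by (auto simp: field_simps)
 finally show ?thesis by (simp add: measure_def G_def)
qed

lemma halfspace_ge:
 assumes v: "v ~= 0"
 shows "measure \<mu> {x. t <= v \<bullet> x} = 1 - G (t / norm v)"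
proof -
 have s: "{x. v \<bullet> x <= t} : sets \<mu>" "{x. v \<bullet> x = t} : sets \<mu>" "{x. v \<bullet> x < t} : sets \<mu>"
  unfolding sets_mu by measurable
 have "{x. v \<bullet> x <= t} = {x. v \<bullet> x < t} Un {x. v \<bullet> x = t}" by auto
 then have "measure \<mu> {x. v \<bullet> x <= t} = measure \<mu> ({x. v \<bullet> x < t} Un {x. v \<bullet> x = t})" by simp
 also have "... = measure \<mu> {x. v \<bullet> x < t} + measure \<mu> {x. v \<bullet> x = t}"
  using s by (intro mu.finite_measure_Union) auto
 also have "measure \<mu> {x. v \<bullet> x = t} = 0" using hyperplane_null[OF v] by (simp add: measure_def)
 finally have "measure \<mu> {x. v \<bullet> x < t} = G (t / norm v)" using halfspace_le[OF v] by simp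
 moreover have "{x. t <= v \<bullet> x} = space \<mu> - {x. v \<bullet> x < t}" by auto
 ultimately show ?thesis using mu.prob_compl[OF s(3)] by simp
qed

lemma G_bounds: "0 <= G h" "G h <= 1"
 by (auto simp: G_def)

lemma mono_G: "mono G"
 unfolding mono_def G_def
 by (intro allI impI mu.finite_measure_mono) (auto simp: sets_mu)

lemma measurable_G [measurable]: "G : borel_measurable borel"
 using mono_G by (rule borel_measurable_mono)

abbreviation M :: "nat set => (nat => 'e) measure" where "M I \<equiv> PiM I (%_. \<mu>)"

sublocale pp: product_prob_space "%_::nat. \<mu>" by standard

lemma prob_M: "prob_space (M I)" by (rule prob_space_PiM) (rule prob)

lemma pred_M:
 assumes "{X. P X} : sets borel" "!!X Y. (ALL i:I. X i = Y i) ==> P X = P Y"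
 shows "Measurable.pred (M I) P"
 by (rule pred_extend0[OF sets_mu assms])

lemma pred_not_face: "finite I ==> Measurable.pred (M I) (%X. not_face U k I (crd X))"
 by (rule pred_M[OF borel_not_face]) (auto intro!: not_face_cong)

lemma pred_aff_indep: "finite I ==> S <= I ==> Measurable.pred (M I) (%X. aff_indep U S (crd X))"
 by (rule pred_M[OF borel_aff_indep]) (auto intro!: aff_indep_cong intro: finite_subset)

text \<open>Points are added one by one. As long as at most card U of them are fixed, they lie on a
  hyperplane in the coordinates of \<open>U\<close>, which the next, independent, point avoids
  almost surely.\<close>

lemma AE_aff_indep:
 assumes "finite I" "S <= I" "U <= Basis" "card S <= card U + 1"
 shows "AE X in M I. aff_indep U S (crd X)"
proof -
 have "finite S" using assms finite_subset by blast
 then show ?thesis using assms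
 proof (induction S rule: finite_induct)
  case empty
  then show ?case by (auto simp: aff_indep_def)
 next
  case (insert i S)
  have fJ: "finite U" using finite_subset[OF insert.prems(3) finite_Basis] .
  show ?case
  proof (cases "S = {}")
   case True
   then show ?thesis by (auto simp: aff_indep_def)
  next
   case False
   have IH: "AE X in M I. aff_indep U S (crd X)"
    using insert by (intro insert.IH) auto
   have mS: "Measurable.pred (M I) (%X. aff_indep U S (crd X))" "Measurable.pred (M I) (%X. aff_indep U (insert i S) (crd X))"
    using insert by (auto intro!: pred_aff_indep)
   let ?B = "{X:space (M I). aff_indep U S (crd X) & ~ aff_indep U (insert i S) (crd X)}"
   have B: "?B : sets (M I)" using mS by measurable
   have Ii: "I = insert i (I - {i})" "i : I" using insert by auto
   have "emeasure (M I) ?B = (\<integral>\<^sup>+X. indicator ?B X \<partial>M I)" using B by simp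
   also have "... = (\<integral>\<^sup>+X. indicator ?B X \<partial>M (insert i (I - {i})))" using Ii by simp
   also have "... = (\<integral>\<^sup>+X. \<integral>\<^sup>+x. indicator ?B (X(i := x)) \<partial>\<mu> \<partial>M (I - {i}))"
    by (rule pp.product_nn_integral_insert) (use insert B Ii in auto)
   also have "... = (\<integral>\<^sup>+X. 0 \<partial>M (I - {i}))"
   proof (rule nn_integral_cong)
    fix X assume "X : space (M (I - {i}))"
    have "card S <= card U" using insert by simp
    then obtain v t where v: "EX b:U. v b ~= 0" "ALL j:S. (\<Sum>b\<in>U. v b * (X j \<bullet> b)) = t"
    using ex_normal[OF insert.hyps(1) fJ _ False, of "crd X"] by auto
    define w where "w = (\<Sum>b\<in>U. v b *\<^sub>R b)"
    have wx: "w \<bullet> x = (\<Sum>b\<in>U. v b * (x \<bullet> b))" for x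
    unfolding w_def inner_sum_left by (simp add: inner_commute)
    have "w ~= 0"
    proof
    assume "w = 0"
    obtain b where b: "b : U" "v b ~= 0" using v(1) by auto
    then have "w \<bullet> b = v b" unfolding w_def using inner_basis_sum[OF insert.prems(3), of b v] insert.prems(3) by auto
    then show False using b \<open>w = 0\<close> by simp
    qed
    have "indicator ?B (X(i := x)) <= (indicator {x. w \<bullet> x = t} x :: ennreal)" for x
    proof (cases "X(i := x) : ?B")
    case True
    have eqS: "crd (X(i := x)) j b = crd X j b" if "j : S" for j b using that insert.hyps by auto
    have "w \<bullet> x = t"
    proof (rule ccontr)
    assume ne: "w \<bullet> x ~= t"
    have "aff_indep U (insert i S) (crd (X(i := x)))"
    by (rule aff_indep_insert[OF insert.hyps, of U _ v t]) (use True v(2) eqS ne fJ in \<open>auto simp: wx\<close>)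
    then show False using True by auto
    qed
    then show ?thesis by (simp add: indicator_def)
    qed simp
    then have "(\<integral>\<^sup>+x. indicator ?B (X(i := x)) \<partial>\<mu>) <= (\<integral>\<^sup>+x. indicator {x. w \<bullet> x = t} x \<partial>\<mu>)"
    by (intro nn_integral_mono)
    also have "... = emeasure \<mu> {x. w \<bullet> x = t}" by (intro nn_integral_indicator) (simp add: sets_mu)
    also have "... = 0" using hyperplane_null[OF \<open>w ~= 0\<close>] .
    finally show "(\<integral>\<^sup>+x. indicator ?B (X(i := x)) \<partial>\<mu>) = 0" by simp
   qed
   finally have "?B : null_sets (M I)" using B by auto
   then have "AE X in M I. X ~: ?B" by (rule AE_not_in)
   then show ?thesis using IH AE_space by eventually_elim auto
  qed
 qed
qed

lemma AE_general_position:
 assumes "finite I"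
 shows "AE X in M I. \<forall>U\<subseteq>Basis. \<forall>S\<subseteq>I. card S <= card U + 1 --> aff_indep U S (crd X)"
proof -
 have "AE X in M I. ALL U:Pow Basis. ALL S:Pow I. card S <= card U + 1 --> aff_indep U S (crd X)"
  using assms by (intro AE_finite_allI) (auto intro!: AE_impI AE_aff_indep)
 then show ?thesis by eventually_elim auto
qed

text \<open>The two one-sided events overlap only if all points lie on the hyperplane, which has
  probability 0; this needs \<open>R\<close> to be nonempty.\<close>

lemma halfspace_both:
 assumes "finite R" "R ~= {}" and w: "w ~= 0"
 shows "emeasure (M R) {Z:space (M R). (ALL i:R. t <= w \<bullet> Z i) | (ALL i:R. w \<bullet> Z i <= t)}
   = ennreal ((1 - G (t / norm w)) ^ card R + G (t / norm w) ^ card R)"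
proof -
 interpret MR: prob_space "M R" by (rule prob_M)
 have U: "{x. t <= w \<bullet> x} : sets \<mu>" "{x. w \<bullet> x <= t} : sets \<mu>" "{x. w \<bullet> x = t} : sets \<mu>"
  unfolding sets_mu by measurable
 let ?A = "PiE R (%_. {x. t <= w \<bullet> x})" and ?B = "PiE R (%_. {x. w \<bullet> x <= t})"
 have AB: "?A : sets (M R)" "?B : sets (M R)" using U assms by (auto intro!: sets_PiM_I_finite)
 have "{Z:space (M R). (ALL i:R. t <= w \<bullet> Z i) | (ALL i:R. w \<bullet> Z i <= t)} = ?A Un ?B"
  unfolding set_eq_iff by (simp add: space_PiM PiE_iff) blast
 moreover have "measure (M R) (?A Un ?B) = measure (M R) ?A + measure (M R) ?B"
 proof -
  obtain i where i: "i : R" using assms by auto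
  have "emeasure (M R) (PiE R (%_. {x. w \<bullet> x = t})) = (\<Prod>i\<in>R. emeasure \<mu> {x. w \<bullet> x = t})"
   by (rule pp.emeasure_PiM) (use assms U in auto)
  also have "... = 0" using assms i hyperplane_null[OF w] by (simp add: prod_constant card_gt_0_iff)
  finally have "PiE R (%_. {x. w \<bullet> x = t}) : null_sets (M R)" using U assms by (auto intro!: sets_PiM_I_finite)
  moreover have "?A Int ?B = PiE R (%_. {x. w \<bullet> x = t})" by (auto simp: PiE_iff intro: antisym)
  ultimately have "measure (M R) (?A Int ?B) = 0" by (simp add: null_setsD1 measure_def)
  then show ?thesis
   using measure_Un3[of ?A "M R" ?B] AB by (simp add: MR.fmeasurable_eq_sets)
 qed
 moreover have mP: "measure (M R) (PiE R (%_. A)) = measure \<mu> A ^ card R" if "A : sets \<mu>" for A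
 proof -
  have "emeasure (M R) (PiE R (%_. A)) = (\<Prod>i\<in>R. emeasure \<mu> A)"
   by (rule pp.emeasure_PiM) (use assms that in auto)
  also have "... = ennreal (measure \<mu> A ^ card R)"
   by (simp add: mu.emeasure_eq_measure ennreal_power)
  finally show ?thesis by (simp add: measure_def)
 qed
 moreover have "measure (M R) ?A = (1 - G (t / norm w)) ^ card R"
  using mP[OF U(1)] halfspace_ge[OF w] by simp
 moreover have "measure (M R) ?B = G (t / norm w) ^ card R"
  using mP[OF U(2)] halfspace_le[OF w] by simp
 ultimately show ?thesis by (simp add: MR.emeasure_eq_measure)
qed

end

section \<open>Independence of the shape of a facet and its hyperplane\<close>

context beta_law
begin

definition vec :: "nat set => 'e set => (nat \<times> 'e => real) => nat => 'e" where
 "vec S U x = (\<lambda>i\<in>S. \<Sum>c\<in>U. x (i, c) *\<^sub>R c)"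

lemma vec_crd:
 assumes "U <= Basis" "c : U" "i : S"
 shows "vec S U x i \<bullet> c = x (i, c)"
proof -
 have "c : Basis" using assms by auto
 then show ?thesis using inner_basis_sum[OF assms(1), of c "%c. x (i, c)"] assms by (simp add: vec_def)
qed

lemma measurable_vec:
 assumes "finite U"
 shows "vec S U : measurable (lb (S \<times> U)) (M S)"
 unfolding vec_def
proof (intro measurable_restrict)
 fix i assume i: "i : S"
 have "(%x. \<Sum>c\<in>U. x (i, c) *\<^sub>R c) : borel_measurable (lb (S \<times> U))"
  using i by (intro borel_measurable_sum borel_measurable_scaleR measurable_lb_component) auto
 then show "(%x. \<Sum>c\<in>U. x (i, c) *\<^sub>R c) : measurable (lb (S \<times> U)) \<mu>"
  by (simp cong: measurable_cong_sets add: sets_mu)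
qed

text \<open>The probability that \<open>r\<close> further points all lie on the same side of a
  hyperplane at signed distance \<open>h\<close> from the origin.\<close>

definition gG :: "nat => real => real" where "gG r h = (1 - G h) ^ r + G h ^ r"

text \<open>\<open>factorization\<close> is applied twice, once with the facet condition and once
  without it. Both results contain the same unevaluated constant \<open>K\<close>; multiplying
  crosswise eliminates it, whence the integrals on both sides.\<close>

lemma facet_factorization:
 assumes U: "U' <= Basis" "b : Basis" "b ~: U'" "insert b U' \<subset> Basis"
  and S: "finite I" "S <= I" "I ~= S" "card S = card U' + 1"
  and A: "{X. A X} : sets borel" "!!X Y. (!!i c. i : S ==> c : U' ==> X i \<bullet> c = Y i \<bullet> c) ==> A X = A Y"
  and A_aff: "!!X Y c \<rho>. \<rho> > 0 ==> (!!i. i : S ==> Y i = c + \<rho> *\<^sub>R X i) ==> A Y = A X"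
 shows "emeasure (M I) {X:space (M I). A X & facet (insert b U') S I (crd X)} *
   (\<integral>\<^sup>+h. hw ((real \<alpha> * real (card S) - 1) / 2) h \<partial>lborel) =
  emeasure (M S) {X:space (M S). A X} *
   (\<integral>\<^sup>+h. hw ((real \<alpha> * real (card S) - 1) / 2) h * ennreal (gG (card (I - S)) h) \<partial>lborel)"
proof -
 define U where "U = insert b U'"
 let ?c = "%X. \<lambda>p\<in>S \<times> U. X (fst p) \<bullet> snd p"
 define R where "R = I - S"
 have JB: "U <= Basis" using U by (auto simp: U_def)
 have fJ: "finite U'" "finite U" using finite_subset[OF U(1) finite_Basis] by (auto simp: U_def)
 have fS: "finite S" "finite R" "R ~= {}" using S finite_subset by (auto simp: R_def)
 have S0: "S ~= {}" using S(4) by auto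
 have cJ: "card U = card S" using S(4) U(3) fJ by (simp add: U_def)
 have I: "I = S Un R" "S Int R = {}" using S by (auto simp: R_def)
 \<comment> \<open>Almost surely equal to \<open>A\<close>; the added independence is what
   \<open>hyperplane_factor\<close> demands of its event \<open>N\<close>.\<close>
 define A' where "A' X \<longleftrightarrow> A X & aff_indep U' S (crd X)" for X :: "nat => 'e"
 define \<beta> where "\<beta> = (real \<alpha> - real (card U)) / 2"
 have A'b: "{X. A' X} : sets borel"
 proof -
  have "{X. A' X} = {X. A X} Int {X. aff_indep U' S (crd X)}" by (auto simp: A'_def)
  then show ?thesis using A(1) borel_aff_indep[OF fS(1)] by auto
 qed
 have A'c: "A' X = A' Y" if "!!i c. i : S ==> c : U' ==> X i \<bullet> c = Y i \<bullet> c" for X Y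
  unfolding A'_def using A(2)[of X Y] aff_indep_cong[of S U' "crd X" "crd Y"] that by blast
 define vec' where "vec' x i = (if i : S then \<Sum>c\<in>U'. x (i, c) *\<^sub>R c else 0)" for x :: "nat \<times> 'e => real" and i
 have vec'_c: "vec' x i \<bullet> c = x (i, c)" if "i : S" "c : U'" for x i c
 proof -
  have "c : Basis" using that U by auto
  then show ?thesis using inner_basis_sum[OF U(1), of c "%c. x (i, c)"] that by (simp add: vec'_def)
 qed
 define N where "N x \<longleftrightarrow> A' (vec' x)" for x
 have mN: "Measurable.pred (lb (S \<times> U')) N"
 proof -
  have "Measurable.pred (M S) A'" by (rule pred_M[OF A'b]) (rule A'c, simp)
  from measurable_compose[OF measurable_vec[OF fJ(1)] this]
  have "Measurable.pred (lb (S \<times> U')) (%x. A' (vec S U' x))" .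
  moreover have "A' (vec S U' x) = N x" for x
   unfolding N_def by (rule A'c) (simp add: vec_crd[OF U(1)] vec'_c)
  ultimately show ?thesis by simp
 qed
 interpret H: hyperplane_factor S U' b \<beta> N
 proof
  show "finite S" "S ~= {}" "finite U'" "b ~: U'" "card S = card U' + 1" using fS S0 fJ U S by auto
  show "Measurable.pred (lb (S \<times> U')) N" by (rule mN)
  show "aff_indep U' S (%i c. x (i, c))" if "N x" for x
  proof -
   have "aff_indep U' S (crd (vec' x))" using that by (simp add: N_def A'_def)
   then show ?thesis using aff_indep_cong[of S U' "crd (vec' x)" "%i c. x (i, c)"] vec'_c by simp
  qed
  show "N (\<lambda>p\<in>S \<times> U'. x0 (snd p) + \<rho> * x p) = N x" if "\<rho> > 0" for x x0 and \<rho> :: real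
  proof -
   let ?y = "\<lambda>p\<in>S \<times> U'. x0 (snd p) + \<rho> * x p"
   have "vec' ?y i = (\<Sum>c\<in>U'. x0 c *\<^sub>R c) + \<rho> *\<^sub>R vec' x i" if "i : S" for i
    using that by (simp add: vec'_def scaleR_sum_right sum.distrib[symmetric] scaleR_add_left cong: sum.cong)
   then have "A (vec' ?y) = A (vec' x)" using A_aff[OF \<open>\<rho> > 0\<close>] by blast
   moreover have "aff_indep U' S (crd (vec' ?y)) = aff_indep U' S (crd (vec' x))"
    by (rule aff_indep_affine[of \<rho> _ _ _ x0]) (use \<open>\<rho> > 0\<close> vec'_c in auto)
   ultimately show ?thesis by (simp add: N_def A'_def)
  qed
 qed
 \<comment> \<open>For the exponent of the marginal in card S coordinates the quadratic terms in
   card S cancel, which leaves an exponent linear in card S.\<close>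
 have \<gamma>: "H.\<gamma> = (real \<alpha> * real (card S) - 1) / 2"
  unfolding H.\<gamma>_def unfolding \<beta>_def cJ by (simp add: power2_eq_square field_simps)
 obtain C where C: "C > 0" "distr \<mu> (lb U) (%x. \<lambda>b\<in>U. x \<bullet> b) =
    density (lb U) (%x. ennreal C * wt \<beta> (\<Sum>b\<in>U. (x b)\<^sup>2))"
  using dens[of U] U(4) unfolding \<beta>_def U_def by blast
 let ?f = "%x. ennreal C * wt \<beta> (\<Sum>b\<in>U. (x b)\<^sup>2)"
 have mf: "?f : borel_measurable (lb U)"
 proof -
  have "(%x. \<Sum>b\<in>U. (x b)\<^sup>2) : borel_measurable (lb U)"
   by (intro borel_measurable_sum borel_measurable_power measurable_lb_component)
  from measurable_compose[OF this measurable_wt[of \<beta>]] show ?thesis by measurable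
 qed
 define K where "K = ennreal (C ^ card S) * (\<integral>\<^sup>+a. ennreal (H.rf a) * H.Zf a \<partial>lb U')"
 have general: "(\<integral>\<^sup>+X. (if A' X then \<Phi> (?c X) else 0) \<partial>M S) = K * (\<integral>\<^sup>+h. hw H.\<gamma> h * g h \<partial>lborel)"
  if \<Phi> [measurable]: "\<Phi> : borel_measurable (lb (S \<times> U))" and g: "g : borel_measurable borel"
  and \<Phi>g: "!!x a t. x : space (lb (S \<times> U')) ==> N x ==> \<Phi> (H.hp x a t) = g (t / H.rf a)" for \<Phi> g
 proof -
  let ?N = "%x. N (restrict x (S \<times> U'))"
  have rsub: "(%x. restrict x (S \<times> U')) : measurable (lb (S \<times> U)) (lb (S \<times> U'))"
   by (rule measurable_restrict_subset) (auto simp: U_def)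
  have [measurable]: "Measurable.pred (lb (S \<times> U)) ?N"
   by (rule measurable_compose[OF rsub mN])
  have mF: "(%x. if ?N x then \<Phi> x else 0) : borel_measurable (lb (S \<times> U))" by measurable
  have "(\<integral>\<^sup>+X. (if A' X then \<Phi> (?c X) else 0) \<partial>M S) =
   (\<integral>\<^sup>+X. (%x. if ?N x then \<Phi> x else 0) (\<lambda>p\<in>S \<times> U. (\<lambda>b\<in>U. X (fst p) \<bullet> b) (snd p)) \<partial>M S)"
  proof (intro nn_integral_cong)
   fix X :: "nat => 'e"
   have e: "(\<lambda>p\<in>S \<times> U. (\<lambda>b\<in>U. X (fst p) \<bullet> b) (snd p)) = (?c X)"
    by (auto simp: fun_eq_iff)
   have "?N (?c X) = A' X"
    unfolding N_def by (rule A'c) (simp add: vec'_c U_def)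
   then show "(if A' X then \<Phi> (?c X) else 0) =
    (%x. if ?N x then \<Phi> x else 0) (\<lambda>p\<in>S \<times> U. (\<lambda>b\<in>U. X (fst p) \<bullet> b) (snd p))" unfolding e by simp
  qed
  also have "... = (\<integral>\<^sup>+x. (\<Prod>i\<in>S. ?f (\<lambda>c\<in>U. x (i, c))) * (if ?N x then \<Phi> x else 0) \<partial>lb (S \<times> U))"
   by (rule nn_integral_PiM_flatten[OF prob fS(1) fJ(2) measurable_coords mf C(2) mF])
  also have "... = (\<integral>\<^sup>+x. ennreal (C ^ card S) * (if ?N x then (\<Prod>i\<in>S. wt \<beta> (\<Sum>c\<in>U. (x (i, c))\<^sup>2)) * \<Phi> x else 0) \<partial>lb (S \<times> U))"
   using C(1) by (intro nn_integral_cong) (simp add: prod.distrib ennreal_power mult.assoc)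
  also have "... = ennreal (C ^ card S) * (\<integral>\<^sup>+x. (if ?N x then (\<Prod>i\<in>S. wt \<beta> (\<Sum>c\<in>U. (x (i, c))\<^sup>2)) * \<Phi> x else 0) \<partial>lb (S \<times> U))"
  proof (rule nn_integral_cmult)
   have "(%x. wt \<beta> (\<Sum>c\<in>U. (x (i, c))\<^sup>2)) : borel_measurable (lb (S \<times> U))" if "i : S" for i
    using that by (intro measurable_compose[OF _ measurable_wt] borel_measurable_sum borel_measurable_power measurable_lb_component) auto
   then have [measurable]: "(%x. \<Prod>i\<in>S. wt \<beta> (\<Sum>c\<in>U. (x (i, c))\<^sup>2)) : borel_measurable (lb (S \<times> U))"
    by (intro borel_measurable_prod_ennreal)
   show "(%x. if ?N x then (\<Prod>i\<in>S. wt \<beta> (\<Sum>c\<in>U. (x (i, c))\<^sup>2)) * \<Phi> x else 0) : borel_measurable (lb (S \<times> U))"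
    by measurable
  qed
  also have "(\<integral>\<^sup>+x. (if ?N x then (\<Prod>i\<in>S. wt \<beta> (\<Sum>c\<in>U. (x (i, c))\<^sup>2)) * \<Phi> x else 0) \<partial>lb (S \<times> U))
   = (\<integral>\<^sup>+a. ennreal (H.rf a) * H.Zf a \<partial>lb U') * (\<integral>\<^sup>+h. (if h\<^sup>2 < 1 then ennreal ((1 - h\<^sup>2) powr H.\<gamma>) * g h else 0) \<partial>lborel)"
   using H.factorization[OF _ g \<Phi>g] \<Phi> unfolding U_def by blast
  also have "(\<integral>\<^sup>+h. (if h\<^sup>2 < 1 then ennreal ((1 - h\<^sup>2) powr H.\<gamma>) * g h else 0) \<partial>lborel) = (\<integral>\<^sup>+h. hw H.\<gamma> h * g h \<partial>lborel)"
   by (intro nn_integral_cong) (simp add: hw_def)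
  finally show ?thesis by (simp add: K_def mult.assoc)
 qed
 have predA': "Measurable.pred (M S) A'" by (rule pred_M[OF A'b]) (rule A'c, simp)
 have one: "emeasure (M S) {X:space (M S). A' X} = K * (\<integral>\<^sup>+h. hw H.\<gamma> h \<partial>lborel)"
 proof -
  have "emeasure (M S) {X:space (M S). A' X} = (\<integral>\<^sup>+X. indicator {X:space (M S). A' X} X \<partial>M S)"
   using predA' by (intro nn_integral_indicator[symmetric]) (simp add: pred_def)
  also have "... = (\<integral>\<^sup>+X. (if A' X then (%_. 1) (?c X) else 0) \<partial>M S)"
   by (intro nn_integral_cong) (simp add: indicator_def)
  also have "... = K * (\<integral>\<^sup>+h. hw H.\<gamma> h * 1 \<partial>lborel)" by (rule general) auto
  finally show ?thesis by simp
 qed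
 define \<Phi> where "\<Phi> x = (\<integral>\<^sup>+Z. indicator {Y. facet U S I (crd Y)} (merge S R (vec S U x, Z)) \<partial>M R)" for x
 define g where "g h = ennreal (gG (card R) h)" for h
 have mfac: "{Y:space (M I). facet U S I (crd Y)} : sets (M I)"
 proof -
  have "Measurable.pred (M I) (%Y. facet U S I (crd Y))"
   by (rule pred_M[OF borel_facet[OF JB S0 S(1)]]) (rule facet_cong[OF S(2)], simp)
  then show ?thesis by (simp add: pred_def)
 qed
 have mfac': "(%Y. indicator {Y. facet U S I (crd Y)} Y :: ennreal) : borel_measurable (M I)"
 proof -
  have "(%Y. indicator {Y:space (M I). facet U S I (crd Y)} Y :: ennreal) : borel_measurable (M I)"
   using mfac by simp
  then show ?thesis by (rule measurable_cong[THEN iffD1, rotated]) (auto simp: indicator_def)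
 qed
 interpret MR: prob_space "M R" by (rule prob_M)
 have mg: "merge S R : measurable (M S \<Otimes>\<^sub>M M R) (M I)" unfolding I(1) by (rule measurable_merge)
 have m\<Phi>: "\<Phi> : borel_measurable (lb (S \<times> U))"
 proof -
  have "(%z. (vec S U (fst z), snd z)) : measurable (lb (S \<times> U) \<Otimes>\<^sub>M M R) (M S \<Otimes>\<^sub>M M R)"
   by (intro measurable_Pair measurable_compose[OF measurable_fst measurable_vec[OF fJ(2)]]) auto
  from measurable_compose[OF measurable_compose[OF this mg] mfac']
  have "(%(x, Z). indicator {Y. facet U S I (crd Y)} (merge S R (vec S U x, Z)) :: ennreal) : borel_measurable (lb (S \<times> U) \<Otimes>\<^sub>M M R)"
   by (simp add: case_prod_beta)
  from MR.borel_measurable_nn_integral[OF this] show ?thesis unfolding \<Phi>_def .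
 qed
 have mG: "g : borel_measurable borel" unfolding g_def gG_def by measurable
 have \<Phi>g: "\<Phi> (H.hp x a t) = g (t / H.rf a)" if x: "x : space (lb (S \<times> U'))" and Nx: "N x" for x a t
 proof -
  let ?x = "H.hp x a t"
  define v where "v c = (if c = b then 1 else - a c)" for c
  define w where "w = (\<Sum>c\<in>U. v c *\<^sub>R c)"
  have wz: "w \<bullet> z = (\<Sum>c\<in>U. v c * (z \<bullet> c))" for z
   unfolding w_def inner_sum_left by (simp add: inner_commute)
  have hpc: "?x (i, c) = (if c = b then t + (\<Sum>c\<in>U'. a c * x (i, c)) else x (i, c))" if "i : S" "c : U" for i c
   using that by (simp add: H.hp_def U_def)
  have sumJ: "(\<Sum>c\<in>U. f c) = f b + (\<Sum>c\<in>U'. f c)" for f :: "'e => real"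
   using fJ U by (simp add: U_def)
  have nv: "v c = - a c" if "c : U'" for c using that U(3) by (auto simp: v_def)
  have normw: "norm w = H.rf a"
  proof -
   have wc: "w \<bullet> c = v c" if "c : U" for c
    unfolding w_def using inner_basis_sum[OF JB, of c v] JB that by auto
   have "w \<bullet> w = (\<Sum>c\<in>U. v c * (w \<bullet> c))" by (rule wz)
   also have "... = (\<Sum>c\<in>U. v c * v c)" using wc by (intro sum.cong) auto
   also have "... = 1 + (\<Sum>c\<in>U'. (a c)\<^sup>2)"
    unfolding sumJ using nv by (simp add: v_def[of b] power2_eq_square cong: sum.cong)
   finally show ?thesis by (simp add: norm_eq_sqrt_inner H.rf_def)
  qed
  have w0: "w ~= 0" using normw H.rf_pos(1)[of a] by auto
  have onS: "(\<Sum>c\<in>U. v c * (vec S U ?x i \<bullet> c)) = t" if i: "i : S" for i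
  proof -
   have "(\<Sum>c\<in>U. v c * (vec S U ?x i \<bullet> c)) = (\<Sum>c\<in>U. v c * ?x (i, c))"
    using vec_crd[OF JB _ i] by (intro sum.cong) auto
   also have "... = t + (\<Sum>c\<in>U'. a c * x (i, c)) + (\<Sum>c\<in>U'. - a c * x (i, c))"
    unfolding sumJ
   proof (intro arg_cong2[of _ _ _ _ "(+)"])
    show "v b * ?x (i, b) = t + (\<Sum>c\<in>U'. a c * x (i, c))" using i hpc[of i b] by (simp add: v_def U_def)
    show "(\<Sum>c\<in>U'. v c * ?x (i, c)) = (\<Sum>c\<in>U'. - a c * x (i, c))"
    proof (intro sum.cong refl)
    fix c assume "c : U'"
    then show "v c * ?x (i, c) = - a c * x (i, c)" using hpc[of i c] nv[of c] i U(3) by (auto simp: U_def)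
    qed
   qed
   also have "... = t" by (simp add: sum_negf)
   finally show ?thesis .
  qed
  have ai: "aff_indep U S (crd (vec S U ?x))"
  proof -
   have "aff_indep U' S (%i c. x (i, c))" using H.N_indep[OF Nx] .
   moreover have "vec S U ?x i \<bullet> c = x (i, c)" if "i : S" "c : U'" for i c
   proof -
    have "c : U" "c ~= b" using that U by (auto simp: U_def)
    then show ?thesis using that vec_crd[OF JB] hpc by simp
   qed
   ultimately have "aff_indep U' S (crd (vec S U ?x))"
    using aff_indep_cong[of S U' "crd (vec S U ?x)" "%i c. x (i, c)"] by simp
   then show ?thesis unfolding aff_indep_def U_def by auto
  qed
  have ind: "indicator {Y. facet U S I (crd Y)} (merge S R (vec S U ?x, Z)) =
    (indicator {Z:space (M R). (ALL i:R. t <= w \<bullet> Z i) | (ALL i:R. w \<bullet> Z i <= t)} Z :: ennreal)" if Z: "Z : space (M R)" for Z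
  proof -
   let ?Y = "merge S R (vec S U ?x, Z)"
   have YS: "?Y i = vec S U ?x i" if "i : S" for i using that by (simp add: merge_def)
   have YR: "?Y i = Z i" if "i : R" for i using that I(2) by (auto simp: merge_def)
   have vb: "EX c:U. v c ~= 0" by (intro bexI[of _ b]) (auto simp: v_def U_def)
   have "facet U S I (crd ?Y) \<longleftrightarrow> (ALL i:I. t <= (\<Sum>c\<in>U. v c * (?Y i \<bullet> c))) | (ALL i:I. (\<Sum>c\<in>U. v c * (?Y i \<bullet> c)) <= t)"
   proof (rule facet_iff[OF fS(1) fJ(2) cJ[symmetric] S0 _ vb])
    show "aff_indep U S (crd ?Y)" using ai aff_indep_cong[of S U "crd ?Y" "crd (vec S U ?x)"] YS by simp
    show "ALL i:S. (\<Sum>c\<in>U. v c * (?Y i \<bullet> c)) = t" using onS YS by simp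
   qed
   also have "... \<longleftrightarrow> (ALL i:R. t <= w \<bullet> Z i) | (ALL i:R. w \<bullet> Z i <= t)"
    unfolding I(1) ball_Un using onS YS YR by (simp add: wz)
   finally show ?thesis using Z by (simp add: indicator_def)
  qed
  have "\<Phi> ?x = (\<integral>\<^sup>+Z. indicator {Z:space (M R). (ALL i:R. t <= w \<bullet> Z i) | (ALL i:R. w \<bullet> Z i <= t)} Z \<partial>M R)"
   unfolding \<Phi>_def by (intro nn_integral_cong ind)
  also have "... = emeasure (M R) {Z:space (M R). (ALL i:R. t <= w \<bullet> Z i) | (ALL i:R. w \<bullet> Z i <= t)}"
  proof (rule nn_integral_indicator)
   have c: "(%Z. w \<bullet> Z i) : borel_measurable (M R)" if "i : R" for i
    using measurable_component_singleton[OF that, of "%_. \<mu>"] by (simp cong: measurable_cong_sets add: sets_mu)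
   show "{Z:space (M R). (ALL i:R. t <= w \<bullet> Z i) | (ALL i:R. w \<bullet> Z i <= t)} : sets (M R)"
    using c fS(2) by (intro sets.sets_Collect) auto
  qed
  also have "... = g (t / H.rf a)" using halfspace_both[OF fS(2,3) w0, of t] by (simp add: normw g_def gG_def)
  finally show ?thesis .
 qed
 have two: "emeasure (M I) {X:space (M I). A' X & facet U S I (crd X)} = K * (\<integral>\<^sup>+h. hw H.\<gamma> h * g h \<partial>lborel)"
 proof -
  have predI: "Measurable.pred (M I) A'" by (rule pred_M[OF A'b]) (rule A'c, use S(2) in auto)
  have E: "{X:space (M I). A' X & facet U S I (crd X)} : sets (M I)"
  proof -
   have "{X:space (M I). A' X & facet U S I (crd X)} = {X:space (M I). A' X} Int {Y:space (M I). facet U S I (crd Y)}" by auto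
   then show ?thesis using predI mfac by (auto simp: pred_def)
  qed
  let ?E = "{X:space (M I). A' X & facet U S I (crd X)}"
  have "emeasure (M I) ?E = (\<integral>\<^sup>+X. indicator ?E X \<partial>M (S Un R))" using nn_integral_indicator[OF E] I(1) by simp
  also have "... = (\<integral>\<^sup>+X. \<integral>\<^sup>+Z. indicator ?E (merge S R (X, Z)) \<partial>M R \<partial>M S)"
   by (rule pp.product_nn_integral_fold[OF I(2) fS(1,2)]) (use E I(1) in simp)
  also have "... = (\<integral>\<^sup>+X. (if A' X then \<Phi> (?c X) else 0) \<partial>M S)"
  proof (rule nn_integral_cong)
   fix X assume X: "X : space (M S)"
   have mem: "merge S R (X, Z) : space (M I)" if "Z : space (M R)" for Z
    using measurable_space[OF mg, of "(X, Z)"] X that by (simp add: space_pair_measure)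
   have a: "A' (merge S R (X, Z)) = A' X" for Z by (rule A'c) (simp add: merge_def)
   have f: "facet U S I (crd (merge S R (X, Z))) = facet U S I (crd (merge S R (vec S U (?c X), Z)))" for Z
   proof (rule facet_cong[OF S(2)])
    fix i c assume "i : I" "c : U"
    then show "merge S R (X, Z) i \<bullet> c = merge S R (vec S U (?c X), Z) i \<bullet> c"
    using vec_crd[OF JB \<open>c : U\<close>] by (simp add: merge_def)
   qed
   have "(\<integral>\<^sup>+Z. indicator ?E (merge S R (X, Z)) \<partial>M R) =
    (\<integral>\<^sup>+Z. (if A' X then indicator {Y. facet U S I (crd Y)} (merge S R (vec S U (?c X), Z)) else 0) \<partial>M R)"
    using mem a f by (intro nn_integral_cong) (simp add: indicator_def)
   also have "... = (if A' X then \<Phi> (?c X) else 0)"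
    by (simp add: \<Phi>_def)
   finally show "(\<integral>\<^sup>+Z. indicator ?E (merge S R (X, Z)) \<partial>M R) = (if A' X then \<Phi> (?c X) else 0)" .
  qed
  also have "... = K * (\<integral>\<^sup>+h. hw H.\<gamma> h * g h \<partial>lborel)" by (rule general[OF m\<Phi> mG \<Phi>g])
  finally show ?thesis .
 qed
 have cS: "card S <= card U' + 1" using S(4) by simp
 have remS: "emeasure (M S) {X:space (M S). A' X} = emeasure (M S) {X:space (M S). A X}"
 proof (rule emeasure_eq_AE)
  show "AE X in M S. X : {X:space (M S). A' X} \<longleftrightarrow> X : {X:space (M S). A X}"
   using AE_aff_indep[OF fS(1) order_refl U(1) cS] by eventually_elim (auto simp: A'_def)
  show "{X:space (M S). A' X} : sets (M S)" using predA' by (simp add: pred_def)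
  have "Measurable.pred (M S) A" by (rule pred_M[OF A(1)]) (rule A(2), simp)
  then show "{X:space (M S). A X} : sets (M S)" by (simp add: pred_def)
 qed
 have remI: "emeasure (M I) {X:space (M I). A' X & facet U S I (crd X)} = emeasure (M I) {X:space (M I). A X & facet U S I (crd X)}"
 proof (rule emeasure_eq_AE)
  show "AE X in M I. X : {X:space (M I). A' X & facet U S I (crd X)} \<longleftrightarrow> X : {X:space (M I). A X & facet U S I (crd X)}"
   using AE_aff_indep[OF S(1,2) U(1) cS] by eventually_elim (auto simp: A'_def)
  have p: "Measurable.pred (M I) A'" "Measurable.pred (M I) A"
   by (rule pred_M[OF A'b], rule A'c, use S(2) in auto) (rule pred_M[OF A(1)], rule A(2), use S(2) in auto)
  have "{X:space (M I). A' X & facet U S I (crd X)} = {X:space (M I). A' X} Int {Y:space (M I). facet U S I (crd Y)}"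
    "{X:space (M I). A X & facet U S I (crd X)} = {X:space (M I). A X} Int {Y:space (M I). facet U S I (crd Y)}" by auto
  then show "{X:space (M I). A' X & facet U S I (crd X)} : sets (M I)" "{X:space (M I). A X & facet U S I (crd X)} : sets (M I)"
   using p mfac by (auto simp: pred_def)
 qed
 show ?thesis unfolding remS[symmetric] U_def[symmetric] remI[symmetric] one two \<gamma> R_def[symmetric] g_def
  by (simp add: mult_ac)
qed

end

section \<open>The integrals solving the recursion\<close>

text \<open>The reciprocal of a normalising constant: \<open>c_const\<close> at (p - 1)/2 is 1 /
  \<open>cosint p\<close>.\<close>

definition cosint :: "nat => real" where
 "cosint p = integral {-(pi/2)..pi/2} (%x. cos x ^ p)"

lemma cosint_0: "cosint 0 = pi"
 by (simp add: cosint_def)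

lemma cosint_1: "cosint 1 = 2"
proof -
 have "((%x. cos x) has_integral (sin (pi/2) - sin (-(pi/2)))) {-(pi/2)..pi/2}"
  by (rule fundamental_theorem_of_calculus)
   (auto intro!: derivative_eq_intros simp: has_real_derivative_iff_has_vector_derivative[symmetric])
 then show ?thesis unfolding cosint_def by (simp add: integral_unique)
qed

text \<open>Integrate the derivative of cos^(p+1) sin over the half circle; the boundary terms
  vanish.\<close>

lemma cosint_rec: "real (p + 2) * cosint (p + 2) = real (p + 1) * cosint p"
proof -
 have "((%x. real (p + 2) * cos x ^ (p + 2) - real (p + 1) * cos x ^ p) has_integral
   (cos (pi/2) ^ (p + 1) * sin (pi/2) - cos (-(pi/2)) ^ (p + 1) * sin (-(pi/2)))) {-(pi/2)..pi/2}"
 proof (rule fundamental_theorem_of_calculus)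
  fix x :: real
  have "((%x. cos x ^ (p + 1) * sin x) has_real_derivative
    (real (p + 1) * (cos x ^ p * (- sin x)) * sin x + cos x ^ (p + 1) * cos x)) (at x within {-(pi/2)..pi/2})"
  proof -
   have c: "(cos has_real_derivative - sin x) (at x within {-(pi/2)..pi/2})"
    by (rule has_field_derivative_at_within[OF DERIV_cos])
   have s: "(sin has_real_derivative cos x) (at x within {-(pi/2)..pi/2})"
    by (rule has_field_derivative_at_within[OF DERIV_sin])
   have "((%x. cos x ^ Suc p) has_real_derivative (1 + real p) * (- sin x * cos x ^ p)) (at x within {-(pi/2)..pi/2})"
    by (rule DERIV_power_Suc[OF c])
   from DERIV_mult[OF this s] show ?thesis by (simp add: algebra_simps)
  qed
  also have "real (p + 1) * (cos x ^ p * (- sin x)) * sin x + cos x ^ (p + 1) * cos x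
    = real (p + 2) * cos x ^ (p + 2) - real (p + 1) * cos x ^ p"
  proof -
   have s: "sin x * sin x = 1 - cos x * cos x" using sin_cos_squared_add[of x] by (simp add: power2_eq_square)
   have "real (p + 1) * (cos x ^ p * (- sin x)) * sin x = - real (p + 1) * cos x ^ p * (sin x * sin x)" by (simp add: algebra_simps)
   also have "... = - real (p + 1) * cos x ^ p * (1 - cos x * cos x)" unfolding s ..
   finally have "real (p + 1) * (cos x ^ p * (- sin x)) * sin x + cos x ^ (p + 1) * cos x
    = - real (p + 1) * cos x ^ p * (1 - cos x * cos x) + cos x ^ (p + 1) * cos x" by (simp only:)
   also have "... = real (p + 2) * cos x ^ (p + 2) - real (p + 1) * cos x ^ p"
    by (simp add: algebra_simps power_add power2_eq_square)
   finally show ?thesis .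
  qed
  finally show "((%x. cos x ^ (p + 1) * sin x) has_vector_derivative
    real (p + 2) * cos x ^ (p + 2) - real (p + 1) * cos x ^ p) (at x within {-(pi/2)..pi/2})"
   by (simp add: has_real_derivative_iff_has_vector_derivative)
 qed simp
 then have 1: "integral {-(pi/2)..pi/2} (%x. real (p + 2) * cos x ^ (p + 2) - real (p + 1) * cos x ^ p) = 0"
  by (simp add: integral_unique)
 have i: "(%x. cos x ^ q) integrable_on {-(pi/2)..pi/2}" for q :: nat
  by (intro integrable_continuous_real continuous_intros)
 have "integral {-(pi/2)..pi/2} (%x. real (p + 2) * cos x ^ (p + 2) - real (p + 1) * cos x ^ p)
  = real (p + 2) * cosint (p + 2) - real (p + 1) * cosint p"
  unfolding cosint_def using i[of "p + 2"] i[of p]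
  by (subst Henstock_Kurzweil_Integration.integral_diff) auto
 then show ?thesis using 1 by simp
qed

lemma Gamma_plus1_pos: "x > 0 ==> Gamma (x + 1) = x * Gamma (x::real)"
 by (rule Gamma_plus1) (auto elim!: nonpos_Ints_cases)

lemma cosint_Gamma: "cosint p = sqrt pi * Gamma ((real p + 1) / 2) / Gamma (real p / 2 + 1)"
proof (induction p rule: nat_less_induct)
 case (1 p)
 consider "p = 0" | "p = 1" | q where "p = q + 2"
  by (metis One_nat_def add_2_eq_Suc' not0_implies_Suc)
 then show ?case
 proof cases
  case 1 then show ?thesis by (simp add: cosint_0 Gamma_one_half_real)
 next
  case 2
  have "Gamma (1/2 + 1 :: real) = 1/2 * Gamma (1/2)" by (rule Gamma_plus1_pos) auto
  then have h: "sqrt pi = 2 * Gamma (3/2 :: real)" by (simp add: Gamma_one_half_real)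
  have "Gamma (3/2 :: real) > 0" by (intro Gamma_real_pos) simp
  then have "Gamma (3/2 :: real) ~= 0" by linarith
  then have "sqrt pi * Gamma ((real 1 + 1) / 2) / Gamma (real 1 / 2 + 1) = 2" unfolding h by simp
  then show ?thesis using 2 cosint_1 by simp
 next
  case (3 q)
  have IH: "cosint q = sqrt pi * Gamma ((real q + 1) / 2) / Gamma (real q / 2 + 1)" using 1 3 by simp
  have a: "Gamma ((real q + 1) / 2 + 1) = (real q + 1) / 2 * Gamma ((real q + 1) / 2)"
   by (rule Gamma_plus1_pos) (simp add: add_nonneg_pos)
  have b: "Gamma (real q / 2 + 1 + 1) = (real q / 2 + 1) * Gamma (real q / 2 + 1)"
   by (rule Gamma_plus1_pos) (simp add: add_nonneg_pos)
  have "cosint p = real (q + 1) / real (q + 2) * cosint q"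
   using cosint_rec[of q] 3 by (simp add: field_simps)
  also have "... = sqrt pi * Gamma ((real q + 1) / 2 + 1) / Gamma (real q / 2 + 1 + 1)"
  proof -
   have aux: "u / w * (s * A / B) = s * (u / 2 * A) / (w / 2 * B)" if "B > 0" "w > 0" for s A B u w :: real
    using that by (simp add: field_simps)
   have "real (q + 1) / real (q + 2) * (s * A / B) = s * ((real q + 1) / 2 * A) / ((real q / 2 + 1) * B)" if "B > 0" for s A B :: real
    using aux[OF that, of "real (q + 2)" "real (q + 1)" s A] by (simp add: add_divide_distrib add.commute)
   moreover have "Gamma (real q / 2 + 1) > 0" by (intro Gamma_real_pos add_nonneg_pos) auto
   ultimately show ?thesis unfolding IH a b by blast
  qed
  finally show ?thesis using 3 by (simp add: add_divide_distrib algebra_simps)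
 qed
qed

lemma cosint_pos: "cosint p > 0"
 unfolding cosint_Gamma by (intro divide_pos_pos mult_pos_pos Gamma_real_pos) (auto simp: add_nonneg_pos)

lemma cosint_nz [simp]: "cosint p ~= 0"
 using cosint_pos[of p] by simp

text \<open>This product evaluates the constant term of \<open>AA_BB_identity\<close> and later
  converts its coefficients into probabilities.\<close>

lemma cosint_mult: "cosint p * cosint (p + 1) = 2 * pi / (real p + 1)"
proof -
 have a: "Gamma ((real p + 1) / 2 + 1) = (real p + 1) / 2 * Gamma ((real p + 1) / 2)"
  by (rule Gamma_plus1_pos) (simp add: add_nonneg_pos)
 have pos: "Gamma ((real p + 1) / 2) > 0" "Gamma (real p / 2 + 1) > 0"
  by (auto intro!: Gamma_real_pos add_nonneg_pos)
 have "cosint p * cosint (p + 1) = (sqrt pi * sqrt pi) * (Gamma ((real p + 1) / 2) * Gamma (real p / 2 + 1)) /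
   (Gamma (real p / 2 + 1) * Gamma ((real p + 1) / 2 + 1))"
  unfolding cosint_Gamma by (simp add: add_divide_distrib algebra_simps)
 also have "... = 2 * pi / (real p + 1)"
 proof -
  have "s * (A * B) / (B * (r / 2 * A)) = 2 * s / r" if "A > 0" "B > 0" "r > 0" for s A B r :: real
   using that by (simp add: field_simps)
  from this[OF pos, of "real p + 1" "sqrt pi * sqrt pi"] show ?thesis unfolding a by simp
 qed
 finally show ?thesis .
qed

text \<open>The entire extension of the distribution function of one coordinate in the angle
  variable: for x between -pi/2 and pi/2 it equals \<open>G (sin x)\<close> (see
  \<open>G_sin\<close>), and on the imaginary axis it is the base of the powers in the line
  integrals.\<close>

definition Fc :: "nat => complex => complex" where
 "Fc \<alpha> z = 1/2 + contour_integral (linepath 0 z) (%w. cos w ^ \<alpha>) / of_real (cosint \<alpha>)"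

lemma contour_integral_primitive_0:
 assumes "f holomorphic_on UNIV"
 shows "((%z. contour_integral (linepath 0 z) f) has_field_derivative f z) (at z)"
proof -
 obtain g where g: "!!z. (g has_field_derivative f z) (at z)"
  using holomorphic_convex_primitive'[OF convex_UNIV open_UNIV assms] by auto
 have "contour_integral (linepath 0 w) f = g w - g 0" for w
  using contour_integral_unique[OF contour_integral_primitive[of UNIV g f "linepath 0 w"]] g by auto
 then have "(%z. contour_integral (linepath 0 z) f) = (%w. g w - g 0)" by auto
 moreover have "((%w. g w - g 0) has_field_derivative f z) (at z)"
  using g[of z] by (auto intro!: derivative_eq_intros)
 ultimately show ?thesis by simp
qed

lemma Fc_deriv: "(Fc \<alpha> has_field_derivative cos z ^ \<alpha> / of_real (cosint \<alpha>)) (at z)"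
proof -
 have "(%w::complex. cos w ^ \<alpha>) holomorphic_on UNIV" by (intro holomorphic_intros)
 from contour_integral_primitive_0[OF this, of z] show ?thesis
  unfolding Fc_def by (auto intro!: derivative_eq_intros)
qed

lemma Fc_0: "Fc \<alpha> 0 = 1/2"
 by (simp add: Fc_def)

lemma Fc_deriv' [derivative_intros]:
 "(f has_field_derivative f') (at z within A) ==>
  ((%x. Fc \<alpha> (f x)) has_field_derivative (cos (f z) ^ \<alpha> / of_real (cosint \<alpha>) * f')) (at z within A)"
 using DERIV_chain2[OF Fc_deriv] .

lemma Fc_minus: "Fc \<alpha> (- z) = 1 - Fc \<alpha> z"
proof -
 have "((%z. Fc \<alpha> (- z) + Fc \<alpha> z) has_field_derivative 0) (at z within UNIV)" for z
  by (auto intro!: derivative_eq_intros)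
 then have "EX c. ALL z:UNIV. Fc \<alpha> (- z) + Fc \<alpha> z = c"
  by (intro has_field_derivative_zero_constant) auto
 then obtain c where c: "!!z. Fc \<alpha> (- z) + Fc \<alpha> z = c" by auto
 from c[of 0] have "c = 1" by (simp add: Fc_0)
 then show ?thesis using c[of z] by (simp add: algebra_simps)
qed

definition Fr :: "nat => real => real" where
 "Fr \<alpha> x = Re (Fc \<alpha> (of_real x))"

lemma Fc_of_real: "Fc \<alpha> (of_real x) = of_real (Fr \<alpha> x)"
proof -
 have "((%x. Im (Fc \<alpha> (of_real x))) has_real_derivative 0) (at x within UNIV)" for x :: real
 proof -
  have "((%x. Fc \<alpha> (of_real x)) has_vector_derivative (cos (of_real x) ^ \<alpha> / of_real (cosint \<alpha>))) (at x)"
   using has_vector_derivative_real_field[OF Fc_deriv] .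
  from bounded_linear.has_vector_derivative[OF bounded_linear_Im this] have "((%x. Im (Fc \<alpha> (of_real x))) has_vector_derivative Im (cos (of_real x) ^ \<alpha> / of_real (cosint \<alpha>))) (at x)" .
  moreover have "Im (cos (of_real x :: complex) ^ \<alpha> / of_real (cosint \<alpha>)) = 0"
   by (simp add: cos_of_real of_real_power[symmetric] of_real_divide[symmetric] del: of_real_power of_real_divide)
  ultimately show ?thesis by (simp add: has_real_derivative_iff_has_vector_derivative)
 qed
 then have "EX c. ALL x:UNIV. Im (Fc \<alpha> (of_real x)) = c"
  by (intro has_field_derivative_zero_constant) auto
 then obtain c where c: "!!x::real. Im (Fc \<alpha> (of_real x)) = c" by auto
 from c[of 0] have "c = 0" by (simp add: Fc_0)
 then show ?thesis using c[of x] by (simp add: Fr_def complex_eq_iff)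
qed

lemma Fr_deriv: "(Fr \<alpha> has_real_derivative cos x ^ \<alpha> / cosint \<alpha>) (at x)"
proof -
 have "((%x. Fc \<alpha> (of_real x)) has_vector_derivative (cos (of_real x) ^ \<alpha> / of_real (cosint \<alpha>))) (at x)"
  using has_vector_derivative_real_field[OF Fc_deriv] .
 from bounded_linear.has_vector_derivative[OF bounded_linear_Re this] have "((%x. Re (Fc \<alpha> (of_real x))) has_vector_derivative Re (cos (of_real x) ^ \<alpha> / of_real (cosint \<alpha>))) (at x)" .
 moreover have "Re (cos (of_real x :: complex) ^ \<alpha> / of_real (cosint \<alpha>)) = cos x ^ \<alpha> / cosint \<alpha>"
  by (simp add: cos_of_real of_real_power[symmetric] of_real_divide[symmetric] del: of_real_power of_real_divide)
 moreover have "Fr \<alpha> = (%x. Re (Fc \<alpha> (of_real x)))" by (auto simp: Fr_def)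
 ultimately show ?thesis by (simp add: has_real_derivative_iff_has_vector_derivative)
qed

lemma Fr_ends: "Fr \<alpha> (- (pi/2)) = 0" "Fr \<alpha> (pi/2) = 1"
proof -
 have "((%x. cos x ^ \<alpha> / cosint \<alpha>) has_integral (Fr \<alpha> (pi/2) - Fr \<alpha> (-(pi/2)))) {-(pi/2)..pi/2}"
  by (rule fundamental_theorem_of_calculus)
   (auto simp: has_real_derivative_iff_has_vector_derivative[symmetric] intro: has_field_derivative_at_within[OF Fr_deriv])
 then have "integral {-(pi/2)..pi/2} (%x. cos x ^ \<alpha> / cosint \<alpha>) = Fr \<alpha> (pi/2) - Fr \<alpha> (-(pi/2))"
  by (rule integral_unique)
 moreover have "integral {-(pi/2)..pi/2} (%x. cos x ^ \<alpha> / cosint \<alpha>) = 1"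
  using cosint_pos[of \<alpha>] by (simp add: cosint_def[symmetric])
 moreover have "Fr \<alpha> (- (pi/2)) = 1 - Fr \<alpha> (pi/2)"
  using Fc_minus[of \<alpha> "of_real (pi/2)"] by (simp add: Fr_def)
 ultimately show "Fr \<alpha> (- (pi/2)) = 0" "Fr \<alpha> (pi/2) = 1" by auto
qed

lemma Fr_minus: "Fr \<alpha> (- x) = 1 - Fr \<alpha> x"
 using Fc_minus[of \<alpha> "of_real x"] by (simp add: Fr_def)

lemma cont_Fr: "continuous_on A (Fr \<alpha>)"
 using Fr_deriv by (meson DERIV_isCont continuous_at_imp_continuous_on)

lemma cos_arctan_sinh: "cos (arctan (sinh y)) = 1 / cosh (y::real)"
proof -
 have "1 + (sinh y)\<^sup>2 = (cosh y)\<^sup>2" by (simp add: cosh_square_eq)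
 then show ?thesis by (simp add: cos_arctan)
qed

lemma sinh_at_top: "filterlim (sinh :: real => real) at_top at_top"
 by (rule sinh_real_at_top)

text \<open>The Gudermannian arctan (sinh y) has derivative 1/cosh y, and 1/cosh y is also its
  cosine, so it transforms the integral into \<open>cosint p\<close>.\<close>

lemma cosh_power_integral:
 "has_bochner_integral lborel (%y::real. 1 / cosh y ^ (p + 1)) (cosint p)"
proof -
 define F where "F y = cosint p * Fr p (arctan (sinh y))" for y
 have dF: "(F has_real_derivative 1 / cosh y ^ (p + 1)) (at y)" for y
 proof -
  have "((%y. arctan (sinh y)) has_real_derivative (inverse (1 + (sinh y)\<^sup>2) * cosh y)) (at y)"
   by (auto intro!: derivative_eq_intros)
  also have "inverse (1 + (sinh y)\<^sup>2) * cosh y = 1 / cosh y"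
  proof -
   have e: "1 + (sinh y)\<^sup>2 = (cosh y)\<^sup>2" by (simp add: cosh_square_eq)
   show ?thesis unfolding e by (simp add: power2_eq_square field_simps)
  qed
  finally have "((%y. arctan (sinh y)) has_real_derivative 1 / cosh y) (at y)" .
  from DERIV_cmult[OF DERIV_chain2[OF Fr_deriv[of p "arctan (sinh y)"] this], of "cosint p"]
  show ?thesis unfolding F_def by (simp add: cos_arctan_sinh power_divide mult.commute)
 qed
 have contF: "continuous_on UNIV (%x. cosint p * Fr p x)"
  by (intro continuous_intros cont_Fr)
 have top: "(F \<longlongrightarrow> cosint p * Fr p (pi/2)) at_top"
  unfolding F_def
  by (rule continuous_on_tendsto_compose[OF contF filterlim_compose[OF tendsto_arctan_at_top sinh_real_at_top]]) auto
 have bot: "(F \<longlongrightarrow> cosint p * Fr p (- (pi/2))) at_bot"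
  unfolding F_def
  by (rule continuous_on_tendsto_compose[OF contF filterlim_compose[OF tendsto_arctan_at_bot sinh_real_at_bot]]) auto
 have *: "set_integrable lborel (einterval (-\<infinity>) \<infinity>) (%y::real. 1 / cosh y ^ (p + 1))"
  "(LBINT y=-\<infinity>..\<infinity>. 1 / cosh y ^ (p + 1)) = cosint p * Fr p (pi/2) - cosint p * Fr p (- (pi/2))"
  using top bot dF
  by (intro interval_integral_FTC_nonneg[where a = "-\<infinity>" and b = "\<infinity>" and F = F
    and A = "cosint p * Fr p (- (pi/2))" and B = "cosint p * Fr p (pi/2)"];
    simp add: ereal_tendsto_simps1 ereal_tendsto_simps2 continuous_intros)+
 then have "integrable lborel (%y::real. 1 / cosh y ^ (p + 1))" "(LINT (y::real)|lborel. 1 / cosh y ^ (p + 1)) = cosint p"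
  by (auto simp: set_integrable_def interval_lebesgue_integral_def set_lebesgue_integral_def Fr_ends)
 then show ?thesis by (simp add: has_bochner_integral_iff)
qed

section \<open>The potential on the strip\<close>

context
 fixes \<alpha> \<kappa> :: nat
begin

text \<open>W is the potential: applying d/dphi - i d/dy to it gives the integrand Iint, because this
 operator annihilates sin(iy - phi) and maps q = cos phi / cosh y to sin(iy - phi) / cosh^2 y.\<close>

definition Wy :: "real => complex" where
 "Wy y = Fc \<alpha> (\<i> * of_real y)"

lemma cos_i_times: "cos (\<i> * complex_of_real y) = of_real (cosh y)"
 by (simp add: cos_exp_eq cosh_def exp_of_real[symmetric] scaleR_conv_of_real flip: of_real_minus)

lemma sin_i_times: "sin (\<i> * complex_of_real y) = \<i> * of_real (sinh y)"
 by (simp add: sin_exp_eq sinh_def exp_of_real[symmetric] scaleR_conv_of_real field_simps flip: of_real_minus)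

lemma Wy_deriv: "(Wy has_vector_derivative \<i> * of_real (cosh y ^ \<alpha> / cosint \<alpha>)) (at y within A)"
proof -
 have "((%z. Fc \<alpha> (\<i> * z)) has_field_derivative cos (\<i> * of_real y) ^ \<alpha> / of_real (cosint \<alpha>) * \<i>) (at (of_real y))"
  by (auto intro!: derivative_eq_intros)
 from has_vector_derivative_real_field[OF this]
 show ?thesis unfolding Wy_def
  by (auto simp: cos_i_times mult.commute intro: has_vector_derivative_at_within)
qed

lemma Wy_0: "Wy 0 = 1/2"
 by (simp add: Wy_def Fc_0)

lemma Wy_minus: "Wy (- y) = 1 - Wy y"
 using Fc_minus[of \<alpha> "\<i> * of_real y"] by (simp add: Wy_def)

lemma cont_Wy: "continuous_on A (Wy)"
 by (rule continuous_on_vector_derivative[OF Wy_deriv])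

lemma Wy_near: "norm (Wy y - 1/2) <= (abs y) * cosh y ^ \<alpha> / cosint \<alpha>"
proof -
 have "norm (Wy y - Wy 0) <= cosh y ^ \<alpha> / cosint \<alpha> * norm (y - 0)"
 proof (rule differentiable_bound)
  show "convex {x. (abs x) <= (abs y)}"
  proof -
   have "{x. (abs x) <= (abs y)} = {-(abs y)..(abs y)}" by auto
   then show ?thesis by simp
  qed
  show "(Wy has_derivative (%h. h *\<^sub>R (\<i> * of_real (cosh x ^ \<alpha> / cosint \<alpha>)))) (at x within {x. (abs x) <= (abs y)})" for x
   using Wy_deriv[of x] by (simp add: has_vector_derivative_def)
  show "onorm (%h. h *\<^sub>R (\<i> * of_real (cosh x ^ \<alpha> / cosint \<alpha>))) <= cosh y ^ \<alpha> / cosint \<alpha>" if "x : {x. (abs x) <= (abs y)}" for x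
  proof (rule onorm_le)
   fix h :: real
   have "cosh x <= cosh y" using that cosh_real_nonneg_le_iff[of "(abs x)" "(abs y)"] by (simp add: cosh_real_abs)
   then have "cosh x ^ \<alpha> / cosint \<alpha> <= cosh y ^ \<alpha> / cosint \<alpha>"
    using cosint_pos[of \<alpha>] by (intro divide_right_mono power_mono) auto
   moreover have "norm (h *\<^sub>R (\<i> * complex_of_real (cosh x ^ \<alpha> / cosint \<alpha>))) = (abs h) * (cosh x ^ \<alpha> / cosint \<alpha>)"
    using cosint_pos[of \<alpha>] by (simp add: norm_mult norm_divide norm_power abs_of_pos)
   ultimately show "norm (h *\<^sub>R (\<i> * complex_of_real (cosh x ^ \<alpha> / cosint \<alpha>))) <= cosh y ^ \<alpha> / cosint \<alpha> * norm h"
    using mult_left_mono[of "cosh x ^ \<alpha> / cosint \<alpha>" "cosh y ^ \<alpha> / cosint \<alpha>" "(abs h)"] by (simp add: mult.commute)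
  qed
 qed auto
 then show ?thesis by (simp add: Wy_0 mult.commute)
qed

lemma norm_Wy: "norm (Wy y) <= 1/2 + (abs y) * cosh y ^ \<alpha> / cosint \<alpha>"
proof -
 have "norm (Wy y) <= norm (Wy y - 1/2) + norm (1/2 :: complex)" by (metis diff_add_cancel norm_triangle_ineq)
 then show ?thesis using Wy_near[of y] by simp
qed

definition qq :: "real => real => real" where "qq \<phi> y = cos \<phi> / cosh y"

text \<open>At the origin the value is \<open>k\<close>, because \<open>Fr\<close> and
  \<open>Wy\<close> are both 1/2 there. Under the operator the derivatives of \<open>Fr\<close> and
  \<open>Wy\<close> cancel, so only the derivative of the power of \<open>qq\<close>
  survives.\<close>

definition EE :: "complex => real => real => complex" where
 "EE k \<phi> y = of_real (Fr \<alpha> \<phi>) - of_real (qq \<phi> y ^ \<alpha>) * (Wy y - k)"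

text \<open>This is sin(iy - phi) in real and imaginary parts. Its only zero with |phi| at most pi/2
  is the origin.\<close>

definition SS :: "real => real => complex" where
 "SS \<phi> y = \<i> * of_real (sinh y * cos \<phi>) - of_real (cosh y * sin \<phi>)"

definition TT :: "nat => complex => real => real => complex" where
 "TT m k \<phi> y = of_real (qq \<phi> y ^ (\<kappa> + 1)) * EE k \<phi> y ^ m"

definition qp :: "real => real => real" where "qp \<phi> y = - sin \<phi> / cosh y"
definition qy :: "real => real => real" where "qy \<phi> y = - cos \<phi> * sinh y / cosh y ^ 2"

definition Ep :: "complex => real => real => complex" where
 "Ep k \<phi> y = of_real (cos \<phi> ^ \<alpha> / cosint \<alpha>) - of_real (real \<alpha> * qq \<phi> y ^ (\<alpha> - 1) * qp \<phi> y) * (Wy y - k)"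
definition Ey :: "complex => real => real => complex" where
 "Ey k \<phi> y = - of_real (real \<alpha> * qq \<phi> y ^ (\<alpha> - 1) * qy \<phi> y) * (Wy y - k)
   - of_real (qq \<phi> y ^ \<alpha>) * (\<i> * of_real (cosh y ^ \<alpha> / cosint \<alpha>))"

lemma cosh_nz [simp]: "cosh (y::real) ~= 0"
 using cosh_real_pos[of y] by linarith

lemma qq_deriv_phi: "((%\<phi>. qq \<phi> y) has_real_derivative qp \<phi> y) (at \<phi> within A)"
 unfolding qq_def qp_def by (auto intro!: derivative_eq_intros)

lemma qq_deriv_y: "((%y. qq \<phi> y) has_real_derivative qy \<phi> y) (at y within A)"
 unfolding qq_def qy_def by (auto intro!: derivative_eq_intros simp: power2_eq_square)

lemma real_pow_vec:
 assumes "(f has_real_derivative f') (at x within A)"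
 shows "((%x. complex_of_real (f x ^ n)) has_vector_derivative of_real (real n * f x ^ (n - 1) * f')) (at x within A)"
 using has_vector_derivative_of_real[where 'a = complex, OF DERIV_power[OF assms, of n]] by (simp add: mult_ac)

lemma EE_deriv_phi: "((%\<phi>. EE k \<phi> y) has_vector_derivative Ep k \<phi> y) (at \<phi> within A)"
proof -
 have 1: "((%\<phi>. complex_of_real (Fr \<alpha> \<phi>)) has_vector_derivative of_real (cos \<phi> ^ \<alpha> / cosint \<alpha>)) (at \<phi> within A)"
  by (rule has_vector_derivative_of_real) (simp add: has_real_derivative_iff_has_vector_derivative[symmetric] has_field_derivative_at_within[OF Fr_deriv])
 have 2: "((%\<phi>. complex_of_real (qq \<phi> y ^ \<alpha>) * (Wy y - k)) has_vector_derivative of_real (real \<alpha> * qq \<phi> y ^ (\<alpha> - 1) * qp \<phi> y) * (Wy y - k)) (at \<phi> within A)"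
  by (rule has_vector_derivative_mult_left[OF real_pow_vec[OF qq_deriv_phi]])
 show ?thesis unfolding EE_def Ep_def by (rule has_vector_derivative_diff[OF 1 2])
qed

lemma EE_deriv_y: "((%y. EE k \<phi> y) has_vector_derivative Ey k \<phi> y) (at y within A)"
proof -
 have 1: "((%y. complex_of_real (Fr \<alpha> \<phi>)) has_vector_derivative 0) (at y within A)" by simp
 have w: "((%y. Wy y - k) has_vector_derivative \<i> * of_real (cosh y ^ \<alpha> / cosint \<alpha>)) (at y within A)"
  using has_vector_derivative_diff[OF Wy_deriv has_vector_derivative_const] by simp
 have 2: "((%y. complex_of_real (qq \<phi> y ^ \<alpha>) * (Wy y - k)) has_vector_derivative
   of_real (qq \<phi> y ^ \<alpha>) * (\<i> * of_real (cosh y ^ \<alpha> / cosint \<alpha>)) + of_real (real \<alpha> * qq \<phi> y ^ (\<alpha> - 1) * qy \<phi> y) * (Wy y - k)) (at y within A)"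
  by (rule has_vector_derivative_mult[OF real_pow_vec[OF qq_deriv_y] w])
 show ?thesis unfolding EE_def Ey_def using has_vector_derivative_diff[OF 1 2] by (simp add: algebra_simps)
qed

lemma vec_power:
 fixes f :: "real => complex"
 assumes "(f has_vector_derivative f') (at x within A)"
 shows "((%x. f x ^ m) has_vector_derivative of_nat m * f x ^ (m - 1) * f') (at x within A)"
proof -
 have "((%z. z ^ m) has_field_derivative of_nat m * f x ^ (m - 1)) (at (f x) within f ` A)"
  by (auto intro!: derivative_eq_intros)
 from field_vector_diff_chain_within[OF assms this] show ?thesis by (simp add: comp_def mult_ac)
qed

definition Tp where "Tp m k \<phi> y = of_real (qq \<phi> y ^ (\<kappa> + 1)) * (of_nat m * EE k \<phi> y ^ (m - 1) * Ep k \<phi> y)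
  + of_real (real (\<kappa> + 1) * qq \<phi> y ^ \<kappa> * qp \<phi> y) * EE k \<phi> y ^ m"
definition Ty where "Ty m k \<phi> y = of_real (qq \<phi> y ^ (\<kappa> + 1)) * (of_nat m * EE k \<phi> y ^ (m - 1) * Ey k \<phi> y)
  + of_real (real (\<kappa> + 1) * qq \<phi> y ^ \<kappa> * qy \<phi> y) * EE k \<phi> y ^ m"

lemma TT_deriv_phi: "((%\<phi>. TT m k \<phi> y) has_vector_derivative Tp m k \<phi> y) (at \<phi> within A)"
 unfolding TT_def Tp_def
 using has_vector_derivative_mult[OF real_pow_vec[where n = "\<kappa> + 1", OF qq_deriv_phi] vec_power[OF EE_deriv_phi]] by simp

lemma TT_deriv_y: "((%y. TT m k \<phi> y) has_vector_derivative Ty m k \<phi> y) (at y within A)"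
 unfolding TT_def Ty_def
 using has_vector_derivative_mult[OF real_pow_vec[where n = "\<kappa> + 1", OF qq_deriv_y] vec_power[OF EE_deriv_y]] by simp

definition Sp where "Sp \<phi> y = - \<i> * of_real (sinh y * sin \<phi>) - of_real (cosh y * cos \<phi>)"
definition Sy where "Sy \<phi> y = \<i> * of_real (cosh y * cos \<phi>) - of_real (sinh y * sin \<phi>)"

lemma SS_deriv_phi: "((%\<phi>. SS \<phi> y) has_vector_derivative Sp \<phi> y) (at \<phi> within A)"
proof -
 have "((%\<phi>. \<i> * complex_of_real (sinh y * cos \<phi>)) has_vector_derivative \<i> * of_real (sinh y * - sin \<phi>)) (at \<phi> within A)"
  by (intro has_vector_derivative_mult_right has_vector_derivative_of_real)
   (auto intro!: derivative_eq_intros simp: has_real_derivative_iff_has_vector_derivative[symmetric])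
 moreover have "((%\<phi>. complex_of_real (cosh y * sin \<phi>)) has_vector_derivative of_real (cosh y * cos \<phi>)) (at \<phi> within A)"
  by (intro has_vector_derivative_of_real)
   (auto intro!: derivative_eq_intros simp: has_real_derivative_iff_has_vector_derivative[symmetric])
 ultimately show ?thesis unfolding SS_def Sp_def using has_vector_derivative_diff by fastforce
qed

lemma SS_deriv_y: "((%y. SS \<phi> y) has_vector_derivative Sy \<phi> y) (at y within A)"
proof -
 have "((%y. \<i> * complex_of_real (sinh y * cos \<phi>)) has_vector_derivative \<i> * of_real (cosh y * cos \<phi>)) (at y within A)"
  by (intro has_vector_derivative_mult_right has_vector_derivative_of_real)
   (auto intro!: derivative_eq_intros simp: has_real_derivative_iff_has_vector_derivative[symmetric])
 moreover have "((%y. complex_of_real (cosh y * sin \<phi>)) has_vector_derivative of_real (sinh y * sin \<phi>)) (at y within A)"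
  by (intro has_vector_derivative_of_real)
   (auto intro!: derivative_eq_intros simp: has_real_derivative_iff_has_vector_derivative[symmetric])
 ultimately show ?thesis unfolding SS_def Sy_def using has_vector_derivative_diff by fastforce
qed

lemma Sp_Sy: "Sp \<phi> y - \<i> * Sy \<phi> y = 0"
 by (simp add: Sp_def Sy_def algebra_simps)

lemma qp_qy: "of_real (qp \<phi> y) - \<i> * of_real (qy \<phi> y) = SS \<phi> y / of_real (cosh y ^ 2)"
proof -
 have "qp \<phi> y = - (sin \<phi> * cosh y) / cosh y ^ 2" by (simp add: qp_def power2_eq_square)
 moreover have "of_real (a / c) - \<i> * of_real (b / c) = (of_real a - \<i> * of_real b) / complex_of_real c" for a b c
  by (simp add: diff_divide_distrib)
 moreover have "of_real (- (sin \<phi> * cosh y)) - \<i> * of_real (- cos \<phi> * sinh y) = SS \<phi> y"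
  by (simp add: SS_def algebra_simps)
 ultimately show ?thesis unfolding qy_def by (simp only:)
qed

definition Iint where "Iint m k \<phi> y =
  (of_real (real (\<kappa> + 1) * qq \<phi> y ^ \<kappa>) * EE k \<phi> y ^ m
  - of_real (qq \<phi> y ^ (\<kappa> + 1)) * (of_nat m * EE k \<phi> y ^ (m - 1)) * (of_real (real \<alpha> * qq \<phi> y ^ (\<alpha> - 1)) * (Wy y - k)))
  / of_real (cosh y ^ 2)"

lemma T_op: "Tp m k \<phi> y - \<i> * Ty m k \<phi> y = SS \<phi> y * Iint m k \<phi> y"
proof -
 define L where "L = of_real (qp \<phi> y) - \<i> * (of_real (qy \<phi> y) :: complex)"
 have L: "L = SS \<phi> y / of_real (cosh y ^ 2)" unfolding L_def by (rule qp_qy)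
 \<comment> \<open>The cancellation behind the potential: in \<open>Ep\<close> - i \<open>Ey\<close>
   the derivative of \<open>Fr\<close> is removed by that of \<open>Wy\<close>, since
   \<open>qq\<close> times cosh y is cos phi.\<close>
 have qc: "complex_of_real (qq \<phi> y ^ \<alpha>) * of_real (cosh y ^ \<alpha> / cosint \<alpha>) = of_real (cos \<phi> ^ \<alpha> / cosint \<alpha>)"
  unfolding of_real_mult[symmetric] by (simp add: qq_def power_divide)
 have E: "Ep k \<phi> y - \<i> * Ey k \<phi> y = - of_real (real \<alpha> * qq \<phi> y ^ (\<alpha> - 1)) * (Wy y - k) * L"
 proof -
  have "Ep k \<phi> y - \<i> * Ey k \<phi> y = of_real (cos \<phi> ^ \<alpha> / cosint \<alpha>)
    - of_real (qq \<phi> y ^ \<alpha>) * of_real (cosh y ^ \<alpha> / cosint \<alpha>)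
    - of_real (real \<alpha> * qq \<phi> y ^ (\<alpha> - 1)) * (Wy y - k) * L"
   unfolding Ep_def Ey_def L_def by (simp add: algebra_simps)
  then show ?thesis unfolding qc by simp
 qed
 have "Tp m k \<phi> y - \<i> * Ty m k \<phi> y =
  of_real (qq \<phi> y ^ (\<kappa> + 1)) * (of_nat m * EE k \<phi> y ^ (m - 1)) * (Ep k \<phi> y - \<i> * Ey k \<phi> y)
  + of_real (real (\<kappa> + 1) * qq \<phi> y ^ \<kappa>) * EE k \<phi> y ^ m * L"
  unfolding Tp_def Ty_def L_def by (simp add: algebra_simps)
 also have "... = SS \<phi> y * Iint m k \<phi> y"
 proof -
  have "P * (- R * U * (S / c)) + Q * (S / c) = S * ((Q - P * (R * U)) / c)" for P Q R S U c :: complex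
   by (simp add: diff_divide_distrib algebra_simps)
  then show ?thesis unfolding E unfolding L Iint_def .
 qed
 finally show ?thesis .
qed

lemma norm_SS: "norm (SS \<phi> y) ^ 2 = (sin \<phi>)\<^sup>2 + (sinh y)\<^sup>2"
proof -
 have "norm (SS \<phi> y) ^ 2 = (cosh y * sin \<phi>)\<^sup>2 + (sinh y * cos \<phi>)\<^sup>2"
  by (simp add: SS_def cmod_power2)
 also have "... = (1 + (sinh y)\<^sup>2) * (sin \<phi>)\<^sup>2 + (sinh y)\<^sup>2 * (1 - (sin \<phi>)\<^sup>2)"
  by (simp add: power_mult_distrib cosh_square_eq cos_squared_eq algebra_simps)
 finally show ?thesis by (simp add: algebra_simps)
qed

lemma SS_nz: "y ~= 0 ==> SS \<phi> y ~= 0"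
 using norm_SS[of \<phi> y] by (auto simp: add_nonneg_eq_0_iff)

definition WW where "WW m k \<phi> y = TT m k \<phi> y / SS \<phi> y"
definition WWy where "WWy m k \<phi> y = (Ty m k \<phi> y * SS \<phi> y - TT m k \<phi> y * Sy \<phi> y) / (SS \<phi> y)\<^sup>2"
definition WWp where "WWp m k \<phi> y = (Tp m k \<phi> y * SS \<phi> y - TT m k \<phi> y * Sp \<phi> y) / (SS \<phi> y)\<^sup>2"

lemma vec_divide:
 fixes f g :: "real => complex"
 assumes f: "(f has_vector_derivative f') (at x within A)" and g: "(g has_vector_derivative g') (at x within A)" and nz: "g x ~= 0"
 shows "((%x. f x / g x) has_vector_derivative (f' * g x - f x * g') / (g x)\<^sup>2) (at x within A)"
proof -
 have "((%z. inverse z) has_field_derivative - (inverse (g x) ^ Suc (Suc 0))) (at (g x) within g ` A)"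
  by (rule DERIV_inverse[OF nz])
 from field_vector_diff_chain_within[OF g this]
 have "((%x. inverse (g x)) has_vector_derivative g' * - (inverse (g x) ^ Suc (Suc 0))) (at x within A)"
  by (simp add: comp_def)
 from has_vector_derivative_mult[OF f this] show ?thesis
  using nz by (simp add: divide_inverse power2_eq_square algebra_simps)
qed

lemma WW_deriv_y: "y ~= 0 ==> ((%y. WW m k \<phi> y) has_vector_derivative WWy m k \<phi> y) (at y within A)"
 unfolding WW_def WWy_def by (rule vec_divide[OF TT_deriv_y SS_deriv_y SS_nz])

lemma WW_deriv_phi: "y ~= 0 ==> ((%\<phi>. WW m k \<phi> y) has_vector_derivative WWp m k \<phi> y) (at \<phi> within A)"
 unfolding WW_def WWp_def by (rule vec_divide[OF TT_deriv_phi SS_deriv_phi SS_nz])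

lemma WW_op: "y ~= 0 ==> WWp m k \<phi> y - \<i> * WWy m k \<phi> y = Iint m k \<phi> y"
proof -
 assume y: "y ~= 0"
 have "WWp m k \<phi> y - \<i> * WWy m k \<phi> y =
  ((Tp m k \<phi> y - \<i> * Ty m k \<phi> y) * SS \<phi> y - TT m k \<phi> y * (Sp \<phi> y - \<i> * Sy \<phi> y)) / (SS \<phi> y)\<^sup>2"
 proof -
  have "(a * s - t * p) / c - \<i> * ((b * s - t * r) / c) = ((a - \<i> * b) * s - t * (p - \<i> * r)) / c" for a b c p r s t :: complex
   by (simp add: diff_divide_distrib add_divide_distrib algebra_simps)
  then show ?thesis unfolding WWp_def WWy_def .
 qed
 also have "... = Iint m k \<phi> y"
  unfolding T_op Sp_Sy using SS_nz[OF y] by (simp add: power2_eq_square)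
 finally show ?thesis .
qed

abbreviation half_circle :: "real set" where "half_circle \<equiv> {-(pi/2)..pi/2}"

lemma continuous_on_Fr [continuous_intros]: "continuous_on A f ==> continuous_on A (%x. Fr \<alpha> (f x))"
 using continuous_on_compose2[OF cont_Fr[of UNIV]] by auto

lemma continuous_on_Wy [continuous_intros]: "continuous_on A f ==> continuous_on A (%x. Wy (f x))"
 using continuous_on_compose2[OF cont_Wy[of UNIV]] by auto

lemma continuous_on_potential [continuous_intros]:
 fixes f g :: "'a::t2_space => real"
 assumes "continuous_on A f" "continuous_on A g"
 shows "continuous_on A (%x. qq (f x) (g x))" "continuous_on A (%x. SS (f x) (g x))" "continuous_on A (%x. Sy (f x) (g x))"
  "continuous_on A (%x. EE k (f x) (g x))" "continuous_on A (%x. TT m k (f x) (g x))"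
  "continuous_on A (%x. Ty m k (f x) (g x))" "continuous_on A (%x. Iint m k (f x) (g x))"
 unfolding Iint_def Ty_def TT_def EE_def Ey_def qy_def SS_def Sy_def qq_def
 by (intro continuous_intros assms; simp)+

lemma continuous_on_WWy:
 fixes f :: "'a::t2_space => real"
 shows "continuous_on A f ==> continuous_on A g ==> (!!x. x : A ==> g x ~= 0) ==> continuous_on A (%x. WWy m k (f x) (g x))"
 unfolding WWy_def by (intro continuous_intros) (auto simp: SS_nz)

lemma continuous_on_WW:
 fixes f :: "'a::t2_space => real"
 shows "continuous_on A f ==> continuous_on A g ==> (!!x. x : A ==> SS (f x) (g x) ~= 0) ==> continuous_on A (%x. WW m k (f x) (g x))"
 unfolding WW_def by (intro continuous_intros) auto

definition VV where "VV m k y = integral half_circle (%\<phi>. WW m k \<phi> y)"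
definition Iy where "Iy m k y = integral half_circle (%\<phi>. Iint m k \<phi> y)"

text \<open>Differentiate under the integral and replace the y-derivative by the integrand and the
  phi-derivative. The latter integrates to 0, because \<open>qq\<close> vanishes at both ends of the
  half circle and enters with exponent at least 1.\<close>

lemma VV_deriv:
 assumes U: "convex U" "y0 : U" "!!y. y : U ==> y ~= 0"
 shows "(VV m k has_vector_derivative \<i> * Iy m k y0) (at y0 within U)"
proof -
 have y0: "y0 ~= 0" using U by auto
 have "((%y. integral (cbox (-(pi/2)) (pi/2)) (%\<phi>. WW m k \<phi> y)) has_vector_derivative
   integral (cbox (-(pi/2)) (pi/2)) (%\<phi>. WWy m k \<phi> y0)) (at y0 within U)"
 proof (rule leibniz_rule_vector_derivative[OF _ _ _ U(2,1)])
  show "((%y. WW m k \<phi> y) has_vector_derivative WWy m k \<phi> y) (at y within U)" if "y : U" for y \<phi>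
   using WW_deriv_y U(3)[OF that] .
  show "(%\<phi>. WW m k \<phi> y) integrable_on cbox (-(pi/2)) (pi/2)" if "y : U" for y
   using U(3)[OF that] by (intro integrable_continuous continuous_on_WW continuous_intros) (auto simp: SS_nz)
  show "continuous_on (U \<times> cbox (-(pi/2)) (pi/2)) (%(y, \<phi>). WWy m k \<phi> y)"
   unfolding case_prod_beta using U(3) by (intro continuous_on_WWy continuous_intros) auto
 qed
 moreover have "integral half_circle (%\<phi>. WWy m k \<phi> y0) = \<i> * Iy m k y0"
 proof -
  have "((%\<phi>. WWp m k \<phi> y0) has_integral (WW m k (pi/2) y0 - WW m k (-(pi/2)) y0)) half_circle"
   by (rule fundamental_theorem_of_calculus) (auto intro: WW_deriv_phi[OF y0])
  moreover have "WW m k (pi/2) y0 = 0" "WW m k (-(pi/2)) y0 = 0"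
   by (simp_all add: WW_def TT_def qq_def)
  ultimately have p: "((%\<phi>. WWp m k \<phi> y0) has_integral 0) half_circle" by simp
  have i: "((%\<phi>. Iint m k \<phi> y0) has_integral Iy m k y0) half_circle"
   unfolding Iy_def by (intro integrable_integral integrable_continuous_real continuous_intros)
  have "((%\<phi>. \<i> * (Iint m k \<phi> y0 - WWp m k \<phi> y0)) has_integral \<i> * (Iy m k y0 - 0)) half_circle"
   by (intro has_integral_mult_right has_integral_diff i p)
  moreover have "\<i> * (Iint m k \<phi> y0 - WWp m k \<phi> y0) = WWy m k \<phi> y0" for \<phi>
   unfolding WW_op[OF y0, symmetric] by (simp add: algebra_simps)
  ultimately show ?thesis by (simp add: integral_unique)
 qed
 ultimately show ?thesis unfolding VV_def by simp
qed

lemma Iy_integral: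
 assumes "a <= b" "0 < a | b < 0"
 shows "((%y. \<i> * Iy m k y) has_integral VV m k b - VV m k a) {a..b}"
 by (rule fundamental_theorem_of_calculus[OF assms(1)], rule VV_deriv) (use assms(2) in auto)

section \<open>Behaviour of the potential at its pole and at infinity\<close>

lemma sin_lower: "(abs \<phi>) <= pi/2 ==> (abs \<phi>) <= pi/2 * \<bar>sin \<phi>\<bar>"
proof -
 have pos: "\<phi> <= pi/2 * sin \<phi>" if "0 <= \<phi>" "\<phi> <= pi/2" for \<phi>
 proof -
  have "concave_on {0..pi} sin"
  proof (rule f''_le0_imp_concave)
   show "(sin has_real_derivative cos x) (at x)" "(cos has_real_derivative - sin x) (at x)" for x :: real
    by (auto intro!: derivative_eq_intros)
  qed (auto intro: sin_ge_zero)
  then have "sin ((1 - \<phi> / (pi/2)) * 0 + (\<phi> / (pi/2)) * (pi/2)) >= (1 - \<phi> / (pi/2)) * sin 0 + (\<phi> / (pi/2)) * sin (pi/2)"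
   using that concave_onD[of "{0..pi}" sin "\<phi> / (pi/2)" 0 "pi/2"] by (simp add: field_simps)
  then show ?thesis using pi_gt_zero by (simp add: field_simps)
 qed
 assume a: "(abs \<phi>) <= pi/2"
 show ?thesis
 proof (cases "0 <= \<phi>")
  case True
  then have "sin \<phi> >= 0" using a by (intro sin_ge_zero) auto
  then show ?thesis using pos[of \<phi>] True a by simp
 next
  case False
  then have "sin (- \<phi>) >= 0" using a by (intro sin_ge_zero) auto
  then show ?thesis using pos[of "- \<phi>"] False a by simp
 qed
qed

lemma sinh_lower: "(abs y) <= \<bar>sinh (y::real)\<bar>"
proof -
 have "y <= sinh y" if "0 <= y" for y :: real
 proof -
  have "sinh 0 - 0 <= sinh y - y"
  proof (rule DERIV_nonneg_imp_nondecreasing[OF that])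
   fix x :: real
   show "EX d. ((%x. sinh x - x) has_real_derivative d) (at x) & 0 <= d"
    by (intro exI[of _ "cosh x - 1"]) (auto intro!: derivative_eq_intros simp: cosh_real_ge_1)
  qed
  then show ?thesis by simp
 qed
 from this[of y] this[of "- y"] show ?thesis by (cases "0 <= y") auto
qed

text \<open>The norm dominates both |sin phi| and |sinh y|, which in turn are at least |phi|/2 and
  |y|.\<close>

lemma SS_lower:
 assumes "(abs \<phi>) <= pi/2"
 shows "(abs \<phi>) + (abs y) <= 4 * norm (SS \<phi> y)"
proof -
 have "\<bar>sin \<phi>\<bar> ^ 2 <= norm (SS \<phi> y) ^ 2" "\<bar>sinh y\<bar> ^ 2 <= norm (SS \<phi> y) ^ 2" unfolding norm_SS by auto
 then have "\<bar>sin \<phi>\<bar> <= norm (SS \<phi> y)" "\<bar>sinh y\<bar> <= norm (SS \<phi> y)"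
  using power2_le_imp_le[OF _ norm_ge_zero] by blast+
 moreover have "(abs \<phi>) <= 2 * \<bar>sin \<phi>\<bar>"
 proof -
  have "pi/2 * \<bar>sin \<phi>\<bar> <= 2 * \<bar>sin \<phi>\<bar>" using pi_less_4 by (intro mult_right_mono) auto
  then show ?thesis using sin_lower[OF assms] by linarith
 qed
 ultimately show ?thesis using sinh_lower[of y] norm_ge_zero[of "SS \<phi> y"] by linarith
qed

lemma power_diff_bound:
 fixes z w :: complex
 assumes "norm z <= M" "norm w <= M" "1 <= M"
 shows "norm (z ^ m - w ^ m) <= real m * M ^ m * norm (z - w)"
proof (induction m)
 case (Suc m)
 have "z ^ Suc m - w ^ Suc m = z * (z ^ m - w ^ m) + (z - w) * w ^ m" by (simp add: algebra_simps)
 then have "norm (z ^ Suc m - w ^ Suc m) <= norm z * norm (z ^ m - w ^ m) + norm (z - w) * norm w ^ m"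
  by (metis norm_mult norm_power norm_triangle_ineq)
 also have "... <= M * (real m * M ^ m * norm (z - w)) + norm (z - w) * M ^ Suc m"
 proof (intro add_mono mult_mono Suc)
  have "norm w ^ m <= M ^ m" using assms by (intro power_mono) auto
  also have "... <= M ^ Suc m" using assms by (intro power_increasing) auto
  finally show "norm w ^ m <= M ^ Suc m" .
 qed (use assms in auto)
 also have "... = real (Suc m) * M ^ Suc m * norm (z - w)" by (simp add: algebra_simps)
 finally show ?case .
qed simp

lemma Fr_near: "\<bar>Fr \<alpha> \<phi> - 1/2\<bar> <= (abs \<phi>) / cosint \<alpha>"
proof -
 have "norm (Fr \<alpha> \<phi> - Fr \<alpha> 0) <= 1 / cosint \<alpha> * norm (\<phi> - 0)"
 proof (rule field_differentiable_bound[of UNIV])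
  show "(Fr \<alpha> has_real_derivative cos x ^ \<alpha> / cosint \<alpha>) (at x within UNIV)" for x using Fr_deriv .
  show "norm (cos x ^ \<alpha> / cosint \<alpha>) <= 1 / cosint \<alpha>" for x
  proof -
   have "\<bar>cos x\<bar> ^ \<alpha> <= 1" by (intro power_le_one) auto
   then show ?thesis using cosint_pos[of \<alpha>] by (simp add: power_abs divide_right_mono abs_of_pos)
  qed
 qed auto
 then show ?thesis by (simp add: Fr_def Fc_0)
qed

lemma qq_bounds:
 assumes "(abs \<phi>) <= pi/2"
 shows "0 <= qq \<phi> y" "qq \<phi> y <= 1" "qq \<phi> y <= 1 / cosh y"
proof -
 have c: "0 <= cos \<phi>" "cos \<phi> <= 1" using assms by (auto intro: cos_ge_zero)
 then show "0 <= qq \<phi> y" by (simp add: qq_def)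
 show "qq \<phi> y <= 1 / cosh y" unfolding qq_def using c by (intro divide_right_mono) auto
 also have "... <= 1" using cosh_real_ge_1[of y] by simp
 finally show "qq \<phi> y <= 1" .
qed

lemma qq_near:
 assumes "(abs \<phi>) <= pi/2"
 shows "1 - qq \<phi> y <= (abs \<phi>) + (abs y)"
proof -
 have "\<bar>cos \<phi> - cos 0\<bar> <= 1 * \<bar>\<phi> - 0\<bar>"
  using field_differentiable_bound[of UNIV cos "%x. - sin x" 1 \<phi> 0] by (auto intro!: derivative_eq_intros)
 then have 1: "1 - cos \<phi> <= (abs \<phi>)" by simp
 have "\<bar>1 / cosh y - 1 / cosh 0\<bar> <= 1 * \<bar>y - 0\<bar>"
 proof -
  have "norm (1 / cosh y - 1 / cosh 0) <= 1 * norm (y - 0)"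
  proof (rule field_differentiable_bound[of UNIV "%y. 1 / cosh y" "%x. - sinh x / cosh x ^ 2"])
   show "((%y. 1 / cosh y) has_real_derivative - sinh x / cosh x ^ 2) (at x within UNIV)" for x :: real
    by (auto intro!: derivative_eq_intros simp: power2_eq_square)
   show "norm (- sinh x / cosh x ^ 2) <= 1" for x :: real
   proof -
    have "\<bar>sinh x\<bar> <= cosh x" by (rule abs_le_square_iff[THEN iffD2, of "sinh x" "cosh x", simplified abs_of_pos[OF cosh_real_pos]]) (simp add: cosh_square_eq)
    also have "... <= cosh x ^ 2" using cosh_real_ge_1[of x] by (simp add: power2_eq_square)
    finally show ?thesis by (simp add: divide_le_eq)
   qed
  qed auto
  then show ?thesis by simp
 qed
 then have 2: "1 - 1 / cosh y <= (abs y)" by simp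
 have "1 - qq \<phi> y = (1 - cos \<phi>) + cos \<phi> * (1 - 1 / cosh y)" by (simp add: qq_def algebra_simps)
 moreover have "cos \<phi> * (1 - 1 / cosh y) <= 1 * (1 - 1 / cosh y)"
  using cosh_real_ge_1[of y] by (intro mult_right_mono) auto
 ultimately have "1 - qq \<phi> y <= (1 - cos \<phi>) + (1 - 1 / cosh y)" by simp
 also have "... <= (abs \<phi>) + (abs y)" by (rule add_mono[OF 1 2])
 finally show ?thesis .
qed

lemma qq_pow_near:
 assumes "(abs \<phi>) <= pi/2"
 shows "\<bar>1 - qq \<phi> y ^ \<alpha>\<bar> <= real \<alpha> * ((abs \<phi>) + (abs y))"
proof -
 note q = qq_bounds[OF assms, of y]
 have "qq \<phi> y ^ \<alpha> >= 1 + real \<alpha> * (qq \<phi> y - 1)"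
  using Bernoulli_inequality[of "qq \<phi> y - 1" \<alpha>] q by simp
 moreover have "qq \<phi> y ^ \<alpha> <= 1" using q by (intro power_le_one)
 moreover have "real \<alpha> * (1 - qq \<phi> y) <= real \<alpha> * ((abs \<phi>) + (abs y))"
  using qq_near[OF assms] by (intro mult_left_mono) auto
 ultimately show ?thesis by (simp add: algebra_simps)
qed

text \<open>The constants add up the Lipschitz bounds of \<open>Fr\<close>, of \<open>Wy\<close> for
  |y| at most 1, and of the power of \<open>qq\<close>; the last counts twice for k = 1, where it is
  multiplied by k once more.\<close>

lemma EE_near:
 assumes "(abs \<phi>) <= pi/2" "(abs y) <= 1"
 shows "norm (EE 0 \<phi> y) <= (1 / cosint \<alpha> + cosh 1 ^ \<alpha> / cosint \<alpha> + real \<alpha>) * ((abs \<phi>) + (abs y))"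
  "norm (EE 1 \<phi> y - 1) <= (1 / cosint \<alpha> + cosh 1 ^ \<alpha> / cosint \<alpha> + 2 * real \<alpha>) * ((abs \<phi>) + (abs y))"
proof -
 let ?c = "cosint \<alpha>" and ?r = "(abs \<phi>) + (abs y)"
 note q = qq_bounds[OF assms(1), of y]
 have c: "?c > 0" by (rule cosint_pos)
 have e: "EE 0 \<phi> y = of_real (Fr \<alpha> \<phi> - 1/2) - of_real (qq \<phi> y ^ \<alpha>) * (Wy y - 1/2) + of_real ((1 - qq \<phi> y ^ \<alpha>) / 2)"
  by (simp add: EE_def algebra_simps diff_divide_distrib)
 have 1: "norm (complex_of_real (Fr \<alpha> \<phi> - 1/2)) <= 1 / ?c * ?r"
 proof -
  have "norm (complex_of_real (Fr \<alpha> \<phi> - 1/2)) = \<bar>Fr \<alpha> \<phi> - 1/2\<bar>" by (simp only: norm_of_real)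
  also have "... <= (abs \<phi>) / ?c" by (rule Fr_near)
  also have "... <= ?r / ?c" using c by (intro divide_right_mono) auto
  finally show ?thesis by simp
 qed
 have 2: "norm (complex_of_real (qq \<phi> y ^ \<alpha>) * (Wy y - 1/2)) <= cosh 1 ^ \<alpha> / ?c * ?r"
 proof -
  have "norm (complex_of_real (qq \<phi> y ^ \<alpha>) * (Wy y - 1/2)) = qq \<phi> y ^ \<alpha> * norm (Wy y - 1/2)"
   using q by (simp add: norm_mult norm_power)
  also have "... <= 1 * norm (Wy y - 1/2)" using q by (intro mult_right_mono power_le_one) auto
  also have "... <= (abs y) * cosh y ^ \<alpha> / ?c" using Wy_near[of y] by simp
  also have "... <= ?r * cosh 1 ^ \<alpha> / ?c"
  proof -
   have "cosh y <= cosh 1" using assms(2) cosh_real_nonneg_le_iff[of "(abs y)" 1] by (simp add: cosh_real_abs)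
   then show ?thesis using c by (intro divide_right_mono mult_mono power_mono) auto
  qed
  finally show ?thesis by (simp add: mult.commute)
 qed
 have 3: "norm (complex_of_real ((1 - qq \<phi> y ^ \<alpha>) / 2)) <= real \<alpha> * ?r"
 proof -
  have "norm (complex_of_real ((1 - qq \<phi> y ^ \<alpha>) / 2)) = \<bar>1 - qq \<phi> y ^ \<alpha>\<bar> / 2" by (simp only: norm_of_real abs_divide abs_numeral)
  then show ?thesis using qq_pow_near[OF assms(1), of y] by simp
 qed
 show E0: "norm (EE 0 \<phi> y) <= (1 / ?c + cosh 1 ^ \<alpha> / ?c + real \<alpha>) * ?r"
 proof -
  have "norm (EE 0 \<phi> y) <= norm (complex_of_real (Fr \<alpha> \<phi> - 1/2)) + norm (complex_of_real (qq \<phi> y ^ \<alpha>) * (Wy y - 1/2)) + norm (complex_of_real ((1 - qq \<phi> y ^ \<alpha>) / 2))"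
   unfolding e by (rule order_trans[OF norm_triangle_ineq add_right_mono[OF norm_triangle_ineq4]])
  also have "... <= 1 / ?c * ?r + cosh 1 ^ \<alpha> / ?c * ?r + real \<alpha> * ?r" by (intro add_mono 1 2 3)
  finally show ?thesis by (simp only: distrib_right)
 qed
 have "EE 1 \<phi> y - 1 = EE 0 \<phi> y - of_real (1 - qq \<phi> y ^ \<alpha>)" by (simp add: EE_def algebra_simps)
 then have "norm (EE 1 \<phi> y - 1) <= norm (EE 0 \<phi> y) + norm (complex_of_real (1 - qq \<phi> y ^ \<alpha>))"
  by (metis norm_triangle_ineq4)
 also have "... <= (1 / ?c + cosh 1 ^ \<alpha> / ?c + real \<alpha>) * ?r + real \<alpha> * ?r"
  using add_mono[OF E0 qq_pow_near[OF assms(1), of y]] by (simp only: norm_of_real)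
 finally show "norm (EE 1 \<phi> y - 1) <= (1 / ?c + cosh 1 ^ \<alpha> / ?c + 2 * real \<alpha>) * ?r" by (simp add: algebra_simps)
qed

text \<open>Applied to numerators, with m at least 1, this vanishes at the pole: \<open>EE\<close>
  is 1 there for k = 1 and 0 for k = 0, so the value is 1 + 0 - 1. The sign (-1)^m does not matter
  for that; it is chosen so that the integral carries the parity factors of the geometric
  recursion.\<close>

definition comb :: "nat => (nat => complex => complex) => complex" where
 "comb m f = f m 1 + (-1) ^ m * f m 0 - f 0 0"

text \<open>The numerator is bounded by a multiple of |phi| + |y|, and so is |phi| + |y| by the
  denominator.\<close>

lemma comb_bound:
 assumes m: "m >= 1"
 obtains C where "!!\<phi> y. (abs \<phi>) <= pi/2 ==> (abs y) <= 1 ==> norm (comb m (%m k. WW m k \<phi> y)) <= C"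
proof -
 define K where "K = 1 / cosint \<alpha> + cosh 1 ^ \<alpha> / cosint \<alpha> + 2 * real \<alpha>"
 have K: "K >= 0" unfolding K_def using cosint_pos[of \<alpha>] by (auto intro!: add_nonneg_nonneg divide_nonneg_pos)
 define Mx where "Mx = 1 + K * 3"
 have Mx: "Mx >= 1" using K by (simp add: Mx_def)
 \<comment> \<open>8 is 2, for the two m-th powers, times the 4 of \<open>SS_lower\<close>.
   \<open>Mx\<close> bounds both values of \<open>EE\<close>, as |phi| + |y| is at most 3 in the
   region.\<close>
 define C where "C = 8 * (real m * Mx ^ m * K)"
 have "norm (comb m (%m k. WW m k \<phi> y)) <= C" if a: "(abs \<phi>) <= pi/2" "(abs y) <= 1" for \<phi> y
 proof -
  let ?r = "(abs \<phi>) + (abs y)" and ?E0 = "EE 0 \<phi> y" and ?E1 = "EE 1 \<phi> y"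
  have r3: "?r <= 3" using a pi_less_4 by linarith
  have E0: "norm ?E0 <= K * ?r"
  proof -
   have "(1 / cosint \<alpha> + cosh 1 ^ \<alpha> / cosint \<alpha> + real \<alpha>) * ?r <= K * ?r" by (intro mult_right_mono) (auto simp: K_def)
   then show ?thesis using EE_near(1)[OF a] by linarith
  qed
  have E1: "norm (?E1 - 1) <= K * ?r" using EE_near(2)[OF a] by (simp add: K_def)
  have Kr: "K * ?r <= K * 3" using K r3 by (intro mult_left_mono)
  have b0: "norm ?E0 <= Mx" "norm ?E1 <= Mx"
  proof -
   show "norm ?E0 <= Mx" using E0 Kr by (simp add: Mx_def)
   have "norm ?E1 <= norm (?E1 - 1) + norm (1 :: complex)" by (metis diff_add_cancel norm_triangle_ineq)
   then show "norm ?E1 <= Mx" using E1 Kr by (simp add: Mx_def)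
  qed
  have p0: "norm (?E0 ^ m) <= real m * Mx ^ m * (K * ?r)"
  proof -
   have "norm (?E0 ^ m - 0 ^ m) <= real m * Mx ^ m * norm (?E0 - 0)"
    using b0 Mx by (intro power_diff_bound) auto
   also have "... <= real m * Mx ^ m * (K * ?r)" using E0 Mx by (intro mult_left_mono) auto
   finally show ?thesis using m by (simp add: power_0_left)
  qed
  have p1: "norm (?E1 ^ m - 1) <= real m * Mx ^ m * (K * ?r)"
  proof -
   have "norm (?E1 ^ m - 1 ^ m) <= real m * Mx ^ m * norm (?E1 - 1)"
    using b0 Mx by (intro power_diff_bound) auto
   also have "... <= real m * Mx ^ m * (K * ?r)" using E1 Mx by (intro mult_left_mono) auto
   finally show ?thesis by simp
  qed
  have eq: "comb m (%m k. WW m k \<phi> y) = of_real (qq \<phi> y ^ (\<kappa> + 1)) * ((?E1 ^ m - 1) + (-1) ^ m * ?E0 ^ m) / SS \<phi> y"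
   by (simp add: comb_def WW_def TT_def algebra_simps add_divide_distrib diff_divide_distrib)
  have n1: "norm (of_real (qq \<phi> y ^ (\<kappa> + 1)) * ((?E1 ^ m - 1) + (-1) ^ m * ?E0 ^ m)) <= 2 * (real m * Mx ^ m * (K * ?r))"
  proof -
   have "norm (complex_of_real (qq \<phi> y ^ (\<kappa> + 1))) <= 1"
    using qq_bounds[OF a(1), of y] power_le_one[of "qq \<phi> y" "\<kappa> + 1"] by (simp only: norm_of_real) (simp add: abs_of_nonneg)
   moreover have "norm ((?E1 ^ m - 1) + (-1) ^ m * ?E0 ^ m) <= 2 * (real m * Mx ^ m * (K * ?r))"
    by (rule order_trans[OF norm_triangle_ineq]) (use p0 p1 in \<open>simp add: norm_mult norm_power\<close>)
   ultimately have "norm (complex_of_real (qq \<phi> y ^ (\<kappa> + 1))) * norm ((?E1 ^ m - 1) + (-1) ^ m * ?E0 ^ m) <= 1 * (2 * (real m * Mx ^ m * (K * ?r)))"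
    by (intro mult_mono) auto
   then show ?thesis by (simp add: norm_mult)
  qed
  show ?thesis
  proof (cases "SS \<phi> y = 0")
   case True
   then show ?thesis unfolding eq using K Mx by (simp add: C_def)
  next
   case False
   have "2 * (real m * Mx ^ m * (K * ?r)) <= 2 * (real m * Mx ^ m * (K * (4 * norm (SS \<phi> y))))"
    using SS_lower[OF a(1), of y] K Mx by (intro mult_left_mono) auto
   then have "norm (of_real (qq \<phi> y ^ (\<kappa> + 1)) * ((?E1 ^ m - 1) + (-1) ^ m * ?E0 ^ m)) <= C * norm (SS \<phi> y)"
    using n1 by (simp add: C_def algebra_simps)
   then show ?thesis unfolding eq norm_divide using False by (simp add: divide_le_eq)
  qed
 qed
 then show ?thesis using that by blast
qed

lemma power_le_fact_exp: "0 <= (x::real) ==> x ^ m <= fact m * exp x"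
proof -
 assume x: "0 <= x"
 have s: "summable (%n. x ^ n /\<^sub>R fact n)" by (rule sums_summable[OF exp_converges])
 have "(\<Sum>n\<in>{m}. x ^ n /\<^sub>R fact n) <= (\<Sum>n. x ^ n /\<^sub>R fact n)"
  by (rule sum_le_suminf[OF s]) (use x in auto)
 then have "x ^ m / fact m <= exp x" using sums_unique[OF exp_converges[of x]] by (simp add: field_simps)
 then show ?thesis by (simp add: pos_divide_le_eq mult.commute)
qed

text \<open>The factor |y| in the growth of \<open>Wy\<close>, taken to any power, costs only one
  factor cosh y. This is why the exponent \<alpha> j + 2 suffices in
  \<open>integrable_Wy\<close>.\<close>

lemma poly_le_cosh: "(1 + (abs y)) ^ m <= 2 * exp 1 * fact m * cosh (y::real)"
proof -
 have "(1 + (abs y)) ^ m <= fact m * exp (1 + (abs y))" by (rule power_le_fact_exp) auto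
 also have "exp (1 + (abs y)) = exp 1 * exp (abs y)" by (rule exp_add)
 also have "exp (abs y) <= 2 * cosh (abs y)" by (simp add: cosh_def)
 finally show ?thesis by (simp add: mult_ac)
qed

lemma norm_Wy_affine:
 assumes "norm k <= 1"
 shows "norm (Wy y - k) <= (3/2 + 1 / cosint \<alpha>) * (1 + (abs y)) * cosh y ^ \<alpha>"
proof -
 let ?c = "cosint \<alpha>"
 have c: "?c > 0" by (rule cosint_pos)
 have 1: "1 <= cosh y ^ \<alpha>" using cosh_real_ge_1[of y] by (rule one_le_power)
 have "norm (Wy y - k) <= norm (Wy y) + norm k" by (rule norm_triangle_ineq4)
 also have "... <= 1/2 + (abs y) * cosh y ^ \<alpha> / ?c + 1" using norm_Wy[of y] assms by linarith
 also have "... <= 3/2 * ((1 + (abs y)) * cosh y ^ \<alpha>) + (1 / ?c) * ((1 + (abs y)) * cosh y ^ \<alpha>)"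
 proof -
  have "1 <= (1 + (abs y)) * cosh y ^ \<alpha>" using mult_mono[OF _ 1, of 1 "1 + (abs y)"] by simp
  moreover have "(abs y) * cosh y ^ \<alpha> <= (1 + (abs y)) * cosh y ^ \<alpha>" using 1 by (intro mult_right_mono) auto
  then have "(abs y) * cosh y ^ \<alpha> / ?c <= 1 / ?c * ((1 + (abs y)) * cosh y ^ \<alpha>)" using c by (simp add: divide_le_cancel)
  ultimately show ?thesis by linarith
 qed
 finally show ?thesis by (simp only: distrib_right mult.assoc)
qed

section \<open>Expansion of the double integral into products of single integrals\<close>

definition BB where "BB p j = (LINT y|lborel. Wy y ^ j / of_real (cosh y ^ p))"

lemma Wy_meas [measurable]: "Wy : borel_measurable borel"
 by (rule borel_measurable_continuous_onI[OF cont_Wy])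

lemma cosh_meas [measurable]: "(cosh :: real => real) : borel_measurable borel"
 by (rule borel_measurable_continuous_onI) (intro continuous_intros)

lemma integrable_Wy:
 assumes p: "\<alpha> * j + 2 <= p"
 shows "integrable lborel (%y. Wy y ^ j / complex_of_real (cosh y ^ p))"
proof -
 let ?K = "(3/2 + 1 / cosint \<alpha>) ^ j * (2 * exp 1 * fact j)"
 have K0: "3/2 + 1 / cosint \<alpha> >= 0" using cosint_pos[of \<alpha>] by (simp add: add_nonneg_nonneg)
 show ?thesis
 proof (rule Bochner_Integration.integrable_bound)
  show "integrable lborel (%y::real. ?K * (1 / cosh y ^ (0 + 1)))"
   using cosh_power_integral[of 0] by (intro integrable_mult_right) (auto simp: has_bochner_integral_iff)
  show "(%y. Wy y ^ j / complex_of_real (cosh y ^ p)) : borel_measurable lborel" by measurable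
  show "AE y in lborel. norm (Wy y ^ j / complex_of_real (cosh y ^ p)) <= norm (?K * (1 / cosh y ^ (0 + 1)))"
  proof (intro AE_I2)
   fix y :: real
   have cp: "1 <= cosh y" by (rule cosh_real_ge_1)
   have "norm (Wy y ^ j / complex_of_real (cosh y ^ p)) = norm (Wy y) ^ j / cosh y ^ p"
    using cp by (simp add: norm_divide norm_power)
   also have "... <= ((3/2 + 1 / cosint \<alpha>) * (1 + (abs y)) * cosh y ^ \<alpha>) ^ j / cosh y ^ p"
    using norm_Wy_affine[of 0 y] cp by (intro divide_right_mono power_mono) auto
   also have "... = (3/2 + 1 / cosint \<alpha>) ^ j * (1 + (abs y)) ^ j * cosh y ^ (\<alpha> * j) / cosh y ^ p"
    by (simp add: power_mult_distrib power_mult)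
   also have "... <= (3/2 + 1 / cosint \<alpha>) ^ j * (2 * exp 1 * fact j * cosh y) * cosh y ^ (\<alpha> * j) / cosh y ^ p"
    using poly_le_cosh[of y j] cp K0 by (intro divide_right_mono mult_right_mono mult_left_mono) auto
   also have "... = ?K * (cosh y ^ (\<alpha> * j + 1) / cosh y ^ p)" by simp
   also have "... <= ?K * (cosh y ^ (\<alpha> * j + 1) / cosh y ^ (\<alpha> * j + 2))"
    using cp p K0 by (intro mult_left_mono divide_left_mono power_increasing mult_pos_pos mult_nonneg_nonneg) auto
   also have "... = norm (?K * (1 / cosh y ^ (0 + 1)))" using cp K0 by simp
   finally show "norm (Wy y ^ j / complex_of_real (cosh y ^ p)) <= norm (?K * (1 / cosh y ^ (0 + 1)))" .
  qed
 qed
qed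

lemma BB_0: "BB (p + 1) 0 = of_real (cosint p)"
proof -
 have "BB (p + 1) 0 = (LINT y|lborel. complex_of_real (1 / cosh y ^ (p + 1)))" by (simp add: BB_def)
 also have "... = of_real (LINT y|lborel. 1 / cosh y ^ (p + 1))" by (rule integral_complex_of_real)
 also have "(LINT y|lborel. 1 / cosh y ^ (p + 1)) = cosint p"
  using cosh_power_integral[of p] by (simp add: has_bochner_integral_iff)
 finally show ?thesis .
qed

lemma BB_reflect:
 "integrable lborel (%y. Wy y ^ j / complex_of_real (cosh y ^ p)) ==> has_bochner_integral lborel (%y. (1 - Wy y) ^ j / complex_of_real (cosh y ^ p)) (BB p j)"
 using lborel_has_bochner_integral_real_affine_iff[of "-1" "%y. Wy y ^ j / complex_of_real (cosh y ^ p)" "BB p j" 0]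
 by (simp add: Wy_minus BB_def has_bochner_integral_iff)

definition AA where "AA p r = integral half_circle (%\<phi>. cos \<phi> ^ p * Fr \<alpha> \<phi> ^ r)"

lemma sum_binomial_times:
 fixes u v :: complex
 shows "(\<Sum>j\<le>m. of_nat (m choose j) * of_nat j * u ^ (m - j) * v ^ j) = of_nat m * v * (u + v) ^ (m - 1)"
proof (cases m)
 case (Suc l)
 have "(\<Sum>j\<le>Suc l. of_nat (Suc l choose j) * of_nat j * u ^ (Suc l - j) * v ^ j)
   = (\<Sum>j\<le>l. of_nat (Suc l choose Suc j) * of_nat (Suc j) * u ^ (l - j) * v ^ Suc j)"
  by (subst sum.atMost_Suc_shift) simp
 also have "... = (\<Sum>j\<le>l. of_nat (Suc l) * v * (of_nat (l choose j) * v ^ j * u ^ (l - j)))"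
 proof (rule sum.cong[OF refl])
  fix j
  have "of_nat (Suc l choose Suc j) * of_nat (Suc j) = (of_nat (Suc l) * of_nat (l choose j) :: complex)"
   using Suc_times_binomial_eq[of l j] by (metis of_nat_mult mult.commute)
  then show "of_nat (Suc l choose Suc j) * of_nat (Suc j) * u ^ (l - j) * v ^ Suc j = of_nat (Suc l) * v * (of_nat (l choose j) * v ^ j * u ^ (l - j))"
   by (simp only: power_Suc mult_ac)
 qed
 also have "... = of_nat (Suc l) * v * (v + u) ^ l"
  by (simp only: binomial_ring[of v u l] sum_distrib_left)
 finally show ?thesis using Suc by (simp add: add.commute)
qed simp

text \<open>Expand the power of \<open>EE\<close> by the binomial theorem. The j-th term has degree
  \<kappa> + \<alpha> j in \<open>qq\<close>; its coefficient collects \<kappa> + 1 from the outer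
  power and \<alpha> j from the derivative of \<open>EE\<close>.\<close>

lemma Iint_expand:
 "Iint m k \<phi> y = (\<Sum>j\<le>m. of_nat (m choose j) * of_real (real (\<kappa> + \<alpha> * j + 1) * (cos \<phi> ^ (\<kappa> + \<alpha> * j) * Fr \<alpha> \<phi> ^ (m - j)))
   * ((k - Wy y) ^ j / of_real (cosh y ^ (\<kappa> + \<alpha> * j + 2))))"
proof -
 define q where "q = complex_of_real (qq \<phi> y)"
 define u where "u = complex_of_real (Fr \<alpha> \<phi>)"
 define v where "v = q ^ \<alpha> * (k - Wy y)"
 define h where "h = complex_of_real (cosh y ^ 2)"
 have E: "EE k \<phi> y = u + v" by (simp add: EE_def u_def v_def q_def algebra_simps)
 have qa: "of_nat \<alpha> * (q * q ^ (\<alpha> - 1)) = of_nat \<alpha> * q ^ \<alpha>" by (cases "\<alpha> = 0") (simp_all flip: power_Suc)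
 have "Iint m k \<phi> y = (of_nat (\<kappa> + 1) * q ^ \<kappa> * (u + v) ^ m + q ^ \<kappa> * (of_nat \<alpha> * (q * q ^ (\<alpha> - 1))) * (of_nat m * (k - Wy y) * (u + v) ^ (m - 1))) / h"
  unfolding Iint_def E h_def q_def by (simp add: algebra_simps)
 also have "... = (of_nat (\<kappa> + 1) * q ^ \<kappa> * (u + v) ^ m + q ^ \<kappa> * of_nat \<alpha> * (of_nat m * v * (u + v) ^ (m - 1))) / h"
  unfolding qa by (simp add: v_def)
 also have "(u + v) ^ m = (\<Sum>j\<le>m. of_nat (m choose j) * u ^ (m - j) * v ^ j)"
  using binomial_ring[of v u m] by (simp add: add.commute mult_ac)
 also have "of_nat m * v * (u + v) ^ (m - 1) = (\<Sum>j\<le>m. of_nat (m choose j) * of_nat j * u ^ (m - j) * v ^ j)"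
  by (rule sum_binomial_times[symmetric])
 also have "(of_nat (\<kappa> + 1) * q ^ \<kappa> * (\<Sum>j\<le>m. of_nat (m choose j) * u ^ (m - j) * v ^ j) + q ^ \<kappa> * of_nat \<alpha> * (\<Sum>j\<le>m. of_nat (m choose j) * of_nat j * u ^ (m - j) * v ^ j)) / h
  = (\<Sum>j\<le>m. of_nat (\<kappa> + \<alpha> * j + 1) * of_nat (m choose j) * u ^ (m - j) * (q ^ \<kappa> * v ^ j / h))"
  unfolding sum_distrib_left sum.distrib[symmetric] sum_divide_distrib
  by (rule sum.cong[OF refl]) (simp add: algebra_simps add_divide_distrib)
 also have "... = (\<Sum>j\<le>m. of_nat (m choose j) * of_real (real (\<kappa> + \<alpha> * j + 1) * (cos \<phi> ^ (\<kappa> + \<alpha> * j) * Fr \<alpha> \<phi> ^ (m - j)))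
   * ((k - Wy y) ^ j / of_real (cosh y ^ (\<kappa> + \<alpha> * j + 2))))"
 proof (rule sum.cong[OF refl])
  fix j
  have "q ^ \<kappa> * v ^ j / h = q ^ (\<kappa> + \<alpha> * j) * (k - Wy y) ^ j / h"
   by (simp add: v_def power_mult_distrib power_add power_mult)
  also have "q ^ (\<kappa> + \<alpha> * j) = of_real (cos \<phi> ^ (\<kappa> + \<alpha> * j)) / of_real (cosh y ^ (\<kappa> + \<alpha> * j))"
   by (simp add: q_def qq_def power_divide)
  finally have e: "q ^ \<kappa> * v ^ j / h = of_real (cos \<phi> ^ (\<kappa> + \<alpha> * j)) / of_real (cosh y ^ (\<kappa> + \<alpha> * j)) * (k - Wy y) ^ j / h" .
  have "complex_of_real (cosh y ^ (\<kappa> + \<alpha> * j + 2)) = of_real (cosh y ^ (\<kappa> + \<alpha> * j)) * h" by (simp add: h_def power_add power2_eq_square)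
  with e have "q ^ \<kappa> * v ^ j / h = of_real (cos \<phi> ^ (\<kappa> + \<alpha> * j)) * ((k - Wy y) ^ j / of_real (cosh y ^ (\<kappa> + \<alpha> * j + 2)))"
   by (simp only: times_divide_eq_left times_divide_eq_right divide_divide_eq_left)
  then show "of_nat (\<kappa> + \<alpha> * j + 1) * of_nat (m choose j) * u ^ (m - j) * (q ^ \<kappa> * v ^ j / h) = of_nat (m choose j) * of_real (real (\<kappa> + \<alpha> * j + 1) * (cos \<phi> ^ (\<kappa> + \<alpha> * j) * Fr \<alpha> \<phi> ^ (m - j)))
   * ((k - Wy y) ^ j / of_real (cosh y ^ (\<kappa> + \<alpha> * j + 2)))"
   by (simp only: u_def of_real_mult of_real_power of_real_of_nat_eq mult_ac)
 qed
 finally show ?thesis .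
qed

lemma Iy_expand:
 "Iy m k y = (\<Sum>j\<le>m. of_nat (m choose j) * of_real (real (\<kappa> + \<alpha> * j + 1) * AA (\<kappa> + \<alpha> * j) (m - j))
   * ((k - Wy y) ^ j / of_real (cosh y ^ (\<kappa> + \<alpha> * j + 2))))"
proof -
 have "((%\<phi>. complex_of_real (real (\<kappa> + \<alpha> * j + 1) * (cos \<phi> ^ (\<kappa> + \<alpha> * j) * Fr \<alpha> \<phi> ^ (m - j)))) has_integral of_real (real (\<kappa> + \<alpha> * j + 1) * AA (\<kappa> + \<alpha> * j) (m - j))) half_circle" for j
  unfolding AA_def
  by (intro has_integral_of_real has_integral_mult_right integrable_integral integrable_continuous_real continuous_intros)
 then have "((%\<phi>. Iint m k \<phi> y) has_integral (\<Sum>j\<le>m. of_nat (m choose j) * of_real (real (\<kappa> + \<alpha> * j + 1) * AA (\<kappa> + \<alpha> * j) (m - j))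
   * ((k - Wy y) ^ j / of_real (cosh y ^ (\<kappa> + \<alpha> * j + 2))))) half_circle"
  unfolding Iint_expand by (intro has_integral_sum has_integral_mult_left has_integral_mult_right) auto
 then show ?thesis unfolding Iy_def by (rule integral_unique)
qed

lemma AA_0: "AA p 0 = cosint p"
 by (simp add: AA_def cosint_def)

text \<open>For k = 1 the reflection y -> -y turns (1 - \<open>Wy\<close>)^j into
  \<open>Wy\<close>^j, for k = 0 a sign (-1)^j comes out; together with the sign in
  \<open>comb\<close> this gives 1 + (-1)^(m + j). The zeroth power integrates to (\<kappa> + 1)
  \<open>cosint \<kappa>\<close> \<open>cosint (\<kappa> + 1)\<close>, which is 2 pi by
  \<open>cosint_mult\<close>.\<close>

lemma comb_Iy_integral:
 "has_bochner_integral lborel (%y. comb m (%m k. Iy m k y))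
  ((\<Sum>j\<le>m. of_nat (m choose j) * of_real (real (\<kappa> + \<alpha> * j + 1) * AA (\<kappa> + \<alpha> * j) (m - j))
    * ((1 + (-1) ^ (m + j)) * BB (\<kappa> + \<alpha> * j + 2) j)) - of_real (2 * pi))"
proof -
 let ?a = "%m j. of_nat (m choose j) * complex_of_real (real (\<kappa> + \<alpha> * j + 1) * AA (\<kappa> + \<alpha> * j) (m - j))"
 let ?B = "%j. BB (\<kappa> + \<alpha> * j + 2) j"
 have int: "integrable lborel (%y. Wy y ^ j / complex_of_real (cosh y ^ (\<kappa> + \<alpha> * j + 2)))" for j
  by (rule integrable_Wy) simp
 have hb0: "has_bochner_integral lborel (%y. Wy y ^ j / complex_of_real (cosh y ^ (\<kappa> + \<alpha> * j + 2))) (?B j)" for j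
  using int[of j] by (simp add: BB_def has_bochner_integral_iff)
 have i1: "has_bochner_integral lborel (%y. Iy m 1 y) (\<Sum>j\<le>m. ?a m j * ?B j)"
  unfolding Iy_expand by (intro has_bochner_integral_sum has_bochner_integral_mult_right BB_reflect int)
 have i0: "has_bochner_integral lborel (%y. Iy m 0 y) (\<Sum>j\<le>m. ?a m j * ((-1) ^ j * ?B j))" for m
 proof -
  have e: "(0 - Wy y) ^ j / complex_of_real (cosh y ^ p) = (-1) ^ j * (Wy y ^ j / complex_of_real (cosh y ^ p))" for j y p
   using power_minus[of "Wy y" j] by simp
  show ?thesis unfolding Iy_expand e
   by (intro has_bochner_integral_sum has_bochner_integral_mult_right hb0)
 qed
 have i00: "has_bochner_integral lborel (%y. Iy 0 0 y) (of_real (2 * pi))"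
 proof -
  have "(\<Sum>j\<le>0. ?a 0 j * ((-1) ^ j * ?B j)) = of_real ((real \<kappa> + 1) * (cosint \<kappa> * cosint (\<kappa> + 1)))"
   using BB_0[of "\<kappa> + 1"] by (simp add: AA_0 numeral_2_eq_2)
  also have "(real \<kappa> + 1) * (cosint \<kappa> * cosint (\<kappa> + 1)) = 2 * pi"
   unfolding cosint_mult by (simp add: field_simps add_nonneg_eq_0_iff)
  finally show ?thesis using i0[of 0] by simp
 qed
 have "has_bochner_integral lborel (%y. comb m (%m k. Iy m k y))
   ((\<Sum>j\<le>m. ?a m j * ?B j) + (-1) ^ m * (\<Sum>j\<le>m. ?a m j * ((-1) ^ j * ?B j)) - of_real (2 * pi))"
  unfolding comb_def
  by (intro has_bochner_integral_diff has_bochner_integral_add has_bochner_integral_mult_right i1 i0 i00)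
 moreover have "(\<Sum>j\<le>m. ?a m j * ?B j) + (-1) ^ m * (\<Sum>j\<le>m. ?a m j * ((-1) ^ j * ?B j)) = (\<Sum>j\<le>m. ?a m j * ((1 + (-1) ^ (m + j)) * ?B j))"
  unfolding sum_distrib_left sum.distrib[symmetric]
  by (rule sum.cong[OF refl]) (simp add: algebra_simps power_add)
 ultimately show ?thesis by simp
qed

lemma comb_diff: "comb m (%m k. f m k - g m k) = comb m f - comb m g"
 by (simp add: comb_def algebra_simps)

lemma comb_mult: "comb m (%m k. c * f m k) = c * comb m f"
 by (simp add: comb_def algebra_simps)

lemma comb_has_integral:
 fixes f :: "nat => complex => real => complex"
 assumes "!!m k. (f m k has_integral I m k) S"
 shows "((%x. comb m (%m k. f m k x)) has_integral comb m I) S"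
 unfolding comb_def by (intro has_integral_diff has_integral_add has_integral_mult_right assms)

lemma WW_integrable: "y ~= 0 ==> (%\<phi>. WW m k \<phi> y) integrable_on half_circle"
 by (intro integrable_continuous_real continuous_on_WW continuous_intros SS_nz)

lemma comb_VV: "y ~= 0 ==> comb m (%m k. VV m k y) = integral half_circle (%\<phi>. comb m (%m k. WW m k \<phi> y))"
 unfolding VV_def
 by (rule integral_unique[symmetric], rule comb_has_integral, rule integrable_integral, rule WW_integrable)

text \<open>Dominated convergence with the bound \<open>comb_bound\<close>; only the angle 0, where
  the pole sits, has to be left out. The limit does not depend on the side from which 0 is
  approached.\<close>

lemma VV_at_0:
 assumes m: "m >= 1" and e: "\<epsilon> \<longlonglongrightarrow> 0" "!!n. \<epsilon> n ~= 0" "!!n. \<bar>\<epsilon> n\<bar> <= 1"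
 shows "(%n. comb m (%m k. VV m k (\<epsilon> n))) \<longlonglongrightarrow> integral (half_circle - {0}) (%\<phi>. comb m (%m k. WW m k \<phi> 0))"
proof -
 obtain C where C: "!!\<phi> y. (abs \<phi>) <= pi/2 ==> (abs y) <= 1 ==> norm (comb m (%m k. WW m k \<phi> y)) <= C"
  using comb_bound[OF m] by metis
 have sp: "integral (half_circle - {0}) (%\<phi>. f \<phi>) = integral half_circle f" for f :: "real => complex"
  by (rule integral_spike_set) (rule negligible_subset[of "{0}"]; auto)+
 have "(%n. integral (half_circle - {0}) (%\<phi>. comb m (%m k. WW m k \<phi> (\<epsilon> n)))) \<longlonglongrightarrow> integral (half_circle - {0}) (%\<phi>. comb m (%m k. WW m k \<phi> 0))"
 proof (rule dominated_convergence(2)[where h = "%_. C"])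
  show "(%\<phi>. comb m (%m k. WW m k \<phi> (\<epsilon> n))) integrable_on half_circle - {0}" for n
  proof -
   have "(%\<phi>. comb m (%m k. WW m k \<phi> (\<epsilon> n))) integrable_on half_circle"
    by (rule has_integral_integrable, rule comb_has_integral, rule integrable_integral, rule WW_integrable[OF e(2)])
   then show ?thesis by (rule integrable_spike_set) (rule negligible_subset[of "{0}"]; auto)+
  qed
  show "(%_. C) integrable_on half_circle - {0}"
  proof -
   have "(%_. C) integrable_on half_circle" by (rule integrable_const_ivl)
   then show ?thesis by (rule integrable_spike_set) (rule negligible_subset[of "{0}"]; auto)+
  qed
  show "norm (comb m (%m k. WW m k x (\<epsilon> n))) <= C" if "x : half_circle - {0}" for n x
   using that e(3) by (intro C) auto
  show "(%n. comb m (%m k. WW m k x (\<epsilon> n))) \<longlonglongrightarrow> comb m (%m k. WW m k x 0)" if x: "x : half_circle - {0}" for x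
  proof -
   have s: "SS x y ~= 0" for y
    proof -
    have "(abs x) <= pi/2" "x ~= 0" using x by auto
    then have "sin x ~= 0" using sin_lower[of x] by auto
    then show ?thesis using norm_SS[of x y] by (auto simp: add_nonneg_eq_0_iff)
   qed
   have "continuous_on UNIV (%y. comb m (%m k. WW m k x y))"
    unfolding comb_def by (intro continuous_intros continuous_on_WW s)
   then have "isCont (%y. comb m (%m k. WW m k x y)) 0" by (simp add: continuous_on_eq_continuous_at)
   then show ?thesis using e(1) by (rule isCont_tendsto_compose)
  qed
 qed
 then show ?thesis unfolding comb_VV[OF e(2)] sp .
qed

lemma EE_far:
 assumes "(abs \<phi>) <= pi/2" "norm k <= 1"
 shows "norm (EE k \<phi> y) <= (2 + 3 / cosint \<alpha>) * (1 + (abs y))"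
proof -
 let ?c = "cosint \<alpha>"
 have c: "?c > 0" by (rule cosint_pos)
 note q = qq_bounds[OF assms(1), of y]
 have 1: "\<bar>Fr \<alpha> \<phi>\<bar> <= 1/2 + 2 / ?c"
 proof -
  have "(abs \<phi>) / ?c <= 2 / ?c" using assms(1) pi_less_4 c by (intro divide_right_mono) auto
  then show ?thesis using Fr_near[of \<phi>] by linarith
 qed
 have "norm (EE k \<phi> y) <= \<bar>Fr \<alpha> \<phi>\<bar> + qq \<phi> y ^ \<alpha> * norm (Wy y - k)"
  unfolding EE_def using norm_triangle_ineq4[of "of_real (Fr \<alpha> \<phi>)" "of_real (qq \<phi> y ^ \<alpha>) * (Wy y - k)"] q
  by (simp add: norm_mult norm_power)
 also have "qq \<phi> y ^ \<alpha> * norm (Wy y - k) <= (1 / cosh y) ^ \<alpha> * ((3/2 + 1 / ?c) * (1 + (abs y)) * cosh y ^ \<alpha>)"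
  using q by (intro mult_mono norm_Wy_affine assms power_mono) auto
 also have "... = (3/2 + 1 / ?c) * (1 + (abs y))" by (simp add: power_divide)
 finally have 2: "norm (EE k \<phi> y) <= 1/2 + 2 / ?c + (3/2 + 1 / ?c) * (1 + (abs y))" using 1 by linarith
 have "1/2 + 2 / ?c <= (1/2 + 2 / ?c) * (1 + (abs y))" using c mult_left_mono[of 1 "1 + (abs y)" "1/2 + 2 / ?c"] by simp
 note order_trans[OF 2 add_right_mono[OF this]]
 also have "(1/2 + 2 / ?c) * (1 + (abs y)) + (3/2 + 1 / ?c) * (1 + (abs y)) = (2 + 3 / ?c) * (1 + (abs y))" by (simp add: algebra_simps add_divide_distrib)
 finally show ?thesis .
qed

text \<open>The denominator is at least |sinh y|. The numerator stays bounded, since one factor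
  \<open>qq\<close> supplies 1/cosh y and absorbs the polynomial growth of the power of
  \<open>EE\<close>.\<close>

lemma VV_far:
 obtains C where "!!y. y ~= 0 ==> norm (comb m (%m k. VV m k y)) <= C / \<bar>sinh y\<bar>"
proof -
 define K where "K = 2 + 3 / cosint \<alpha>"
 have K: "K >= 1" using cosint_pos[of \<alpha>] by (simp add: K_def)
 have W: "norm (WW l k \<phi> y) <= K ^ l * (2 * exp 1 * fact l) / \<bar>sinh y\<bar>"
  if a: "(abs \<phi>) <= pi/2" "y ~= 0" "norm k <= 1" for l k \<phi> y
 proof -
  note q = qq_bounds[OF a(1), of y]
  have "norm (EE k \<phi> y) <= K * (1 + (abs y))" using EE_far[OF a(1,3), of y] unfolding K_def .
  then have "norm (EE k \<phi> y ^ l) <= (K * (1 + (abs y))) ^ l" unfolding norm_power by (rule power_mono) auto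
  also have "... = K ^ l * (1 + (abs y)) ^ l" by (rule power_mult_distrib)
  also have "... <= K ^ l * (2 * exp 1 * fact l * cosh y)" using K by (intro mult_left_mono poly_le_cosh) auto
  finally have E: "norm (EE k \<phi> y ^ l) <= K ^ l * (2 * exp 1 * fact l * cosh y)" .
  have Q: "norm (complex_of_real (qq \<phi> y ^ (\<kappa> + 1))) <= 1 / cosh y"
  proof -
   have "qq \<phi> y ^ (\<kappa> + 1) <= 1 * qq \<phi> y" using q power_le_one[of "qq \<phi> y" \<kappa>] by (simp add: mult.commute mult_left_le)
   then show ?thesis using q by (simp only: norm_of_real abs_of_nonneg zero_le_power)
  qed
  have "norm (TT l k \<phi> y) <= 1 / cosh y * (K ^ l * (2 * exp 1 * fact l * cosh y))"
   unfolding TT_def norm_mult by (rule mult_mono[OF Q E]) auto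
  then have T: "norm (TT l k \<phi> y) <= K ^ l * (2 * exp 1 * fact l)" by simp
  have "\<bar>sinh y\<bar> ^ 2 <= norm (SS \<phi> y) ^ 2" unfolding norm_SS by auto
  then have "\<bar>sinh y\<bar> <= norm (SS \<phi> y)" using power2_le_imp_le[OF _ norm_ge_zero] by blast
  then show ?thesis unfolding WW_def norm_divide using a(2) K by (intro frac_le[OF _ T]) auto
 qed
 define C where "C = pi * (K ^ m * (2 * exp 1 * fact m) + K ^ m * (2 * exp 1 * fact m) + K ^ 0 * (2 * exp 1 * fact 0))"
 have "norm (comb m (%m k. VV m k y)) <= C / \<bar>sinh y\<bar>" if y: "y ~= 0" for y
 proof -
  have b: "norm (comb m (%m k. WW m k \<phi> y)) <= C / pi / \<bar>sinh y\<bar>" if "\<phi> : half_circle" for \<phi>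
  proof -
   have p: "(abs \<phi>) <= pi/2" using that by auto
   have "norm (comb m (%m k. WW m k \<phi> y)) <= norm (WW m 1 \<phi> y) + norm (WW m 0 \<phi> y) + norm (WW 0 0 \<phi> y)"
    unfolding comb_def by (intro order_trans[OF norm_triangle_ineq4] add_right_mono order_trans[OF norm_triangle_ineq]) (simp add: norm_mult norm_power)
   also have "... <= K ^ m * (2 * exp 1 * fact m) / \<bar>sinh y\<bar> + K ^ m * (2 * exp 1 * fact m) / \<bar>sinh y\<bar> + K ^ 0 * (2 * exp 1 * fact 0) / \<bar>sinh y\<bar>"
    by (intro add_mono W p y) auto
   also have "... = C / pi / \<bar>sinh y\<bar>" by (simp add: C_def add_divide_distrib)
   finally show ?thesis .
  qed
  have "norm (integral half_circle (%\<phi>. comb m (%m k. WW m k \<phi> y))) <= integral half_circle (%\<phi>. C / pi / \<bar>sinh y\<bar>)"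
  proof (rule integral_norm_bound_integral[OF _ integrable_const_ivl b])
   show "(%\<phi>. comb m (%m k. WW m k \<phi> y)) integrable_on half_circle"
    by (rule has_integral_integrable, rule comb_has_integral, rule integrable_integral, rule WW_integrable[OF y])
  qed
  then show ?thesis unfolding comb_VV[OF y] by simp
 qed
 then show ?thesis using that by blast
qed

text \<open>The integral over -R..-\<epsilon> and \<epsilon>..R is -i times the changes of the
  combined potential. Its values at R and -R tend to 0, and those at \<epsilon> and -\<epsilon> have
  the same limit and opposite signs.\<close>

lemma comb_Iy_zero:
 assumes m: "m >= 1"
 shows "(LINT y|lborel. comb m (%m k. Iy m k y)) = 0"
proof -
 let ?g = "%y. comb m (%m k. Iy m k y)" and ?V = "%y. comb m (%m k. VV m k y)"
 define \<epsilon> where "\<epsilon> = (%n. 1 / (real n + 1))"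
 define R where "R = (%n. real n + 1)"
 have ei: "\<epsilon> n > 0" "\<epsilon> n <= 1" "\<epsilon> n <= R n" "R n > 0" for n
  using mult_mono[of 1 "real n + 1" 1 "real n + 1"] by (auto simp: \<epsilon>_def R_def divide_simps)
 define A where "A n = {-R n..-\<epsilon> n} Un {\<epsilon> n..R n}" for n
 have int: "integrable lborel ?g" using comb_Iy_integral[of m] by (auto simp: has_bochner_integral_iff)
 have "(%n. LINT y|lborel. indicator (A n) y *\<^sub>R ?g y) \<longlonglongrightarrow> (LINT y|lborel. ?g y)"
 proof (rule integral_dominated_convergence[where w = "%y. norm (?g y)"])
  show "AE y in lborel. (%n. indicator (A n) y *\<^sub>R ?g y) \<longlonglongrightarrow> ?g y"
  proof -
   have "AE y in lborel. y ~= (0::real)" by (rule AE_lborel_singleton)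
   then show ?thesis
   proof eventually_elim
    case (elim y)
    obtain N where N: "max (abs y) (1 / (abs y)) <= real N" using real_arch_simple by blast
    have "y : A n" if "n >= N" for n
    proof -
    have "(abs y) <= R n" using N that by (simp add: R_def)
    moreover have "1 / (abs y) <= real n + 1" using N that by simp
    then have "\<epsilon> n <= (abs y)" using elim by (simp add: \<epsilon>_def field_simps)
    ultimately show ?thesis by (auto simp: A_def)
    qed
    then have "eventually (%n. indicator (A n) y *\<^sub>R ?g y = ?g y) sequentially"
    unfolding eventually_sequentially by (intro exI[of _ N]) auto
    then show ?case by (rule tendsto_eventually)
   qed
  qed
  show "(%y. indicator (A n) y *\<^sub>R ?g y) : borel_measurable lborel" for n
   using borel_measurable_integrable[OF int] by (intro borel_measurable_scaleR borel_measurable_indicator) (auto simp: A_def)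
 qed (use int in \<open>auto simp: indicator_def\<close>)
 moreover have "(LINT y|lborel. indicator (A n) y *\<^sub>R ?g y) = - \<i> * (?V (R n) - ?V (\<epsilon> n) + (?V (- \<epsilon> n) - ?V (- R n)))" for n
 proof -
  have h: "((%y. comb m (%m k. \<i> * Iy m k y)) has_integral comb m (%m k. VV m k b - VV m k a)) {a..b}"
   if "a <= b" "0 < a | b < 0" for a b
   by (intro comb_has_integral Iy_integral that)
  have h': "(?g has_integral - \<i> * (?V b - ?V a)) {a..b}" if "a <= b" "0 < a | b < 0" for a b
   using has_integral_mult_right[OF h[OF that], of "- \<i>"] by (simp add: comb_mult comb_diff mult.assoc[symmetric])
  have "(?g has_integral - \<i> * (?V (- \<epsilon> n) - ?V (- R n)) + - \<i> * (?V (R n) - ?V (\<epsilon> n))) (A n)"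
   unfolding A_def
  proof (rule has_integral_Un)
   have "{- R n..- \<epsilon> n} Int {\<epsilon> n..R n} = {}" using ei[of n] by auto
   then show "negligible ({- R n..- \<epsilon> n} Int {\<epsilon> n..R n})" by simp
  qed (rule h'; use ei[of n] in force)+
  moreover have "(?g has_integral (LINT y|lborel. indicator (A n) y *\<^sub>R ?g y)) (A n)"
  proof -
   have "set_integrable lborel (A n) ?g"
    unfolding set_integrable_def using int by (rule integrable_mult_indicator[rotated]) (auto simp: A_def)
   from set_borel_integral_eq_integral[OF this] show ?thesis
    by (simp add: set_lebesgue_integral_def has_integral_integrable_integral)
  qed
  ultimately have "(LINT y|lborel. indicator (A n) y *\<^sub>R ?g y) = - \<i> * (?V (- \<epsilon> n) - ?V (- R n)) + - \<i> * (?V (R n) - ?V (\<epsilon> n))"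
   by (rule has_integral_unique[rotated])
  then show ?thesis by (simp add: algebra_simps)
 qed
 moreover have "(%n. - \<i> * (?V (R n) - ?V (\<epsilon> n) + (?V (- \<epsilon> n) - ?V (- R n)))) \<longlonglongrightarrow> 0"
 proof -
  obtain C where C: "!!y. y ~= 0 ==> norm (?V y) <= C / \<bar>sinh y\<bar>" using VV_far[of m] by metis
  have CR: "(%n. C / \<bar>sinh (R n)\<bar>) \<longlonglongrightarrow> 0"
  proof -
   have "filterlim R at_top sequentially" unfolding R_def
    by (rule filterlim_tendsto_add_at_top[OF tendsto_const filterlim_real_sequentially, of 1, simplified add.commute[of 1]])
   then have "filterlim (%n. sinh (R n)) at_top sequentially" by (rule filterlim_compose[OF sinh_at_top])
   then have "((%n. C / sinh (R n)) \<longlongrightarrow> 0) sequentially"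
    by (intro tendsto_divide_0[OF tendsto_const] filterlim_at_top_imp_at_infinity)
   moreover have "\<bar>sinh (R n)\<bar> = sinh (R n)" for n using ei[of n] by simp
   ultimately show ?thesis by simp
  qed
  have VR: "(%n. ?V (R n)) \<longlonglongrightarrow> 0" "(%n. ?V (- R n)) \<longlonglongrightarrow> 0"
  proof -
   have "norm (?V (R n)) <= C / \<bar>sinh (R n)\<bar>" "norm (?V (- R n)) <= C / \<bar>sinh (R n)\<bar>" for n
    using C[of "R n"] C[of "- R n"] ei(4)[of n] by simp_all
   then show "(%n. ?V (R n)) \<longlonglongrightarrow> 0" "(%n. ?V (- R n)) \<longlonglongrightarrow> 0"
    by (auto intro!: Lim_null_comparison[OF always_eventually CR])
  qed
  have e0: "\<epsilon> \<longlonglongrightarrow> 0" unfolding \<epsilon>_def using LIMSEQ_inverse_real_of_nat by (simp add: inverse_eq_divide add.commute)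
  let ?L = "integral (half_circle - {0}) (%\<phi>. comb m (%m k. WW m k \<phi> 0))"
  have "(%n. ?V (\<epsilon> n)) \<longlonglongrightarrow> ?L"
   by (rule VV_at_0[OF m e0]) (use ei in \<open>auto simp: less_imp_neq[symmetric] abs_of_pos\<close>)
  moreover have "(%n. ?V (- \<epsilon> n)) \<longlonglongrightarrow> ?L"
   using tendsto_minus[OF e0] by (intro VV_at_0[OF m]) (use ei in \<open>auto simp: less_imp_neq[symmetric] abs_of_pos\<close>)
  ultimately have "(%n. - \<i> * (?V (R n) - ?V (\<epsilon> n) + (?V (- \<epsilon> n) - ?V (- R n)))) \<longlonglongrightarrow> - \<i> * (0 - ?L + (?L - 0))"
   by (intro tendsto_intros VR)
  then show ?thesis by simp
 qed
 ultimately show ?thesis using LIMSEQ_unique by force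
qed

theorem AA_BB_identity:
 assumes m: "m >= 1"
 shows "(\<Sum>j\<le>m. of_nat (m choose j) * of_real (real (\<kappa> + \<alpha> * j + 1) * AA (\<kappa> + \<alpha> * j) (m - j))
    * ((1 + (-1) ^ (m + j)) * BB (\<kappa> + \<alpha> * j + 2) j)) = of_real (2 * pi)"
 using comb_Iy_integral[of m] comb_Iy_zero[OF m] by (simp add: has_bochner_integral_iff)

end

section \<open>The line integral as a residue\<close>

lemma sin_pow_int_deriv: "(sin_pow_int \<alpha> has_field_derivative sin z ^ \<alpha>) (at z)"
 unfolding sin_pow_int_def by (rule contour_integral_primitive_0) (intro holomorphic_intros)

lemma sin_pow_int_0: "sin_pow_int \<alpha> 0 = 0"
 by (simp add: sin_pow_int_def)

lemma holomorphic_sin_pow_int [holomorphic_intros]: "sin_pow_int \<alpha> holomorphic_on A"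
 using sin_pow_int_deriv by (meson field_differentiable_at_within field_differentiable_def holomorphic_on_def)

lemma deriv_zero_eq:
 fixes f :: "complex => complex"
 assumes "!!z. (f has_field_derivative 0) (at z)"
 shows "f z = f w"
proof -
 have "EX c. ALL z:UNIV. f z = c"
  using assms by (intro has_field_derivative_zero_constant) auto
 then show ?thesis by auto
qed

text \<open>Both sides have the same derivative in w, and both vanish at w = -pi/2 because
  \<open>Fr\<close> does.\<close>

lemma sin_pow_int_Fc:
 fixes w :: complex
 shows "sin_pow_int \<alpha> (pi/2 + w) = of_real (cosint \<alpha>) * Fc \<alpha> w"
proof -
 have "((%w. sin_pow_int \<alpha> (pi/2 + w) - of_real (cosint \<alpha>) * Fc \<alpha> w) has_field_derivative 0) (at w)" for w
  by (auto intro!: derivative_eq_intros DERIV_chain2[OF sin_pow_int_deriv] simp: sin_add sin_of_real cos_of_real)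
 note deriv_zero_eq[OF this, of w "- (pi/2)"]
 moreover have "Fc \<alpha> (- (complex_of_real (pi/2))) = 0"
  using Fc_of_real[of \<alpha> "-(pi/2)"] by (simp add: Fr_ends)
 ultimately show ?thesis by (simp add: sin_pow_int_0)
qed

lemma sin_pow_int_minus: "sin_pow_int \<alpha> (- z) = (-1) ^ (\<alpha> + 1) * sin_pow_int \<alpha> z"
proof -
 have "((%z. sin_pow_int \<alpha> (- z) - (-1) ^ (\<alpha> + 1) * sin_pow_int \<alpha> z) has_field_derivative 0) (at z)" for z
  by (auto intro!: derivative_eq_intros DERIV_chain2[OF sin_pow_int_deriv] simp: power_minus[of "sin z"])
 from deriv_zero_eq[OF this, of z 0] show ?thesis by (simp add: sin_pow_int_0 eq_neg_iff_add_eq_0)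
qed

lemma norm_sin_bounds: "\<bar>sinh (Im z)\<bar> <= norm (sin z)" "norm (sin z) <= cosh (Im z)"
proof -
 have e: "norm (sin z) ^ 2 = (sin (Re z))\<^sup>2 + (sinh (Im z))\<^sup>2"
 proof -
  have "sin z = of_real (sin (Re z) * cosh (Im z)) + \<i> * of_real (cos (Re z) * sinh (Im z))"
   by (subst complex_eq[of z]) (simp add: sin_add sin_of_real cos_of_real cos_i_times sin_i_times)
  then have "norm (sin z) ^ 2 = (sin (Re z) * cosh (Im z))\<^sup>2 + (cos (Re z) * sinh (Im z))\<^sup>2" by (simp add: cmod_power2)
  also have "... = (sin (Re z))\<^sup>2 * (1 + (sinh (Im z))\<^sup>2) + (1 - (sin (Re z))\<^sup>2) * (sinh (Im z))\<^sup>2"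
   by (simp add: power_mult_distrib cosh_square_eq cos_squared_eq algebra_simps)
  finally show ?thesis by (simp add: algebra_simps)
 qed
 then have "\<bar>sinh (Im z)\<bar> ^ 2 <= norm (sin z) ^ 2" by simp
 then show "\<bar>sinh (Im z)\<bar> <= norm (sin z)" by (rule power2_le_imp_le) simp
 have "(sin (Re z))\<^sup>2 <= 1" by (simp add: abs_square_le_1)
 then have "norm (sin z) ^ 2 <= cosh (Im z) ^ 2" unfolding e cosh_square_eq by simp
 then show "norm (sin z) <= cosh (Im z)" by (rule power2_le_imp_le) (simp add: less_imp_le)
qed

lemma cosh_mono_abs: "(abs x) <= (abs y) ==> cosh x <= cosh (y::real)"
 using cosh_real_nonneg_le_iff[of "(abs x)" "(abs y)"] by (simp add: cosh_real_abs)

lemma norm_sin_pow_int: "norm (sin_pow_int \<alpha> z) <= cosh (Im z) ^ \<alpha> * norm z"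
proof -
 have "norm (contour_integral (linepath 0 z) (%y. sin y ^ \<alpha>)) <= cosh (Im z) ^ \<alpha> * norm (z - 0)"
 proof (rule contour_integral_bound_linepath)
  show "(%y. sin y ^ \<alpha>) contour_integrable_on linepath 0 z"
   by (intro contour_integrable_continuous_linepath continuous_intros)
  fix w assume "w : closed_segment 0 z"
  then obtain u where u: "0 <= u" "u <= 1" "w = u *\<^sub>R z" by (auto simp: in_segment)
  have "\<bar>Im w\<bar> <= \<bar>Im z\<bar>" using u mult_right_mono[of u 1 "\<bar>Im z\<bar>"] by (simp add: abs_mult)
  then have "norm (sin w) <= cosh (Im z)" using norm_sin_bounds(2)[of w] cosh_mono_abs by (meson order_trans)
  then show "norm (sin w ^ \<alpha>) <= cosh (Im z) ^ \<alpha>" by (simp add: norm_power power_mono)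
 qed (simp add: less_imp_le)
 then show ?thesis by (simp add: sin_pow_int_def)
qed

lemma sin_nz_strip: "\<bar>Re z\<bar> < pi ==> z ~= 0 ==> sin (z :: complex) ~= 0"
proof
 assume z: "\<bar>Re z\<bar> < pi" "z ~= 0" "sin z = 0"
 then obtain n where n: "Re z = of_int n * pi" "Im z = 0"
  unfolding sin_eq_0 by auto
 then have "\<bar>of_int n\<bar> * pi < 1 * pi" using z(1) by (simp add: abs_mult)
 then have "\<bar>of_int n :: real\<bar> < 1" by (simp only: mult_less_cancel_right) auto
 then have "n = 0" by linarith
 with n z(2) show False by (simp add: complex_eq_iff)
qed

lemma contour_rect_decomp:
 assumes "continuous_on (path_image (rectpath a b)) g"
 shows "contour_integral (rectpath a b) g =
  contour_integral (linepath a (Complex (Re b) (Im a))) g + contour_integral (linepath (Complex (Re b) (Im a)) b) g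
  - contour_integral (linepath (Complex (Re a) (Im b)) b) g - contour_integral (linepath a (Complex (Re a) (Im b))) g"
proof -
 let ?p = "Complex (Re b) (Im a)" and ?q = "Complex (Re a) (Im b)"
 have pi: "path_image (rectpath a b) = closed_segment a ?p Un closed_segment ?p b Un closed_segment b ?q Un closed_segment ?q a"
  by (simp add: rectpath_def Let_def path_image_join Un_assoc)
 have c: "g contour_integrable_on linepath a ?p" "g contour_integrable_on linepath ?p b"
  "g contour_integrable_on linepath b ?q" "g contour_integrable_on linepath ?q a"
  by (intro contour_integrable_continuous_linepath continuous_on_subset[OF assms]; auto simp: pi)+
 have "contour_integral (rectpath a b) g = contour_integral (linepath a ?p) g + (contour_integral (linepath ?p b) g
   + (contour_integral (linepath b ?q) g + contour_integral (linepath ?q a) g))"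
  unfolding rectpath_def Let_def using c by (simp add: valid_path_join)
 moreover have "contour_integral (linepath b ?q) g = - contour_integral (linepath ?q b) g"
  using contour_integral_reversepath[of "linepath ?q b" g] by simp
 moreover have "contour_integral (linepath ?q a) g = - contour_integral (linepath a ?q) g"
  using contour_integral_reversepath[of "linepath a ?q" g] by simp
 ultimately show ?thesis by simp
qed

lemma residue_line_integral:
 assumes m: "m <= n" and odd: "odd ((\<alpha> + 1) * m + (\<alpha> * n + 2))"
 shows "BB \<alpha> (\<alpha> * n + 2) m * of_real (cosint \<alpha> ^ m) = pi * residue (%x. sin_pow_int \<alpha> x ^ m / sin x ^ (\<alpha> * n + 2)) 0"
proof -
 define p where "p = \<alpha> * n + 2"
 define g where "g = (%x. sin_pow_int \<alpha> x ^ m / sin x ^ p)"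
 define a where "a N = Complex (-(pi/2)) (- (real N + 1))" for N
 define b where "b N = Complex (pi/2) (real N + 1)" for N
 define S where "S = {z :: complex. \<bar>Re z\<bar> < pi}"
 have S: "open S" "convex S"
 proof -
  have e: "S = Re -` {-pi<..<pi}" by (auto simp: S_def)
  show "open S" unfolding e by (intro open_vimage continuous_intros)
  show "convex S" unfolding e by (intro convex_linear_vimage) (auto simp: linear_iff)
 qed
 have hol: "g holomorphic_on S - {0}"
  unfolding g_def by (intro holomorphic_intros) (auto simp: S_def sin_nz_strip)
 have gm: "g (- z) = - g z" for z
 proof -
  have "g (- z) = (-1) ^ ((\<alpha> + 1) * m) * (-1) ^ p * (sin_pow_int \<alpha> z ^ m / sin z ^ p)"
   unfolding g_def sin_pow_int_minus sin_minus power_mult_distrib power_minus[of "sin z"] power_mult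
   by (cases "even p") simp_all
  also have "(-1) ^ ((\<alpha> + 1) * m) * (-1) ^ p = (-1 :: complex)"
   unfolding power_add[symmetric] p_def using odd by (simp only: minus_one_power_iff if_False)
  finally show ?thesis by (simp add: g_def)
 qed
 have gr: "g (Complex (pi/2) y) = of_real (cosint \<alpha>) ^ m * (Wy \<alpha> y ^ m / of_real (cosh y ^ p))" for y
 proof -
  have "Complex (pi/2) y = complex_of_real (pi/2) + \<i> * of_real y" by (simp add: complex_eq_iff)
  then show ?thesis using sin_pow_int_Fc[of \<alpha> "\<i> * of_real y"]
   by (simp add: g_def Wy_def sin_add cos_i_times sin_of_real cos_of_real power_mult_distrib)
 qed
 have pimg: "path_image (rectpath (a N) (b N)) <= S - {0}" for N
 proof -
  have "path_image (rectpath (a N) (b N)) = cbox (a N) (b N) - box (a N) (b N)"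
   by (rule path_image_rectpath_cbox_minus_box) (auto simp: a_def b_def)
  moreover have "0 : box (a N) (b N)" by (auto simp: in_box_complex_iff a_def b_def)
  moreover have "cbox (a N) (b N) <= S"
  proof
   fix z assume "z : cbox (a N) (b N)"
   then have "\<bar>Re z\<bar> <= pi/2" by (auto simp: in_cbox_complex_iff a_def b_def)
   then show "z : S" using pi_gt_zero by (simp only: S_def mem_Collect_eq)
  qed
  ultimately show ?thesis by blast
 qed
 let ?hor = "%N. contour_integral (linepath (a N) (Complex (Re (b N)) (Im (a N)))) g - contour_integral (linepath (Complex (Re (a N)) (Im (b N))) (b N)) g"
 let ?ver = "%N. integral {-(real N + 1)..real N + 1} (%y. g (Complex (pi/2) y))"
 have cauchy: "2 * pi * \<i> * residue g 0 = ?hor N + 2 * \<i> * ?ver N" for N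
 proof -
  have "contour_integral (rectpath (a N) (b N)) g = 2 * pi * \<i> * (\<Sum>p\<in>{0}. winding_number (rectpath (a N) (b N)) p * residue g p)"
  proof (rule Residue_theorem[OF S(1) convex_connected[OF S(2)] _ hol])
   show "ALL z. z ~: S --> winding_number (rectpath (a N) (b N)) z = 0"
    using pimg[of N] S(2) by (intro allI impI winding_number_zero_outside[of _ S]) auto
  qed (use pimg in auto)
  moreover have "winding_number (rectpath (a N) (b N)) 0 = 1"
   by (rule winding_number_rectpath) (auto simp: in_box_complex_iff a_def b_def)
  ultimately have 1: "contour_integral (rectpath (a N) (b N)) g = 2 * pi * \<i> * residue g 0" by simp
  have cont: "continuous_on (path_image (rectpath (a N) (b N))) g"
   using holomorphic_on_imp_continuous_on[OF hol] pimg continuous_on_subset by blast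
  have r: "contour_integral (linepath (Complex (Re (b N)) (Im (a N))) (b N)) g = \<i> * ?ver N"
   by (rule contour_integral_linepath_same_Re) (auto simp: a_def b_def)
  have "contour_integral (linepath (a N) (Complex (Re (a N)) (Im (b N)))) g = \<i> * integral {-(real N + 1)..real N + 1} (%y. g (Complex (-(pi/2)) y))"
   by (rule contour_integral_linepath_same_Re) (auto simp: a_def b_def)
  also have "integral {-(real N + 1)..real N + 1} (%y. g (Complex (-(pi/2)) y)) = integral {-(real N + 1)..real N + 1} (%y. g (Complex (-(pi/2)) (- y)))"
   using Henstock_Kurzweil_Integration.integral_reflect_real[of "real N + 1" "-(real N + 1)" "%y. g (Complex (-(pi/2)) y)"] by (simp only: minus_minus)
  also have "(%y. g (Complex (-(pi/2)) (- y))) = (%y. - g (Complex (pi/2) y))"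
  proof
   fix y
   have "Complex (-(pi/2)) (- y) = - Complex (pi/2) y" by (simp add: complex_eq_iff)
   then show "g (Complex (-(pi/2)) (- y)) = - g (Complex (pi/2) y)" using gm by simp
  qed
  finally have l: "contour_integral (linepath (a N) (Complex (Re (a N)) (Im (b N)))) g = - \<i> * ?ver N" by simp
  show ?thesis using 1 unfolding contour_rect_decomp[OF cont] r l by (simp add: algebra_simps)
 qed
 \<comment> \<open>Degree count on the horizontal sides: the numerator is at most cosh^(\<alpha> n)
   times one factor cosh for the polynomial part, the denominator is of order cosh^(\<alpha> n + 2),
   so the quotient decays like 1/cosh.\<close>
 obtain C where C: "!!N. norm (?hor N) <= C / cosh (real N + 1)"
 proof -
  define K where "K = 4 ^ m * (2 * exp 1 * fact m) * 2 ^ p * pi"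
  have g_bound: "norm (g z) <= K / pi / cosh (real N + 1)" if z: "\<bar>Re z\<bar> <= pi/2" "\<bar>Im z\<bar> = real N + 1" for z N
  proof -
   let ?y = "real N + 1"
   have ch: "cosh (Im z) = cosh ?y" "\<bar>sinh (Im z)\<bar> = sinh ?y"
    using z(2) cosh_real_abs[of "Im z"] sinh_real_abs[of "Im z"] by auto
   \<comment> \<open>The height is at least 1, so exp of it is at least 2 and the lower bound sinh
     for |sin| is comparable with cosh.\<close>
   have chs: "cosh ?y <= 2 * sinh ?y"
   proof -
    have "exp ?y >= 1 + ?y" by (rule exp_ge_add_one_self)
    then have e: "exp ?y >= 2" by simp
    have "exp (- ?y) * exp ?y = 1" by (simp flip: exp_add)
    then have "3 * exp (- ?y) <= exp ?y"
    using e mult_mono[OF e e] mult_right_mono[of 3 "exp ?y * exp ?y" "exp (- ?y)"] by (simp add: mult_ac)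
    then show ?thesis by (simp add: cosh_def sinh_def field_simps)
   qed
   have "norm z <= pi/2 + ?y" using order_trans[OF cmod_le add_mono[OF z(1) eq_refl[OF z(2)]]] .
   moreover have "\<bar>?y\<bar> = ?y" by simp
   moreover have "pi/2 + ?y <= 4 * (1 + ?y)"
   proof -
    have "0 <= real N" by simp
    then have "4 * (1 + ?y) - ?y >= 4" by (simp add: algebra_simps)
    moreover have "pi/2 <= 4" using pi_less_4 pi_gt_zero by simp
    ultimately show ?thesis by linarith
   qed
   ultimately have nz: "norm z <= 4 * (1 + \<bar>?y\<bar>)" by simp
   have "norm (sin_pow_int \<alpha> z) ^ m <= (cosh ?y ^ \<alpha> * (4 * (1 + \<bar>?y\<bar>))) ^ m"
   proof (rule power_mono)
    have "norm (sin_pow_int \<alpha> z) <= cosh ?y ^ \<alpha> * norm z" using norm_sin_pow_int[of \<alpha> z] unfolding ch(1) .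
    also have "... <= cosh ?y ^ \<alpha> * (4 * (1 + \<bar>?y\<bar>))" by (rule mult_left_mono[OF nz]) (simp add: less_imp_le)
    finally show "norm (sin_pow_int \<alpha> z) <= cosh ?y ^ \<alpha> * (4 * (1 + \<bar>?y\<bar>))" .
   qed simp
   also have "... = cosh ?y ^ (\<alpha> * m) * (4 ^ m * (1 + \<bar>?y\<bar>) ^ m)" by (simp only: power_mult_distrib power_mult)
   also have "... <= cosh ?y ^ (\<alpha> * n) * (4 ^ m * (2 * exp 1 * fact m * cosh ?y))"
    using m by (intro mult_mono power_increasing mult_left_mono poly_le_cosh) (auto simp: cosh_real_ge_1 less_imp_le)
   finally have num: "norm (sin_pow_int \<alpha> z) ^ m <= cosh ?y ^ (\<alpha> * n) * (4 ^ m * (2 * exp 1 * fact m * cosh ?y))" .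
   have "(cosh ?y / 2) ^ p <= norm (sin z) ^ p"
    using chs norm_sin_bounds(1)[of z] ch(2) by (intro power_mono) auto
   then have "norm (g z) <= cosh ?y ^ (\<alpha> * n) * (4 ^ m * (2 * exp 1 * fact m * cosh ?y)) / (cosh ?y / 2) ^ p"
    unfolding g_def norm_divide norm_power using num by (intro frac_le) auto
   also have "... = K / pi / cosh ?y" by (simp add: K_def p_def power_add power_divide power2_eq_square divide_simps)
   finally show ?thesis .
  qed
  have seg: "closed_segment (Complex (-(pi/2)) y) (Complex (pi/2) y) <= {z. \<bar>Re z\<bar> <= pi/2 & Im z = y}" for y
  proof (rule closed_segment_subset)
   have "{z. \<bar>Re z\<bar> <= pi/2 & Im z = y} = Re -` {-(pi/2)..pi/2} Int Im -` {y}" by auto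
   then show "convex {z. \<bar>Re z\<bar> <= pi/2 & Im z = y}"
    by (simp only:) (intro convex_Int convex_linear_vimage; auto simp: linear_iff)
  qed auto
  have h: "norm (contour_integral (linepath (Complex (-(pi/2)) y) (Complex (pi/2) y)) g) <= K / pi / cosh (real N + 1) * pi" if y: "(abs y) = real N + 1" for y N
  proof -
   have n0: "y ~= 0" using y by linarith
   have "norm (contour_integral (linepath (Complex (-(pi/2)) y) (Complex (pi/2) y)) g) <= K / pi / cosh (real N + 1) * norm (Complex (pi/2) y - Complex (-(pi/2)) y)"
   proof (rule contour_integral_bound_linepath)
    have "closed_segment (Complex (-(pi/2)) y) (Complex (pi/2) y) <= S - {0}"
    proof
    fix z assume "z : closed_segment (Complex (-(pi/2)) y) (Complex (pi/2) y)"
    then have "\<bar>Re z\<bar> <= pi/2" "Im z = y" using seg[of y] by auto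
    moreover from this(1) have "\<bar>Re z\<bar> < pi" by (rule le_less_trans) simp
    ultimately show "z : S - {0}" using n0 unfolding S_def by auto
    qed
    then show "g contour_integrable_on linepath (Complex (-(pi/2)) y) (Complex (pi/2) y)"
    by (intro contour_integrable_continuous_linepath continuous_on_subset[OF holomorphic_on_imp_continuous_on[OF hol]])
    show "0 <= K / pi / cosh (real N + 1)" by (simp add: K_def less_imp_le)
    show "norm (g x) <= K / pi / cosh (real N + 1)" if "x : closed_segment (Complex (-(pi/2)) y) (Complex (pi/2) y)" for x
    using seg[of y] that y by (intro g_bound) auto
   qed
   also have "norm (Complex (pi/2) y - Complex (-(pi/2)) y) = pi" by (simp add: cmod_def)
   finally show ?thesis .
  qed
  have "norm (?hor N) <= 2 * K / cosh (real N + 1)" for N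
  proof -
   have "norm (?hor N) <= K / pi / cosh (real N + 1) * pi + K / pi / cosh (real N + 1) * pi"
    unfolding a_def b_def complex.sel by (intro order_trans[OF norm_triangle_ineq4] add_mono h) auto
   then show ?thesis by simp
  qed
  then show ?thesis using that by blast
 qed
 have "(%N. ?hor N) \<longlonglongrightarrow> 0"
 proof (rule Lim_null_comparison[OF always_eventually])
  show "ALL N. norm (?hor N) <= C / cosh (real N + 1)" using C by blast
  have "filterlim (%N. real N + 1) at_top sequentially"
   by (rule filterlim_tendsto_add_at_top[OF tendsto_const filterlim_real_sequentially, of 1, simplified add.commute[of 1]])
  then have "filterlim (%N. cosh (real N + 1)) at_top sequentially"
   using cosh_real_at_top filterlim_compose by blast
  then show "(%N. C / cosh (real N + 1)) \<longlonglongrightarrow> 0"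
   by (intro tendsto_divide_0[OF tendsto_const] filterlim_at_top_imp_at_infinity)
 qed
 moreover have "(%N. ?ver N) \<longlonglongrightarrow> of_real (cosint \<alpha>) ^ m * BB \<alpha> p m"
 proof -
  let ?f = "%y. g (Complex (pi/2) y)"
  have int: "integrable lborel ?f" and val: "(LINT y|lborel. ?f y) = of_real (cosint \<alpha>) ^ m * BB \<alpha> p m"
  proof -
   have i: "integrable lborel (%y. Wy \<alpha> y ^ m / complex_of_real (cosh y ^ p))" by (rule integrable_Wy) (use m in \<open>auto simp: p_def\<close>)
   show "integrable lborel ?f" unfolding gr by (rule integrable_mult_right[OF i])
   show "(LINT y|lborel. ?f y) = of_real (cosint \<alpha>) ^ m * BB \<alpha> p m"
    unfolding gr BB_def by (rule Bochner_Integration.integral_mult_right[OF i])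
  qed
  let ?i = "%N y. indicator {-(real N + 1)..real N + 1} y :: real"
  have "(%N. LINT y|lborel. ?i N y *\<^sub>R ?f y) \<longlonglongrightarrow> (LINT y|lborel. ?f y)"
  proof (rule integral_dominated_convergence[where w = "%y. norm (?f y)"])
   show "AE y in lborel. (%N. ?i N y *\<^sub>R ?f y) \<longlonglongrightarrow> ?f y"
   proof (intro AE_I2)
    fix y :: real
    obtain N0 where N0: "(abs y) <= real N0" using real_arch_simple by blast
    have "?i N y *\<^sub>R ?f y = ?f y" if "N >= N0" for N
    using N0 that by (auto simp: indicator_def)
    then have "eventually (%N. ?i N y *\<^sub>R ?f y = ?f y) sequentially"
    unfolding eventually_sequentially by blast
    then show "(%N. ?i N y *\<^sub>R ?f y) \<longlonglongrightarrow> ?f y" by (rule tendsto_eventually)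
   qed
   show "(%y. ?i N y *\<^sub>R ?f y) : borel_measurable lborel" for N
    using borel_measurable_integrable[OF int] by (intro borel_measurable_scaleR borel_measurable_indicator) auto
  qed (use int in \<open>auto simp: indicator_def\<close>)
  moreover have "(LINT y|lborel. ?i N y *\<^sub>R ?f y) = ?ver N" for N
  proof -
   have "set_integrable lborel {-(real N + 1)..real N + 1} ?f"
    unfolding set_integrable_def using int by (rule integrable_mult_indicator[rotated]) auto
   from set_borel_integral_eq_integral(2)[OF this] show ?thesis by (simp add: set_lebesgue_integral_def)
  qed
  ultimately show ?thesis using val by simp
 qed
 ultimately have "(%N. ?hor N + 2 * \<i> * ?ver N) \<longlonglongrightarrow> 0 + 2 * \<i> * (of_real (cosint \<alpha>) ^ m * BB \<alpha> p m)"
  by (intro tendsto_intros)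
 then have "2 * pi * \<i> * residue g 0 = 0 + 2 * \<i> * (of_real (cosint \<alpha>) ^ m * BB \<alpha> p m)"
  unfolding cauchy[symmetric] by (rule LIMSEQ_unique[OF tendsto_const])
 then show ?thesis unfolding g_def p_def by (simp add: mult_ac)
qed

lemma c_const_cosint: "c_const (real p / 2) = 1 / cosint (p + 1)" "c_const ((real p - 1) / 2) = 1 / cosint p"
proof -
 have e: "real p / 2 + 3 / 2 = real (p + 1) / 2 + 1" "real p / 2 + 1 = (real (p + 1) + 1) / 2"
  "(real p - 1) / 2 + 3/2 = real p / 2 + 1" "(real p - 1) / 2 + 1 = (real p + 1) / 2"
  by (simp_all add: field_simps)
 show "c_const (real p / 2) = 1 / cosint (p + 1)" "c_const ((real p - 1) / 2) = 1 / cosint p"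
  unfolding c_const_def e cosint_Gamma by simp_all
qed

section \<open>The recursion for the angles\<close>

text \<open>Substitute h = sin phi: the weight becomes cos^(p-1) and the differential supplies one
  more cosine. The end points, where the cosine vanishes, are null.\<close>

lemma hw_substitution:
 fixes f :: "real => ennreal"
 assumes [measurable]: "f : borel_measurable borel"
 shows "(\<integral>\<^sup>+h. hw ((real p - 1) / 2) h * f h \<partial>lborel) =
  (\<integral>\<^sup>+\<phi>. indicator half_circle \<phi> * (ennreal (cos \<phi> ^ p) * f (sin \<phi>)) \<partial>lborel)"
proof -
 let ?F = "%h. hw ((real p - 1) / 2) h * f h"
 have "(\<integral>\<^sup>+h. ?F h \<partial>lborel) = (\<integral>\<^sup>+h. ?F h * indicator {sin (-(pi/2))..sin (pi/2)} h \<partial>lborel)"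
 proof (rule nn_integral_cong)
  fix h :: real
  have "h\<^sup>2 < 1 ==> -1 <= h & h <= 1" by (auto simp: abs_square_less_1)
  then show "?F h = ?F h * indicator {sin (-(pi/2))..sin (pi/2)} h" by (auto simp: hw_def indicator_def)
 qed
 also have "... = (\<integral>\<^sup>+\<phi>. ?F (sin \<phi>) * ennreal (cos \<phi>) * indicator half_circle \<phi> \<partial>lborel)"
  by (rule nn_integral_substitution_aux)
   (auto intro!: derivative_eq_intros continuous_intros cos_ge_zero)
 also have "... = (\<integral>\<^sup>+\<phi>. indicator half_circle \<phi> * (ennreal (cos \<phi> ^ p) * f (sin \<phi>)) \<partial>lborel)"
 proof (rule nn_integral_cong_AE)
  have "AE \<phi> in lborel. \<phi> ~= pi/2 & \<phi> ~= -(pi/2)"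
   using AE_lborel_singleton[of "pi/2"] AE_lborel_singleton[of "-(pi/2)"] by eventually_elim simp
  then show "AE \<phi> in lborel. ?F (sin \<phi>) * ennreal (cos \<phi>) * indicator half_circle \<phi> = indicator half_circle \<phi> * (ennreal (cos \<phi> ^ p) * f (sin \<phi>))"
  proof eventually_elim
   case (elim \<phi>)
   show ?case
   proof (cases "\<phi> : half_circle")
    case True
    then have c: "cos \<phi> > 0" using elim by (intro cos_gt_zero_pi) auto
    have s: "(sin \<phi>)\<^sup>2 < 1" using c by (simp add: sin_squared_eq)
    have "(1 - (sin \<phi>)\<^sup>2) powr ((real p - 1) / 2) * cos \<phi> = cos \<phi> ^ p"
    proof -
    have e: "1 - (sin \<phi>)\<^sup>2 = cos \<phi> powr 2" using c by (simp add: sin_squared_eq powr_realpow)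
    have "(1 - (sin \<phi>)\<^sup>2) powr ((real p - 1) / 2) * cos \<phi> = cos \<phi> powr (real p - 1) * cos \<phi> powr 1"
    unfolding e powr_powr using c by (simp add: diff_divide_distrib)
    also have "... = cos \<phi> ^ p" using c by (simp only: powr_add[symmetric]) (simp add: powr_realpow)
    finally show ?thesis .
    qed
    then have "hw ((real p - 1) / 2) (sin \<phi>) * ennreal (cos \<phi>) = ennreal (cos \<phi> ^ p)"
    using c s by (simp add: hw_def ennreal_mult[symmetric])
    then show ?thesis using True by (simp add: mult_ac) (metis mult.commute mult.left_commute)
   qed simp
  qed
 qed
 finally show ?thesis .
qed

lemma hw_integral_cont:
 assumes c: "continuous_on UNIV g" "!!\<phi>. \<phi> : half_circle ==> 0 <= g \<phi>" and f: "f : borel_measurable borel"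
  and fg: "!!\<phi>. \<phi> : half_circle ==> f (sin \<phi>) = ennreal (g \<phi>)"
 shows "(\<integral>\<^sup>+h. hw ((real p - 1) / 2) h * f h \<partial>lborel) = ennreal (integral half_circle (%\<phi>. cos \<phi> ^ p * g \<phi>))"
proof -
 have "(\<integral>\<^sup>+h. hw ((real p - 1) / 2) h * f h \<partial>lborel) = (\<integral>\<^sup>+\<phi>. ennreal (indicator half_circle \<phi> * (cos \<phi> ^ p * g \<phi>)) \<partial>lborel)"
  unfolding hw_substitution[OF f]
  by (rule nn_integral_cong) (auto simp: indicator_def fg c(2) ennreal_mult cos_ge_zero)
 also have "... = ennreal (integral half_circle (%\<phi>. cos \<phi> ^ p * g \<phi>))"
  by (rule nn_integral_has_integral_lebesgue)
   (auto intro!: integrable_integral integrable_continuous_real continuous_intros continuous_on_subset[OF c(1)] mult_nonneg_nonneg c(2) cos_ge_zero zero_le_power)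
 finally show ?thesis .
qed

context beta_law
begin

text \<open>The unknown constant of the one-dimensional marginal is fixed by the total mass as 1 /
  \<open>cosint \<alpha>\<close>; the substitution h = sin phi then yields the primitive of
  cos^\<alpha>.\<close>

lemma G_sin:
 assumes t: "t : half_circle"
 shows "G (sin t) = Fr \<alpha> t"
proof -
 have "{b0} \<subset> Basis"
 proof -
  have "{b0} ~= (Basis :: 'e set)" using dim2 by (metis One_nat_def Suc_1 card.empty card_insert_disjoint empty_iff finite.emptyI not_less_eq_eq order_refl)
  then show ?thesis using b0 by auto
 qed
 then obtain C where C: "C > 0" "distr \<mu> (lb {b0}) (%x. \<lambda>c\<in>{b0}. x \<bullet> c) =
    density (lb {b0}) (%x. ennreal C * wt ((real \<alpha> - real (card {b0})) / 2) (\<Sum>c\<in>{b0}. (x c)\<^sup>2))"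
  using dens by blast
 have wh: "wt ((real \<alpha> - 1) / 2) (h\<^sup>2) = hw ((real \<alpha> - 1) / 2) h" for h by (simp add: wt_def hw_def)
 have E: "emeasure \<mu> {x. Q (x \<bullet> b0)} = ennreal C * (\<integral>\<^sup>+h. hw ((real \<alpha> - 1) / 2) h * of_bool (Q h) \<partial>lborel)"
  if Q[measurable]: "Measurable.pred borel Q" for Q
 proof -
  have mQ: "Measurable.pred (lb {b0}) (%x. Q (x b0))" by (rule measurable_compose[OF _ Q]) (simp add: measurable_lb_component)
  have "emeasure \<mu> {x. Q (x \<bullet> b0)} = emeasure (distr \<mu> (lb {b0}) (%x. \<lambda>c\<in>{b0}. x \<bullet> c)) {x\<in>space (lb {b0}). Q (x b0)}"
  proof -
   have "(%x. \<lambda>c\<in>{b0}. x \<bullet> c) -` {x\<in>space (lb {b0}). Q (x b0)} Int space \<mu> = {x. Q (x \<bullet> b0)}"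
    by (auto simp: space_PiM)
   then show ?thesis using mQ by (subst emeasure_distr[OF measurable_coords]) (auto simp: pred_def)
  qed
  also have "... = (\<integral>\<^sup>+x. (ennreal C * wt ((real \<alpha> - 1) / 2) ((x b0)\<^sup>2)) * of_bool (Q (x b0)) \<partial>lb {b0})"
   unfolding C using mQ measurable_lb_component[of b0 "{b0}"]
   by (subst emeasure_density) (auto simp: pred_def indicator_def intro!: nn_integral_cong)
  also have "... = (\<integral>\<^sup>+h. (ennreal C * wt ((real \<alpha> - 1) / 2) (h\<^sup>2)) * of_bool (Q h) \<partial>lborel)"
   by (subst lb.product_nn_integral_singleton[symmetric]) auto
  also have "... = ennreal C * (\<integral>\<^sup>+h. hw ((real \<alpha> - 1) / 2) h * of_bool (Q h) \<partial>lborel)"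
   unfolding wh by (subst nn_integral_cmult[symmetric]) (auto simp: mult.assoc)
  finally show ?thesis .
 qed
 have Cc: "C * cosint \<alpha> = 1"
 proof -
  have "1 = ennreal C * (\<integral>\<^sup>+h. hw ((real \<alpha> - 1) / 2) h * of_bool True \<partial>lborel)"
   using E[of "%_. True"] mu.emeasure_space_1 by simp
  also have "(\<integral>\<^sup>+h. hw ((real \<alpha> - 1) / 2) h * of_bool True \<partial>lborel) = ennreal (cosint \<alpha>)"
   using hw_integral_cont[of "%_. 1" "%_. 1" \<alpha>] by (simp add: cosint_def)
  finally show ?thesis using C(1) cosint_pos[of \<alpha>] by (simp flip: ennreal_mult ennreal_1)
 qed
 have "emeasure \<mu> {x. x \<bullet> b0 <= sin t} = ennreal C * (\<integral>\<^sup>+h. hw ((real \<alpha> - 1) / 2) h * of_bool (h <= sin t) \<partial>lborel)"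
  by (rule E) measurable
 also have "(\<integral>\<^sup>+h. hw ((real \<alpha> - 1) / 2) h * of_bool (h <= sin t) \<partial>lborel) = (\<integral>\<^sup>+\<phi>. ennreal (cos \<phi> ^ \<alpha>) * indicator {-(pi/2)..t} \<phi> \<partial>lborel)"
  unfolding hw_substitution[where f = "%h. of_bool (h <= sin t)", simplified]
  using t by (intro nn_integral_cong) (auto simp: indicator_def sin_mono_le_eq)
 also have "... = ennreal (cosint \<alpha> * Fr \<alpha> t - cosint \<alpha> * Fr \<alpha> (-(pi/2)))"
 proof -
  have d: "((%x. cosint \<alpha> * Fr \<alpha> x) has_real_derivative cos x ^ \<alpha>) (at x)" for x
   using DERIV_cmult[OF Fr_deriv[of \<alpha> x], of "cosint \<alpha>"] by simp
  show ?thesis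
   by (rule nn_integral_FTC_Icc[OF _ d]) (use t in \<open>auto intro!: zero_le_power cos_ge_zero\<close>)
 qed
 finally have "emeasure \<mu> {x. x \<bullet> b0 <= sin t} = ennreal (C * cosint \<alpha> * Fr \<alpha> t)"
  using C(1) by (simp add: Fr_ends ennreal_mult' mult.assoc)
 then have e: "emeasure \<mu> {x. x \<bullet> b0 <= sin t} = ennreal (Fr \<alpha> t)" by (simp add: Cc)
 have d: "EX y. (Fr \<alpha> has_real_derivative y) (at x) & 0 <= y" if "-(pi/2) <= x" "x <= t" for x
  using that t cosint_pos[of \<alpha>] by (intro exI[of _ "cos x ^ \<alpha> / cosint \<alpha>"] conjI Fr_deriv divide_nonneg_pos zero_le_power cos_ge_zero) auto
 have "Fr \<alpha> (-(pi/2)) <= Fr \<alpha> t"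
  by (rule DERIV_nonneg_imp_nondecreasing[OF _ d]) (use t in auto)
 then show ?thesis using e by (simp add: G_def measure_def Fr_ends)
qed

text \<open>The reflection phi -> -phi exchanges \<open>Fr\<close> and 1 - \<open>Fr\<close>, so the
  two sides of the hyperplane contribute equally.\<close>

lemma hw_gG:
 "(\<integral>\<^sup>+h. hw ((real p - 1) / 2) h * ennreal (gG r h) \<partial>lborel) = ennreal (2 * AA \<alpha> p r)"
proof -
 have Fr01: "0 <= Fr \<alpha> \<phi>" "Fr \<alpha> \<phi> <= 1" if "\<phi> : half_circle" for \<phi>
  using G_sin[OF that] G_bounds[of "sin \<phi>"] by auto
 have "(\<integral>\<^sup>+h. hw ((real p - 1) / 2) h * ennreal (gG r h) \<partial>lborel) =
  ennreal (integral half_circle (%\<phi>. cos \<phi> ^ p * ((1 - Fr \<alpha> \<phi>) ^ r + Fr \<alpha> \<phi> ^ r)))"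
  by (rule hw_integral_cont) (auto simp: gG_def G_sin Fr01 intro!: continuous_intros)
 also have "integral half_circle (%\<phi>. cos \<phi> ^ p * ((1 - Fr \<alpha> \<phi>) ^ r + Fr \<alpha> \<phi> ^ r)) =
   integral half_circle (%\<phi>. cos \<phi> ^ p * (1 - Fr \<alpha> \<phi>) ^ r) + AA \<alpha> p r"
  unfolding AA_def distrib_left
  by (intro Henstock_Kurzweil_Integration.integral_add integrable_continuous_real continuous_intros)
 also have "integral half_circle (%\<phi>. cos \<phi> ^ p * (1 - Fr \<alpha> \<phi>) ^ r) = AA \<alpha> p r"
  using Henstock_Kurzweil_Integration.integral_reflect_real[of "pi/2" "-(pi/2)" "%\<phi>. cos \<phi> ^ p * Fr \<alpha> \<phi> ^ r"] by (simp add: AA_def Fr_minus)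
 finally show ?thesis by simp
qed

lemma AA_nonneg: "0 <= AA \<alpha> p r"
proof -
 have "0 <= Fr \<alpha> \<phi>" if "\<phi> : half_circle" for \<phi> using G_sin[OF that] G_bounds[of "sin \<phi>"] by auto
 then show ?thesis unfolding AA_def by (intro integral_nonneg integrable_continuous_real continuous_intros) (auto intro!: mult_nonneg_nonneg zero_le_power cos_ge_zero)
qed

text \<open>For a marginal in \<open>s\<close> dimensions, 2 * \<open>aa r s\<close> is the
  probability that \<open>r\<close> further points lie on one side of the hyperplane through
  \<open>s\<close> points; see \<open>facet_probability\<close> with a trivial event.\<close>

definition aa :: "nat => nat => real" where "aa r s = AA \<alpha> (\<alpha> * s) r / cosint (\<alpha> * s)"

definition Pr :: "nat set => ((nat => 'e) => bool) => real" where
 "Pr I Q = measure (M I) {X:space (M I). Q X}"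

lemma facet_probability:
 assumes U: "U' <= Basis" "b : Basis" "b ~: U'" "insert b U' \<subset> Basis"
  and S: "finite I" "S <= I" "I ~= S" "card S = card U' + 1"
  and A: "{X. A X} : sets borel" "!!X Y. (!!i c. i : S ==> c : U' ==> X i \<bullet> c = Y i \<bullet> c) ==> A X = A Y"
  and A_aff: "!!X Y c \<rho>. \<rho> > 0 ==> (!!i. i : S ==> Y i = c + \<rho> *\<^sub>R X i) ==> A Y = A X"
 shows "Pr I (%X. A X & facet (insert b U') S I (crd X)) = Pr S A * (2 * aa (card (I - S)) (card S))"
proof -
 note em = finite_measure.emeasure_eq_measure[OF prob_space.finite_measure[OF prob_M]]
 have hw0: "(\<integral>\<^sup>+h. hw ((real \<alpha> * real (card S) - 1) / 2) h \<partial>lborel) = ennreal (cosint (\<alpha> * card S))"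
  using hw_integral_cont[of "%_. 1" "%_. 1" "\<alpha> * card S"] by (simp add: cosint_def)
 have hw1: "(\<integral>\<^sup>+h. hw ((real \<alpha> * real (card S) - 1) / 2) h * ennreal (gG r h) \<partial>lborel) = ennreal (2 * AA \<alpha> (\<alpha> * card S) r)" for r
  using hw_gG[of "\<alpha> * card S" r] by simp
 let ?f = "%X. A X & facet (insert b U') S I (crd X)"
 have "emeasure (M I) {X:space (M I). ?f X} * (\<integral>\<^sup>+h. hw ((real \<alpha> * real (card S) - 1) / 2) h \<partial>lborel) =
  emeasure (M S) {X:space (M S). A X} *
   (\<integral>\<^sup>+h. hw ((real \<alpha> * real (card S) - 1) / 2) h * ennreal (gG (card (I - S)) h) \<partial>lborel)"
 proof (rule facet_factorization[OF U S A(1)])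
  show "A X = A Y" if "!!i c. i : S ==> c : U' ==> X i \<bullet> c = Y i \<bullet> c" for X Y using that by (rule A(2))
  show "A Y = A X" if "\<rho> > 0" "!!i. i : S ==> Y i = c + \<rho> *\<^sub>R X i" for X Y c \<rho> using that by (rule A_aff)
 qed
 then have "ennreal (Pr I ?f) * ennreal (cosint (\<alpha> * card S)) = ennreal (Pr S A) * ennreal (2 * AA \<alpha> (\<alpha> * card S) (card (I - S)))"
  unfolding hw0 hw1 em Pr_def .
 then have "ennreal (Pr I ?f * cosint (\<alpha> * card S)) = ennreal (Pr S A * (2 * AA \<alpha> (\<alpha> * card S) (card (I - S))))"
  using cosint_pos[of "\<alpha> * card S"] AA_nonneg by (subst ennreal_mult, simp_all add: Pr_def ennreal_mult less_imp_le)
 then have "Pr I (%X. A X & facet (insert b U') S I (crd X)) * cosint (\<alpha> * card S) = Pr S A * (2 * AA \<alpha> (\<alpha> * card S) (card (I - S)))"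
  using cosint_pos[of "\<alpha> * card S"] AA_nonneg by (subst (asm) ennreal_inj) (auto simp: Pr_def)
 then show ?thesis by (simp add: aa_def field_simps)
qed

abbreviation NF :: "'e set => nat => nat set => (nat => 'e) => bool" where
 "NF U k I X \<equiv> not_face U k I (crd X)"

text \<open>The points are exchangeable, but \<open>not_face\<close> singles out the first
  \<open>k\<close> indices, so the relabelling has to fix these.\<close>

lemma NF_inject:
 assumes S: "finite S" "{..<k} <= S"
 shows "Pr S (NF U k S) = Pr {..<card S} (NF U k {..<card S})"
proof -
 have fin: "finite (S - {..<k})" "k <= card S" using S card_mono[OF S] by auto
 have "card (S - {..<k}) = card {k..<card S}" using S fin by (simp add: card_Diff_subset)
 then obtain \<tau> where \<tau>: "bij_betw \<tau> {k..<card S} (S - {..<k})"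
  using fin finite_same_card_bij[of "{k..<card S}" "S - {..<k}"] by auto
 define \<sigma> where "\<sigma> i = (if i < k then i else \<tau> i)" for i
 have \<sigma>2: "bij_betw \<sigma> {k..<card S} (S - {..<k})" using \<tau> by (subst bij_betw_cong[of _ _ \<tau>]) (auto simp: \<sigma>_def)
 have \<sigma>1: "bij_betw \<sigma> {..<k} {..<k}" by (subst bij_betw_cong[of _ _ id]) (auto simp: \<sigma>_def)
 have "bij_betw \<sigma> ({..<k} Un {k..<card S}) ({..<k} Un (S - {..<k}))" by (rule bij_betw_combine[OF \<sigma>1 \<sigma>2]) auto
 moreover have "{..<k} Un {k..<card S} = {..<card S}" "{..<k} Un (S - {..<k}) = S" using fin S by auto
 ultimately have \<sigma>: "bij_betw \<sigma> {..<card S} S" by simp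
 have \<sigma>k: "k <= \<sigma> i \<longleftrightarrow> k <= i" if "i < card S" for i
 proof (cases "i < k")
  case False
  then have "\<sigma> i : S - {..<k}" using that \<sigma>2 by (auto simp: bij_betw_def)
  then show ?thesis using False by auto
 qed (simp add: \<sigma>_def)
 have nf: "NF U k {..<card S} (\<lambda>n\<in>{..<card S}. X (\<sigma> n)) = NF U k S X" for X
 proof -
  have s: "(\<Sum>i<card S. f (\<sigma> i)) = sum f S" for f :: "nat => real" by (rule sum.reindex_bij_betw[OF \<sigma>])
  let ?Y = "\<lambda>n\<in>{..<card S}. X (\<sigma> n)"
  have ex: "P \<longleftrightarrow> Q" if "P ==> Q" "Q ==> P" for P Q using that by blast
  show ?thesis
  proof (rule ex)
   assume "NF U k S X"
   then obtain l i0 where l: "sum l S = 0" "ALL b:U. (\<Sum>i\<in>S. l i * crd X i b) = 0" "ALL i:S. k <= i --> 0 <= l i" "i0 : S" "k <= i0" "0 < l i0"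
    unfolding not_face_def by blast
   obtain j0 where j0: "j0 < card S" "\<sigma> j0 = i0"
    using l(4) bij_betw_imp_surj_on[OF \<sigma>] by (metis imageE lessThan_iff)
   show "NF U k {..<card S} ?Y" unfolding not_face_def
   proof (intro exI[of _ "l \<circ> \<sigma>"] conjI ballI impI)
    show "sum (l \<circ> \<sigma>) {..<card S} = 0" using s[of l] l(1) by simp
    show "(\<Sum>i<card S. (l \<circ> \<sigma>) i * crd ?Y i b) = 0" if "b : U" for b
    using s[of "%i. l i * crd X i b"] l(2) that by simp
    show "0 <= (l \<circ> \<sigma>) i" if "i : {..<card S}" "k <= i" for i
    using l(3) that \<sigma> \<sigma>k[of i] by (auto simp: bij_betw_def)
    show "EX i:{..<card S}. k <= i & 0 < (l \<circ> \<sigma>) i" using j0 l \<sigma>k[of j0] by auto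
   qed
  next
   assume "NF U k {..<card S} ?Y"
   then obtain l i0 where l: "sum l {..<card S} = 0" "ALL b:U. (\<Sum>i<card S. l i * crd ?Y i b) = 0" "ALL i<card S. k <= i --> 0 <= l i" "i0 < card S" "k <= i0" "0 < l i0"
    unfolding not_face_def by auto
   define l' where "l' = l \<circ> the_inv_into {..<card S} \<sigma>"
   have l': "l' (\<sigma> i) = l i" if "i < card S" for i
    using that \<sigma> by (simp add: l'_def the_inv_into_f_f bij_betw_def)
   show "NF U k S X" unfolding not_face_def
   proof (intro exI[of _ l'] conjI ballI impI)
    show "sum l' S = 0" unfolding s[symmetric] using l(1) by (simp add: l')
    show "(\<Sum>i\<in>S. l' i * crd X i b) = 0" if "b : U" for b
    using l(2) that unfolding s[symmetric] by (simp add: l')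
    show "0 <= l' i" if "i : S" "k <= i" for i
    proof -
    have "i : \<sigma> ` {..<card S}" using that(1) bij_betw_imp_surj_on[OF \<sigma>] by simp
    then obtain j where j: "j < card S" "\<sigma> j = i" by auto
    then show ?thesis using l(3) l'[of j] \<sigma>k[of j] that by auto
    qed
    show "EX i:S. k <= i & 0 < l' i"
    proof (intro bexI conjI)
    show "k <= \<sigma> i0" "0 < l' (\<sigma> i0)" using l(4-6) l'[of i0] \<sigma>k[of i0] by simp_all
    show "\<sigma> i0 : S" using \<sigma> l(4) by (auto simp: bij_betw_def)
    qed
   qed
  qed
 qed
 have D: "distr (M S) (M {..<card S}) (%X. \<lambda>n\<in>{..<card S}. X (\<sigma> n)) = M {..<card S}"
  using \<sigma> by (intro distr_PiM_reindex prob) (auto simp: bij_betw_def)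
 have m: "(%X. \<lambda>n\<in>{..<card S}. X (\<sigma> n)) : measurable (M S) (M {..<card S})"
  using \<sigma> by (intro measurable_restrict measurable_component_singleton) (auto simp: bij_betw_def)
 have "Pr {..<card S} (NF U k {..<card S}) = measure (distr (M S) (M {..<card S}) (%X. \<lambda>n\<in>{..<card S}. X (\<sigma> n))) {X\<in>space (M {..<card S}). NF U k {..<card S} X}"
  unfolding D Pr_def ..
 also have "... = measure (M S) ((%X. \<lambda>n\<in>{..<card S}. X (\<sigma> n)) -` {X\<in>space (M {..<card S}). NF U k {..<card S} X} Int space (M S))"
  by (rule measure_distr[OF m]) (use pred_not_face[of "{..<card S}"] in \<open>auto simp: pred_def\<close>)
 also have "(%X. \<lambda>n\<in>{..<card S}. X (\<sigma> n)) -` {X\<in>space (M {..<card S}). NF U k {..<card S} X} Int space (M S) = {X:space (M S). NF U k S X}"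
  using measurable_space[OF m] nf by auto
 finally show ?thesis by (simp add: Pr_def)
qed

lemma Pr_cong_AE: "(AE X in M I. P X = Q X) ==> Measurable.pred (M I) P ==> Measurable.pred (M I) Q ==> Pr I P = Pr I Q"
 unfolding Pr_def by (rule measure_eq_AE) (auto simp: pred_def elim!: eventually_mono)

lemma Pr_True: "Pr I (%_. True) = 1"
 using prob_space.prob_space[OF prob_M] by (simp add: Pr_def)

lemma integral_of_bool: "Measurable.pred (M I) P ==> has_bochner_integral (M I) (%X. of_bool (P X)) (Pr I P)"
proof -
 assume "Measurable.pred (M I) P"
 then have s: "{X:space (M I). P X} : sets (M I)" by (simp add: pred_def)
 have "has_bochner_integral (M I) (indicator {X:space (M I). P X}) (Pr I P)"
  unfolding Pr_def using s
  by (intro has_bochner_integral_real_indicator) (auto simp: finite_measure.emeasure_eq_measure[OF prob_space.finite_measure[OF prob_M]])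
 then show ?thesis
  by (subst (asm) has_bochner_integral_cong[OF refl _ refl]) (auto simp: indicator_def)
qed

lemma pred_facet: "finite I ==> U <= Basis ==> S ~= {} ==> S <= I ==> Measurable.pred (M I) (%X. facet U S I (crd X))"
 by (rule pred_M[OF borel_facet]) (auto intro!: facet_cong)

lemma card_supersets:
 fixes k n D :: nat
 assumes "k <= D" "k <= n"
 shows "card {S. {..<k} <= S & S <= {..<n} & card S = D} = (n - k) choose (D - k)"
proof -
 have "bij_betw (%T. {..<k} Un T) {T. T <= {k..<n} & card T = D - k} {S. {..<k} <= S & S <= {..<n} & card S = D}"
 proof (rule bij_betwI[where g = "%S. S - {..<k}"])
  show "(%T. {..<k} Un T) : {T. T <= {k..<n} & card T = D - k} \<rightarrow> {S. {..<k} <= S & S <= {..<n} & card S = D}"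
  proof
   fix T assume T: "T : {T. T <= {k..<n} & card T = D - k}"
   then have "finite T" "{..<k} Int T = {}" using finite_subset by auto
   then have "card ({..<k} Un T) = k + (D - k)" using T by (subst card_Un_disjoint) auto
   then show "{..<k} Un T : {S. {..<k} <= S & S <= {..<n} & card S = D}" using T assms by auto
  qed
  show "(%S. S - {..<k}) : {S. {..<k} <= S & S <= {..<n} & card S = D} \<rightarrow> {T. T <= {k..<n} & card T = D - k}"
   by (auto simp: card_Diff_subset)
 qed auto
 then have "card {S. {..<k} <= S & S <= {..<n} & card S = D} = card {T. T <= {k..<n} & card T = D - k}"
  using bij_betw_same_card by fastforce
 then show ?thesis by (simp add: n_subsets)
qed

text \<open>The expectation of \<open>not_face_difference\<close>, which holds almost surely. For
  each \<open>S\<close> the event in \<open>J2\<close> concerns only the shape of the points, so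
  \<open>facet_probability\<close> splits off the facet condition, and the sum over \<open>S\<close>
  becomes a binomial coefficient by exchangeability.\<close>

lemma NF_step:
 assumes U: "U \<subset> Basis" "e1 : U" "e2 : U" "e1 ~= e2" and k: "1 <= k" "k + 1 <= card U" "card U + 1 <= n"
 defines "J2 \<equiv> U - {e1, e2}"
 shows "2 * (Pr {..<n} (NF J2 k {..<n}) - Pr {..<n} (NF U k {..<n})) =
  real ((n - k) choose (card U - k)) * (2 * aa (n - card U) (card U)) * Pr {..<card U} (NF J2 k {..<card U})"
proof -
 let ?I = "{..<n}" and ?A = "{S. {..<k} <= S & S <= {..<n} & card S = card U}"
 have finA: "finite ?A" by (rule finite_subset[of _ "Pow ?I"]) auto
 have fJ: "finite U" using U(1) by (intro finite_subset[OF psubset_imp_subset finite_Basis])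
 have cJ2: "card J2 = card U - 2"
 proof -
  have "J2 = U - {e1} - {e2}" by (auto simp: J2_def)
  then show ?thesis using U fJ by simp
 qed
 \<comment> \<open>\<open>e1\<close> serves as the graph direction of the hyperplanes. It is one of
   the dropped coordinates, so the event in \<open>J2\<close> can be read off from
   \<open>U'\<close>.\<close>
 define U' where "U' = U - {e1}"
 have U': "U = insert e1 U'" "U' <= Basis" "e1 : Basis" "e1 ~: U'" "card U = card U' + 1" "J2 <= U'"
  using U fJ card_Suc_Diff1[of U e1] by (auto simp: U'_def J2_def)
 have S_ne: "S ~= {}" if "S : ?A" for S using that k by auto
 have m1: "Measurable.pred (M ?I) (NF J2 k ?I)" "Measurable.pred (M ?I) (NF U k ?I)" by (auto intro!: pred_not_face)
 have m2: "Measurable.pred (M ?I) (%X. facet U S ?I (crd X) & NF J2 k S X)" if S: "S : ?A" for S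
 proof -
  have "Measurable.pred (M ?I) (NF J2 k S)"
   using S by (intro pred_M[OF borel_not_face]) (auto intro!: not_face_cong intro: finite_subset)
  moreover have "Measurable.pred (M ?I) (%X. facet U S ?I (crd X))"
   using S U(1) S_ne[OF S] by (intro pred_facet) auto
  ultimately show ?thesis by (rule pred_intros_logic(3)[rotated])
 qed
 have hb1: "has_bochner_integral (M ?I) (%X. 2 * (of_bool (NF J2 k ?I X) - of_bool (NF U k ?I X))) (2 * (Pr ?I (NF J2 k ?I) - Pr ?I (NF U k ?I)))"
  by (intro has_bochner_integral_mult_right has_bochner_integral_diff integral_of_bool m1)
 have hb2: "has_bochner_integral (M ?I) (%X. \<Sum>S\<in>?A. of_bool (facet U S ?I (crd X) & NF J2 k S X)) (\<Sum>S\<in>?A. Pr ?I (%X. facet U S ?I (crd X) & NF J2 k S X))"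
  by (intro has_bochner_integral_sum integral_of_bool m2)
 have hae: "AE X in M ?I. 2 * (of_bool (NF J2 k ?I X) - of_bool (NF U k ?I X)) = (\<Sum>S\<in>?A. of_bool (facet U S ?I (crd X) & NF J2 k S X) :: real)"
 proof -
  have "AE X in M ?I. \<forall>U\<subseteq>Basis. \<forall>S\<subseteq>?I. card S <= card U + 1 --> aff_indep U S (crd X)" by (rule AE_general_position) simp
  then show ?thesis
  proof eventually_elim
   case (elim X)
   interpret planar_cone "crd X" U e1 e2 ?I k
   proof
    show "aff_indep U S (crd X)" if "S <= ?I" "card S <= card U + 1" for S using elim U(1) that by blast
    show "aff_indep (U - {e1, e2}) S (crd X)" if "S <= ?I" "card S <= card U - 1" for S
    proof -
    have "J2 <= Basis" "card S <= card J2 + 1" using U(1) that cJ2 k by (auto simp: J2_def)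
    then show ?thesis using elim that unfolding J2_def by blast
    qed
   qed (use U k in auto)
   show ?case using not_face_difference unfolding J2_def .
  qed
 qed
 have "2 * (Pr ?I (NF J2 k ?I) - Pr ?I (NF U k ?I)) = (\<Sum>S\<in>?A. Pr ?I (%X. facet U S ?I (crd X) & NF J2 k S X))"
  by (rule has_bochner_integral_eq_AE[OF hb1 hb2 hae])
 also have "... = (\<Sum>S\<in>?A. (2 * aa (n - card U) (card U)) * Pr {..<card U} (NF J2 k {..<card U}))"
 proof (rule sum.cong[OF refl])
  fix S assume S: "S : ?A"
  have fS: "finite S" using S finite_subset by auto
  have "Pr ?I (%X. NF J2 k S X & facet (insert e1 U') S ?I (crd X)) = Pr S (NF J2 k S) * (2 * aa (card (?I - S)) (card S))"
  proof (rule facet_probability)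
   show "?I ~= S" using S k by auto
   show "{X. NF J2 k S X} : sets borel" by (rule borel_not_face[OF fS])
   show "NF J2 k S X = NF J2 k S Y" if "!!i c. i : S ==> c : U' ==> X i \<bullet> c = Y i \<bullet> c" for X Y
    using that U'(6) by (intro not_face_cong) auto
   show "NF J2 k S Y = NF J2 k S X" if "\<rho> > 0" "!!i. i : S ==> Y i = c + \<rho> *\<^sub>R X i" for X Y c \<rho>
    using that by (intro not_face_affine[where c = "%b. c \<bullet> b" and \<rho> = \<rho>]) (auto simp: inner_add_left)
  qed (use U' U S in auto)
  also have "card (?I - S) = n - card U" using S fS by (simp add: card_Diff_subset)
  finally show "Pr ?I (%X. facet U S ?I (crd X) & NF J2 k S X) = (2 * aa (n - card U) (card U)) * Pr {..<card U} (NF J2 k {..<card U})"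
   using S NF_inject[OF fS, of k J2] by (simp add: U'(1)[symmetric] conj_commute mult.commute)
 qed
 also have "... = real ((n - k) choose (card U - k)) * (2 * aa (n - card U) (card U)) * Pr {..<card U} (NF J2 k {..<card U})"
  using card_supersets[of k "card U" n] k by simp
 finally show ?thesis .
qed

lemma NF_codim0:
 assumes U: "U \<subset> Basis" and k: "1 <= k" "card U = k" "k < n"
 shows "Pr {..<n} (NF U k {..<n}) = 1 - 2 * aa (n - k) k"
proof -
 let ?I = "{..<n}"
 have fJ: "finite U" using U by (intro finite_subset[OF psubset_imp_subset finite_Basis])
 obtain b where b: "b : U" using k by fastforce
 define U' where "U' = U - {b}"
 have U': "U = insert b U'" "U' <= Basis" "b : Basis" "b ~: U'" "card U = card U' + 1"
  using U b fJ card_Suc_Diff1[of U b] by (auto simp: U'_def)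
 have sub: "{..<k} <= ?I" using k by auto
 have mf: "Measurable.pred (M ?I) (%X. facet U {..<k} ?I (crd X))" using U k sub by (intro pred_facet) (auto simp: lessThan_empty_iff)
 have "Pr ?I (NF U k ?I) = Pr ?I (%X. ~ facet U {..<k} ?I (crd X))"
 proof (rule Pr_cong_AE)
  have "AE X in M ?I. \<forall>U\<subseteq>Basis. \<forall>S\<subseteq>?I. card S <= card U + 1 --> aff_indep U S (crd X)" by (rule AE_general_position) simp
  then show "AE X in M ?I. NF U k ?I X = (~ facet U {..<k} ?I (crd X))"
  proof eventually_elim
   case (elim X)
   show ?case by (rule not_face_iff_not_facet) (use elim U k fJ sub in auto)
  qed
 qed (use mf pred_not_face in auto)
 also have "... = 1 - Pr ?I (%X. facet U {..<k} ?I (crd X))"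
  using prob_space.prob_neg[OF prob_M, of ?I "%X. facet U {..<k} ?I (crd X)"] mf unfolding Pr_def pred_def by simp
 also have "Pr ?I (%X. True & facet (insert b U') {..<k} ?I (crd X)) = Pr {..<k} (%_. True) * (2 * aa (card (?I - {..<k})) (card {..<k}))"
  using U U' k sub by (intro facet_probability) auto
 then have "Pr ?I (%X. facet U {..<k} ?I (crd X)) = 2 * aa (n - k) k"
  using sub by (simp add: U'(1)[symmetric] Pr_True card_Diff_subset)
 finally show ?thesis .
qed

lemma NF_full:
 assumes U: "U <= Basis" and k: "card U + 1 = k" "k < n"
 shows "Pr {..<n} (NF U k {..<n}) = 1"
proof -
 let ?I = "{..<n}"
 have fJ: "finite U" using U by (rule finite_subset) simp
 have sub: "{..<k} <= ?I" using k by auto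
 have "Pr ?I (NF U k ?I) = Pr ?I (%_. True)"
 proof (rule Pr_cong_AE)
  have "AE X in M ?I. \<forall>U\<subseteq>Basis. \<forall>S\<subseteq>?I. card S <= card U + 1 --> aff_indep U S (crd X)" by (rule AE_general_position) simp
  then show "AE X in M ?I. NF U k ?I X = True"
  proof eventually_elim
   case (elim X)
   have "aff_indep U {..<k} (crd X)" using elim U k sub by auto
   then show ?case using not_face_full_dim[of ?I k k U "crd X"] k fJ sub by auto
  qed
 qed (use pred_not_face in auto)
 then show ?thesis by (simp add: Pr_True)
qed

definition Bl :: "'e list" where "Bl = (SOME xs. distinct xs & set xs = Basis)"

lemma Bl: "distinct Bl" "set Bl = Basis" "length Bl = DIM('e)"
proof -
 have "EX xs. distinct xs & set xs = (Basis :: 'e set)" using finite_distinct_list[OF finite_Basis] by blast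
 then have "distinct Bl & set Bl = Basis" unfolding Bl_def by (rule someI_ex)
 then show "distinct Bl" "set Bl = Basis" "length Bl = DIM('e)" by (auto simp: distinct_card[symmetric])
qed

text \<open>A fixed increasing sequence of coordinate sets: passing from dimension D to D - 2 drops
  two named basis vectors.\<close>

definition chain :: "nat => 'e set" where "chain D = set (take D Bl)"

lemma chain:
 assumes "D <= DIM('e)" shows "chain D <= Basis" "card (chain D) = D"
proof -
 show "chain D <= Basis" using Bl(2) set_take_subset[of D Bl] by (simp add: chain_def)
 show "card (chain D) = D" unfolding chain_def using Bl assms by (simp add: distinct_card)
qed

lemma chain_psubset: "D < DIM('e) ==> chain D \<subset> Basis"
 using chain[of D] by (metis less_imp_le nat_neq_iff psubsetI)

lemma chain_Suc: "D < DIM('e) ==> chain (Suc D) = insert (Bl ! D) (chain D) & Bl ! D ~: chain D"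
 unfolding chain_def using Bl by (auto simp: take_Suc_conv_app_nth in_set_conv_nth nth_eq_iff_index_eq)

text \<open>The expected internal angle at a face with \<open>k\<close> vertices of a simplex with
  \<open>s\<close> vertices: half the probability that projecting its space of dimension s - 1 along
  one direction destroys the face. For s = k this is the angle of a simplex at itself.\<close>

definition Bprob :: "nat => nat => real" where
 "Bprob k s = (if s = k then 1 else Pr {..<s} (NF (chain (s - 2)) k {..<s}) / 2)"

text \<open>\<open>NF_step\<close> telescopes over the dimensions of the parity of n, and the weight
  is 2 at the visited ones and 0 at the skipped ones. The last term, j = n - k, is the probability
  in dimension n - 2 itself, because \<open>aa 0 n\<close> is 1.\<close>

lemma Bprob_recursion:
 assumes k: "1 <= k" "k < n" and n: "n <= DIM('e) + 1"
 shows "(\<Sum>j\<le>n-k. (1 + (-1) ^ (n - k + j)) * (real ((n - k) choose j) * aa (n - k - j) (k + j) * Bprob k (k + j))) = 1"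
proof -
 define t where "t j = (1 + (-1) ^ (n - k + j)) * (real ((n - k) choose j) * aa (n - k - j) (k + j) * Bprob k (k + j))" for j
 let ?p = "%D. Pr {..<n} (NF (chain D) k {..<n})"
 have Q: "?p D + (\<Sum>j<D+1-k. t j) = 1" if "k <= D + 1" "D + 2 <= n" "even (D + n)" for D
  using that
 proof (induction D rule: less_induct)
  case (less D)
  have Dd: "D < DIM('e)" using less.prems n by simp
  \<comment> \<open>The descent in steps of two ends in one of two dimensions, depending on parity:
    at k - 1 the face fills the space and is lost surely, at k it is itself a candidate
    facet.\<close>
  consider "D + 1 = k" | "D = k" | "k + 1 <= D" using less.prems by linarith
  then show ?case
  proof cases
   case 1
   then show ?thesis using NF_full[of "chain D" k n] chain[of D] Dd k by simp
  next
   case 2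
   have "even (n - k)" using less.prems 2 by auto
   then have "t 0 = 2 * aa (n - k) k" by (simp add: t_def Bprob_def)
   then show ?thesis using NF_codim0[of "chain D" k n] chain_psubset[OF Dd] chain[of D] Dd k 2 by simp
  next
   case 3
   then have "D = (D - 2) + 2" using k by simp
   then obtain D' where D': "D = D' + 2" by blast
   define U where "U = chain D"
   have D'd: "D' < DIM('e)" "Suc D' < DIM('e)" using Dd D' by auto
   have ch: "U = insert (Bl ! Suc D') (insert (Bl ! D') (chain D'))" "Bl ! Suc D' ~: insert (Bl ! D') (chain D')" "Bl ! D' ~: chain D'"
    using chain_Suc[OF D'd(1)] chain_Suc[OF D'd(2)] by (auto simp: U_def D')
   have J2: "U - {Bl ! Suc D', Bl ! D'} = chain D'" using ch by auto
   have cJ: "card U = D" using chain[of D] Dd by (simp add: U_def)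
   have "2 * (?p D' - ?p D) = real ((n - k) choose (D - k)) * (2 * aa (n - D) D) * Pr {..<D} (NF (chain D') k {..<D})"
    using NF_step[of U "Bl ! Suc D'" "Bl ! D'" k n] ch chain_psubset[OF Dd] k 3 less.prems
    unfolding J2 cJ by (auto simp: U_def)
   moreover have "Pr {..<D} (NF (chain D') k {..<D}) = 2 * Bprob k D" using 3 D' by (simp add: Bprob_def)
   moreover have "t (D - k) = 2 * (real ((n - k) choose (D - k)) * aa (n - D) D * Bprob k D)"
   proof -
    have "even (n - k + (D - k))" using less.prems 3 k by auto
    moreover have "n - k - (D - k) = n - D" "k + (D - k) = D" using 3 by auto
    ultimately show ?thesis by (simp add: t_def)
   qed
   ultimately have st: "?p D' = ?p D + t (D - k)" by simp
   have "t (D' + 1 - k) = 0"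
   proof -
    have "odd (n - k + (D' + 1 - k))" using less.prems 3 k D' by auto
    then show ?thesis by (simp add: t_def)
   qed
   moreover have e: "D + 1 - k = Suc (Suc (D' + 1 - k))" "D - k = Suc (D' + 1 - k)" using 3 D' by auto
   ultimately have "(\<Sum>j<D+1-k. t j) = (\<Sum>j<D'+1-k. t j) + t (D - k)"
    unfolding e sum.lessThan_Suc by simp
   moreover have "?p D' + (\<Sum>j<D'+1-k. t j) = 1" using less.prems 3 D' by (intro less.IH) auto
   ultimately show ?thesis using st by simp
  qed
 qed
 have n2: "n = n - 2 + 2" using k by simp
 have "?p (n - 2) + (\<Sum>j<n-2+1-k. t j) = 1"
  using k by (intro Q) (auto simp: even_diff_nat)
 moreover have "?p (n - 2) = t (n - k)"
 proof -
  have "aa 0 n = 1" by (simp add: aa_def AA_0)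
  then show ?thesis using k by (simp add: t_def Bprob_def)
 qed
 moreover have "(\<Sum>j\<le>n-k. t j) = (\<Sum>j<n-2+1-k. t j) + t (n - k)"
 proof -
  have a: "n - k = Suc (n - 2 + 1 - k)" using k by auto
  have "odd (n - k + (n - 2 + 1 - k))" unfolding a by simp
  then have "t (n - 2 + 1 - k) = 0" by (simp add: t_def)
  moreover have "(\<Sum>j\<le>n-k. t j) = (\<Sum>j<Suc (Suc (n - 2 + 1 - k)). t j)" unfolding a lessThan_Suc_atMost ..
  ultimately show ?thesis using a by simp
 qed
 ultimately show ?thesis unfolding t_def by simp
qed

text \<open>The recursion is triangular: the unknown with index n occurs with coefficient 2 *
  \<open>aa 0 n\<close> = 2, all others have smaller index. So it determines the values by
  induction.\<close>

theorem Bprob_eq: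
 assumes k: "1 <= k" "k <= n" and n: "n <= DIM('e) + 1"
 shows "complex_of_real (Bprob k n) = BB \<alpha> (\<alpha> * n + 2) (n - k) / of_real (cosint (\<alpha> * n + 1))"
 using k(2) n
proof (induction n rule: less_induct)
 case (less n)
 let ?bf = "%s. BB \<alpha> (\<alpha> * s + 2) (s - k) / complex_of_real (cosint (\<alpha> * s + 1))"
 show ?case
 proof (cases "n = k")
  case True
  then show ?thesis using BB_0[of \<alpha> "\<alpha> * n + 1"] by (simp add: Bprob_def numeral_2_eq_2)
 next
  case False
  then have kn: "k < n" using less.prems by simp
  define m where "m = n - k"
  have m: "m >= 1" "n = k + m" using kn by (auto simp: m_def)
  let ?w = "%j. complex_of_real (1 + (-1) ^ (m + j)) * of_real (real (m choose j) * aa (m - j) (k + j))"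
  have 1: "(\<Sum>j\<le>m. ?w j * of_real (Bprob k (k + j))) = 1"
  proof -
   have "(\<Sum>j\<le>m. ?w j * of_real (Bprob k (k + j))) = of_real (\<Sum>j\<le>m. (1 + (-1) ^ (m + j)) * (real (m choose j) * aa (m - j) (k + j) * Bprob k (k + j)))"
    by (simp add: mult.assoc)
   then show ?thesis using Bprob_recursion[OF k(1) kn less.prems(2)] by (simp only: m_def of_real_1)
  qed
  have cancel: "x = y" if "a = a'" "a + x = 1" "a' + y = 1" for a a' x y :: complex
   using that by (metis add_left_imp_eq)
  have 2: "(\<Sum>j\<le>m. ?w j * ?bf (k + j)) = 1"
  proof -
   have e: "complex_of_real (real (m choose j)) * of_real (real (\<alpha> * k + \<alpha> * j + 1) * AA \<alpha> (\<alpha> * k + \<alpha> * j) (m - j))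
    * ((1 + (-1) ^ (m + j)) * BB \<alpha> (\<alpha> * k + \<alpha> * j + 2) j) = of_real (2 * pi) * (?w j * ?bf (k + j))" for j
   proof -
    define p where "p = \<alpha> * (k + j)"
    have p: "\<alpha> * k + \<alpha> * j = p" by (simp add: p_def algebra_simps)
    \<comment> \<open>By \<open>cosint_mult\<close> the coefficient p + 1 equals 2 pi divided by two
      consecutive cosine integrals; one normalises \<open>AA\<close> to \<open>aa\<close>, the other
      normalises \<open>BB\<close>.\<close>
    have "real (p + 1) * AA \<alpha> p (m - j) = 2 * pi * (aa (m - j) (k + j) / cosint (p + 1))"
    proof -
    have "real (p + 1) * (cosint p * cosint (p + 1)) = 2 * pi" unfolding cosint_mult by (simp add: divide_simps)
    then have "2 * pi * (aa (m - j) (k + j) / cosint (p + 1)) = real (p + 1) * (cosint p * cosint (p + 1)) * (aa (m - j) (k + j) / cosint (p + 1))" by simp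
    also have "... = real (p + 1) * AA \<alpha> p (m - j)" by (simp add: aa_def p_def)
    finally show ?thesis by simp
    qed
    then show ?thesis unfolding p by (simp add: p_def mult_ac)
   qed
   have "of_real (2 * pi) * (\<Sum>j\<le>m. ?w j * ?bf (k + j)) = of_real (2 * pi)"
    unfolding sum_distrib_left e[symmetric] using AA_BB_identity[OF m(1), of "\<alpha> * k" \<alpha>] by (simp only: of_real_of_nat_eq)
   then show ?thesis by simp
  qed
  have "(\<Sum>j<m. ?w j * of_real (Bprob k (k + j))) = (\<Sum>j<m. ?w j * ?bf (k + j))"
  proof (rule sum.cong[OF refl])
   fix j assume "j : {..<m}"
   then have "complex_of_real (Bprob k (k + j)) = ?bf (k + j)" using less.IH[of "k + j"] less.prems m by auto
   then show "?w j * of_real (Bprob k (k + j)) = ?w j * ?bf (k + j)" by simp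
  qed
  moreover have "(\<Sum>j<m. ?w j * of_real (Bprob k (k + j))) + ?w m * of_real (Bprob k (k + m)) = 1"
   "(\<Sum>j<m. ?w j * ?bf (k + j)) + ?w m * ?bf (k + m) = 1"
   using 1 2 unfolding lessThan_Suc_atMost[symmetric] sum.lessThan_Suc .
  ultimately have "?w m * of_real (Bprob k (k + m)) = ?w m * ?bf (k + m)"
   by (rule cancel)
  moreover have "?w m = 2"
   using cosint_pos[of "\<alpha> * (k + m)"] by (simp add: aa_def AA_0)
  ultimately have "2 * complex_of_real (Bprob k (k + m)) = 2 * ?bf (k + m)" by (simp only:)
  then have "complex_of_real (Bprob k (k + m)) = ?bf (k + m)" by (simp only: mult_cancel_left) simp
  then show ?thesis unfolding m(2) .
 qed
qed

end

section \<open>Internal angles as volumes of cones\<close>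

lemma mem_cone_over_Basis:
 "x : cone_over Basis k I (crd X) \<longleftrightarrow> (EX l. sum l I = 0 & (ALL i:I. k <= i --> 0 <= l i) & x = (\<Sum>i\<in>I. l i *\<^sub>R X i))"
 unfolding cone_over_def by (simp add: euclidean_eq_iff[of x] inner_sum_left)

lemma mem_cone_over_scale:
 assumes "r > 0" shows "r *\<^sub>R x : cone_over Basis k I (crd X) \<longleftrightarrow> x : cone_over Basis k I (crd X)"
proof -
 have s: "c *\<^sub>R y : cone_over Basis k I (crd X)" if "y : cone_over Basis k I (crd X)" "0 < c" for y and c :: real
  using that convex_cone_cone_over[of Basis k I "crd X"] unfolding convex_cone_def conic_def by (meson less_imp_le)
 show ?thesis using s[of x r] s[of "r *\<^sub>R x" "inverse r"] assms by auto
qed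

text \<open>Near a point z in the relative interior of the face the simplex coincides with z plus
  the cone: a displacement shorter than \<open>r0\<close> changes each barycentric coordinate by at
  most the least positive coordinate of z. The ratio of volumes is therefore constant for small
  radii.\<close>

lemma internal_angle_cone:
 fixes X :: "nat => 'e::euclidean_space"
 assumes k: "1 <= k" "k <= n" and n: "n = DIM('e) + 1" and ai: "aff_indep Basis {..<n} (crd X)"
 shows "internal_angle (convex hull (X ` {..<k})) (convex hull (X ` {..<n})) =
  measure lborel (ball 0 1 Int cone_over Basis k {..<n} (crd X)) / measure lborel (ball (0::'e) 1)"
proof -
 let ?C = "cone_over Basis k {..<n} (crd X)" and ?F = "convex hull (X ` {..<k})" and ?T = "convex hull (X ` {..<n})"
 have hull: "convex hull (X ` {..<m}) = {\<Sum>i<m. c i *\<^sub>R X i | c. (ALL i<m. 0 <= c i) & sum c {..<m} = 1}" for m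
 proof -
  have "convex hull (\<Union>i\<in>{..<m}. {X i}) = {sum (%i. c i *\<^sub>R s i) {..<m} | c s. (ALL i:{..<m}. c i >= 0) & sum c {..<m} = 1 & (ALL i:{..<m}. s i : {X i})}"
   by (rule convex_hull_finite_union) auto
  also have "... = {\<Sum>i<m. c i *\<^sub>R X i | c. (ALL i<m. 0 <= c i) & sum c {..<m} = 1}" by force
  finally show ?thesis by (simp add: UNION_singleton_eq_range)
 qed
 have rel: "rel_interior ?F = {\<Sum>i<k. c i *\<^sub>R X i | c. (ALL i<k. 0 < c i) & sum c {..<k} = 1}"
 proof -
  have "rel_interior (convex hull (\<Union>i\<in>{..<k}. {X i})) = {sum (%i. c i *\<^sub>R s i) {..<k} | c s. (ALL i:{..<k}. c i > 0) & sum c {..<k} = 1 & (ALL i:{..<k}. s i : rel_interior {X i})}"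
   by (rule rel_interior_convex_hull_union) auto
  also have "... = {\<Sum>i<k. c i *\<^sub>R X i | c. (ALL i<k. 0 < c i) & sum c {..<k} = 1}" by force
  finally show ?thesis by (simp add: UNION_singleton_eq_range)
 qed
 define z where "z = (SOME z. z : rel_interior ?F)"
 have "z : rel_interior ?F" unfolding z_def
 proof (rule someI_ex)
  have "?F ~= {}" using k by (auto simp: lessThan_empty_iff)
  then show "EX z. z : rel_interior ?F" using rel_interior_eq_empty[of ?F] by auto
 qed
 then obtain u where u: "!!i. i < k ==> 0 < u i" "sum u {..<k} = 1" "z = (\<Sum>i<k. u i *\<^sub>R X i)"
  unfolding rel by auto
 define u' where "u' i = (if i < k then u i else 0)" for i
 have sub: "{..<n} Int {i. i < k} = {..<k}" using k by auto
 have u': "sum u' {..<n} = 1" "z = (\<Sum>i<n. u' i *\<^sub>R X i)"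
 proof -
  show "sum u' {..<n} = 1" unfolding u'_def using u(2) by (simp add: sum.If_cases sub)
  have "(\<Sum>i<n. u' i *\<^sub>R X i) = (\<Sum>i<n. if i < k then u i *\<^sub>R X i else 0)" by (intro sum.cong) (auto simp: u'_def)
  then show "z = (\<Sum>i<n. u' i *\<^sub>R X i)" using u(3) by (simp add: sum.If_cases sub)
 qed
 have sub_cone: "x - z : ?C" if x: "x : ?T" for x
 proof -
  obtain c where c: "!!i. i < n ==> 0 <= c i" "sum c {..<n} = 1" "x = (\<Sum>i<n. c i *\<^sub>R X i)"
   using x unfolding hull[of n] by auto
  show ?thesis unfolding mem_cone_over_Basis
  proof (intro exI[of _ "%i. c i - u' i"] conjI)
   show "(\<Sum>i<n. c i - u' i) = 0" using c(2) u'(1) by (simp add: sum_subtractf)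
   show "ALL i:{..<n}. k <= i --> 0 <= c i - u' i" using c(1) by (auto simp: u'_def)
   show "x - z = (\<Sum>i<n. (c i - u' i) *\<^sub>R X i)" using c(3) u'(2) by (simp add: sum_subtractf scaleR_diff_left)
  qed
 qed
 have "ALL b:Basis. EX l. sum l {..<n} = 0 & (\<Sum>i<n. l i *\<^sub>R X i) = b"
 proof
  fix b :: 'e assume "b : Basis"
  obtain l where "sum l {..<n} = 0" "ALL b':Basis. (\<Sum>i<n. l i * crd X i b') = b \<bullet> b'"
   using aff_indep_spans[of "{..<n}" Basis "crd X" "%b'. b \<bullet> b'"] ai n by auto
  then show "EX l. sum l {..<n} = 0 & (\<Sum>i<n. l i *\<^sub>R X i) = b"
   by (intro exI[of _ l]) (auto simp: euclidean_eq_iff[of _ b] inner_sum_left)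
 qed
 then obtain L where L: "!!b. b : Basis ==> sum (L b) {..<n} = 0" "!!b. b : Basis ==> (\<Sum>i<n. L b i *\<^sub>R X i) = b"
  by metis
 \<comment> \<open>A Lipschitz constant for the barycentric coordinates; the summand 1 keeps it
   positive.\<close>
 define K where "K = 1 + (\<Sum>b\<in>Basis. \<Sum>i<n. \<bar>L b i\<bar>)"
 have K: "K > 0" unfolding K_def by (intro add_pos_nonneg sum_nonneg) auto
 have coord: "\<bar>l i\<bar> <= K * norm x" if l: "sum l {..<n} = 0" "x = (\<Sum>i<n. l i *\<^sub>R X i)" and i: "i < n" for l x i
 proof -
  define l' where "l' i = (\<Sum>b\<in>Basis. (x \<bullet> b) * L b i)" for i
  have "sum l' {..<n} = (\<Sum>b\<in>Basis. (x \<bullet> b) * sum (L b) {..<n})" unfolding l'_def sum_distrib_left by (rule sum.swap)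
  then have s: "sum l' {..<n} = 0" by (simp add: L)
  have "(\<Sum>i<n. l' i *\<^sub>R X i) = (\<Sum>b\<in>Basis. (x \<bullet> b) *\<^sub>R (\<Sum>i<n. L b i *\<^sub>R X i))"
   unfolding l'_def scaleR_sum_left scaleR_sum_right scaleR_scaleR by (rule sum.swap)
  also have "... = x" by (simp add: L euclidean_representation)
  finally have x': "(\<Sum>i<n. l' i *\<^sub>R X i) = x" .
  have "ALL i:{..<n}. l i - l' i = 0"
  proof (rule mp[OF ai[unfolded aff_indep_def, THEN spec, of "%i. l i - l' i"]])
   show "(\<Sum>i<n. l i - l' i) = 0 & (ALL b:Basis. (\<Sum>i<n. (l i - l' i) * crd X i b) = 0)"
   proof (intro conjI ballI)
    show "(\<Sum>i<n. l i - l' i) = 0" using s l(1) by (simp add: sum_subtractf)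
    fix b :: 'e
    have "(\<Sum>i<n. (l i - l' i) * crd X i b) = ((\<Sum>i<n. l i *\<^sub>R X i) - (\<Sum>i<n. l' i *\<^sub>R X i)) \<bullet> b"
    by (simp add: inner_sum_left inner_diff_left sum_subtractf left_diff_distrib)
    then show "(\<Sum>i<n. (l i - l' i) * crd X i b) = 0" using x' l(2) by simp
   qed
  qed
  then have "l i = l' i" using i by auto
  then have "\<bar>l i\<bar> <= (\<Sum>b\<in>Basis. \<bar>x \<bullet> b\<bar> * \<bar>L b i\<bar>)" unfolding l'_def by (auto intro: order_trans[OF sum_abs] simp: abs_mult)
  also have "... <= (\<Sum>b\<in>Basis. norm x * (\<Sum>i<n. \<bar>L b i\<bar>))"
   using i by (intro sum_mono mult_mono Basis_le_norm member_le_sum) auto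
  also have "... = norm x * (\<Sum>b\<in>Basis. \<Sum>i<n. \<bar>L b i\<bar>)" by (rule sum_distrib_left[symmetric])
  also have "... <= K * norm x" by (simp add: K_def algebra_simps)
  finally show ?thesis .
 qed
 define m where "m = Min (u ` {..<k})"
 have m: "m > 0" "!!i. i < k ==> m <= u i"
 proof -
  have ne: "u ` {..<k} ~= {}" using k by (auto simp: lessThan_empty_iff)
  show "m > 0" unfolding m_def using ne u(1) by (subst Min_gr_iff) auto
  show "m <= u i" if "i < k" for i unfolding m_def using that by (intro Min_le) auto
 qed
 define r0 where "r0 = m / K"
 have r0: "r0 > 0" using m K by (simp add: r0_def)
 have eq: "ball z r Int ?T = (%x. r *\<^sub>R x + z) ` (ball 0 1 Int ?C)" if r: "0 < r" "r <= r0" for r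
 proof (intro set_eqI iffI)
  fix x assume x: "x : ball z r Int ?T"
  have "x - z : ?C" using x sub_cone by auto
  then have "(1/r) *\<^sub>R (x - z) : ?C" using mem_cone_over_scale[of "1/r"] r by auto
  moreover have "norm ((1/r) *\<^sub>R (x - z)) < 1" using x r by (simp add: dist_norm norm_minus_commute)
  ultimately have "(1/r) *\<^sub>R (x - z) : ball 0 1 Int ?C" by (simp only: Int_iff mem_ball_0)
  moreover have "x = r *\<^sub>R ((1/r) *\<^sub>R (x - z)) + z" using r by simp
  ultimately show "x : (%x. r *\<^sub>R x + z) ` (ball 0 1 Int ?C)" by (rule rev_image_eqI)
 next
  fix x assume "x : (%x. r *\<^sub>R x + z) ` (ball 0 1 Int ?C)"
  then obtain w where w: "norm w < 1" "w : ?C" "x = r *\<^sub>R w + z" by auto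
  have nw: "norm (r *\<^sub>R w) < r" using w r by simp
  have "r *\<^sub>R w : ?C" using mem_cone_over_scale[of r w] r w by simp
  then obtain l where l: "sum l {..<n} = 0" "ALL i:{..<n}. k <= i --> 0 <= l i" "r *\<^sub>R w = (\<Sum>i<n. l i *\<^sub>R X i)"
   unfolding mem_cone_over_Basis by auto
  have "x = (\<Sum>i<n. (l i + u' i) *\<^sub>R X i)" using w(3) l(3) u'(2) by (simp add: scaleR_add_left sum.distrib)
  moreover have "(\<Sum>i<n. l i + u' i) = 1" using l(1) u'(1) by (simp add: sum.distrib)
  moreover have "0 <= l i + u' i" if "i < n" for i
  proof (cases "i < k")
   case True
   have "\<bar>l i\<bar> <= K * norm (r *\<^sub>R w)" by (rule coord[OF l(1,3) that])
   also have "... <= K * r0" using K by (intro mult_left_mono order_trans[OF less_imp_le[OF nw] r(2)]) auto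
   also have "... = m" using K by (simp add: r0_def)
   also have "... <= u i" using True by (rule m)
   finally show ?thesis using True by (simp add: u'_def)
  qed (use l(2) that in \<open>auto simp: u'_def\<close>)
  ultimately have "x : ?T" unfolding hull[of n] by (auto intro!: exI[of _ "%i. l i + u' i"])
  then show "x : ball z r Int ?T" using w(3) nw by (simp add: dist_norm)
 qed
 have ratio: "measure lebesgue (ball z r Int ?T) / measure lebesgue (ball z r) = measure lebesgue (ball 0 1 Int ?C) / measure lebesgue (ball (0::'e) 1)"
  if r: "0 < r" "r <= r0" for r
 proof -
  have "ball z r = (%x. r *\<^sub>R x + z) ` ball 0 1"
  proof (intro set_eqI iffI)
   fix x assume "x : ball z r"
   then have "norm ((1/r) *\<^sub>R (x - z)) < 1" using r by (simp add: dist_norm norm_minus_commute)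
   then have "(1/r) *\<^sub>R (x - z) : ball 0 1" by (simp only: mem_ball_0)
   moreover have "x = r *\<^sub>R ((1/r) *\<^sub>R (x - z)) + z" using r by simp
   ultimately show "x : (%x. r *\<^sub>R x + z) ` ball 0 1" by (rule rev_image_eqI)
  qed (use r in \<open>auto simp: dist_norm\<close>)
  then have "measure lebesgue (ball z r) = (abs r) ^ DIM('e) * measure lebesgue (ball (0::'e) 1)"
   using measure_lebesgue_affine[of r z "ball 0 1"] by simp
  moreover have "measure lebesgue (ball z r Int ?T) = (abs r) ^ DIM('e) * measure lebesgue (ball 0 1 Int ?C)"
   unfolding eq[OF r] by (rule measure_lebesgue_affine)
  ultimately show ?thesis using r by simp
 qed
 have cl: "closed ?C" using k by (intro closed_cone_over[of _ 0]) auto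
 have "internal_angle ?F ?T = measure lebesgue (ball 0 1 Int ?C) / measure lebesgue (ball (0::'e) 1)"
  unfolding internal_angle_def Let_def z_def[symmetric]
 proof (rule tendsto_Lim)
  show "((%r. measure lebesgue (ball z r Int ?T) / measure lebesgue (ball z r)) \<longlongrightarrow> measure lebesgue (ball 0 1 Int ?C) / measure lebesgue (ball (0::'e) 1)) (at_right 0)"
  proof (rule tendsto_eventually)
   show "eventually (%r. measure lebesgue (ball z r Int ?T) / measure lebesgue (ball z r) = measure lebesgue (ball 0 1 Int ?C) / measure lebesgue (ball (0::'e) 1)) (at_right 0)"
    unfolding eventually_at_right_field using r0 ratio by (intro exI[of _ r0]) auto
  qed
 qed simp
 also have "... = measure lborel (ball 0 1 Int ?C) / measure lborel (ball (0::'e) 1)"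
  using cl by (simp add: borel_closed)
 finally show ?thesis .
qed

text \<open>A degenerate simplex lies in a hyperplane, so all volumes vanish. Knowing this value,
  one can express the angle for every configuration, which gives its measurability in
  \<open>expected_internal_angle\<close>.\<close>

lemma internal_angle_degenerate:
 fixes X :: "nat => 'e::euclidean_space"
 assumes n: "n = DIM('e) + 1" and nai: "~ aff_indep Basis {..<n} (crd X)"
 shows "internal_angle F (convex hull (X ` {..<n})) = 0"
proof -
 let ?T = "convex hull (X ` {..<n})"
 obtain l i0 where l: "sum l {..<n} = 0" "ALL b:Basis. (\<Sum>i<n. l i * crd X i b) = 0" "i0 < n" "l i0 ~= 0"
  using nai unfolding aff_indep_def by auto
 let ?S = "{..<n} - {i0}"
 obtain v t where v: "EX b:Basis. v b ~= 0" "ALL i:?S. (\<Sum>b\<in>Basis. v b * crd X i b) = t"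
 proof -
  have c: "card ?S = DIM('e)" using l(3) n by simp
  moreover have "?S ~= {}" using c DIM_positive[where 'a = 'e] by (metis card.empty less_irrefl)
  ultimately show ?thesis using ex_normal[of ?S Basis "crd X"] that by auto
 qed
 define a where "a = (\<Sum>b\<in>Basis. v b *\<^sub>R b :: 'e)"
 have ab: "a \<bullet> x = (\<Sum>b\<in>Basis. v b * (x \<bullet> b))" for x
  unfolding a_def inner_sum_left inner_scaleR_left by (simp add: inner_commute)
 have a0: "a ~= 0"
 proof -
  obtain b where b: "b : Basis" "v b ~= 0" using v(1) by auto
  then have "a \<bullet> b = v b" by (simp add: a_def inner_sum_left inner_Basis if_distrib sum.delta cong: if_cong)
  then show ?thesis using b by auto
 qed
 have S: "a \<bullet> X i = t" if "i : ?S" for i using v(2) that by (simp add: ab)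
 have "(\<Sum>i<n. l i *\<^sub>R X i) = 0"
 proof (rule euclidean_eqI)
  fix b :: 'e assume b: "b : Basis"
  have "(\<Sum>i<n. l i *\<^sub>R X i) \<bullet> b = (\<Sum>i<n. l i * crd X i b)" unfolding inner_sum_left inner_scaleR_left ..
  also have "... = 0" using l(2) b by blast
  finally show "(\<Sum>i<n. l i *\<^sub>R X i) \<bullet> b = 0 \<bullet> b" by simp
 qed
 then have "a \<bullet> (\<Sum>i<n. l i *\<^sub>R X i) = 0" by simp
 then have "(\<Sum>i<n. l i * (a \<bullet> X i)) = 0" unfolding inner_sum_right inner_scaleR_right .
 moreover have "(\<Sum>i<n. l i * (a \<bullet> X i)) = l i0 * (a \<bullet> X i0) + (\<Sum>i\<in>?S. l i * t)"
  using l(3) S by (subst sum.remove[of _ i0]) (auto intro!: sum.cong)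
 moreover have "sum l {..<n} = l i0 + sum l ?S" using l(3) by (subst sum.remove[of _ i0]) auto
 then have "sum l ?S = - l i0" using l(1) by simp
 then have "(\<Sum>i\<in>?S. l i * t) = - l i0 * t" unfolding sum_distrib_right[symmetric] by simp
 ultimately have "l i0 * (a \<bullet> X i0 - t) = 0" by (simp add: algebra_simps)
 then have "a \<bullet> X i0 = t" using l(4) by simp
 then have "X ` {..<n} <= {x. a \<bullet> x = t}" using S by auto
 then have "?T <= {x. a \<bullet> x = t}" by (intro hull_minimal convex_hyperplane)
 then have "negligible (ball z r Int ?T)" for z r
  using negligible_hyperplane[of a t] a0 negligible_subset by (metis inf.coboundedI2)
 then have "measure lebesgue (ball z r Int ?T) = 0" for z r by (rule negligible_imp_measure0)
 then show ?thesis unfolding internal_angle_def Let_def by (simp add: tendsto_Lim)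
qed

context beta_law
begin

lemma distr_rotate:
 assumes f: "orthogonal_transformation f" and I: "finite I"
 shows "distr (M I) (M I) (%X. \<lambda>i\<in>I. f (X i)) = M I" "(%X. \<lambda>i\<in>I. f (X i)) : measurable (M I) (M I)"
proof -
 have mf: "f : borel_measurable borel"
  using f by (intro borel_measurable_continuous_onI linear_continuous_on)
   (simp add: linear_conv_bounded_linear orthogonal_transformation_def)
 then have mf': "f : measurable \<mu> \<mu>" by (simp cong: measurable_cong_sets add: sets_mu)
 have "distr (M I) (M I) (compose I f) = PiM I (%i. distr \<mu> \<mu> f)"
  by (rule distr_PiM_finite_prob_space') (use I prob mf' in auto)
 moreover have "distr \<mu> \<mu> f = \<mu>" using rot[OF f] by (subst distr_cong[OF refl sets_mu refl]) auto
 moreover have "compose I f = (%X. \<lambda>i\<in>I. f (X i))" by (simp add: compose_def fun_eq_iff)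
 ultimately show "distr (M I) (M I) (%X. \<lambda>i\<in>I. f (X i)) = M I" by simp
 show "(%X. \<lambda>i\<in>I. f (X i)) : measurable (M I) (M I)"
  using mf' by (intro measurable_restrict) (auto intro: measurable_compose[OF measurable_component_singleton])
qed

abbreviation in_cone :: "nat => nat set => 'e => (nat => 'e) => bool" where
 "in_cone k I y X \<equiv> y : cone_over Basis k I (crd X)"

lemma cone_cong: "(!!i. i : I ==> X i = Y i) ==> cone_over Basis k I (crd X) = cone_over Basis k I (crd Y)"
 unfolding cone_over_def by simp

text \<open>The tested vector is stored as one more point of the configuration, at an index
  \<open>m\<close> outside \<open>I\<close>; then \<open>borel_cone_over\<close> applies.\<close>

lemma pred_cone_pair:
 assumes "finite I"
 shows "Measurable.pred (M I \<Otimes>\<^sub>M lborel) (%p. in_cone k I (snd p) (fst p))"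
proof -
 obtain m where m: "m ~: I" using assms by (meson infinite_nat_iff_unbounded_le ex_new_if_finite infinite_UNIV_nat)
 define f where "f p i = (if i = m then snd p else extend0 I (fst p) i)" for p :: "(nat => 'e) \<times> 'e" and i
 have "f : measurable (M I \<Otimes>\<^sub>M lborel) (PiM UNIV (%_. borel))"
 proof (rule measurable_PiM_single')
  fix i :: nat
  have "(%X. X i) : measurable (M I) borel" if "i : I"
   using measurable_component_singleton[OF that, of "%_. \<mu>"] sets_mu by (simp cong: measurable_cong_sets)
  then show "(%p. f p i) : borel_measurable (M I \<Otimes>\<^sub>M lborel)"
   unfolding f_def by (cases "i = m"; cases "i : I") (auto simp: extend0_def intro: measurable_compose[OF measurable_fst])
 qed auto
 then have f: "f : measurable (M I \<Otimes>\<^sub>M lborel) borel" by (simp cong: measurable_cong_sets add: sets_PiM_equal_borel)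
 have "Measurable.pred borel (%X. X m : cone_over Basis k I (crd X))"
  using borel_cone_over[OF assms, of m Basis k] by (simp add: pred_def)
 from measurable_compose[OF f this] have "Measurable.pred (M I \<Otimes>\<^sub>M lborel) (%p. f p m : cone_over Basis k I (crd (f p)))" .
 moreover have "cone_over Basis k I (crd (f p)) = cone_over Basis k I (crd (fst p))" for p
  by (rule cone_cong) (use m in \<open>auto simp: f_def extend0_def\<close>)
 ultimately show ?thesis by (simp add: f_def)
qed

lemma pred_cone: "finite I ==> Measurable.pred (M I) (in_cone k I y)"
 using measurable_compose[OF measurable_Pair[OF measurable_ident measurable_const[of y lborel]] pred_cone_pair[of I k]]
 by simp

lemma cone_rotate:
 assumes f: "orthogonal_transformation f"
 shows "in_cone k I (f y) (\<lambda>i\<in>I. f (X i)) = in_cone k I y X"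
proof -
 have l: "linear f" and inj: "inj f" using f by (auto simp: orthogonal_transformation_linear orthogonal_transformation_inj)
 have "f y = (\<Sum>i\<in>I. l' i *\<^sub>R (\<lambda>i\<in>I. f (X i)) i) \<longleftrightarrow> y = (\<Sum>i\<in>I. l' i *\<^sub>R X i)" for l'
 proof -
  have "(\<Sum>i\<in>I. l' i *\<^sub>R (\<lambda>i\<in>I. f (X i)) i) = f (\<Sum>i\<in>I. l' i *\<^sub>R X i)"
   by (simp add: linear_sum[OF l] linear_scale[OF l])
  then show ?thesis using inj by (simp add: inj_eq)
 qed
 then show ?thesis unfolding mem_cone_over_Basis by simp
qed

lemma Pr_cone_rotate:
 assumes f: "orthogonal_transformation f" and I: "finite I"
 shows "Pr I (in_cone k I (f y)) = Pr I (in_cone k I y)"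
proof -
 have "Pr I (in_cone k I (f y)) = measure (distr (M I) (M I) (%X. \<lambda>i\<in>I. f (X i))) {X:space (M I). in_cone k I (f y) X}"
  unfolding distr_rotate(1)[OF f I] Pr_def ..
 also have "... = measure (M I) ((%X. \<lambda>i\<in>I. f (X i)) -` {X:space (M I). in_cone k I (f y) X} Int space (M I))"
  by (rule measure_distr[OF distr_rotate(2)[OF f I]]) (use pred_cone[OF I] in \<open>auto simp: pred_def\<close>)
 also have "(%X. \<lambda>i\<in>I. f (X i)) -` {X:space (M I). in_cone k I (f y) X} Int space (M I) = {X:space (M I). in_cone k I y X}"
  using measurable_space[OF distr_rotate(2)[OF f I]] cone_rotate[OF f] by auto
 finally show ?thesis by (simp add: Pr_def)
qed

lemma Pr_cone_const:
 assumes I: "finite I" and xy: "x ~= 0" "y ~= 0"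
 shows "Pr I (in_cone k I x) = Pr I (in_cone k I y)"
proof -
 have "norm x = norm ((norm x / norm y) *\<^sub>R y)" using xy by simp
 then obtain f where f: "orthogonal_transformation f" "f x = (norm x / norm y) *\<^sub>R y"
  by (rule ex_orthogonal_transformation)
 have "in_cone k I (f x) X = in_cone k I y X" for X
  unfolding f(2) using xy by (intro mem_cone_over_scale) simp
 then show ?thesis using Pr_cone_rotate[OF f(1) I, where y = x and k = k] by simp
qed

text \<open>Fubini for configuration and point of the ball. By \<open>Pr_cone_const\<close> the
  inner probability is the same for every nonzero point.\<close>

lemma expected_cone_volume:
 assumes I: "finite I" and e: "e ~= 0"
 shows "(%X. measure lborel (ball 0 1 Int cone_over Basis k I (crd X))) : borel_measurable (M I)"
  and "(\<integral>X. measure lborel (ball 0 1 Int cone_over Basis k I (crd X)) \<partial>M I) = measure lborel (ball (0::'e) 1) * Pr I (in_cone k I e)"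
proof -
 interpret MI: prob_space "M I" by (rule prob_M)
 interpret P: pair_sigma_finite "M I" "lborel :: 'e measure" by standard
 note em = finite_measure.emeasure_eq_measure[OF prob_space.finite_measure[OF prob_M]]
 let ?B = "ball (0::'e) 1" and ?g = "%X y. indicator (ball 0 1) y * of_bool (in_cone k I y X) :: ennreal"
 let ?C = "%X. ball (0::'e) 1 Int cone_over Basis k I (crd X)"
 have m: "(%(X, y). ?g X y) : borel_measurable (M I \<Otimes>\<^sub>M lborel)"
 proof -
  have "(%p. indicator ?B (snd p) * of_bool (in_cone k I (snd p) (fst p)) :: ennreal) : borel_measurable (M I \<Otimes>\<^sub>M lborel)"
  proof (intro borel_measurable_times_ennreal)
   show "(%p. indicator ?B (snd p) :: ennreal) : borel_measurable (M I \<Otimes>\<^sub>M lborel)"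
    by (rule measurable_compose[OF measurable_snd borel_measurable_indicator]) simp
   show "(%p. of_bool (in_cone k I (snd p) (fst p)) :: ennreal) : borel_measurable (M I \<Otimes>\<^sub>M lborel)"
    using pred_cone_pair[OF I, of k] by (rule measurable_compose) simp
  qed
  then show ?thesis by (simp add: case_prod_beta)
 qed
 have inner: "(\<integral>\<^sup>+y. ?g X y \<partial>lborel) = ennreal (measure lborel (?C X))" if X: "X : space (M I)" for X
 proof -
  have "Measurable.pred lborel (%y. in_cone k I y X)"
   using measurable_compose[OF measurable_Pair[OF measurable_const[OF X] measurable_ident] pred_cone_pair[OF I, of k]] by simp
  then have s: "cone_over Basis k I (crd X) : sets lborel" by (simp add: pred_def)
  have "(\<integral>\<^sup>+y. ?g X y \<partial>lborel) = (\<integral>\<^sup>+y. indicator (?C X) y \<partial>lborel)"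
   by (rule nn_integral_cong) (auto simp: indicator_def)
  also have "... = emeasure lborel (?C X)" using s by (intro nn_integral_indicator) auto
  also have "... = ennreal (measure lborel (?C X))"
  proof (rule emeasure_eq_ennreal_measure)
   have "emeasure lborel (?C X) <= emeasure lborel ?B" by (rule emeasure_mono) auto
   also have "... < \<infinity>" by (rule emeasure_bounded_finite) simp
   finally show "emeasure lborel (?C X) ~= top" by simp
  qed
  finally show ?thesis .
 qed
 have "(\<integral>\<^sup>+X. ennreal (measure lborel (?C X)) \<partial>M I) = (\<integral>\<^sup>+X. (\<integral>\<^sup>+y. ?g X y \<partial>lborel) \<partial>M I)"
  by (rule nn_integral_cong) (simp add: inner)
 also have "... = (\<integral>\<^sup>+y. (\<integral>\<^sup>+X. ?g X y \<partial>M I) \<partial>lborel)"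
  by (rule P.Fubini'[symmetric, OF m])
 also have "... = (\<integral>\<^sup>+y. ennreal (Pr I (in_cone k I e)) * indicator ?B y \<partial>lborel)"
 proof (rule nn_integral_cong_AE)
  have "AE y in lborel. y ~= (0::'e)" by (rule AE_lborel_singleton)
  then show "AE y in lborel. (\<integral>\<^sup>+X. ?g X y \<partial>M I) = ennreal (Pr I (in_cone k I e)) * indicator ?B y"
  proof eventually_elim
   case (elim y)
   have s: "{X:space (M I). in_cone k I y X} : sets (M I)" using pred_cone[OF I] by (simp add: pred_def)
   have "(\<integral>\<^sup>+X. ?g X y \<partial>M I) = (\<integral>\<^sup>+X. indicator ?B y * indicator {X:space (M I). in_cone k I y X} X \<partial>M I)"
    by (rule nn_integral_cong) (auto simp: indicator_def)
   also have "... = indicator ?B y * ennreal (Pr I (in_cone k I y))"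
    using s by (subst nn_integral_cmult_indicator) (auto simp: em Pr_def)
   finally show ?case using Pr_cone_const[OF I elim e, of k] by (simp add: mult.commute)
  qed
 qed
 also have "... = ennreal (Pr I (in_cone k I e)) * emeasure lborel ?B" by (rule nn_integral_cmult_indicator) simp
 also have "emeasure lborel ?B = ennreal (measure lborel ?B)"
 proof (rule emeasure_eq_ennreal_measure)
  show "emeasure lborel ?B ~= top" using emeasure_bounded_finite[OF bounded_ball, of "0::'e" 1] by (metis infinity_ennreal_def less_irrefl)
 qed
 finally have nn: "(\<integral>\<^sup>+X. ennreal (measure lborel (?C X)) \<partial>M I) = ennreal (measure lborel ?B * Pr I (in_cone k I e))"
  by (simp add: Pr_def ennreal_mult mult.commute)
 have meas: "(%X. measure lborel (?C X)) : borel_measurable (M I)"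
 proof -
  have "(%X. enn2real (\<integral>\<^sup>+y. ?g X y \<partial>lborel)) : borel_measurable (M I)"
   using lborel.borel_measurable_nn_integral[OF m] by (intro borel_measurable_enn2real) simp
  then show ?thesis by (subst measurable_cong[where g = "%X. enn2real (\<integral>\<^sup>+y. ?g X y \<partial>lborel)"]) (simp_all add: inner)
 qed
 show "(%X. measure lborel (?C X)) : borel_measurable (M I)" by (rule meas)
 show "(\<integral>X. measure lborel (?C X) \<partial>M I) = measure lborel (ball (0::'e) 1) * Pr I (in_cone k I e)"
  using meas nn by (subst integral_eq_nn_integral) (auto simp: Pr_def)
qed

theorem expected_internal_angle:
 assumes k: "1 <= k" "k <= n" and n: "n = DIM('e) + 1"
 shows "(\<integral>X. internal_angle (convex hull (X ` {..<k})) (convex hull (X ` {..<n})) \<partial>M {..<n}) = Bprob k n"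
proof -
 let ?I = "{..<n}" and ?d = "DIM('e)"
 \<comment> \<open>The last basis vector of the list, so that removing it leaves
   \<open>chain (n - 2)\<close>, the coordinate set in \<open>Bprob\<close>.\<close>
 define e where "e = Bl ! (?d - 1)"
 have d: "?d - 1 < ?d" "Suc (?d - 1) = ?d" "n - 2 = ?d - 1" using dim2 n by auto
 have e: "e : Basis" "Basis - {e} = chain (n - 2)"
 proof -
  have "chain ?d = Basis" using Bl by (simp add: chain_def)
  then have "Basis = insert e (chain (?d - 1))" "e ~: chain (?d - 1)" using chain_Suc[OF d(1)] d(2) by (auto simp: e_def)
  then show "e : Basis" "Basis - {e} = chain (n - 2)" using d(3) by auto
 qed
 have e0: "e ~= 0" using e(1) nonzero_Basis by blast
 have gp: "AE X in M ?I. \<forall>U\<subseteq>Basis. \<forall>S\<subseteq>?I. card S <= card U + 1 --> aff_indep U S (crd X)" by (rule AE_general_position) simp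
 let ?V = "measure lborel (ball (0::'e) 1)"
 have V: "?V > 0" using content_ball_pos[of 1 "0::'e"] by simp
 have "(\<integral>X. internal_angle (convex hull (X ` {..<k})) (convex hull (X ` {..<n})) \<partial>M ?I)
   = (\<integral>X. measure lborel (ball 0 1 Int cone_over Basis k ?I (crd X)) / ?V \<partial>M ?I)"
 proof -
  have ae: "AE X in M ?I. internal_angle (convex hull (X ` {..<k})) (convex hull (X ` {..<n})) = measure lborel (ball 0 1 Int cone_over Basis k ?I (crd X)) / ?V"
   using gp
  proof eventually_elim
   case (elim X)
   then have "aff_indep Basis ?I (crd X)" using n by auto
   then show ?case by (rule internal_angle_cone[OF k n])
  qed
  have m2: "(%X. measure lborel (ball 0 1 Int cone_over Basis k ?I (crd X)) / ?V) : borel_measurable (M ?I)"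
   using expected_cone_volume(1)[OF _ e0, of ?I k] by (intro borel_measurable_divide) auto
  have eq: "internal_angle (convex hull (X ` {..<k})) (convex hull (X ` {..<n})) =
    (if aff_indep Basis ?I (crd X) then measure lborel (ball 0 1 Int cone_over Basis k ?I (crd X)) / ?V else 0)" for X :: "nat => 'e"
   using internal_angle_cone[OF k n] internal_angle_degenerate[OF n] by auto
  have "(%X. internal_angle (convex hull (X ` {..<k})) (convex hull (X ` {..<n}))) : borel_measurable (M ?I)"
   unfolding eq using m2 pred_aff_indep[of ?I ?I Basis] by (intro measurable_If) (auto simp: pred_def)
  then show ?thesis by (rule integral_cong_AE[OF _ m2 ae])
 qed
 also have "... = Pr ?I (in_cone k ?I e)"
  using expected_cone_volume(2)[OF _ e0, of ?I k] V by simp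
 also have "... = Bprob k n"
 proof (cases "k = n")
  case True
  have "Pr ?I (in_cone k ?I e) = Pr ?I (%_. True)"
  proof (rule Pr_cong_AE)
   show "AE X in M ?I. in_cone k ?I e X = True" using gp
   proof eventually_elim
    case (elim X)
    then have "aff_indep Basis ?I (crd X)" using n by auto
    then obtain l where "sum l ?I = 0" "ALL b:Basis. (\<Sum>i\<in>?I. l i * crd X i b) = e \<bullet> b"
    using aff_indep_spans[of ?I Basis "crd X" "%b. e \<bullet> b"] n by auto
    then show ?case using True unfolding cone_over_def by (auto intro!: exI[of _ l])
   qed
  qed (use pred_cone in auto)
  then show ?thesis using True by (simp add: Pr_True Bprob_def)
 next
  case False
  have m: "Measurable.pred (M ?I) (in_cone k ?I e)" "Measurable.pred (M ?I) (in_cone k ?I (- e))" "Measurable.pred (M ?I) (NF (Basis - {e}) k ?I)"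
   by (auto intro!: pred_cone pred_not_face)
  have hb1: "has_bochner_integral (M ?I) (%X. of_bool (in_cone k ?I e X) + of_bool (in_cone k ?I (- e) X)) (Pr ?I (in_cone k ?I e) + Pr ?I (in_cone k ?I (- e)))"
   by (intro has_bochner_integral_add integral_of_bool m)
  have hb2: "has_bochner_integral (M ?I) (%X. of_bool (NF (Basis - {e}) k ?I X)) (Pr ?I (NF (Basis - {e}) k ?I))"
   by (intro integral_of_bool m)
  have hae: "AE X in M ?I. of_bool (in_cone k ?I e X) + of_bool (in_cone k ?I (- e) X) = (of_bool (NF (Basis - {e}) k ?I X) :: real)"
   using gp
  proof eventually_elim
   case (elim X)
   show ?case
   proof (rule basis_vector_in_cone[OF _ _ e(1)])
    show "aff_indep Basis ?I (crd X)" using elim n by auto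
    show "aff_indep (Basis - {e}) {..<k} (crd X)"
    proof -
    have "card (Basis - {e}) = ?d - 1" using e(1) by simp
    then have "card {..<k} <= card (Basis - {e}) + 1" using k False n d by simp
    moreover have "{..<k} <= ?I" using k by auto
    ultimately show ?thesis by (intro elim[rule_format]) auto
    qed
   qed (use k in auto)
  qed
  have "Pr ?I (in_cone k ?I e) + Pr ?I (in_cone k ?I (- e)) = Pr ?I (NF (Basis - {e}) k ?I)"
   by (rule has_bochner_integral_eq_AE[OF hb1 hb2 hae])
  moreover have "Pr ?I (in_cone k ?I (- e)) = Pr ?I (in_cone k ?I e)" using e0 by (intro Pr_cone_const) auto
  ultimately show ?thesis using False e(2) by (simp add: Bprob_def)
 qed
 finally show ?thesis .
qed

end

section \<open>Beta distributions\<close>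

abbreviation coords :: "'e set => 'e::euclidean_space => 'e => real" where
 "coords U x \<equiv> (\<lambda>b\<in>U. x \<bullet> b)"

lemma measurable_coords [measurable]: "coords U : measurable borel (lb U)"
 by (intro measurable_restrict) simp

lemma nn_integral_lborel_coords:
 fixes f :: "'e::euclidean_space => ennreal"
 assumes "f : borel_measurable borel"
 shows "(\<integral>\<^sup>+x. f x \<partial>lborel) = (\<integral>\<^sup>+y. f (\<Sum>b\<in>Basis. y b *\<^sub>R b) \<partial>lb Basis)"
proof -
 have "(%y. \<Sum>b\<in>Basis. y b *\<^sub>R b :: 'e) : measurable (lb Basis) borel"
  by (intro borel_measurable_sum borel_measurable_scaleR measurable_lb_component) auto
 then show ?thesis using assms by (subst lborel_eq) (simp add: nn_integral_distr)
qed

lemma norm_coords_sum: "(norm (\<Sum>b\<in>Basis. y b *\<^sub>R b :: 'e::euclidean_space))\<^sup>2 = (\<Sum>b\<in>Basis. (y b)\<^sup>2)"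
 unfolding norm_eq_sqrt_inner using euclidean_inner[of "\<Sum>b\<in>Basis. y b *\<^sub>R b :: 'e" "\<Sum>b\<in>Basis. y b *\<^sub>R b"]
 by (simp add: power2_eq_square sum_nonneg)

text \<open>Scaling t by sqrt(1 - s) leaves the integral \<open>cosint p\<close>; the length factor
  raises the exponent of 1 - s by one half.\<close>

lemma wt_slice:
 assumes "0 <= s"
 shows "(\<integral>\<^sup>+t. wt ((real p - 1) / 2) (s + t\<^sup>2) \<partial>lborel) = ennreal (cosint p) * wt (real p / 2) s"
proof (cases "s < 1")
 case True
 define c where "c = sqrt (1 - s)"
 have c: "c > 0" "c\<^sup>2 = 1 - s" using True by (auto simp: c_def)
 have "(\<integral>\<^sup>+t. wt ((real p - 1) / 2) (s + t\<^sup>2) \<partial>lborel) = ennreal (abs c) * (\<integral>\<^sup>+t. wt ((real p - 1) / 2) (s + (0 + c * t)\<^sup>2) \<partial>lborel)"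
  using c by (intro nn_integral_real_affine) auto
 also have "(\<integral>\<^sup>+t. wt ((real p - 1) / 2) (s + (0 + c * t)\<^sup>2) \<partial>lborel) = (\<integral>\<^sup>+t. ennreal ((1 - s) powr ((real p - 1) / 2)) * (hw ((real p - 1) / 2) t * 1) \<partial>lborel)"
 proof (rule nn_integral_cong)
  fix t :: real
  have "(0 + c * t)\<^sup>2 = (1 - s) * t\<^sup>2" unfolding add_0 power_mult_distrib c(2) ..
  then have e: "1 - (s + (0 + c * t)\<^sup>2) = (1 - s) * (1 - t\<^sup>2)" by (simp add: algebra_simps)
  have "s + (0 + c * t)\<^sup>2 < 1 \<longleftrightarrow> 0 < 1 - (s + (0 + c * t)\<^sup>2)" by (simp only: diff_gt_0_iff_gt)
  also have "... \<longleftrightarrow> t\<^sup>2 < 1" unfolding e using True by (simp only: zero_less_mult_iff diff_gt_0_iff_gt) auto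
  finally show "wt ((real p - 1) / 2) (s + (0 + c * t)\<^sup>2) = ennreal ((1 - s) powr ((real p - 1) / 2)) * (hw ((real p - 1) / 2) t * 1)"
   unfolding wt_def hw_def e using True by (auto simp: powr_mult ennreal_mult)
 qed
 also have "... = ennreal ((1 - s) powr ((real p - 1) / 2)) * ennreal (cosint p)"
  using hw_integral_cont[of "%_. 1" "%_. 1" p] by (subst nn_integral_cmult) (simp_all add: cosint_def)
 also have "ennreal (abs c) * (ennreal ((1 - s) powr ((real p - 1) / 2)) * ennreal (cosint p)) = ennreal (cosint p) * ennreal ((abs c) * (1 - s) powr ((real p - 1) / 2))"
  by (simp add: ennreal_mult mult_ac)
 also have "(abs c) * (1 - s) powr ((real p - 1) / 2) = (1 - s) powr (1/2) * (1 - s) powr ((real p - 1) / 2)"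
  using c True by (simp add: c_def powr_half_sqrt)
 also have "... = (1 - s) powr (real p / 2)" unfolding powr_add[symmetric] by (simp add: diff_divide_distrib)
 finally show ?thesis using True by (simp add: wt_def)
next
 case False
 have "s + t\<^sup>2 >= 1" for t :: real using False zero_le_power2[of t] by linarith
 then have "wt ((real p - 1) / 2) (s + t\<^sup>2) = 0" for t unfolding wt_def by (simp add: not_less)
 then show ?thesis using False by (simp add: wt_def)
qed

definition radial :: "'e::euclidean_space measure => nat => 'e set => real => bool" where
 "radial \<mu> \<alpha> U C \<longleftrightarrow> distr \<mu> (lb U) (coords U) =
   density (lb U) (%x. ennreal C * wt ((real \<alpha> - real (card U)) / 2) (\<Sum>b\<in>U. (x b)\<^sup>2))"

lemma radial_measurable:
 "finite U ==> (%x. ennreal C * wt a (\<Sum>b\<in>U. (x b)\<^sup>2)) : borel_measurable (lb U)"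
 by (intro borel_measurable_times_ennreal measurable_compose[OF _ measurable_wt] borel_measurable_sum borel_measurable_power measurable_lb_component) auto

text \<open>One coordinate is integrated out by \<open>wt_slice\<close>. The bound on the
  cardinality makes \<open>p\<close> a genuine difference, so the exponent (p - 1)/2 stays at least
  -1/2.\<close>

lemma radial_marginal:
 fixes \<mu> :: "'e::euclidean_space measure"
 assumes sets: "sets \<mu> = sets borel" and U: "finite U'" "b ~: U'" "card (insert b U') <= \<alpha> + 1"
  and R: "radial \<mu> \<alpha> (insert b U') C"
 shows "radial \<mu> \<alpha> U' (C * cosint (\<alpha> + 1 - card (insert b U')))"
 unfolding radial_def
proof (rule measure_eqI)
 let ?U = "insert b U'"
 define p where "p = \<alpha> + 1 - card ?U"
 have p: "(real \<alpha> - real (card ?U)) / 2 = (real p - 1) / 2" "(real \<alpha> - real (card U')) / 2 = real p / 2"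
  using U by (auto simp: p_def)
 have mc: "coords K : measurable \<mu> (lb K)" for K using sets by (simp cong: measurable_cong_sets)
 fix A assume "A : sets (distr \<mu> (lb U') (coords U'))"
 then have A: "A : sets (lb U')" by simp
 have mr: "(%y. restrict y U') : measurable (lb ?U) (lb U')" by (rule measurable_restrict_subset) auto
 have spA: "A <= space (lb U')" using A by (rule sets.sets_into_space)
 let ?A = "(%y. restrict y U') -` A Int space (lb ?U)"
 have "emeasure (distr \<mu> (lb U') (coords U')) A = emeasure \<mu> (coords U' -` A Int space \<mu>)" by (rule emeasure_distr[OF mc A])
 also have "coords U' -` A Int space \<mu> = coords ?U -` ?A Int space \<mu>"
 proof -
  have "restrict (coords ?U x) U' = coords U' x" for x by (auto simp: restrict_def)
  moreover have "coords ?U x : space (lb ?U)" for x by (simp add: space_PiM)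
  ultimately show ?thesis by auto
 qed
 also have "emeasure \<mu> ... = emeasure (distr \<mu> (lb ?U) (coords ?U)) ?A"
  by (rule emeasure_distr[symmetric, OF mc measurable_sets[OF mr A]])
 also have "... = (\<integral>\<^sup>+y. ennreal C * wt ((real p - 1) / 2) (\<Sum>c\<in>?U. (y c)\<^sup>2) * indicator ?A y \<partial>lb ?U)"
  using R unfolding radial_def p by (simp only:) (intro emeasure_density radial_measurable measurable_sets[OF mr A], use U in auto)
 also have "... = (\<integral>\<^sup>+u. (\<integral>\<^sup>+t. ennreal C * wt ((real p - 1) / 2) (\<Sum>c\<in>?U. ((u(b := t)) c)\<^sup>2) * indicator ?A (u(b := t)) \<partial>lborel) \<partial>lb U')"
  using U by (intro lb.product_nn_integral_insert borel_measurable_times_ennreal radial_measurable borel_measurable_indicator measurable_sets[OF mr A]) auto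
 also have "... = (\<integral>\<^sup>+u. ennreal (C * cosint p) * wt (real p / 2) (\<Sum>c\<in>U'. (u c)\<^sup>2) * indicator A u \<partial>lb U')"
 proof (rule nn_integral_cong)
  fix u assume u: "u : space (lb U')"
  have r: "restrict (u(b := t)) U' = u" for t using u U(2) by (auto simp: space_PiM PiE_def extensional_def restrict_def fun_eq_iff)
  have sp: "u(b := t) : space (lb ?U)" for t using u by (auto simp: space_PiM PiE_def extensional_def)
  have s: "(\<Sum>c\<in>?U. ((u(b := t)) c)\<^sup>2) = (\<Sum>c\<in>U'. (u c)\<^sup>2) + t\<^sup>2" for t
   using U(1,2) by (simp add: add.commute) (intro sum.cong, auto)
  have i: "indicator ?A (u(b := t)) = (indicator A u :: ennreal)" for t
   using r[of t] sp[of t] by (simp add: indicator_def)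
  have "(\<integral>\<^sup>+t. ennreal C * wt ((real p - 1) / 2) ((\<Sum>c\<in>U'. (u c)\<^sup>2) + t\<^sup>2) * indicator A u \<partial>lborel) =
    ennreal C * (\<integral>\<^sup>+t. wt ((real p - 1) / 2) ((\<Sum>c\<in>U'. (u c)\<^sup>2) + t\<^sup>2) \<partial>lborel) * indicator A u"
   by (subst nn_integral_multc, simp, subst nn_integral_cmult) simp_all
  also have "... = ennreal C * (ennreal (cosint p) * wt (real p / 2) (\<Sum>c\<in>U'. (u c)\<^sup>2)) * indicator A u"
   by (subst wt_slice) (auto intro: sum_nonneg)
  finally show "(\<integral>\<^sup>+t. ennreal C * wt ((real p - 1) / 2) (\<Sum>c\<in>?U. ((u(b := t)) c)\<^sup>2) * indicator ?A (u(b := t)) \<partial>lborel)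
   = ennreal (C * cosint p) * wt (real p / 2) (\<Sum>c\<in>U'. (u c)\<^sup>2) * indicator A u"
   unfolding s i using cosint_pos[of p] by (simp add: ennreal_mult'' less_imp_le mult.assoc)
 qed
 also have "... = emeasure (density (lb U') (%x. ennreal (C * cosint p) * wt (real p / 2) (\<Sum>b\<in>U'. (x b)\<^sup>2))) A"
  by (rule emeasure_density[symmetric, OF radial_measurable[OF U(1)] A])
 finally show "emeasure (distr \<mu> (lb U') (coords U')) A = emeasure (density (lb U') (%x. ennreal (C * cosint (\<alpha> + 1 - card ?U)) * wt ((real \<alpha> - real (card U')) / 2) (\<Sum>b\<in>U'. (x b)\<^sup>2))) A"
  unfolding p(2) p_def[symmetric] .
qed simp

lemma beta_const_pos: "j <= \<alpha> + 1 ==> beta_const j ((real \<alpha> - real j) / 2) > 0"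
 unfolding beta_const_def by (intro divide_pos_pos mult_pos_pos Gamma_real_pos) (auto simp: field_simps)

lemma beta_const_Suc:
 assumes "Suc j <= \<alpha> + 1"
 shows "beta_const (Suc j) ((real \<alpha> - real (Suc j)) / 2) * cosint (\<alpha> - j) = beta_const j ((real \<alpha> - real j) / 2)"
proof -
 define g where "g = Gamma ((real (\<alpha> - j) + 1) / 2)"
 have g: "g > 0" unfolding g_def by (intro Gamma_real_pos) (simp add: add_nonneg_pos)
 have e: "real (Suc j) / 2 + (real \<alpha> - real (Suc j)) / 2 + 1 = real \<alpha> / 2 + 1" "real j / 2 + (real \<alpha> - real j) / 2 + 1 = real \<alpha> / 2 + 1"
  "(real \<alpha> - real (Suc j)) / 2 + 1 = (real (\<alpha> - j) + 1) / 2" "(real \<alpha> - real j) / 2 + 1 = real (\<alpha> - j) / 2 + 1"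
  using assms by (simp_all add: field_simps of_nat_diff)
 have pw: "pi powr (real (Suc j) / 2) = pi powr (real j / 2) * sqrt pi"
 proof -
  have "real (Suc j) / 2 = real j / 2 + 1/2" by (simp add: field_simps)
  then show ?thesis by (simp only: powr_add) (simp add: powr_half_sqrt)
 qed
 show ?thesis
  unfolding beta_const_def e cosint_Gamma pw g_def[symmetric] using g by simp
qed

text \<open>Coordinates are removed one at a time, and the constants change by the same factors as
  \<open>beta_const\<close>. The factor \<open>K\<close> allows a starting marginal whose constant
  is not computed, as for the sphere.\<close>

lemma radial_subset:
 fixes \<mu> :: "'e::euclidean_space measure"
 assumes sets: "sets \<mu> = sets borel" and J0: "finite J0" "card J0 <= \<alpha> + 1"
  and R: "radial \<mu> \<alpha> J0 (K * beta_const (card J0) ((real \<alpha> - real (card J0)) / 2))" and U: "U <= J0"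
 shows "radial \<mu> \<alpha> U (K * beta_const (card U) ((real \<alpha> - real (card U)) / 2))"
proof -
 have "radial \<mu> \<alpha> (J0 - D) (K * beta_const (card (J0 - D)) ((real \<alpha> - real (card (J0 - D))) / 2))" if "D <= J0" "finite D" for D
  using that(2,1)
 proof (induction D rule: finite_induct)
  case (insert b D)
  have b: "insert b (J0 - insert b D) = J0 - D" using insert by auto
  have fin: "finite (J0 - insert b D)" using J0 by auto
  have c: "card (J0 - D) = Suc (card (J0 - insert b D))" unfolding b[symmetric] using fin by (subst card_insert_disjoint) auto
  have le: "card (J0 - D) <= \<alpha> + 1" using J0 card_mono[of J0 "J0 - D"] by auto
  have "radial \<mu> \<alpha> (J0 - insert b D) (K * beta_const (card (J0 - D)) ((real \<alpha> - real (card (J0 - D))) / 2) * cosint (\<alpha> + 1 - card (J0 - D)))"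
   using radial_marginal[OF sets fin, of b \<alpha> "K * beta_const (card (J0 - D)) ((real \<alpha> - real (card (J0 - D))) / 2)"] insert le unfolding b by auto
  then show ?case using beta_const_Suc[of "card (J0 - insert b D)" \<alpha>] le unfolding c by (simp add: mult.assoc)
 qed (use R in simp)
 from this[of "J0 - U"] show ?thesis using U J0 by (simp add: double_diff)
qed

lemma distr_lborel_orthogonal:
 fixes f :: "'e::euclidean_space => 'e"
 assumes f: "orthogonal_transformation f"
 shows "f : borel_measurable borel" "distr lborel borel f = lborel"
proof -
 have lin: "linear f" using f by (rule orthogonal_transformation_linear)
 show mf: "f : borel_measurable borel"
  using lin by (intro borel_measurable_continuous_onI linear_continuous_on) (simp add: linear_conv_bounded_linear)
 let ?L = "%c i. f c \<bullet> i" and ?v = "%u. \<Sum>b\<in>Basis. u b *\<^sub>R b :: 'e"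
 have fv: "(\<Sum>c\<in>Basis. u c * ?L c i) = f (?v u) \<bullet> i" for u i
  by (simp add: linear_sum[OF lin] linear_scale[OF lin] inner_sum_left)
 have inj: "(ALL c:Basis. u c = 0)" if "ALL i:Basis. (\<Sum>c\<in>Basis. u c * ?L c i) = 0" for u
 proof -
  have "f (?v u) = 0"
  proof (rule euclidean_eqI)
   fix i :: 'e assume "i : Basis"
   then show "f (?v u) \<bullet> i = 0 \<bullet> i" using that unfolding fv inner_zero_left by blast
  qed
  then have "?v u = 0" using orthogonal_transformation_norm[OF f, of "?v u"] by simp
  then have "?v u \<bullet> c = 0" for c by simp
  then show ?thesis by (metis inner_sum_left_Basis)
 qed
 define \<kappa> where "\<kappa> = inverse (cube_mass Basis Basis ?L)"
 have cov: "(\<integral>\<^sup>+x. F x \<partial>lborel) = \<kappa> * (\<integral>\<^sup>+x. F (f x) \<partial>lborel)" if F: "F : borel_measurable borel" for F :: "'e => ennreal"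
 proof -
  have mv: "?v : measurable (lb Basis) borel"
   by (intro borel_measurable_sum borel_measurable_scaleR measurable_lb_component) auto
  have "(\<integral>\<^sup>+x. F x \<partial>lborel) = (\<integral>\<^sup>+y. F (?v y) \<partial>lb Basis)" by (rule nn_integral_lborel_coords[OF F])
  also have "... = \<kappa> * (\<integral>\<^sup>+u. F (?v (\<lambda>i\<in>Basis. \<Sum>c\<in>Basis. u c * ?L c i)) \<partial>lb Basis)"
   unfolding \<kappa>_def
   by (rule nn_integral_lb_linear(3)[OF finite_Basis finite_Basis refl _ measurable_compose[OF mv F]]) (erule inj)
  also have "(%u. F (?v (\<lambda>i\<in>Basis. \<Sum>c\<in>Basis. u c * ?L c i))) = (%u. F (f (?v u)))"
   unfolding fv by (simp add: euclidean_representation)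
  also have "(\<integral>\<^sup>+u. F (f (?v u)) \<partial>lb Basis) = (\<integral>\<^sup>+x. F (f x) \<partial>lborel)"
   by (rule nn_integral_lborel_coords[symmetric, OF measurable_compose[OF mf F]])
  finally show ?thesis .
 qed
 \<comment> \<open>The Jacobian is found by testing it on the unit ball, which is invariant and has
   positive finite volume.\<close>
 have "\<kappa> = 1"
 proof -
  let ?B = "ball (0::'e) 1"
  define V where "V = emeasure lborel ?B"
  have V: "V ~= 0" "V ~= top"
   using emeasure_bounded_finite[OF bounded_ball, of "0::'e" 1] content_ball_pos[of 1 "0::'e"] unfolding V_def by (auto simp: measure_def)
  have "indicator ?B (f x) = (indicator ?B x :: ennreal)" for x
   using orthogonal_transformation_norm[OF f, of x] by (simp add: indicator_def)
  moreover have "(indicator ?B :: 'e => ennreal) : borel_measurable borel" by (rule borel_measurable_indicator) simp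
  ultimately have e: "V = \<kappa> * V" using cov[of "indicator ?B"] by (simp add: V_def)
  have "\<kappa> = \<kappa> * V / V" using V by (simp add: ennreal_times_divide[symmetric] ennreal_divide_self top.not_eq_extremum)
  also have "... = 1" using V unfolding e[symmetric] by (simp add: ennreal_divide_self top.not_eq_extremum)
  finally show ?thesis .
 qed
 show "distr lborel borel f = lborel"
 proof (rule measure_eqI)
  fix A assume "A : sets (distr lborel borel f)"
  then have A: "A : sets borel" by simp
  have "emeasure (distr lborel borel f) A = (\<integral>\<^sup>+x. indicator A (f x) \<partial>lborel)"
  proof -
   have "(\<integral>\<^sup>+x. indicator A x \<partial>distr lborel borel f) = (\<integral>\<^sup>+x. indicator A (f x) \<partial>lborel)"
    by (rule nn_integral_distr) (use A mf in auto)
   then show ?thesis using A by (simp add: nn_integral_indicator)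
  qed
  also have "... = emeasure lborel A" using cov[of "indicator A"] A \<open>\<kappa> = 1\<close> by simp
  finally show "emeasure (distr lborel borel f) A = emeasure lborel A" .
 qed simp
qed

lemma distr_density_orthogonal:
 fixes f :: "'e::euclidean_space => 'e"
 assumes f: "orthogonal_transformation f" and g: "g : borel_measurable borel" "!!x. g (f x) = g x"
 shows "distr (density lborel g) borel f = density lborel g"
proof -
 have "density (distr lborel borel f) g = distr (density lborel (%x. g (f x))) borel f"
  using g(1) distr_lborel_orthogonal(1)[OF f] by (intro density_distr) auto
 then show ?thesis unfolding g(2) distr_lborel_orthogonal(2)[OF f] by (rule sym)
qed

lemma beta_law_density:
 assumes d: "DIM('e) >= 2" "DIM('e) <= \<alpha> + 1"
 shows "beta_law (beta_dist ((real \<alpha> - real DIM('e)) / 2) :: 'e::euclidean_space measure) \<alpha>"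
proof -
 let ?d = "DIM('e)" and ?\<mu> = "beta_dist ((real \<alpha> - real DIM('e)) / 2) :: 'e measure"
 define c where "c = beta_const ?d ((real \<alpha> - real ?d) / 2)"
 have c: "c > 0" unfolding c_def using d by (intro beta_const_pos)
 define g where "g x = ennreal c * wt ((real \<alpha> - real ?d) / 2) ((norm x)\<^sup>2)" for x :: "'e"
 have mg: "g : borel_measurable borel" unfolding g_def by measurable
 have mu: "?\<mu> = density lborel g"
 proof -
  have "(real \<alpha> - real ?d) / 2 ~= -1" using d by (simp add: field_simps)
  moreover have "ennreal (c * (1 - norm x ^ 2) powr ((real \<alpha> - real ?d) / 2) * indicator (ball 0 1) x) = g x" for x :: "'e"
   using c abs_square_less_1[of "norm x"] by (auto simp: g_def wt_def indicator_def ennreal_mult)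
  ultimately show ?thesis unfolding beta_dist_def c_def by simp
 qed
 have sets: "sets ?\<mu> = sets borel" by (simp add: mu)
 have R: "radial ?\<mu> \<alpha> Basis (1 * beta_const (card (Basis :: 'e set)) ((real \<alpha> - real (card (Basis :: 'e set))) / 2))"
  unfolding radial_def
 proof (rule measure_eqI)
  let ?B = "Basis :: 'e set"
  fix A assume "A : sets (distr ?\<mu> (lb ?B) (coords ?B))"
  then have A: "A : sets (lb ?B)" by simp
  have mc: "coords ?B : measurable ?\<mu> (lb ?B)" using sets by (simp cong: measurable_cong_sets)
  have mc': "coords ?B -` A : sets borel" using measurable_sets[OF measurable_coords A] by simp
  have "emeasure (distr ?\<mu> (lb ?B) (coords ?B)) A = emeasure ?\<mu> (coords ?B -` A Int space ?\<mu>)" by (rule emeasure_distr[OF mc A])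
  also have "coords ?B -` A Int space ?\<mu> = coords ?B -` A" by (simp add: mu)
  also have "emeasure ?\<mu> (coords ?B -` A) = (\<integral>\<^sup>+x. g x * indicator (coords ?B -` A) x \<partial>lborel)"
   unfolding mu using mg mc' by (intro emeasure_density) auto
  also have "... = (\<integral>\<^sup>+y. g (\<Sum>b\<in>Basis. y b *\<^sub>R b) * indicator (coords ?B -` A) (\<Sum>b\<in>Basis. y b *\<^sub>R b) \<partial>lb ?B)"
   using mg mc' by (intro nn_integral_lborel_coords) auto
  also have "... = (\<integral>\<^sup>+y. ennreal c * wt ((real \<alpha> - real ?d) / 2) (\<Sum>b\<in>Basis. (y b)\<^sup>2) * indicator A y \<partial>lb ?B)"
  proof (rule nn_integral_cong)
   fix y assume y: "y : space (lb ?B)"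
   have "coords ?B (\<Sum>b\<in>Basis. y b *\<^sub>R b) = y"
    using y by (auto simp: space_PiM PiE_def extensional_def restrict_def fun_eq_iff)
   then have "indicator (coords ?B -` A) (\<Sum>b\<in>Basis. y b *\<^sub>R b) = (indicator A y :: ennreal)" by (simp add: indicator_def)
   then show "g (\<Sum>b\<in>Basis. y b *\<^sub>R b) * indicator (coords ?B -` A) (\<Sum>b\<in>Basis. y b *\<^sub>R b) = ennreal c * wt ((real \<alpha> - real ?d) / 2) (\<Sum>b\<in>Basis. (y b)\<^sup>2) * indicator A y"
    unfolding g_def norm_coords_sum by simp
  qed
  also have "... = emeasure (density (lb ?B) (%y. ennreal c * wt ((real \<alpha> - real ?d) / 2) (\<Sum>b\<in>Basis. (y b)\<^sup>2))) A"
   by (rule emeasure_density[symmetric, OF radial_measurable[OF finite_Basis] A])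
  finally show "emeasure (distr ?\<mu> (lb ?B) (coords ?B)) A = emeasure (density (lb ?B) (%x. ennreal (1 * beta_const (card ?B) ((real \<alpha> - real (card ?B)) / 2)) * wt ((real \<alpha> - real (card ?B)) / 2) (\<Sum>b\<in>?B. (x b)\<^sup>2))) A"
   unfolding mult_1 c_def[symmetric] .
 qed simp
 have RJ: "radial ?\<mu> \<alpha> U (beta_const (card U) ((real \<alpha> - real (card U)) / 2))" if "U <= Basis" for U
  using radial_subset[OF sets finite_Basis _ R that] d by simp
 show ?thesis
 proof (rule beta_law.intro)
  show "sets ?\<mu> = sets borel" by (rule sets)
  show "2 <= DIM('e)" using d by simp
  \<comment> \<open>The total mass is the marginal on the empty set of coordinates, so it is 1
    because \<open>beta_const\<close> is 1 in dimension 0; no integral over the ball is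
    evaluated.\<close>
  show "prob_space ?\<mu>"
  proof (rule prob_spaceI)
   have mc: "coords {} : measurable ?\<mu> (lb {})" using sets by (simp cong: measurable_cong_sets)
   have "emeasure ?\<mu> (space ?\<mu>) = emeasure (distr ?\<mu> (lb {}) (coords {})) (space (lb ({} :: 'e set)))"
    using measurable_space[OF mc] by (subst emeasure_distr[OF mc]) (auto intro!: arg_cong[where f = "emeasure ?\<mu>"])
   also have "... = emeasure (density (lb {}) (%x. ennreal (beta_const 0 (real \<alpha> / 2)) * wt (real \<alpha> / 2) 0)) (space (lb ({} :: 'e set)))"
    using RJ[of "{}"] by (simp add: radial_def)
   also have "... = 1"
   proof -
    have "beta_const 0 (real \<alpha> / 2) = 1"
    unfolding beta_const_def using less_imp_neq[OF Gamma_real_pos[of "real \<alpha> / 2 + 1"]] by (simp add: add_nonneg_pos)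
    then show ?thesis by (simp add: wt_def PiM_empty emeasure_density nn_integral_count_space_finite)
   qed
   finally show "emeasure ?\<mu> (space ?\<mu>) = 1" .
  qed
  show "distr ?\<mu> borel f = ?\<mu>" if f: "orthogonal_transformation f" for f
   unfolding mu using f by (intro distr_density_orthogonal mg) (auto simp: g_def orthogonal_transformation_norm)
  show "EX C>0. distr ?\<mu> (lb U) (coords U) = density (lb U) (%x. ennreal C * wt ((real \<alpha> - real (card U)) / 2) (\<Sum>b\<in>U. (x b)\<^sup>2))" if U: "U \<subset> Basis" for U
  proof (intro exI conjI)
   have "card U <= \<alpha> + 1" using d psubset_card_mono[OF finite_Basis U] by simp
   then show "beta_const (card U) ((real \<alpha> - real (card U)) / 2) > 0" by (rule beta_const_pos)
   show "distr ?\<mu> (lb U) (coords U) = density (lb U) (%x. ennreal (beta_const (card U) ((real \<alpha> - real (card U)) / 2)) * wt ((real \<alpha> - real (card U)) / 2) (\<Sum>b\<in>U. (x b)\<^sup>2))"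
    using RJ[of U] U by (simp add: radial_def)
  qed
 qed
qed

section \<open>The uniform law on the sphere\<close>

lemma nn_integral_even:
 fixes F :: "real => ennreal"
 assumes [measurable]: "F : borel_measurable borel" and even: "!!s. F (- s) = F s"
 shows "(\<integral>\<^sup>+s. F s \<partial>lborel) = 2 * (\<integral>\<^sup>+s. F s * indicator {0..} s \<partial>lborel)"
proof -
 have "AE s in lborel. F s = F s * indicator {0..} s + F s * indicator {..0} s"
  using AE_lborel_singleton[of "0::real"] by eventually_elim (auto simp: indicator_def)
 then have "(\<integral>\<^sup>+s. F s \<partial>lborel) = (\<integral>\<^sup>+s. F s * indicator {0..} s + F s * indicator {..0} s \<partial>lborel)"
  by (rule nn_integral_cong_AE)
 also have "... = (\<integral>\<^sup>+s. F s * indicator {0..} s \<partial>lborel) + (\<integral>\<^sup>+s. F s * indicator {..0} s \<partial>lborel)"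
  by (rule nn_integral_add) measurable
 also have "(\<integral>\<^sup>+s. F s * indicator {..0} s \<partial>lborel) = (\<integral>\<^sup>+s. F s * indicator {0..} s \<partial>lborel)"
  by (subst nn_integral_real_affine[where c = "-1" and t = 0]) (auto simp: even indicator_def intro!: nn_integral_cong)
 finally show ?thesis by (simp add: mult_2)
qed

text \<open>For fixed squared length q of the other coordinates, the last coordinate s is exchanged
  for the radius r = sqrt(q + s^2) on each half line. As h vanishes from 1 on, the substitution can
  be confined to s in 0..1.\<close>

lemma nn_integral_radius:
 fixes h :: "real => ennreal"
 assumes [measurable]: "h : borel_measurable borel" and h: "!!r. 1 <= r ==> h r = 0" and q: "0 <= q"
 shows "(\<integral>\<^sup>+s. h (sqrt (q + s\<^sup>2)) \<partial>lborel) =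
  2 * (\<integral>\<^sup>+r. h r * (if 0 < r & q < r\<^sup>2 then ennreal (r / sqrt (r\<^sup>2 - q)) else 0) \<partial>lborel)"
proof -
 let ?k = "%r. if 0 < r & q < r\<^sup>2 then ennreal (r / sqrt (r\<^sup>2 - q)) else 0"
 have "(\<integral>\<^sup>+s. h (sqrt (q + s\<^sup>2)) \<partial>lborel) = 2 * (\<integral>\<^sup>+s. h (sqrt (q + s\<^sup>2)) * indicator {0..} s \<partial>lborel)"
  by (rule nn_integral_even) auto
 also have "(\<integral>\<^sup>+s. h (sqrt (q + s\<^sup>2)) * indicator {0..} s \<partial>lborel) = (\<integral>\<^sup>+r. h r * ?k r \<partial>lborel)"
 \<comment> \<open>For q = 0 the radius is |s|, which is not differentiable at 0; there nothing has
   to be substituted on s >= 0.\<close>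
 proof (cases "q = 0")
  case True
  have "AE s in lborel. h (sqrt (q + s\<^sup>2)) * indicator {0..} s = h s * ?k s"
   using AE_lborel_singleton[of "0::real"] by eventually_elim (auto simp: True indicator_def)
  then show ?thesis by (rule nn_integral_cong_AE)
 next
  case False
  then have q: "q > 0" using q by simp
  define g where "g s = sqrt (q + s\<^sup>2)" for s
  define g' where "g' s = s / sqrt (q + s\<^sup>2)" for s
  have pos: "q + s\<^sup>2 > 0" for s using q zero_le_power2[of s] by linarith
  have "(\<integral>\<^sup>+r. h r * ?k r \<partial>lborel) = (\<integral>\<^sup>+r. (h r * ?k r) * indicator {g 0..g 1} r \<partial>lborel)"
  proof (rule nn_integral_cong)
   fix r :: real
   show "h r * ?k r = (h r * ?k r) * indicator {g 0..g 1} r"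
   proof (cases "r : {g 0..g 1}")
    case F: False
    have "r < sqrt q | 1 <= r"
    proof -
    have "1 <= g 1" using q by (simp add: g_def)
    moreover have "r < g 0 | g 1 < r" using F by auto
    moreover have "g 0 = sqrt q" by (simp add: g_def)
    ultimately show ?thesis by linarith
    qed
    then have "h r * ?k r = 0"
    proof
    assume "r < sqrt q"
    then have "~ (0 < r & q < r\<^sup>2)" by (metis less_asym real_sqrt_less_mono real_sqrt_unique less_imp_le)
    then show ?thesis by (simp only: if_False mult_zero_right)
    qed (simp add: h)
    then show ?thesis by (simp only: mult_zero_left)
   qed simp
  qed
  also have "... = (\<integral>\<^sup>+s. (h (g s) * ?k (g s)) * g' s * indicator {0..1} s \<partial>lborel)"
  proof (rule nn_integral_substitution_aux)
   show "(%r. h r * ?k r) : borel_measurable borel" by measurable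
   show "(g has_real_derivative g' s) (at s)" for s
    unfolding g_def g'_def using pos[of s] by (auto intro!: derivative_eq_intros simp: field_simps)
   show "continuous_on {0..1} g'" unfolding g'_def using pos by (intro continuous_intros) (auto simp: less_imp_neq[symmetric])
  qed (use pos in \<open>auto simp: g'_def less_imp_le\<close>)
  also have "... = (\<integral>\<^sup>+s. h (sqrt (q + s\<^sup>2)) * indicator {0..} s \<partial>lborel)"
  proof (rule nn_integral_cong_AE)
   have "AE s in lborel. s ~= (0::real)" by (rule AE_lborel_singleton)
   then show "AE s in lborel. (h (g s) * ?k (g s)) * g' s * indicator {0..1} s = h (sqrt (q + s\<^sup>2)) * indicator {0..} s"
   proof eventually_elim
    case (elim s)
    show ?case
    proof (cases "0 < s & s <= 1")
    case True
    have gs: "(g s)\<^sup>2 = q + s\<^sup>2" "g s > 0" using pos[of s] by (auto simp: g_def less_imp_le)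
    have "?k (g s) = ennreal (g s / s)" using True gs q by (simp add: real_sqrt_abs)
    then have "?k (g s) * g' s = ennreal (g s / s * g' s)"
    using True gs(2) pos[of s] by (subst ennreal_mult) (auto simp: g'_def less_imp_le)
    also have "g s / s * g' s = 1" using True gs(2) by (simp add: g'_def g_def)
    finally show ?thesis using True by (simp add: g_def mult.assoc)
    next
    case F: False
    have "h (sqrt (q + s\<^sup>2)) = 0" if "s > 1"
    proof (rule h)
    have "1 <= s\<^sup>2" using that by (simp add: one_le_power)
    then show "1 <= sqrt (q + s\<^sup>2)" using q by simp
    qed
    then show ?thesis using F elim by (auto simp: indicator_def)
    qed
   qed
  qed
  finally show ?thesis ..
 qed
 finally show ?thesis .
qed

text \<open>A point of the ball is described by its coordinates u in \<open>U\<close> and its radius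
  r, and the event depends on u/r. Scaling u by r separates the radius from the direction and leaves
  the density (1 - |w|^2)^(-1/2), that of the orthogonal projection of the sphere.\<close>

lemma sphere_radial:
 assumes b: "b : (Basis :: 'e::euclidean_space set)" and d: "DIM('e) = \<alpha> + 2"
 shows "EX C>0. radial (beta_dist (-1) :: 'e measure) \<alpha> (Basis - {b}) C"
proof -
 let ?\<mu> = "beta_dist (-1) :: 'e measure" and ?B = "ball (0::'e) 1"
 define U where "U = (Basis - {b} :: 'e set)"
 have U: "finite U" "b ~: U" "Basis = insert b U" "card U = \<alpha> + 1" using b d by (auto simp: U_def)
 define q where "q u = (\<Sum>c\<in>U. (u c)\<^sup>2)" for u :: "'e => real"
 have q0: "0 <= q u" for u by (simp add: q_def sum_nonneg)
 have mq [measurable]: "q : borel_measurable (lb U)"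
  unfolding q_def by (intro borel_measurable_sum borel_measurable_power measurable_lb_component) auto
 define V where "V = emeasure lborel ?B"
 have V: "V ~= 0" "V ~= \<infinity>"
  using emeasure_bounded_finite[OF bounded_ball, of "0::'e" 1] content_ball_pos[of 1 "0::'e"] unfolding V_def by (auto simp: measure_def)
 have mu: "?\<mu> = distr (uniform_measure lborel ?B) borel sgn" by (simp add: beta_dist_def)
 have msgn: "sgn : measurable (uniform_measure lborel ?B) borel" by simp
 have sets: "sets ?\<mu> = sets borel" by (simp add: mu)
 have prob: "prob_space ?\<mu>"
  unfolding mu using V by (intro prob_space.prob_space_distr[OF prob_space_uniform_measure msgn]) (auto simp: V_def)
 define K where "K = 2 * (\<integral>\<^sup>+r. indicator {0<..<1} r * ennreal (r ^ card U) \<partial>lborel) / V"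
 have K: "emeasure (distr ?\<mu> (lb U) (coords U)) A = K * emeasure (density (lb U) (%w. wt (-1/2) (q w))) A" if "A : sets (lb U)" for A
 proof -
  note A = that
  have mA [measurable]: "Measurable.pred (lb U) (%w. w : A)" using A by (simp add: pred_def)
  define \<phi> where "\<phi> u r = (if r < 1 then indicator A (\<lambda>c\<in>U. u c / r) else 0 :: ennreal)" for u :: "'e => real" and r :: real
  define \<psi> where "\<psi> u r = \<phi> u r * (if 0 < r & q u < r\<^sup>2 then ennreal (r / sqrt (r\<^sup>2 - q u)) else 0)" for u r
  have m1: "(%p. \<lambda>c\<in>U. fst p c / snd p) : measurable (lb U \<Otimes>\<^sub>M borel) (lb U)"
  proof (rule measurable_restrict)
   fix c assume "c : U"
   then have "(%p. fst p c) : borel_measurable (lb U \<Otimes>\<^sub>M (borel :: real measure))"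
    by (intro measurable_compose[OF measurable_fst measurable_lb_component])
   then show "(%p. fst p c / snd p) : measurable (lb U \<Otimes>\<^sub>M borel) lborel" by simp
  qed
  have m\<phi>: "(%p. \<phi> (fst p) (snd p)) : borel_measurable (lb U \<Otimes>\<^sub>M borel)"
   unfolding \<phi>_def
   by (intro measurable_If measurable_compose[OF m1 borel_measurable_indicator[OF A]]) auto
  have m\<phi>r: "\<phi> u : borel_measurable borel" if "u : space (lb U)" for u
   using measurable_compose[OF measurable_Pair[OF measurable_const[OF that] measurable_ident] m\<phi>] by simp
  have mc: "coords U : measurable ?\<mu> (lb U)" using sets by (simp cong: measurable_cong_sets)
  define S where "S = sgn -` (coords U -` A) Int (UNIV :: 'e set)"
  have mS: "S : sets borel"
  proof -
   have "coords U -` A : sets borel" using measurable_sets[OF measurable_coords A] by simp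
   then have "sgn -` (coords U -` A) Int space (borel :: 'e measure) : sets borel"
    by (intro measurable_sets[of sgn borel borel]) auto
   then show ?thesis by (simp add: S_def)
  qed
  have fub: "(\<integral>\<^sup>+u. 2 * (\<integral>\<^sup>+r. \<psi> u r \<partial>lborel) \<partial>lb U) = 2 * (\<integral>\<^sup>+u. (\<integral>\<^sup>+r. \<psi> u r \<partial>lborel) \<partial>lb U)"
   and fub2: "(\<integral>\<^sup>+u. (\<integral>\<^sup>+r. \<psi> u r \<partial>lborel) \<partial>lb U)
    = (\<integral>\<^sup>+r. (\<integral>\<^sup>+u. \<psi> u r \<partial>lb U) \<partial>lborel)"
  proof -
   interpret sU: sigma_finite_measure "lb U" by (rule sigma_finite_lb[OF U(1)])
   interpret P: pair_sigma_finite "lb U" "lborel :: real measure" by standard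
   have mq': "(%p. q (fst p)) : borel_measurable (lb U \<Otimes>\<^sub>M lborel)" by (rule measurable_compose[OF measurable_fst mq])
   have ms: "(%p. snd p) : borel_measurable (lb U \<Otimes>\<^sub>M (lborel :: real measure))" by simp
   have "(%p. \<phi> (fst p) (snd p)) : borel_measurable (lb U \<Otimes>\<^sub>M lborel)" using m\<phi> by (simp cong: measurable_cong_sets)
   then have m: "(%(u, r). \<psi> u r) : borel_measurable (lb U \<Otimes>\<^sub>M lborel)"
    unfolding case_prod_beta \<psi>_def using mq' ms by (intro borel_measurable_times_ennreal) (assumption, measurable)
   show "(\<integral>\<^sup>+u. (\<integral>\<^sup>+r. \<psi> u r \<partial>lborel) \<partial>lb U)
    = (\<integral>\<^sup>+r. (\<integral>\<^sup>+u. \<psi> u r \<partial>lb U) \<partial>lborel)"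
    by (rule P.Fubini'[symmetric, OF m])
   show "(\<integral>\<^sup>+u. 2 * (\<integral>\<^sup>+r. \<psi> u r \<partial>lborel) \<partial>lb U)
    = 2 * (\<integral>\<^sup>+u. (\<integral>\<^sup>+r. \<psi> u r \<partial>lborel) \<partial>lb U)"
    using lborel.borel_measurable_nn_integral[OF m] by (intro nn_integral_cmult) simp
  qed
  have "emeasure (distr ?\<mu> (lb U) (coords U)) A = emeasure ?\<mu> (coords U -` A)"
   using emeasure_distr[OF mc A] by (simp add: mu)
  also have "... = emeasure (uniform_measure lborel ?B) S"
   unfolding mu S_def using measurable_sets[OF measurable_coords A] by (subst emeasure_distr[OF msgn]) auto
  also have "... = emeasure lborel (?B Int S) / V" using mS by (simp add: emeasure_uniform_measure V_def)
  also have "emeasure lborel (?B Int S) = (\<integral>\<^sup>+x. indicator (?B Int S) x \<partial>lborel)" using mS by (simp add: nn_integral_indicator)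
  also have "... = (\<integral>\<^sup>+y. indicator (?B Int S) (\<Sum>c\<in>Basis. y c *\<^sub>R c) \<partial>lb (insert b U))"
   unfolding U(3)[symmetric] using mS by (intro nn_integral_lborel_coords borel_measurable_indicator sets.Int) auto
  also have "... = (\<integral>\<^sup>+u. (\<integral>\<^sup>+s. indicator (?B Int S) (\<Sum>c\<in>Basis. (u(b := s)) c *\<^sub>R c) \<partial>lborel) \<partial>lb U)"
  proof (rule lb.product_nn_integral_insert[OF U(1,2)])
   have "(%y. \<Sum>c\<in>Basis. y c *\<^sub>R c :: 'e) : measurable (lb (insert b U)) borel"
    by (intro borel_measurable_sum borel_measurable_scaleR measurable_lb_component) (auto simp: U(3))
   then show "(%y. indicator (?B Int S) (\<Sum>c\<in>Basis. y c *\<^sub>R c) :: ennreal) : borel_measurable (lb (insert b U))"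
    using mS by (intro measurable_compose[OF _ borel_measurable_indicator]) auto
  qed
  also have "... = (\<integral>\<^sup>+u. (\<integral>\<^sup>+s. \<phi> u (sqrt (q u + s\<^sup>2)) \<partial>lborel) \<partial>lb U)"
  proof (intro nn_integral_cong)
   fix u s assume "u : space (lb U)"
   define x where "x = (\<Sum>c\<in>Basis. (u(b := s)) c *\<^sub>R c :: 'e)"
   have n2: "(norm x)\<^sup>2 = q u + s\<^sup>2"
    unfolding x_def norm_coords_sum unfolding U(3) q_def using U(1,2) by (auto simp: add.commute intro!: sum.cong)
   then have n: "norm x = sqrt (q u + s\<^sup>2)" by (metis norm_ge_zero real_sqrt_unique)
   have "coords U (sgn x) = (\<lambda>c\<in>U. u c / sqrt (q u + s\<^sup>2))"
   proof (rule restrict_ext)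
    fix c assume c: "c : U"
    then have "c : Basis" "c ~= b" using U by auto
    then have "x \<bullet> c = u c" by (simp add: x_def)
    then show "sgn x \<bullet> c = u c / sqrt (q u + s\<^sup>2)" by (simp add: sgn_div_norm n divide_inverse mult.commute)
   qed
   then show "indicator (?B Int S) (\<Sum>c\<in>Basis. (u(b := s)) c *\<^sub>R c) = \<phi> u (sqrt (q u + s\<^sup>2))"
    unfolding x_def[symmetric] \<phi>_def S_def by (auto simp: indicator_def n)
  qed
  also have "... = (\<integral>\<^sup>+u. 2 * (\<integral>\<^sup>+r. \<psi> u r \<partial>lborel) \<partial>lb U)"
   unfolding \<psi>_def by (intro nn_integral_cong nn_integral_radius q0 m\<phi>r) (auto simp: \<phi>_def)
  also note fub
  also note fub2
  also have "(\<integral>\<^sup>+r. (\<integral>\<^sup>+u. \<psi> u r \<partial>lb U) \<partial>lborel)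
    = (\<integral>\<^sup>+r. indicator {0<..<1} r * ennreal (r ^ card U) * emeasure (density (lb U) (%w. wt (-1/2) (q w))) A \<partial>lborel)"
  proof (rule nn_integral_cong)
   fix r :: real
   show "(\<integral>\<^sup>+u. \<psi> u r \<partial>lb U)
    = indicator {0<..<1} r * ennreal (r ^ card U) * emeasure (density (lb U) (%w. wt (-1/2) (q w))) A"
   proof (cases "0 < r & r < 1")
    case True
    let ?f = "%u. \<psi> u r"
    have m\<phi>u: "(%u. \<phi> u r) : borel_measurable (lb U)"
    using measurable_compose[OF measurable_Pair[OF measurable_ident measurable_const[of r borel]] m\<phi>] by simp
    have "(\<integral>\<^sup>+u. ?f u \<partial>lb U) = (\<Prod>a\<in>U. ennreal (abs r)) * (\<integral>\<^sup>+w. ?f (\<lambda>a\<in>U. 0 + r * w a) \<partial>lb U)"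
    unfolding \<psi>_def using True m\<phi>u by (intro nn_integral_lb_affine U(1) borel_measurable_times_ennreal) auto
    also have "(\<Prod>a\<in>U. ennreal (abs r)) = ennreal (r ^ card U)" using True by (simp add: ennreal_power)
    also have "(\<integral>\<^sup>+w. ?f (\<lambda>a\<in>U. 0 + r * w a) \<partial>lb U) = (\<integral>\<^sup>+w. wt (-1/2) (q w) * indicator A w \<partial>lb U)"
    proof (rule nn_integral_cong)
    fix w assume w: "w : space (lb U)"
    have qr: "q (\<lambda>a\<in>U. 0 + r * w a) = r\<^sup>2 * q w" by (simp add: q_def power_mult_distrib sum_distrib_left)
    have ww: "(\<lambda>c\<in>U. (\<lambda>a\<in>U. 0 + r * w a) c / r) = w"
    using w True by (auto simp: space_PiM PiE_def extensional_def restrict_def fun_eq_iff)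
    have lt: "r\<^sup>2 * q w < r\<^sup>2 \<longleftrightarrow> q w < 1" using True by simp
    have k: "r / sqrt (r\<^sup>2 - r\<^sup>2 * q w) = (1 - q w) powr (-1/2)" if "q w < 1"
    proof -
    have "r\<^sup>2 - r\<^sup>2 * q w = r\<^sup>2 * (1 - q w)" by (simp add: algebra_simps)
    then have "r / sqrt (r\<^sup>2 - r\<^sup>2 * q w) = 1 / sqrt (1 - q w)" using True by (simp add: real_sqrt_mult)
    also have "... = (1 - q w) powr (-1/2)" using that by (simp add: powr_half_sqrt[symmetric] powr_minus_divide)
    finally show ?thesis .
    qed
    show "?f (\<lambda>a\<in>U. 0 + r * w a) = wt (-1/2) (q w) * indicator A w"
    unfolding \<psi>_def \<phi>_def ww qr lt wt_def using True k by (simp add: mult.commute)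
    qed
    also have "... = emeasure (density (lb U) (%w. wt (-1/2) (q w))) A"
    using mq A by (intro emeasure_density[symmetric] measurable_compose[OF mq measurable_wt])
    finally show ?thesis using True by simp
   qed (auto simp: \<phi>_def \<psi>_def)
  qed
  also have "... = (\<integral>\<^sup>+r. indicator {0<..<1} r * ennreal (r ^ card U) \<partial>lborel) * emeasure (density (lb U) (%w. wt (-1/2) (q w))) A"
   by (rule nn_integral_multc) simp
  finally show ?thesis unfolding K_def divide_ennreal_def by (simp only: mult_ac)
 qed
 have mw: "(%w. wt (-1/2) (q w)) : borel_measurable (lb U)" by (rule measurable_compose[OF mq measurable_wt])
 have mc: "coords U : measurable ?\<mu> (lb U)" using sets by (simp cong: measurable_cong_sets)
 \<comment> \<open>The radial integral in \<open>K\<close> is not computed: that \<open>K\<close> is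
   positive and finite follows from the total mass 1.\<close>
 have "1 = K * emeasure (density (lb U) (%w. wt (-1/2) (q w))) (space (lb U))"
  using prob_space.emeasure_space_1[OF prob_space.prob_space_distr[OF prob mc]] by (simp add: K)
 then have "K ~= 0" "K ~= top" by (auto simp: ennreal_top_mult split: if_splits)
 then obtain C where C: "K = ennreal C" "C > 0"
  by (cases K rule: ennreal_cases) (auto simp: less_le)
 have "radial ?\<mu> \<alpha> U C" unfolding radial_def
 proof (rule measure_eqI)
  fix A assume "A : sets (distr ?\<mu> (lb U) (coords U))"
  then have A: "A : sets (lb U)" by simp
  have e: "(real \<alpha> - real (card U)) / 2 = -1/2" by (simp add: U(4))
  have "emeasure (distr ?\<mu> (lb U) (coords U)) A = ennreal C * (\<integral>\<^sup>+w. wt (-1/2) (q w) * indicator A w \<partial>lb U)"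
   unfolding K[OF A] emeasure_density[OF mw A] C(1) ..
  also have "... = (\<integral>\<^sup>+w. ennreal C * wt (-1/2) (q w) * indicator A w \<partial>lb U)"
   using mw A by (subst nn_integral_cmult[symmetric]) (auto simp: mult.assoc)
  also have "... = emeasure (density (lb U) (%w. ennreal C * wt (-1/2) (q w))) A"
   using mw A by (intro emeasure_density[symmetric]) auto
  finally show "emeasure (distr ?\<mu> (lb U) (coords U)) A = emeasure (density (lb U) (%x. ennreal C * wt ((real \<alpha> - real (card U)) / 2) (\<Sum>b\<in>U. (x b)\<^sup>2))) A"
   unfolding e q_def .
 qed simp
 then show ?thesis using C(2) unfolding U_def by blast
qed

lemma beta_law_sphere:
 assumes d: "DIM('e) = \<alpha> + 2"
 shows "beta_law (beta_dist (-1) :: 'e::euclidean_space measure) \<alpha>"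
proof -
 let ?\<mu> = "beta_dist (-1) :: 'e measure" and ?B = "ball (0::'e) 1"
 have mu: "?\<mu> = distr (uniform_measure lborel ?B) borel sgn" by (simp add: beta_dist_def)
 have msgn: "sgn : measurable (uniform_measure lborel ?B) borel" by simp
 have sets: "sets ?\<mu> = sets borel" by (simp add: mu)
 have V: "emeasure lborel ?B ~= 0" "emeasure lborel ?B ~= top"
  using emeasure_bounded_finite[OF bounded_ball, of "0::'e" 1] content_ball_pos[of 1 "0::'e"] by (auto simp: measure_def)
 show ?thesis
 proof (rule beta_law.intro)
  show "sets ?\<mu> = sets borel" by (rule sets)
  show "2 <= DIM('e)" using d by simp
  show "prob_space ?\<mu>"
   unfolding mu using V by (intro prob_space.prob_space_distr[OF prob_space_uniform_measure msgn]) auto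
  show "distr ?\<mu> borel f = ?\<mu>" if f: "orthogonal_transformation f" for f
  proof -
   have mf: "f : borel_measurable borel" by (rule distr_lborel_orthogonal(1)[OF f])
   have mfu: "f : measurable (uniform_measure lborel ?B) borel" using mf by simp
   have inv: "distr (uniform_measure lborel ?B) borel f = uniform_measure lborel ?B"
    unfolding uniform_measure_def
    by (rule distr_density_orthogonal[OF f]) (auto simp: indicator_def orthogonal_transformation_norm[OF f])
   have "f (sgn x) = sgn (f x)" for x
    by (simp add: sgn_div_norm linear_scale[OF orthogonal_transformation_linear[OF f]] orthogonal_transformation_norm[OF f])
   then have c: "f \<circ> sgn = sgn \<circ> f" by auto
   have "distr ?\<mu> borel f = distr (uniform_measure lborel ?B) borel (f \<circ> sgn)"
    unfolding mu by (rule distr_distr[OF mf msgn])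
   also have "... = distr (distr (uniform_measure lborel ?B) borel f) borel sgn"
    unfolding c by (rule distr_distr[symmetric, OF _ mfu]) simp
   also have "... = ?\<mu>" unfolding inv mu ..
   finally show ?thesis .
  qed
  show "EX C>0. distr ?\<mu> (lb U) (coords U) = density (lb U) (%x. ennreal C * wt ((real \<alpha> - real (card U)) / 2) (\<Sum>b\<in>U. (x b)\<^sup>2))" if U: "U \<subset> Basis" for U
  proof -
   obtain b where b: "b : Basis" "b ~: U" using U by auto
   let ?U0 = "Basis - {b}"
   obtain C where C: "C > 0" "radial ?\<mu> \<alpha> ?U0 C" using sphere_radial[OF b(1) d] by blast
   have c: "card ?U0 <= \<alpha> + 1" using b d by simp
   note p0 = beta_const_pos[OF c]
   define K where "K = C / beta_const (card ?U0) ((real \<alpha> - real (card ?U0)) / 2)"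
   have "K * beta_const (card ?U0) ((real \<alpha> - real (card ?U0)) / 2) = C" unfolding K_def using p0 by (intro nonzero_eq_divide_eq[THEN iffD1, OF _ refl]) linarith
   then have R0: "radial ?\<mu> \<alpha> ?U0 (K * beta_const (card ?U0) ((real \<alpha> - real (card ?U0)) / 2))" using C(2) by (simp only:)
   have R: "radial ?\<mu> \<alpha> U (K * beta_const (card U) ((real \<alpha> - real (card U)) / 2))"
    by (rule radial_subset[OF sets _ c R0]) (use U b in auto)
   have "U <= ?U0" using U b by auto
   then have "card U <= card ?U0" by (intro card_mono) auto
   then have "card U <= \<alpha> + 1" using c by linarith
   then have "K * beta_const (card U) ((real \<alpha> - real (card U)) / 2) > 0"
    using p0 C(1) by (intro mult_pos_pos beta_const_pos) (auto simp: K_def)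
   then show ?thesis using R unfolding radial_def by blast
  qed
 qed
qed

theorem theorem1p2:
  fixes n k \<alpha> :: nat
  assumes "n \<ge> 3" and "1 \<le> k" and "k \<le> n" and "\<alpha> + 3 \<ge> n"
    and "CARD('d::finite) + 1 = n"
    and "(even \<alpha> \<and> odd (n - k)) \<or> (odd \<alpha> \<and> odd n)"
  shows "complex_of_real (J TYPE(real^'d) n k ((real \<alpha> - real n + 1) / 2)) =
    complex_of_real (real (n choose k) * c_const (real \<alpha> * real n / 2)
       * c_const ((real \<alpha> - 1) / 2) ^ (n - k) * pi)
    * residue (\<lambda>x. sin_pow_int \<alpha> x ^ (n - k) / sin x ^ (\<alpha> * n + 2)) 0"
proof -
 let ?\<beta> = "(real \<alpha> - real n + 1) / 2"
 have d: "DIM(real^'d) + 1 = n" using assms(5) by simp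
 \<comment> \<open>\<alpha> = n - 3 is the exponent -1, the sphere in dimension \<alpha> + 2; for
   larger \<alpha> the dimension is at most \<alpha> + 1 and there is a density.\<close>
 interpret beta_law "beta_dist ?\<beta> :: (real^'d) measure" \<alpha>
 proof (cases "\<alpha> + 3 = n")
  case True
  then have e: "?\<beta> = -1" by auto
  show "beta_law (beta_dist ?\<beta> :: (real^'d) measure) \<alpha>"
   unfolding e using True d by (intro beta_law_sphere) simp
 next
  case False
  have e: "?\<beta> = (real \<alpha> - real DIM(real^'d)) / 2" unfolding d[symmetric] by simp
  show "beta_law (beta_dist ?\<beta> :: (real^'d) measure) \<alpha>"
   unfolding e using False assms(1,4) d by (intro beta_law_density) simp_all
 qed
 have J: "J TYPE(real^'d) n k ?\<beta> = real (n choose k) * Bprob k n"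
  unfolding J_def expected_internal_angle[OF assms(2,3) d[symmetric]] ..
 \<comment> \<open>The two alternatives of the hypothesis are precisely the two ways for this sum of
   exponents to be odd: even \<alpha> leaves the parity of n - k, odd \<alpha> that of n.\<close>
 have odd: "odd ((\<alpha> + 1) * (n - k) + (\<alpha> * n + 2))" using assms(6) by auto
 have c: "c_const (real \<alpha> * real n / 2) = 1 / cosint (\<alpha> * n + 1)" "c_const ((real \<alpha> - 1) / 2) = 1 / cosint \<alpha>"
  using c_const_cosint(1)[of "\<alpha> * n"] c_const_cosint(2)[of \<alpha>] by simp_all
 define R where "R = residue (%x. sin_pow_int \<alpha> x ^ (n - k) / sin x ^ (\<alpha> * n + 2)) 0"
 have "BB \<alpha> (\<alpha> * n + 2) (n - k) * of_real (cosint \<alpha> ^ (n - k)) = pi * R"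
  unfolding R_def by (rule residue_line_integral[OF _ odd]) simp
 then have B: "BB \<alpha> (\<alpha> * n + 2) (n - k) = pi * R / of_real (cosint \<alpha> ^ (n - k))" by (simp add: field_simps)
 have "complex_of_real (Bprob k n) = BB \<alpha> (\<alpha> * n + 2) (n - k) / of_real (cosint (\<alpha> * n + 1))"
  using d by (intro Bprob_eq assms) simp
 then show ?thesis unfolding J c R_def[symmetric] of_real_mult B by (simp add: power_divide field_simps)
qed

end
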